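(* Let $\mathcal T$ be an essentially small triangulated category and let $T\subseteq\mathrm{Thick}\,\mathcal T$ be a sublattice which is closed under arbitrary joins and contains $0$ and $\mathcal T$. Then its centre $Z(T)\subseteq T$ is also a sublattice and closed under arbitrary joins. Moreover, $Z(T)$ is a spatial frame, and for any pair $\mathcal U,\mathcal V$ in $T$ the Mayer--Vietoris sequence $\lambda_{\mathcal U,\mathcal V}$ exists provided at least one of $\mathcal U$ and $\mathcal V$ belongs to $Z(T)$.
   Context: Lattice: A thick subcategory of $\mathcal T$ is a full triangulated subcategory closed under direct summands. $\mathrm{Thick}\,\mathcal T$ is the lattice of thick subcategories ordered by inclusion; the meet $\mathcal U\wedge\mathcal V$ is the intersection, and joins $\mathcal U\vee\mathcal V$, $\bigvee_i\mathcal U_i$ are the smallest thick subcategories containing the given ones. A sublattice is closed under finite meets and finite joins (computed in $\mathrm{Thick}\,\mathcal T$); closed under arbitrary joins means closed under joins computed in $\mathrm{Thick}\,\mathcal T$. Centre: A pair $\mathcal U,\mathcal V\in\mathrm{Thick}\,\mathcal T$ is commuting if every morphism between an object of $\mathcal U$ and an object of $\mathcal V$ (in either direction) factors through an object of $\mathcal U\wedge\mathcal V$. The centre of $T$ is $Z(T)=\{\mathcal U\in T\mid \mathcal U\text{ and }\mathcal V\text{ commute for all }\mathcal V\in T\}$. Frames: A frame is a complete lattice with $\bigvee_i(x_i\wedge y)=(\bigvee_i x_i)\wedge y$ for all families $(x_i)$ and all $y$. Frame morphisms preserve finite meets and arbitrary joins. The points of a frame $F$ are the frame morphisms $p\colon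 F\to\{0,1\}$; the space $\mathrm{Pt}\,F$ of points has open sets $U(a)=\{p\mid p(a)=1\}$, $a\in F$. $F$ is spatial if $a\mapsto U(a)$ is an isomorphism from $F$ onto the lattice of open subsets of $\mathrm{Pt}\,F$. Mayer--Vietoris sequence: $\mathrm{Coh}\,\mathcal T$ is the category of cohomological functors $\mathcal T^{\mathrm{op}}\to\mathrm{Ab}$ (taking exact triangles to exact sequences), with $\Sigma F=F\circ\Sigma^{-1}$. For a triangulated subcategory $\mathcal S\subseteq\mathcal T$ with quotient functor $q\colon\mathcal T\to\mathcal T/\mathcal S$, let $q_*\colon\mathrm{Coh}\,\mathcal T/\mathcal S\to\mathrm{Coh}\,\mathcal T$ be restriction along $q$, $q^*$ its left adjoint (the filtered-colimit-preserving functor with $\mathrm{Hom}_{\mathcal T}(-,X)\mapsto\mathrm{Hom}_{\mathcal T/\mathcal S}(-,q(X))$), and $L_{\mathcal S}=q_*\circ q^*$. Thus $L_{\mathcal S}\mathrm{Hom}_{\mathcal T}(-,X)=\mathrm{Hom}_{\mathcal T/\mathcal S}(-,X)$. An inclusion $\mathcal S_1\subseteq\mathcal S_2$ induces a canonical morphism $L_{\mathcal S_1}\to L_{\mathcal S_2}$. The sequence $\lambda_{\mathcal U,\mathcal V}$ is a canonical long exact sequence of functors $\mathrm{Coh}\,\mathcal T\to\mathrm{Coh}\,\mathcal T$ $$\cdots\to\Sigma^{-1}L_{\mathcal U\vee\mathcal V}\to L_{\mathcal U\wedge\mathcal V}\to L_{\mathcal U}\oplus L_{\mathcal V}\to L_{\mathcal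 U\vee\mathcal V}\to\Sigma L_{\mathcal U\wedge\mathcal V}\to\cdots$$ (exact after evaluation at every $F\in\mathrm{Coh}\,\mathcal T$ and every object of $\mathcal T$) in which $L_{\mathcal U\wedge\mathcal V}\to L_{\mathcal U}\oplus L_{\mathcal V}$ is induced by the inclusions $\mathcal U\wedge\mathcal V\subseteq\mathcal U$ and $\mathcal U\wedge\mathcal V\subseteq\mathcal V$. *)

theory Defs
  imports
    "HOL-Algebra.Coset"
    "HOL-Algebra.Complete_Lattice"
    "HOL-Analysis.Abstract_Topology"
begin

section \<open>Additive and triangulated categories\<close>

text \<open>
  Objects and arrows are the elements of carrier sets inside two HOL types. Every such category is
  small; since all notions below are invariant under equivalence, this is how an essentially small
  category is represented.
\<close>

record ('o, 'm) preadditive =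
  Obj :: "'o set"
  Arr :: "'m set"
  Dom :: "'m \<Rightarrow> 'o"
  Cod :: "'m \<Rightarrow> 'o"
  Id :: "'o \<Rightarrow> 'm"
  Comp :: "'m \<Rightarrow> 'm \<Rightarrow> 'm" (infixl \<open>\<cdot>\<index>\<close> 70)
  Add :: "'m \<Rightarrow> 'm \<Rightarrow> 'm"
  Zero :: "'o \<Rightarrow> 'o \<Rightarrow> 'm"

definition Hom :: "('o, 'm, 'z) preadditive_scheme \<Rightarrow> 'o \<Rightarrow> 'o \<Rightarrow> 'm set" where
  "Hom C X Y = {f \<in> Arr C. Dom C f = X \<and> Cod C f = Y}"

definition hom_group :: "('o, 'm, 'z) preadditive_scheme \<Rightarrow> 'o \<Rightarrow> 'o \<Rightarrow> 'm monoid" where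
  "hom_group C X Y = \<lparr>carrier = Hom C X Y, monoid.mult = Add C, one = Zero C X Y\<rparr>"

definition neg :: "('o, 'm, 'z) preadditive_scheme \<Rightarrow> 'm \<Rightarrow> 'm" where
  "neg C f = inv\<^bsub>hom_group C (Dom C f) (Cod C f)\<^esub> f"

definition iso_arr :: "('o, 'm, 'z) preadditive_scheme \<Rightarrow> 'm \<Rightarrow> bool" where
  "iso_arr C f \<longleftrightarrow> f \<in> Arr C \<and>
    (\<exists>g \<in> Hom C (Cod C f) (Dom C f).
      Comp C g f = Id C (Dom C f) \<and> Comp C f g = Id C (Cod C f))"

definition zero_object :: "('o, 'm, 'z) preadditive_scheme \<Rightarrow> 'o \<Rightarrow> bool" where
  "zero_object C Z \<longleftrightarrow> Z \<in> Obj C \<and>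
    (\<forall>X \<in> Obj C. (\<exists>!f. f \<in> Hom C Z X) \<and> (\<exists>!f. f \<in> Hom C X Z))"

definition is_biproduct :: "('o, 'm, 'z) preadditive_scheme \<Rightarrow> 'o \<Rightarrow> 'o \<Rightarrow> 'o \<Rightarrow> bool" where
  "is_biproduct C X Y B \<longleftrightarrow> X \<in> Obj C \<and> Y \<in> Obj C \<and> B \<in> Obj C \<and>
    (\<exists>i \<in> Hom C X B. \<exists>j \<in> Hom C Y B. \<exists>p \<in> Hom C B X. \<exists>r \<in> Hom C B Y.
      Comp C p i = Id C X \<and> Comp C r j = Id C Y \<and>
      Comp C p j = Zero C Y X \<and> Comp C r i = Zero C X Y \<and>
      Add C (Comp C i p) (Comp C j r) = Id C B)"

locale additive_category =
  fixes C :: "('o, 'm, 'z) preadditive_scheme" (structure)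
  assumes dom_closed: "f \<in> Arr C \<Longrightarrow> Dom C f \<in> Obj C"
    and cod_closed: "f \<in> Arr C \<Longrightarrow> Cod C f \<in> Obj C"
    and id_closed: "X \<in> Obj C \<Longrightarrow> Id C X \<in> Hom C X X"
    and comp_closed: "f \<in> Hom C X Y \<Longrightarrow> g \<in> Hom C Y Z \<Longrightarrow> g \<cdot> f \<in> Hom C X Z"
    and id_right: "f \<in> Hom C X Y \<Longrightarrow> f \<cdot> Id C X = f"
    and id_left: "f \<in> Hom C X Y \<Longrightarrow> Id C Y \<cdot> f = f"
    and comp_assoc: "f \<in> Hom C W X \<Longrightarrow> g \<in> Hom C X Y \<Longrightarrow> h \<in> Hom C Y Z \<Longrightarrow>
      (h \<cdot> g) \<cdot> f = h \<cdot> (g \<cdot> f)"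
    and hom_comm_group: "X \<in> Obj C \<Longrightarrow> Y \<in> Obj C \<Longrightarrow> comm_group (hom_group C X Y)"
    and comp_add_right: "f \<in> Hom C X Y \<Longrightarrow> f' \<in> Hom C X Y \<Longrightarrow> g \<in> Hom C Y Z \<Longrightarrow>
      g \<cdot> Add C f f' = Add C (g \<cdot> f) (g \<cdot> f')"
    and comp_add_left: "f \<in> Hom C X Y \<Longrightarrow> g \<in> Hom C Y Z \<Longrightarrow> g' \<in> Hom C Y Z \<Longrightarrow>
      Add C g g' \<cdot> f = Add C (g \<cdot> f) (g' \<cdot> f)"
    and zero_object_exists: "\<exists>Z. zero_object C Z"
    and biproduct_exists: "X \<in> Obj C \<Longrightarrow> Y \<in> Obj C \<Longrightarrow> \<exists>B. is_biproduct C X Y B"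

definition additive_endofunctor ::
  "('o, 'm, 'z) preadditive_scheme \<Rightarrow> ('o \<Rightarrow> 'o) \<Rightarrow> ('m \<Rightarrow> 'm) \<Rightarrow> bool" where
  "additive_endofunctor C F\<^sub>0 F\<^sub>1 \<longleftrightarrow>
    (\<forall>X \<in> Obj C. F\<^sub>0 X \<in> Obj C \<and> F\<^sub>1 (Id C X) = Id C (F\<^sub>0 X)) \<and>
    (\<forall>X Y. \<forall>f \<in> Hom C X Y. F\<^sub>1 f \<in> Hom C (F\<^sub>0 X) (F\<^sub>0 Y)) \<and>
    (\<forall>X Y Z. \<forall>f \<in> Hom C X Y. \<forall>g \<in> Hom C Y Z. F\<^sub>1 (Comp C g f) = Comp C (F\<^sub>1 g) (F\<^sub>1 f)) \<and>
    (\<forall>X Y. \<forall>f \<in> Hom C X Y. \<forall>g \<in> Hom C X Y. F\<^sub>1 (Add C f g) = Add C (F\<^sub>1 f) (F\<^sub>1 g))"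

text \<open>
  The suspension \<open>\<Sigma>\<close> is an autoequivalence; \<open>Desusp_obj\<close>, \<open>Desusp_arr\<close> give a chosen quasi-inverse
  \<open>\<Sigma>\<^sup>-\<close>, and \<open>Unit\<close> an isomorphism of functors from the identity to \<open>\<Sigma>\<^sup>- \<circ> \<Sigma>\<close>. An element
  \<open>(f, g, h)\<close> of \<open>Dist\<close> is an exact triangle \<open>X \<rightarrow> Y \<rightarrow> Z \<rightarrow> \<Sigma> X\<close>.
\<close>

record ('o, 'm) tricat = "('o, 'm) preadditive" +
  Susp_obj :: "'o \<Rightarrow> 'o"
  Susp_arr :: "'m \<Rightarrow> 'm"
  Desusp_obj :: "'o \<Rightarrow> 'o"
  Desusp_arr :: "'m \<Rightarrow> 'm"
  Unit :: "'o \<Rightarrow> 'm"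
  Dist :: "('m \<times> 'm \<times> 'm) set"

definition candidate_triangle :: "('o, 'm) tricat \<Rightarrow> 'm \<Rightarrow> 'm \<Rightarrow> 'm \<Rightarrow> bool" where
  "candidate_triangle \<T> f g h \<longleftrightarrow> f \<in> Arr \<T> \<and> g \<in> Arr \<T> \<and> h \<in> Arr \<T> \<and>
    Dom \<T> g = Cod \<T> f \<and> Dom \<T> h = Cod \<T> g \<and> Cod \<T> h = Susp_obj \<T> (Dom \<T> f)"

locale triangulated_category = additive_category \<T>
  for \<T> :: "('o, 'm) tricat" (structure) +
  assumes susp_functor: "additive_endofunctor \<T> (Susp_obj \<T>) (Susp_arr \<T>)"
    and desusp_functor: "additive_endofunctor \<T> (Desusp_obj \<T>) (Desusp_arr \<T>)"
    and unit_hom: "X \<in> Obj \<T> \<Longrightarrow> Unit \<T> X \<in> Hom \<T> X (Desusp_obj \<T> (Susp_obj \<T> X))"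
    and unit_iso: "X \<in> Obj \<T> \<Longrightarrow> iso_arr \<T> (Unit \<T> X)"
    and unit_natural: "f \<in> Hom \<T> X Y \<Longrightarrow>
      Unit \<T> Y \<cdot> f = Desusp_arr \<T> (Susp_arr \<T> f) \<cdot> Unit \<T> X"
    and counit: "\<exists>\<epsilon>.
      (\<forall>X \<in> Obj \<T>. \<epsilon> X \<in> Hom \<T> (Susp_obj \<T> (Desusp_obj \<T> X)) X \<and> iso_arr \<T> (\<epsilon> X)) \<and>
      (\<forall>X Y. \<forall>f \<in> Hom \<T> X Y. \<epsilon> Y \<cdot> Susp_arr \<T> (Desusp_arr \<T> f) = f \<cdot> \<epsilon> X)"
    and dist_candidate: "(f, g, h) \<in> Dist \<T> \<Longrightarrow> candidate_triangle \<T> f g h"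
    and dist_iso: "(f, g, h) \<in> Dist \<T> \<Longrightarrow> candidate_triangle \<T> f' g' h' \<Longrightarrow>
      a \<in> Hom \<T> (Dom \<T> f) (Dom \<T> f') \<Longrightarrow> b \<in> Hom \<T> (Cod \<T> f) (Cod \<T> f') \<Longrightarrow>
      c \<in> Hom \<T> (Cod \<T> g) (Cod \<T> g') \<Longrightarrow>
      iso_arr \<T> a \<Longrightarrow> iso_arr \<T> b \<Longrightarrow> iso_arr \<T> c \<Longrightarrow>
      b \<cdot> f = f' \<cdot> a \<Longrightarrow> c \<cdot> g = g' \<cdot> b \<Longrightarrow> Susp_arr \<T> a \<cdot> h = h' \<cdot> c \<Longrightarrow>
      (f', g', h') \<in> Dist \<T>"
    and dist_id: "X \<in> Obj \<T> \<Longrightarrow> zero_object \<T> Z \<Longrightarrow>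
      (Id \<T> X, Zero \<T> X Z, Zero \<T> Z (Susp_obj \<T> X)) \<in> Dist \<T>"
    and dist_complete: "f \<in> Arr \<T> \<Longrightarrow> \<exists>g h. (f, g, h) \<in> Dist \<T>"
    and dist_rotate: "candidate_triangle \<T> f g h \<Longrightarrow>
      (f, g, h) \<in> Dist \<T> \<longleftrightarrow> (g, h, neg \<T> (Susp_arr \<T> f)) \<in> Dist \<T>"
    and dist_morphism: "(f, g, h) \<in> Dist \<T> \<Longrightarrow> (f', g', h') \<in> Dist \<T> \<Longrightarrow>
      a \<in> Hom \<T> (Dom \<T> f) (Dom \<T> f') \<Longrightarrow> b \<in> Hom \<T> (Cod \<T> f) (Cod \<T> f') \<Longrightarrow>
      b \<cdot> f = f' \<cdot> a \<Longrightarrow>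
      \<exists>c \<in> Hom \<T> (Cod \<T> g) (Cod \<T> g'). c \<cdot> g = g' \<cdot> b \<and> Susp_arr \<T> a \<cdot> h = h' \<cdot> c"
    and octahedral: "(f\<^sub>1, f\<^sub>2, f\<^sub>3) \<in> Dist \<T> \<Longrightarrow> (g\<^sub>1, g\<^sub>2, g\<^sub>3) \<in> Dist \<T> \<Longrightarrow>
      Dom \<T> g\<^sub>1 = Cod \<T> f\<^sub>1 \<Longrightarrow> (g\<^sub>1 \<cdot> f\<^sub>1, h\<^sub>2, h\<^sub>3) \<in> Dist \<T> \<Longrightarrow>
      \<exists>d\<^sub>1 \<in> Hom \<T> (Cod \<T> f\<^sub>2) (Cod \<T> h\<^sub>2). \<exists>d\<^sub>2 \<in> Hom \<T> (Cod \<T> h\<^sub>2) (Cod \<T> g\<^sub>2). \<exists>d\<^sub>3.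
        (d\<^sub>1, d\<^sub>2, d\<^sub>3) \<in> Dist \<T> \<and>
        d\<^sub>1 \<cdot> f\<^sub>2 = h\<^sub>2 \<cdot> g\<^sub>1 \<and> h\<^sub>3 \<cdot> d\<^sub>1 = f\<^sub>3 \<and>
        d\<^sub>2 \<cdot> h\<^sub>2 = g\<^sub>2 \<and> g\<^sub>3 \<cdot> d\<^sub>2 = Susp_arr \<T> f\<^sub>1 \<cdot> h\<^sub>3 \<and>
        d\<^sub>3 = Susp_arr \<T> f\<^sub>2 \<cdot> g\<^sub>3"


section \<open>Thick subcategories and the centre\<close>

text \<open>Full subcategories are represented by their sets of objects.\<close>

definition triangulated_subcat :: "('o, 'm) tricat \<Rightarrow> 'o set \<Rightarrow> bool" where
  "triangulated_subcat \<T> \<U> \<longleftrightarrow> \<U> \<subseteq> Obj \<T> \<and>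
    (\<exists>Z \<in> \<U>. zero_object \<T> Z) \<and>
    (\<forall>X \<in> \<U>. Susp_obj \<T> X \<in> \<U> \<and> Desusp_obj \<T> X \<in> \<U>) \<and>
    (\<forall>f g h. (f, g, h) \<in> Dist \<T> \<longrightarrow>
      (Dom \<T> f \<in> \<U> \<and> Cod \<T> f \<in> \<U> \<longrightarrow> Cod \<T> g \<in> \<U>) \<and>
      (Dom \<T> f \<in> \<U> \<and> Cod \<T> g \<in> \<U> \<longrightarrow> Cod \<T> f \<in> \<U>) \<and>
      (Cod \<T> f \<in> \<U> \<and> Cod \<T> g \<in> \<U> \<longrightarrow> Dom \<T> f \<in> \<U>))"

definition Thick :: "('o, 'm) tricat \<Rightarrow> 'o set set" where
  "Thick \<T> = {\<U>. triangulated_subcat \<T> \<U> \<and>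
    (\<forall>X Y B. is_biproduct \<T> X Y B \<and> B \<in> \<U> \<longrightarrow> X \<in> \<U>)}"

definition thick_meet :: "('o, 'm) tricat \<Rightarrow> 'o set set \<Rightarrow> 'o set" where
  "thick_meet \<T> A = Obj \<T> \<inter> \<Inter>A"

definition thick_join :: "('o, 'm) tricat \<Rightarrow> 'o set set \<Rightarrow> 'o set" where
  "thick_join \<T> A = \<Inter>{\<W> \<in> Thick \<T>. \<Union>A \<subseteq> \<W>}"

definition zero_subcat :: "('o, 'm) tricat \<Rightarrow> 'o set" where
  "zero_subcat \<T> = {X. zero_object \<T> X}"

text \<open>Finite meets and joins include the empty ones.\<close>

definition thick_sublattice :: "('o, 'm) tricat \<Rightarrow> 'o set set \<Rightarrow> bool" where
  "thick_sublattice \<T> L \<longleftrightarrow> L \<subseteq> Thick \<T> \<and>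
    (\<forall>A. finite A \<and> A \<subseteq> L \<longrightarrow> thick_meet \<T> A \<in> L \<and> thick_join \<T> A \<in> L)"

definition closed_under_joins :: "('o, 'm) tricat \<Rightarrow> 'o set set \<Rightarrow> bool" where
  "closed_under_joins \<T> L \<longleftrightarrow> (\<forall>A. A \<subseteq> L \<longrightarrow> thick_join \<T> A \<in> L)"

definition factors_through :: "('o, 'm) tricat \<Rightarrow> 'm \<Rightarrow> 'o set \<Rightarrow> bool" where
  "factors_through \<T> f \<W> \<longleftrightarrow>
    (\<exists>W \<in> \<W>. \<exists>u \<in> Hom \<T> (Dom \<T> f) W. \<exists>v \<in> Hom \<T> W (Cod \<T> f). f = Comp \<T> v u)"

definition commuting :: "('o, 'm) tricat \<Rightarrow> 'o set \<Rightarrow> 'o set \<Rightarrow> bool" where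
  "commuting \<T> \<U> \<V> \<longleftrightarrow> (\<forall>X \<in> \<U>. \<forall>Y \<in> \<V>. \<forall>f \<in> Hom \<T> X Y \<union> Hom \<T> Y X.
    factors_through \<T> f (thick_meet \<T> {\<U>, \<V>}))"

definition centre :: "('o, 'm) tricat \<Rightarrow> 'o set set \<Rightarrow> 'o set set" where
  "centre \<T> L = {\<U> \<in> L. \<forall>\<V> \<in> L. commuting \<T> \<U> \<V>}"


section \<open>Spatial frames\<close>

definition inclusion_order :: "'a set set \<Rightarrow> 'a set gorder" where
  "inclusion_order L = \<lparr>carrier = L, eq = (=), le = (\<subseteq>)\<rparr>"

definition two :: "bool gorder" where
  "two = \<lparr>carrier = UNIV, eq = (=), le = (\<le>)\<rparr>"

definition frame :: "'a gorder \<Rightarrow> bool" where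
  "frame F \<longleftrightarrow> complete_lattice F \<and>
    (\<forall>A y. A \<subseteq> carrier F \<and> y \<in> carrier F \<longrightarrow>
      \<Squnion>\<^bsub>F\<^esub>((\<lambda>x. x \<sqinter>\<^bsub>F\<^esub> y) ` A) = (\<Squnion>\<^bsub>F\<^esub>A) \<sqinter>\<^bsub>F\<^esub> y)"

definition frame_morphism :: "'a gorder \<Rightarrow> 'b gorder \<Rightarrow> ('a \<Rightarrow> 'b) \<Rightarrow> bool" where
  "frame_morphism F G p \<longleftrightarrow> p \<in> carrier F \<rightarrow> carrier G \<and>
    p \<top>\<^bsub>F\<^esub> = \<top>\<^bsub>G\<^esub> \<and>
    (\<forall>x \<in> carrier F. \<forall>y \<in> carrier F. p (x \<sqinter>\<^bsub>F\<^esub> y) = p x \<sqinter>\<^bsub>G\<^esub> p y) \<and>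
    (\<forall>A. A \<subseteq> carrier F \<longrightarrow> p (\<Squnion>\<^bsub>F\<^esub>A) = \<Squnion>\<^bsub>G\<^esub>(p ` A))"

text \<open>Extensionality makes points that agree on the carrier equal.\<close>

definition points :: "'a gorder \<Rightarrow> ('a \<Rightarrow> bool) set" where
  "points F = {p \<in> extensional (carrier F). frame_morphism F two p}"

definition point_open :: "'a gorder \<Rightarrow> 'a \<Rightarrow> ('a \<Rightarrow> bool) set" where
  "point_open F a = {p \<in> points F. p a}"

definition Pt :: "'a gorder \<Rightarrow> ('a \<Rightarrow> bool) topology" where
  "Pt F = topology (\<lambda>W. W \<in> point_open F ` carrier F)"

definition spatial_frame :: "'a gorder \<Rightarrow> bool" where
  "spatial_frame F \<longleftrightarrow> frame F \<and>
    bij_betw (point_open F) (carrier F) {W. openin (Pt F) W} \<and>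
    (\<forall>a \<in> carrier F. \<forall>b \<in> carrier F. a \<sqsubseteq>\<^bsub>F\<^esub> b \<longleftrightarrow> point_open F a \<subseteq> point_open F b)"


section \<open>Cohomological functors\<close>

text \<open>
  A presheaf is a contravariant functor to abelian groups, the groups being written
  multiplicatively; only its values on the objects and arrows of the category matter.
\<close>

record ('o, 'm, 'g) presheaf =
  Val :: "'o \<Rightarrow> 'g monoid"
  Res :: "'m \<Rightarrow> 'g \<Rightarrow> 'g"

definition cohomological :: "('o, 'm) tricat \<Rightarrow> ('o, 'm, 'g) presheaf \<Rightarrow> bool" where
  "cohomological \<T> F \<longleftrightarrow>
    (\<forall>X \<in> Obj \<T>. comm_group (Val F X) \<and> (\<forall>x \<in> carrier (Val F X). Res F (Id \<T> X) x = x)) \<and>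
    (\<forall>X Y. \<forall>f \<in> Hom \<T> X Y. Res F f \<in> hom (Val F Y) (Val F X)) \<and>
    (\<forall>X Y Z. \<forall>f \<in> Hom \<T> X Y. \<forall>g \<in> Hom \<T> Y Z. \<forall>x \<in> carrier (Val F Z).
      Res F (Comp \<T> g f) x = Res F f (Res F g x)) \<and>
    (\<forall>X Y. \<forall>f \<in> Hom \<T> X Y. \<forall>g \<in> Hom \<T> X Y. \<forall>x \<in> carrier (Val F Y).
      Res F (Add \<T> f g) x = Res F f x \<otimes>\<^bsub>Val F X\<^esub> Res F g x) \<and>
    (\<forall>f g h. (f, g, h) \<in> Dist \<T> \<longrightarrow>
      Res F g ` carrier (Val F (Cod \<T> g))
        = kernel (Val F (Cod \<T> f)) (Val F (Dom \<T> f)) (Res F f) \<and>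
      Res F h ` carrier (Val F (Cod \<T> h))
        = kernel (Val F (Cod \<T> g)) (Val F (Cod \<T> f)) (Res F g))"

definition natural_transformation ::
  "('o, 'm, 'z) preadditive_scheme \<Rightarrow> ('o, 'm, 'g) presheaf \<Rightarrow> ('o, 'm, 'h) presheaf \<Rightarrow>
    ('o \<Rightarrow> 'g \<Rightarrow> 'h) \<Rightarrow> bool" where
  "natural_transformation C F G \<alpha> \<longleftrightarrow>
    (\<forall>X \<in> Obj C. \<alpha> X \<in> hom (Val F X) (Val G X)) \<and>
    (\<forall>X Y. \<forall>f \<in> Hom C X Y. \<forall>x \<in> carrier (Val F Y). \<alpha> X (Res F f x) = Res G f (\<alpha> Y x))"

definition exact_presheaves ::
  "('o, 'm, 'z) preadditive_scheme \<Rightarrow> ('o, 'm, 'g) presheaf \<Rightarrow> ('o \<Rightarrow> 'g \<Rightarrow> 'h) \<Rightarrow>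
    ('o, 'm, 'h) presheaf \<Rightarrow> ('o \<Rightarrow> 'h \<Rightarrow> 'k) \<Rightarrow> ('o, 'm, 'k) presheaf \<Rightarrow> bool" where
  "exact_presheaves C F \<alpha> G \<beta> H \<longleftrightarrow>
    (\<forall>X \<in> Obj C. \<alpha> X ` carrier (Val F X) = kernel (Val G X) (Val H X) (\<beta> X))"

definition presheaf_sum ::
  "('o, 'm, 'g) presheaf \<Rightarrow> ('o, 'm, 'h) presheaf \<Rightarrow> ('o, 'm, 'g \<times> 'h) presheaf" where
  "presheaf_sum F G =
    \<lparr>Val = (\<lambda>X. Val F X \<times>\<times> Val G X), Res = (\<lambda>f. map_prod (Res F f) (Res G f))\<rparr>"

definition susp_pow_obj :: "('o, 'm) tricat \<Rightarrow> int \<Rightarrow> 'o \<Rightarrow> 'o" where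
  "susp_pow_obj \<T> n =
    (if 0 \<le> n then Susp_obj \<T> ^^ nat n else Desusp_obj \<T> ^^ nat (- n))"

definition susp_pow_arr :: "('o, 'm) tricat \<Rightarrow> int \<Rightarrow> 'm \<Rightarrow> 'm" where
  "susp_pow_arr \<T> n =
    (if 0 \<le> n then Susp_arr \<T> ^^ nat n else Desusp_arr \<T> ^^ nat (- n))"

text \<open>\<open>\<Sigma>\<^sup>n F = F \<circ> \<Sigma>\<^sup>-\<^sup>n\<close>, on presheaves and on natural transformations.\<close>

definition shift :: "('o, 'm) tricat \<Rightarrow> int \<Rightarrow> ('o, 'm, 'g) presheaf \<Rightarrow> ('o, 'm, 'g) presheaf" where
  "shift \<T> n F =
    \<lparr>Val = (\<lambda>X. Val F (susp_pow_obj \<T> (- n) X)), Res = (\<lambda>f. Res F (susp_pow_arr \<T> (- n) f))\<rparr>"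

definition shift_nt :: "('o, 'm) tricat \<Rightarrow> int \<Rightarrow> ('o \<Rightarrow> 'g \<Rightarrow> 'h) \<Rightarrow> 'o \<Rightarrow> 'g \<Rightarrow> 'h" where
  "shift_nt \<T> n \<alpha> = (\<lambda>X. \<alpha> (susp_pow_obj \<T> (- n) X))"


section \<open>Verdier quotients\<close>

definition cone_in :: "('o, 'm) tricat \<Rightarrow> 'o set \<Rightarrow> 'm set" where
  "cone_in \<T> \<S> = {s. \<exists>g h. (s, g, h) \<in> Dist \<T> \<and> Cod \<T> g \<in> \<S>}"

text \<open>
  The quotient \<open>\<T>/\<S>\<close> is the localisation of \<open>\<T>\<close> at \<open>cone_in \<T> \<S>\<close>, described by the calculus of
  fractions. The pair \<open>(s, f)\<close> stands for the fraction \<open>f s\<^sup>-\<^sup>1\<close> from \<open>Cod s\<close> to \<open>Cod f\<close>.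
\<close>

definition fractions :: "('o, 'm) tricat \<Rightarrow> 'o set \<Rightarrow> ('m \<times> 'm) set" where
  "fractions \<T> \<S> = {(s, f). s \<in> cone_in \<T> \<S> \<and> f \<in> Arr \<T> \<and> Dom \<T> s = Dom \<T> f}"

definition frac_equiv :: "('o, 'm) tricat \<Rightarrow> 'o set \<Rightarrow> (('m \<times> 'm) \<times> ('m \<times> 'm)) set" where
  "frac_equiv \<T> \<S> = {((s, f), (s', f')).
    (s, f) \<in> fractions \<T> \<S> \<and> (s', f') \<in> fractions \<T> \<S> \<and>
    Cod \<T> s = Cod \<T> s' \<and> Cod \<T> f = Cod \<T> f' \<and>
    (\<exists>W. \<exists>u \<in> Hom \<T> W (Dom \<T> s). \<exists>v \<in> Hom \<T> W (Dom \<T> s').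
      Comp \<T> s u = Comp \<T> s' v \<and> Comp \<T> f u = Comp \<T> f' v \<and> Comp \<T> s u \<in> cone_in \<T> \<S>)}"

definition frac :: "('o, 'm) tricat \<Rightarrow> 'o set \<Rightarrow> 'm \<Rightarrow> 'm \<Rightarrow> ('m \<times> 'm) set" where
  "frac \<T> \<S> s f = frac_equiv \<T> \<S> `` {(s, f)}"

text \<open>
  Operations on equivalence classes are written as unions over representatives: all
  representatives give the same class. For composition, \<open>u\<close> and \<open>v\<close> range over the completions
  of the middle cospan to a commuting square; for addition, the two fractions are brought to a
  common denominator.
\<close>

definition verdier_quotient :: "('o, 'm) tricat \<Rightarrow> 'o set \<Rightarrow> ('o, ('m \<times> 'm) set) preadditive" where
  "verdier_quotient \<T> \<S> =
    \<lparr>Obj = Obj \<T>,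
     Arr = fractions \<T> \<S> // frac_equiv \<T> \<S>,
     Dom = (\<lambda>\<phi>. THE X. \<exists>(s, f) \<in> \<phi>. X = Cod \<T> s),
     Cod = (\<lambda>\<phi>. THE X. \<exists>(s, f) \<in> \<phi>. X = Cod \<T> f),
     Id = (\<lambda>X. frac \<T> \<S> (Id \<T> X) (Id \<T> X)),
     Comp = (\<lambda>\<psi> \<phi>. \<Union>{frac \<T> \<S> (Comp \<T> s u) (Comp \<T> g v) | s f t g u v.
        (s, f) \<in> \<phi> \<and> (t, g) \<in> \<psi> \<and> u \<in> cone_in \<T> \<S> \<and> v \<in> Arr \<T> \<and>
        Cod \<T> u = Dom \<T> f \<and> Cod \<T> v = Dom \<T> t \<and> Dom \<T> u = Dom \<T> v \<and>
        Comp \<T> f u = Comp \<T> t v}),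
     Add = (\<lambda>\<phi> \<psi>. \<Union>{frac \<T> \<S> s (Add \<T> f g) | s f g. (s, f) \<in> \<phi> \<and> (s, g) \<in> \<psi>}),
     Zero = (\<lambda>X Y. frac \<T> \<S> (Id \<T> X) (Zero \<T> X Y))\<rparr>"

definition quotient_arr :: "('o, 'm) tricat \<Rightarrow> 'o set \<Rightarrow> 'm \<Rightarrow> ('m \<times> 'm) set" where
  "quotient_arr \<T> \<S> f = frac \<T> \<S> (Id \<T> (Dom \<T> f)) f"

text \<open>The functor \<open>\<T>/\<S>\<^sub>1 \<rightarrow> \<T>/\<S>\<^sub>2\<close> induced by \<open>\<S>\<^sub>1 \<subseteq> \<S>\<^sub>2\<close>, on arrows; it depends on \<open>\<S>\<^sub>2\<close> only.\<close>

definition quotient_change :: "('o, 'm) tricat \<Rightarrow> 'o set \<Rightarrow> ('m \<times> 'm) set \<Rightarrow> ('m \<times> 'm) set" where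
  "quotient_change \<T> \<S>\<^sub>2 \<phi> = \<Union>{frac \<T> \<S>\<^sub>2 s f | s f. (s, f) \<in> \<phi>}"


section \<open>The localisation functors\<close>

definition restrict_presheaf ::
  "('o, 'm) tricat \<Rightarrow> 'o set \<Rightarrow> ('o, ('m \<times> 'm) set, 'g) presheaf \<Rightarrow> ('o, 'm, 'g) presheaf" where
  "restrict_presheaf \<T> \<S> G = \<lparr>Val = Val G, Res = (\<lambda>f. Res G (quotient_arr \<T> \<S> f))\<rparr>"

text \<open>
  A cohomological functor \<open>F\<close> is the filtered colimit of the representable functors
  \<open>Hom\<^sub>\<T>(-, X)\<close> over its category of elements: the objects are the pairs \<open>(X, x)\<close> with
  \<open>x \<in> F X\<close>, the arrows \<open>(X, x) \<rightarrow> (X', x')\<close> are the \<open>f: X \<rightarrow> X'\<close> with \<open>F f x' = x\<close>. The left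
  adjoint \<open>q\<^sup>*\<close> of restriction along the quotient functor \<open>q\<close> (left Kan extension) preserves this
  colimit and sends \<open>Hom\<^sub>\<T>(-, X)\<close> to \<open>Hom\<^bsub>\<T>/\<S>\<^esub>(-, q X)\<close>. So \<open>q\<^sup>*F\<close> is defined at \<open>Y\<close> as the colimit
  of the groups \<open>Hom\<^bsub>\<T>/\<S>\<^esub>(Y, q X)\<close> over the category of elements of \<open>F\<close>. As this category is
  filtered, the colimit is formed on underlying sets: its elements are classes of triples
  \<open>(X, x, \<phi>)\<close> for the equivalence relation generated by \<open>elem_step\<close>, and any two classes have
  representatives over a common \<open>(X, x)\<close>, where they can be added.
\<close>

type_synonym ('o, 'm, 'g) germ = "('o \<times> 'g \<times> ('m \<times> 'm) set) set"

definition elem_triples ::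
  "('o, 'm) tricat \<Rightarrow> 'o set \<Rightarrow> ('o, 'm, 'g) presheaf \<Rightarrow> 'o \<Rightarrow> ('o, 'm, 'g) germ" where
  "elem_triples \<T> \<S> F Y = {(X, x, \<phi>).
    X \<in> Obj \<T> \<and> x \<in> carrier (Val F X) \<and> \<phi> \<in> Hom (verdier_quotient \<T> \<S>) Y X}"

definition elem_step ::
  "('o, 'm) tricat \<Rightarrow> 'o set \<Rightarrow> ('o, 'm, 'g) presheaf \<Rightarrow> 'o \<Rightarrow>
    (('o \<times> 'g \<times> ('m \<times> 'm) set) \<times> ('o \<times> 'g \<times> ('m \<times> 'm) set)) set" where
  "elem_step \<T> \<S> F Y =
    {((X, Res F f x', \<phi>), (X', x', Comp (verdier_quotient \<T> \<S>) (quotient_arr \<T> \<S> f) \<phi>))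
      | X X' f x' \<phi>. f \<in> Hom \<T> X X' \<and> x' \<in> carrier (Val F X') \<and>
        \<phi> \<in> Hom (verdier_quotient \<T> \<S>) Y X}"

definition germ ::
  "('o, 'm) tricat \<Rightarrow> 'o set \<Rightarrow> ('o, 'm, 'g) presheaf \<Rightarrow> 'o \<Rightarrow> 'o \<times> 'g \<times> ('m \<times> 'm) set \<Rightarrow>
    ('o, 'm, 'g) germ" where
  "germ \<T> \<S> F Y t = ((elem_step \<T> \<S> F Y \<union> (elem_step \<T> \<S> F Y)\<inverse>)\<^sup>*) `` {t}"

definition extend_presheaf ::
  "('o, 'm) tricat \<Rightarrow> 'o set \<Rightarrow> ('o, 'm, 'g) presheaf \<Rightarrow>
    ('o, ('m \<times> 'm) set, ('o, 'm, 'g) germ) presheaf" where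
  "extend_presheaf \<T> \<S> F =
    \<lparr>Val = (\<lambda>Y.
      \<lparr>carrier = germ \<T> \<S> F Y ` elem_triples \<T> \<S> F Y,
       monoid.mult = (\<lambda>A B. \<Union>{germ \<T> \<S> F Y (X, x, Add (verdier_quotient \<T> \<S>) \<phi> \<psi>) | X x \<phi> \<psi>.
         (X, x, \<phi>) \<in> A \<and> (X, x, \<psi>) \<in> B}),
       one = \<Union>{germ \<T> \<S> F Y (X, x, Zero (verdier_quotient \<T> \<S>) Y X) | X x.
         X \<in> Obj \<T> \<and> x \<in> carrier (Val F X)}\<rparr>),
     Res = (\<lambda>\<psi> A. \<Union>{germ \<T> \<S> F (Dom (verdier_quotient \<T> \<S>) \<psi>)
         (X, x, Comp (verdier_quotient \<T> \<S>) \<phi> \<psi>) | X x \<phi>. (X, x, \<phi>) \<in> A})\<rparr>"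

definition Loc ::
  "('o, 'm) tricat \<Rightarrow> 'o set \<Rightarrow> ('o, 'm, 'g) presheaf \<Rightarrow> ('o, 'm, ('o, 'm, 'g) germ) presheaf" where
  "Loc \<T> \<S> F = restrict_presheaf \<T> \<S> (extend_presheaf \<T> \<S> F)"

text \<open>The action of \<open>L\<^sub>\<S>\<close> on a natural transformation \<open>\<alpha>\<close> from some functor to \<open>F'\<close>.\<close>

definition Loc_map ::
  "('o, 'm) tricat \<Rightarrow> 'o set \<Rightarrow> ('o, 'm, 'g) presheaf \<Rightarrow> ('o \<Rightarrow> 'g \<Rightarrow> 'g) \<Rightarrow>
    'o \<Rightarrow> ('o, 'm, 'g) germ \<Rightarrow> ('o, 'm, 'g) germ" where
  "Loc_map \<T> \<S> F' \<alpha> Y A = \<Union>{germ \<T> \<S> F' Y (X, \<alpha> X x, \<phi>) | X x \<phi>. (X, x, \<phi>) \<in> A}"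

text \<open>The morphism \<open>L\<^bsub>\<S>\<^sub>1\<^esub> F \<rightarrow> L\<^bsub>\<S>\<^sub>2\<^esub> F\<close> induced by an inclusion \<open>\<S>\<^sub>1 \<subseteq> \<S>\<^sub>2\<close>.\<close>

definition Loc_incl ::
  "('o, 'm) tricat \<Rightarrow> 'o set \<Rightarrow> ('o, 'm, 'g) presheaf \<Rightarrow>
    'o \<Rightarrow> ('o, 'm, 'g) germ \<Rightarrow> ('o, 'm, 'g) germ" where
  "Loc_incl \<T> \<S>\<^sub>2 F Y A = \<Union>{germ \<T> \<S>\<^sub>2 F Y (X, x, quotient_change \<T> \<S>\<^sub>2 \<phi>) | X x \<phi>. (X, x, \<phi>) \<in> A}"


section \<open>The Mayer--Vietoris sequence\<close>

definition mv_in ::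
  "('o, 'm) tricat \<Rightarrow> 'o set \<Rightarrow> 'o set \<Rightarrow> ('o, 'm, 'g) presheaf \<Rightarrow>
    'o \<Rightarrow> ('o, 'm, 'g) germ \<Rightarrow> ('o, 'm, 'g) germ \<times> ('o, 'm, 'g) germ" where
  "mv_in \<T> \<U> \<V> F Y A = (Loc_incl \<T> \<U> F Y A, Loc_incl \<T> \<V> F Y A)"

definition mv_out ::
  "('o, 'm) tricat \<Rightarrow> 'o set \<Rightarrow> 'o set \<Rightarrow> ('o, 'm, 'g) presheaf \<Rightarrow>
    'o \<Rightarrow> ('o, 'm, 'g) germ \<times> ('o, 'm, 'g) germ \<Rightarrow> ('o, 'm, 'g) germ" where
  "mv_out \<T> \<U> \<V> F Y = (\<lambda>(A, B).
    let J = thick_join \<T> {\<U>, \<V>}; G = Val (Loc \<T> J F) Y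
    in Loc_incl \<T> J F Y A \<otimes>\<^bsub>G\<^esub> inv\<^bsub>G\<^esub> (Loc_incl \<T> J F Y B))"

text \<open>
  For \<open>c: H \<rightarrow> \<Sigma> G\<close> this is \<open>\<Sigma>\<^sup>n c: \<Sigma>\<^sup>n H \<rightarrow> \<Sigma>\<^sup>n\<^sup>+\<^sup>1 G\<close>. For \<open>n < 0\<close> the functor \<open>\<Sigma>\<^sup>n \<Sigma> G\<close> is
  identified with \<open>\<Sigma>\<^sup>n\<^sup>+\<^sup>1 G\<close> along the isomorphism from the identity to \<open>\<Sigma>\<^sup>- \<circ> \<Sigma>\<close>; for
  \<open>n \<ge> 0\<close> the two are equal.
\<close>

definition shift_connecting ::
  "('o, 'm) tricat \<Rightarrow> int \<Rightarrow> ('o, 'm, 'g) presheaf \<Rightarrow> ('o \<Rightarrow> 'h \<Rightarrow> 'g) \<Rightarrow> 'o \<Rightarrow> 'h \<Rightarrow> 'g" where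
  "shift_connecting \<T> n G c = (\<lambda>X x.
    if 0 \<le> n then shift_nt \<T> n c X x
    else Res G (Unit \<T> (susp_pow_obj \<T> (- n - 1) X)) (shift_nt \<T> n c X x))"

text \<open>
  The terms are functors of \<open>F\<close>: the connecting morphism \<open>c\<close> is natural both in the
  object of \<open>\<T>\<close> and in \<open>F\<close>. The type argument fixes the universe \<open>'g\<close> for the values of \<open>F\<close>.
\<close>

definition mayer_vietoris_exists ::
  "('o, 'm) tricat \<Rightarrow> 'g itself \<Rightarrow> 'o set \<Rightarrow> 'o set \<Rightarrow> bool" where
  "mayer_vietoris_exists \<T> (_ :: 'g itself) \<U> \<V> \<longleftrightarrow>
    (let I = thick_meet \<T> {\<U>, \<V>}; J = thick_join \<T> {\<U>, \<V>} in
     \<exists>c :: ('o, 'm, 'g) presheaf \<Rightarrow> 'o \<Rightarrow> ('o, 'm, 'g) germ \<Rightarrow> ('o, 'm, 'g) germ.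
      (\<forall>F. cohomological \<T> F \<longrightarrow>
        natural_transformation \<T> (Loc \<T> J F) (shift \<T> 1 (Loc \<T> I F)) (c F)) \<and>
      (\<forall>F F' \<alpha>. cohomological \<T> F \<and> cohomological \<T> F' \<and> natural_transformation \<T> F F' \<alpha> \<longrightarrow>
        (\<forall>X \<in> Obj \<T>. \<forall>A \<in> carrier (Val (Loc \<T> J F) X).
          c F' X (Loc_map \<T> J F' \<alpha> X A) = shift_nt \<T> 1 (Loc_map \<T> I F' \<alpha>) X (c F X A))) \<and>
      (\<forall>F n. cohomological \<T> F \<longrightarrow>
        exact_presheaves \<T>
          (shift \<T> n (Loc \<T> I F)) (shift_nt \<T> n (mv_in \<T> \<U> \<V> F))
          (shift \<T> n (presheaf_sum (Loc \<T> \<U> F) (Loc \<T> \<V> F))) (shift_nt \<T> n (mv_out \<T> \<U> \<V> F))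
          (shift \<T> n (Loc \<T> J F)) \<and>
        exact_presheaves \<T>
          (shift \<T> n (presheaf_sum (Loc \<T> \<U> F) (Loc \<T> \<V> F))) (shift_nt \<T> n (mv_out \<T> \<U> \<V> F))
          (shift \<T> n (Loc \<T> J F)) (shift_connecting \<T> n (Loc \<T> I F) (c F))
          (shift \<T> (n + 1) (Loc \<T> I F)) \<and>
        exact_presheaves \<T>
          (shift \<T> n (Loc \<T> J F)) (shift_connecting \<T> n (Loc \<T> I F) (c F))
          (shift \<T> (n + 1) (Loc \<T> I F)) (shift_nt \<T> (n + 1) (mv_in \<T> \<U> \<V> F))
          (shift \<T> (n + 1) (presheaf_sum (Loc \<T> \<U> F) (Loc \<T> \<V> F)))))"

end

theory Submission
  imports Defs
begin

text \<open>
  Let \<open>\<N> \<subseteq> \<V>\<close> be thick. The objects \<open>X\<close> such that all morphisms from \<open>X\<close> to objects of \<open>\<V>\<close> factor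
  through \<open>\<N>\<close> form a thick subcategory, and dually. If all \<open>\<U>\<^sub>i\<close> commute with \<open>\<V>\<close>, this applies to
  \<open>\<N> = (\<Or>\<U>\<^sub>i) \<and> \<V>\<close>, which shows that the centre is closed under joins, and to \<open>\<N> = \<Or>(\<U>\<^sub>i \<and> \<V>)\<close>, which
  gives the frame law by factoring identity morphisms. There are enough points because unions of
  chains of thick subcategories are thick: for \<open>X \<in> \<U> - \<V>\<close> Zorn's lemma yields a central subcategory
  that is maximal among those containing \<open>\<V>\<close> but not \<open>X\<close>, and it is prime.

  For the Mayer--Vietoris sequence, \<open>L\<^sub>\<S> F\<close> at \<open>Y\<close> is the colimit of the \<open>F Y'\<close> over the morphisms
  \<open>Y' \<rightarrow> Y\<close> with cone in \<open>\<S>\<close>. Put \<open>G = L\<^sub>\<I> F\<close> with \<open>\<I> = \<U> \<and> \<V>\<close>; it vanishes on \<open>\<I>\<close>, so that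
  \<open>\<U>\<close>-torsion elements of \<open>G\<close> (those that die in \<open>L\<^sub>\<U> F\<close>) restrict to zero on objects of \<open>\<V>\<close> and
  lift along morphisms with cone in \<open>\<V>\<close>. For \<open>W\<close> in the join of \<open>\<U>\<close> and \<open>\<V>\<close> it follows that \<open>G W\<close> is
  the direct sum of its \<open>\<U>\<close>-torsion and its \<open>\<V>\<close>-torsion. The connecting morphism restricts an
  element from \<open>Y'\<close> to the fibre \<open>W\<close> of \<open>Y' \<rightarrow> Y\<close>, projects to the \<open>\<U>\<close>-torsion and restricts
  further along \<open>\<Sigma>\<^sup>-Y \<rightarrow> W\<close>.
\<close>

section \<open>Additive categories\<close>

text \<open>The third arrow in \<open>dist_morphism\<close> is not unique, so kernels and cokernels
  are only weak and nothing built from triangles is functorial by itself. What must be canonical,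
  above all the connecting morphism, is therefore pinned down on elements, where uniqueness of the
  torsion decomposition absorbs all choices. In the Mayer-Vietoris part commutativity enters mostly
  through one manoeuvre. A morphism between an object A of \<U> and an object B of \<V> that
  obstructs an extension or a lift factors through some Q in \<U> \<inter> \<V>. Replacing A by the
  cone or fibre of its morphism from or to Q removes the obstruction and keeps A in \<U>; on
  elements nothing is lost, because G vanishes on Q. The functors \<open>Loc\<close> are given by
  germs, that is, by a generated equivalence relation on triples, in which equality cannot be read
  off. An invariant of triples identifies germs with elements of the colimit over denominators. A
  short list of properties (\<open>localisation\<close>) then replaces germs in the exactness
  argument.\<close>

context additive_category
begin

abbreviation Mor (infix \<open>\<leadsto>\<close> 60) where "X \<leadsto> Y \<equiv> Hom C X Y"
abbreviation add_mor (infixl \<open>\<^bold>+\<close> 65) where "f \<^bold>+ g \<equiv> Add C f g"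
abbreviation minus_mor (infixl \<open>\<^bold>-\<close> 65) where "f \<^bold>- g \<equiv> Add C f (neg C g)"

lemma homD:
  assumes "f \<in> X \<leadsto> Y"
  shows "f \<in> Arr C" "Dom C f = X" "Cod C f = Y" "X \<in> Obj C" "Y \<in> Obj C"
  using assms dom_closed cod_closed by (auto simp: Hom_def)

lemma arr_hom: "f \<in> Arr C \<Longrightarrow> f \<in> Dom C f \<leadsto> Cod C f"
  by (simp add: Hom_def)

lemma hom_group_simps [simp]:
  "carrier (hom_group C X Y) = X \<leadsto> Y" "monoid.mult (hom_group C X Y) = Add C"
  "one (hom_group C X Y) = Zero C X Y"
  by (simp_all add: hom_group_def)

lemma hom_group: "f \<in> X \<leadsto> Y \<Longrightarrow> comm_group (hom_group C X Y)"
  by (rule hom_comm_group[OF homD(4,5)])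

lemma zero_closed: "X \<in> Obj C \<Longrightarrow> Y \<in> Obj C \<Longrightarrow> Zero C X Y \<in> X \<leadsto> Y"
  using comm_groupE(2)[OF hom_comm_group] by simp

lemma
  assumes "f \<in> X \<leadsto> Y"
  shows neg_closed: "neg C f \<in> X \<leadsto> Y"
    and zero_add: "Zero C X Y \<^bold>+ f = f"
    and add_zero: "f \<^bold>+ Zero C X Y = f"
    and add_neg: "f \<^bold>- f = Zero C X Y"
    and neg_add: "neg C f \<^bold>+ f = Zero C X Y"
    and neg_neg: "neg C (neg C f) = f"
proof -
  interpret comm_group "hom_group C X Y" by (rule hom_group[OF assms])
  have n: "neg C g = inv\<^bsub>hom_group C X Y\<^esub> g" if "g \<in> X \<leadsto> Y" for g
    using that by (simp add: neg_def homD[OF that])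
  have c: "f \<in> carrier (hom_group C X Y)" using assms by simp
  show nc: "neg C f \<in> X \<leadsto> Y" using inv_closed[OF c] n assms by simp
  show "Zero C X Y \<^bold>+ f = f" "f \<^bold>+ Zero C X Y = f" "f \<^bold>- f = Zero C X Y"
    "neg C f \<^bold>+ f = Zero C X Y"
    using l_one[OF c] r_one[OF c] r_inv[OF c] l_inv[OF c] n assms by simp_all
  show "neg C (neg C f) = f" using n[OF nc] n[OF assms] inv_inv[OF c] by simp
qed

lemma
  assumes "f \<in> X \<leadsto> Y" "g \<in> X \<leadsto> Y"
  shows add_closed: "f \<^bold>+ g \<in> X \<leadsto> Y"
    and neg_eqI: "f \<^bold>+ g = Zero C X Y \<Longrightarrow> neg C f = g"
    and minus_eq_zero: "f \<^bold>- g = Zero C X Y \<Longrightarrow> f = g"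
proof -
  interpret comm_group "hom_group C X Y" by (rule hom_group[OF assms(1)])
  have n: "neg C g = inv\<^bsub>hom_group C X Y\<^esub> g" if "g \<in> X \<leadsto> Y" for g
    using that by (simp add: neg_def homD[OF that])
  have c: "f \<in> carrier (hom_group C X Y)" "g \<in> carrier (hom_group C X Y)" using assms by simp_all
  show "f \<^bold>+ g \<in> X \<leadsto> Y" using m_closed[OF c] by simp
  show "neg C f = g" if "f \<^bold>+ g = Zero C X Y"
    unfolding n[OF assms(1)] by (rule inv_equality) (use that m_comm[OF c] c in simp_all)
  show "f = g" if "f \<^bold>- g = Zero C X Y"
  proof -
    have "inv\<^bsub>hom_group C X Y\<^esub> (inv\<^bsub>hom_group C X Y\<^esub> g) = f"
      by (rule inv_equality) (use that inv_closed[OF c(2)] c n[OF assms(2)] in simp_all)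
    then show ?thesis using inv_inv[OF c(2)] by simp
  qed
qed

lemma neg_inj: "f \<in> X \<leadsto> Y \<Longrightarrow> g \<in> X \<leadsto> Y \<Longrightarrow> neg C f = neg C g \<Longrightarrow> f = g"
  by (metis neg_neg)

lemma add_assoc:
  assumes "f \<in> X \<leadsto> Y" "g \<in> X \<leadsto> Y" "h \<in> X \<leadsto> Y"
  shows "f \<^bold>+ g \<^bold>+ h = f \<^bold>+ (g \<^bold>+ h)"
proof -
  interpret comm_group "hom_group C X Y" by (rule hom_group[OF assms(1)])
  show ?thesis using m_assoc[unfolded hom_group_simps, OF assms] .
qed

lemma minus_closed: "f \<in> X \<leadsto> Y \<Longrightarrow> g \<in> X \<leadsto> Y \<Longrightarrow> f \<^bold>- g \<in> X \<leadsto> Y"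
  by (simp add: add_closed neg_closed)

lemma idem_zero:
  assumes "f \<in> X \<leadsto> Y" "f \<^bold>+ f = f" shows "f = Zero C X Y"
proof -
  have "f = f \<^bold>+ f \<^bold>- f"
    using add_assoc[OF assms(1,1) neg_closed[OF assms(1)]] add_neg[OF assms(1)] add_zero[OF assms(1)]
    by simp
  then show ?thesis using assms add_neg by simp
qed

lemma comp_zero_right:
  assumes "g \<in> Y \<leadsto> Z" "X \<in> Obj C" shows "g \<cdot> Zero C X Y = Zero C X Z"
proof -
  have z: "Zero C X Y \<in> X \<leadsto> Y" using zero_closed[OF assms(2) homD(4)[OF assms(1)]] .
  show ?thesis using comp_add_right[OF z z assms(1)] zero_add[OF z] comp_closed[OF z assms(1)]
    by (intro idem_zero) simp_all
qed

lemma comp_zero_left: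
  assumes "g \<in> Y \<leadsto> Z" "X \<in> Obj C" shows "Zero C Z X \<cdot> g = Zero C Y X"
proof -
  have z: "Zero C Z X \<in> Z \<leadsto> X" using zero_closed[OF homD(5)[OF assms(1)] assms(2)] .
  show ?thesis using comp_add_left[OF assms(1) z z] zero_add[OF z] comp_closed[OF assms(1) z]
    by (intro idem_zero) simp_all
qed

lemma comp_neg_right:
  assumes "f \<in> X \<leadsto> Y" "g \<in> Y \<leadsto> Z" shows "g \<cdot> neg C f = neg C (g \<cdot> f)"
  using comp_add_right[OF assms(1) neg_closed[OF assms(1)] assms(2)] add_neg[OF assms(1)]
    comp_zero_right[OF assms(2)] homD(4)[OF assms(1)]
  by (intro neg_eqI[OF comp_closed[OF assms] comp_closed[OF neg_closed[OF assms(1)] assms(2)], symmetric]) simp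

lemma comp_neg_left:
  assumes "f \<in> X \<leadsto> Y" "g \<in> Y \<leadsto> Z" shows "neg C g \<cdot> f = neg C (g \<cdot> f)"
  using comp_add_left[OF assms neg_closed[OF assms(2)]] add_neg[OF assms(2)]
    comp_zero_left[OF assms(1)] homD(5)[OF assms(2)]
  by (intro neg_eqI[OF comp_closed[OF assms] comp_closed[OF assms(1) neg_closed[OF assms(2)]], symmetric]) simp

lemma comp_minus_right:
  assumes "f \<in> X \<leadsto> Y" "f' \<in> X \<leadsto> Y" "g \<in> Y \<leadsto> Z" shows "g \<cdot> (f \<^bold>- f') = g \<cdot> f \<^bold>- g \<cdot> f'"
  using comp_add_right[OF assms(1) neg_closed[OF assms(2)] assms(3)] comp_neg_right[OF assms(2,3)] by simp

lemma comp_minus_left: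
  assumes "f \<in> X \<leadsto> Y" "g \<in> Y \<leadsto> Z" "g' \<in> Y \<leadsto> Z" shows "(g \<^bold>- g') \<cdot> f = g \<cdot> f \<^bold>- g' \<cdot> f"
  using comp_add_left[OF assms(1,2) neg_closed[OF assms(3)]] comp_neg_left[OF assms(1,3)] by simp

lemma neg_zero: "X \<in> Obj C \<Longrightarrow> Y \<in> Obj C \<Longrightarrow> neg C (Zero C X Y) = Zero C X Y"
  by (rule neg_eqI) (use zero_closed zero_add in auto)

lemma zero_object_hom:
  assumes "zero_object C Z"
  shows "Z \<in> Obj C" "f \<in> Z \<leadsto> X \<Longrightarrow> f = Zero C Z X" "f \<in> X \<leadsto> Z \<Longrightarrow> f = Zero C X Z"
proof -
  show o: "Z \<in> Obj C" using assms unfolding zero_object_def by blast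
  show "f = Zero C Z X" if f: "f \<in> Z \<leadsto> X"
    using assms f zero_closed[OF o homD(5)[OF f]] homD(5)[OF f] unfolding zero_object_def by blast
  show "f = Zero C X Z" if f: "f \<in> X \<leadsto> Z"
    using assms f zero_closed[OF homD(4)[OF f] o] homD(4)[OF f] unfolding zero_object_def by blast
qed

lemma zero_objectI:
  assumes "Z \<in> Obj C" "Id C Z = Zero C Z Z" shows "zero_object C Z"
proof -
  have "f = Zero C Z X" if "f \<in> Z \<leadsto> X" for f X
    using id_right[OF that] comp_zero_right[OF that assms(1)] assms(2) by simp
  moreover have "f = Zero C X Z" if "f \<in> X \<leadsto> Z" for f X
    using id_left[OF that] comp_zero_left[OF that assms(1)] assms(2) by simp
  ultimately show ?thesis unfolding zero_object_def using assms zero_closed by blast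
qed

lemma iso_inverse:
  assumes "iso_arr C f" "f \<in> X \<leadsto> Y"
  obtains g where "g \<in> Y \<leadsto> X" "g \<cdot> f = Id C X" "f \<cdot> g = Id C Y"
  using assms homD[OF assms(2)] unfolding iso_arr_def by auto

lemma iso_arrI:
  assumes "f \<in> X \<leadsto> Y" "g \<in> Y \<leadsto> X" "g \<cdot> f = Id C X" "f \<cdot> g = Id C Y" shows "iso_arr C f"
  using assms homD[OF assms(1)] unfolding iso_arr_def by auto

lemma iso_id: "X \<in> Obj C \<Longrightarrow> iso_arr C (Id C X)"
  using iso_arrI[OF id_closed id_closed] id_left id_closed by metis

end

section \<open>Additive endofunctors on zero morphisms and negatives\<close>

lemma additive_endofunctorD:
  assumes "additive_endofunctor C F\<^sub>0 F\<^sub>1"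
  shows "X \<in> Obj C \<Longrightarrow> F\<^sub>0 X \<in> Obj C" "X \<in> Obj C \<Longrightarrow> F\<^sub>1 (Id C X) = Id C (F\<^sub>0 X)"
    "f \<in> Hom C X Y \<Longrightarrow> F\<^sub>1 f \<in> Hom C (F\<^sub>0 X) (F\<^sub>0 Y)"
    "f \<in> Hom C X Y \<Longrightarrow> g \<in> Hom C Y Z \<Longrightarrow> F\<^sub>1 (Comp C g f) = Comp C (F\<^sub>1 g) (F\<^sub>1 f)"
    "f \<in> Hom C X Y \<Longrightarrow> g \<in> Hom C X Y \<Longrightarrow> F\<^sub>1 (Add C f g) = Add C (F\<^sub>1 f) (F\<^sub>1 g)"
  using assms unfolding additive_endofunctor_def by blast+

context additive_category
begin

lemma endofunctor_zero:
  assumes F: "additive_endofunctor C F\<^sub>0 F\<^sub>1" and o: "X \<in> Obj C" "Y \<in> Obj C"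
  shows "F\<^sub>1 (Zero C X Y) = Zero C (F\<^sub>0 X) (F\<^sub>0 Y)"
proof (rule idem_zero)
  note z = zero_closed[OF o]
  show "F\<^sub>1 (Zero C X Y) \<in> F\<^sub>0 X \<leadsto> F\<^sub>0 Y" using additive_endofunctorD(3)[OF F z] .
  show "F\<^sub>1 (Zero C X Y) \<^bold>+ F\<^sub>1 (Zero C X Y) = F\<^sub>1 (Zero C X Y)"
    using additive_endofunctorD(5)[OF F z z] zero_add[OF z] by simp
qed

lemma endofunctor_neg:
  assumes F: "additive_endofunctor C F\<^sub>0 F\<^sub>1" and f: "f \<in> X \<leadsto> Y"
  shows "F\<^sub>1 (neg C f) = neg C (F\<^sub>1 f)"
proof (rule neg_eqI[symmetric])
  note n = neg_closed[OF f]
  show "F\<^sub>1 f \<in> F\<^sub>0 X \<leadsto> F\<^sub>0 Y" "F\<^sub>1 (neg C f) \<in> F\<^sub>0 X \<leadsto> F\<^sub>0 Y"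
    using additive_endofunctorD(3)[OF F] f n by blast+
  show "F\<^sub>1 f \<^bold>+ F\<^sub>1 (neg C f) = Zero C (F\<^sub>0 X) (F\<^sub>0 Y)"
    using additive_endofunctorD(5)[OF F f n] add_neg[OF f] endofunctor_zero[OF F] homD[OF f] by simp
qed

end

section \<open>Triangulated categories\<close>

context additive_category
begin

lemma iso_cancel_left:
  assumes "iso_arr C a" "a \<in> Y \<leadsto> Z" "f \<in> X \<leadsto> Y" "g \<in> X \<leadsto> Y" "a \<cdot> f = a \<cdot> g"
  shows "f = g"
proof -
  obtain b where b: "b \<in> Z \<leadsto> Y" "b \<cdot> a = Id C Y" using iso_inverse[OF assms(1,2)] by metis
  have "f = b \<cdot> (a \<cdot> f)" "g = b \<cdot> (a \<cdot> g)"
    using comp_assoc[OF assms(3) assms(2) b(1)] comp_assoc[OF assms(4) assms(2) b(1)]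
      id_left[OF assms(3)] id_left[OF assms(4)] b(2) by simp_all
  then show ?thesis using assms(5) by simp
qed

lemma iso_cancel_right:
  assumes "iso_arr C a" "a \<in> X \<leadsto> Y" "f \<in> Y \<leadsto> Z" "g \<in> Y \<leadsto> Z" "f \<cdot> a = g \<cdot> a"
  shows "f = g"
proof -
  obtain b where b: "b \<in> Y \<leadsto> X" "a \<cdot> b = Id C Y" using iso_inverse[OF assms(1,2)] by metis
  have "f = (f \<cdot> a) \<cdot> b" "g = (g \<cdot> a) \<cdot> b"
    using comp_assoc[OF b(1) assms(2) assms(3)] comp_assoc[OF b(1) assms(2) assms(4)]
      id_right[OF assms(3)] id_right[OF assms(4)] b(2) by simp_all
  then show ?thesis using assms(5) by simp
qed

end

context triangulated_category
begin

notation Mor (infix \<open>\<leadsto>\<close> 60)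
notation add_mor (infixl \<open>\<^bold>+\<close> 65)
notation minus_mor (infixl \<open>\<^bold>-\<close> 65)
abbreviation "\<Sigma>\<^sub>0 \<equiv> Susp_obj \<T>"
abbreviation "\<Sigma>\<^sub>1 \<equiv> Susp_arr \<T>"
abbreviation "\<Omega>\<^sub>0 \<equiv> Desusp_obj \<T>"
abbreviation "\<Omega>\<^sub>1 \<equiv> Desusp_arr \<T>"

section \<open>The suspension as a fully faithful functor with chosen quasi-inverse\<close>

lemmas susp = additive_endofunctorD[OF susp_functor]
lemmas desusp = additive_endofunctorD[OF desusp_functor]
lemmas susp_zero = endofunctor_zero[OF susp_functor]
lemmas susp_neg = endofunctor_neg[OF susp_functor]
lemmas desusp_zero = endofunctor_zero[OF desusp_functor]

lemma susp_faithful: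
  assumes f: "f \<in> X \<leadsto> Y" and g: "g \<in> X \<leadsto> Y" and eq: "\<Sigma>\<^sub>1 f = \<Sigma>\<^sub>1 g"
  shows "f = g"
  by (rule iso_cancel_left[OF unit_iso[OF homD(5)[OF f]] unit_hom[OF homD(5)[OF f]] f g])
    (simp add: unit_natural[OF f] unit_natural[OF g] eq)

text \<open>The axiom \<open>counit\<close> only asserts existence, so one natural isomorphism from
  \<open>\<Sigma>\<^sub>0 (\<Omega>\<^sub>0 X)\<close> to X is fixed here. No triangle identity is
  available between it and \<open>Unit\<close>; the arguments use each of the two on its
  own.\<close>

definition eps :: "'o \<Rightarrow> 'm" where
  "eps = (SOME \<epsilon>. (\<forall>X \<in> Obj \<T>. \<epsilon> X \<in> \<Sigma>\<^sub>0 (\<Omega>\<^sub>0 X) \<leadsto> X \<and> iso_arr \<T> (\<epsilon> X)) \<and>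
    (\<forall>X Y. \<forall>f \<in> X \<leadsto> Y. \<epsilon> Y \<cdot> \<Sigma>\<^sub>1 (\<Omega>\<^sub>1 f) = f \<cdot> \<epsilon> X))"

definition eps' :: "'o \<Rightarrow> 'm" where
  "eps' X = (SOME g. g \<in> X \<leadsto> \<Sigma>\<^sub>0 (\<Omega>\<^sub>0 X) \<and> g \<cdot> eps X = Id \<T> (\<Sigma>\<^sub>0 (\<Omega>\<^sub>0 X)) \<and> eps X \<cdot> g = Id \<T> X)"

lemma
  shows eps_hom: "X \<in> Obj \<T> \<Longrightarrow> eps X \<in> \<Sigma>\<^sub>0 (\<Omega>\<^sub>0 X) \<leadsto> X"
    and eps_iso: "X \<in> Obj \<T> \<Longrightarrow> iso_arr \<T> (eps X)"
    and eps_natural: "f \<in> X \<leadsto> Y \<Longrightarrow> eps Y \<cdot> \<Sigma>\<^sub>1 (\<Omega>\<^sub>1 f) = f \<cdot> eps X"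
  using someI_ex[OF counit] unfolding eps_def[symmetric] by blast+

lemma eps':
  assumes "X \<in> Obj \<T>"
  shows "eps' X \<in> X \<leadsto> \<Sigma>\<^sub>0 (\<Omega>\<^sub>0 X)" "eps' X \<cdot> eps X = Id \<T> (\<Sigma>\<^sub>0 (\<Omega>\<^sub>0 X))"
    "eps X \<cdot> eps' X = Id \<T> X" "iso_arr \<T> (eps' X)"
proof -
  have "\<exists>g. g \<in> X \<leadsto> \<Sigma>\<^sub>0 (\<Omega>\<^sub>0 X) \<and> g \<cdot> eps X = Id \<T> (\<Sigma>\<^sub>0 (\<Omega>\<^sub>0 X)) \<and> eps X \<cdot> g = Id \<T> X"
    using iso_inverse[OF eps_iso[OF assms] eps_hom[OF assms]] by metis
  then have *: "eps' X \<in> X \<leadsto> \<Sigma>\<^sub>0 (\<Omega>\<^sub>0 X) \<and> eps' X \<cdot> eps X = Id \<T> (\<Sigma>\<^sub>0 (\<Omega>\<^sub>0 X)) \<and>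
      eps X \<cdot> eps' X = Id \<T> X"
    unfolding eps'_def by (rule someI_ex)
  then show "eps' X \<in> X \<leadsto> \<Sigma>\<^sub>0 (\<Omega>\<^sub>0 X)" "eps' X \<cdot> eps X = Id \<T> (\<Sigma>\<^sub>0 (\<Omega>\<^sub>0 X))"
    "eps X \<cdot> eps' X = Id \<T> X" by blast+
  show "iso_arr \<T> (eps' X)"
    using iso_arrI[of "eps' X" X "\<Sigma>\<^sub>0 (\<Omega>\<^sub>0 X)" "eps X"] * eps_hom[OF assms] by blast
qed

lemma eps_cancel:
  assumes "f \<in> X \<leadsto> Y"
  shows "eps Y \<cdot> (eps' Y \<cdot> f) = f"
    "(f \<cdot> eps X) \<cdot> eps' X = f"
  using comp_assoc[OF assms eps'(1) eps_hom] comp_assoc[OF eps'(1) eps_hom assms]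
    eps'(3) id_left[OF assms] id_right[OF assms] homD(4,5)[OF assms] by simp_all

lemma desusp_faithful:
  assumes f: "f \<in> X \<leadsto> Y" and g: "g \<in> X \<leadsto> Y" and eq: "\<Omega>\<^sub>1 f = \<Omega>\<^sub>1 g"
  shows "f = g"
  by (rule iso_cancel_right[OF eps_iso[OF homD(4)[OF f]] eps_hom[OF homD(4)[OF f]] f g])
    (simp add: eps_natural[OF f, symmetric] eps_natural[OF g, symmetric] eq)

text \<open>The candidate is the conjugate of \<open>\<Omega>\<^sub>1 h\<close> by the unit.
  Naturality of the unit gives the equation only after applying \<open>\<Omega>\<^sub>1\<close>, and
  faithfulness of the quasi-inverse, which comes from the counit, removes it again.\<close>

lemma susp_full:
  assumes h: "h \<in> \<Sigma>\<^sub>0 X \<leadsto> \<Sigma>\<^sub>0 Y" and o: "X \<in> Obj \<T>" "Y \<in> Obj \<T>"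
  obtains f where "f \<in> X \<leadsto> Y" "\<Sigma>\<^sub>1 f = h"
proof -
  obtain v where v: "v \<in> \<Omega>\<^sub>0 (\<Sigma>\<^sub>0 Y) \<leadsto> Y" "Unit \<T> Y \<cdot> v = Id \<T> (\<Omega>\<^sub>0 (\<Sigma>\<^sub>0 Y))"
    using iso_inverse[OF unit_iso unit_hom, OF o(2,2)] by metis
  define f where "f = v \<cdot> (\<Omega>\<^sub>1 h \<cdot> Unit \<T> X)"
  have k: "\<Omega>\<^sub>1 h \<cdot> Unit \<T> X \<in> X \<leadsto> \<Omega>\<^sub>0 (\<Sigma>\<^sub>0 Y)" using comp_closed[OF unit_hom[OF o(1)] desusp(3)[OF h]] .
  have f: "f \<in> X \<leadsto> Y" using comp_closed[OF k v(1)] by (simp add: f_def)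
  have "Unit \<T> Y \<cdot> f = \<Omega>\<^sub>1 h \<cdot> Unit \<T> X"
    unfolding f_def using comp_assoc[OF k v(1) unit_hom[OF o(2)]] v(2) id_left[OF k] by simp
  then have "\<Omega>\<^sub>1 (\<Sigma>\<^sub>1 f) = \<Omega>\<^sub>1 h"
    using unit_natural[OF f] iso_cancel_right[OF unit_iso unit_hom desusp(3)[OF susp(3)[OF f]] desusp(3)[OF h], OF o(1,1)]
    by simp
  then have "\<Sigma>\<^sub>1 f = h" using desusp_faithful[OF susp(3)[OF f] h] by simp
  then show thesis using f that by blast
qed

subsection \<open>Exact triangles\<close>

definition tri :: "'o \<Rightarrow> 'm \<Rightarrow> 'o \<Rightarrow> 'm \<Rightarrow> 'o \<Rightarrow> 'm \<Rightarrow> bool" where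
  "tri X f Y g Z h \<longleftrightarrow> (f, g, h) \<in> Dist \<T> \<and> f \<in> X \<leadsto> Y \<and> g \<in> Y \<leadsto> Z \<and> h \<in> Z \<leadsto> \<Sigma>\<^sub>0 X"

lemma triD:
  assumes "tri X f Y g Z h"
  shows "(f, g, h) \<in> Dist \<T>" "f \<in> X \<leadsto> Y" "g \<in> Y \<leadsto> Z" "h \<in> Z \<leadsto> \<Sigma>\<^sub>0 X"
    "X \<in> Obj \<T>" "Y \<in> Obj \<T>" "Z \<in> Obj \<T>"
  using assms homD(4,5)[of f X Y] homD(5)[of g Y Z] unfolding tri_def by auto

lemma tri_dom_cod:
  assumes "tri X f Y g Z h"
  shows "Dom \<T> f = X" "Cod \<T> f = Y" "Dom \<T> g = Y" "Cod \<T> g = Z" "Dom \<T> h = Z" "Cod \<T> h = \<Sigma>\<^sub>0 X"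
  using homD(2,3) triD(2-4)[OF assms] by auto

lemma dist_tri: "(f, g, h) \<in> Dist \<T> \<Longrightarrow> tri (Dom \<T> f) f (Cod \<T> f) g (Cod \<T> g) h"
  using dist_candidate[of f g h] unfolding tri_def candidate_triangle_def Hom_def by auto

lemma candidateI:
  "f \<in> X \<leadsto> Y \<Longrightarrow> g \<in> Y \<leadsto> Z \<Longrightarrow> h \<in> Z \<leadsto> \<Sigma>\<^sub>0 X \<Longrightarrow> candidate_triangle \<T> f g h"
  unfolding candidate_triangle_def Hom_def by auto

lemma tri_exists:
  assumes "f \<in> X \<leadsto> Y" obtains g Z h where "tri X f Y g Z h"
  using dist_complete[of f] dist_tri homD(1-3)[OF assms] by metis

lemma tri_rotate: "tri X f Y g Z h \<Longrightarrow> tri Y g Z h (\<Sigma>\<^sub>0 X) (neg \<T> (\<Sigma>\<^sub>1 f))"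
  using dist_rotate[OF candidateI, of f X Y g Z h] neg_closed[OF susp(3), of f X Y] unfolding tri_def by blast

lemma tri_unrotate:
  "tri Y g Z h (\<Sigma>\<^sub>0 X) (neg \<T> (\<Sigma>\<^sub>1 f)) \<Longrightarrow> f \<in> X \<leadsto> Y \<Longrightarrow> tri X f Y g Z h"
  using dist_rotate[OF candidateI, of f X Y g Z h] unfolding tri_def by blast

lemma tri_iso:
  assumes t: "tri X f Y g Z h" and "f' \<in> X' \<leadsto> Y'" "g' \<in> Y' \<leadsto> Z'" "h' \<in> Z' \<leadsto> \<Sigma>\<^sub>0 X'"
    and "a \<in> X \<leadsto> X'" "b \<in> Y \<leadsto> Y'" "c \<in> Z \<leadsto> Z'" "iso_arr \<T> a" "iso_arr \<T> b" "iso_arr \<T> c"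
    and "b \<cdot> f = f' \<cdot> a" "c \<cdot> g = g' \<cdot> b" "\<Sigma>\<^sub>1 a \<cdot> h = h' \<cdot> c"
  shows "tri X' f' Y' g' Z' h'"
proof -
  have "(f', g', h') \<in> Dist \<T>"
    by (rule dist_iso[OF triD(1)[OF t] candidateI[OF assms(2-4)], of a b c])
      (simp_all add: assms tri_dom_cod[OF t] homD(2,3)[OF assms(2)] homD(2,3)[OF assms(3)])
  then show ?thesis using assms unfolding tri_def by blast
qed

lemma tri_morphism:
  assumes t: "tri X f Y g Z h" and t': "tri X' f' Y' g' Z' h'"
    and "a \<in> X \<leadsto> X'" "b \<in> Y \<leadsto> Y'" "b \<cdot> f = f' \<cdot> a"
  obtains c where "c \<in> Z \<leadsto> Z'" "c \<cdot> g = g' \<cdot> b" "\<Sigma>\<^sub>1 a \<cdot> h = h' \<cdot> c"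
  using dist_morphism[OF triD(1)[OF t] triD(1)[OF t'], of a b] assms tri_dom_cod[OF t] tri_dom_cod[OF t'] by auto

lemma tri_id:
  assumes "X \<in> Obj \<T>" "zero_object \<T> Z"
  shows "tri X (Id \<T> X) X (Zero \<T> X Z) Z (Zero \<T> Z (\<Sigma>\<^sub>0 X))"
  unfolding tri_def
  using dist_id[OF assms] id_closed[OF assms(1)] zero_closed susp(1) zero_object_hom(1)[OF assms(2)] assms(1)
  by blast

text \<open>A comparison with the triangle on the identity of X, whose third object is zero, factors
  \<open>g \<cdot> f\<close> through a zero object. The second equation is the first for the rotated
  triangle.\<close>

lemma tri_comp_zero:
  assumes t: "tri X f Y g Z h" shows "g \<cdot> f = Zero \<T> X Z" "h \<cdot> g = Zero \<T> Y (\<Sigma>\<^sub>0 X)"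
proof -
  have *: "g \<cdot> f = Zero \<T> X Z" if t: "tri X f Y g Z h" for X f Y g Z h
  proof -
    obtain N where N: "zero_object \<T> N" using zero_object_exists by blast
    obtain c where c: "c \<in> N \<leadsto> Z" "c \<cdot> Zero \<T> X N = g \<cdot> f"
      using tri_morphism[OF tri_id[OF triD(5)[OF t] N] t id_closed[OF triD(5)[OF t]] triD(2)[OF t]]
      by (metis)
    show ?thesis using comp_zero_right[OF c(1) triD(5)[OF t]] c(2) by simp
  qed
  show "g \<cdot> f = Zero \<T> X Z" "h \<cdot> g = Zero \<T> Y (\<Sigma>\<^sub>0 X)" using *[OF t] *[OF tri_rotate[OF t]] by auto
qed

section \<open>Weak kernels and weak cokernels in a triangle\<close>

lemma zero_object_susp: "zero_object \<T> Z \<Longrightarrow> zero_object \<T> (\<Sigma>\<^sub>0 Z)"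
  using zero_object_hom(1)[of Z] zero_object_hom(2)[of Z "Id \<T> Z" Z] susp(1,2)[of Z] susp_zero[of Z Z] id_closed[of Z] by (intro zero_objectI) simp_all

lemma tri_zero_left:
  assumes "B \<in> Obj \<T>" "zero_object \<T> Z"
  shows "tri Z (Zero \<T> Z B) B (Id \<T> B) B (Zero \<T> B (\<Sigma>\<^sub>0 Z))"
proof -
  note o = zero_object_hom(1)[OF assms(2)] zero_object_hom(1)[OF zero_object_susp[OF assms(2)]]
  show ?thesis
    using tri_id[OF assms(1) zero_object_susp[OF assms(2)]] zero_closed[OF o(1) assms(1)]
      susp_zero[OF o(1) assms(1)] neg_zero[OF o(2) susp(1)[OF assms(1)]]
    by - (rule tri_unrotate, simp_all)
qed

text \<open>A morphism that kills \<open>f\<close> gives a morphism to the triangle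
  \<open>N \<rightarrow> B = B\<close> with N zero; its third component is the factorisation, which
  is not unique.\<close>

lemma weak_cokernel:
  assumes t: "tri X f Y g Z h" and b: "b \<in> Y \<leadsto> B" "b \<cdot> f = Zero \<T> X B"
  obtains c where "c \<in> Z \<leadsto> B" "c \<cdot> g = b"
proof -
  obtain N where N: "zero_object \<T> N" using zero_object_exists by blast
  note B = homD(5)[OF b(1)]
  have z: "Zero \<T> X N \<in> X \<leadsto> N" "Zero \<T> N B \<in> N \<leadsto> B"
    using zero_closed triD(5)[OF t] zero_object_hom(1)[OF N] B by auto
  have "b \<cdot> f = Zero \<T> N B \<cdot> Zero \<T> X N" using b comp_zero_left[OF z(1) B] by simp
  from tri_morphism[OF t tri_zero_left[OF B N] z(1) b(1) this] obtain c where
    "c \<in> Z \<leadsto> B" "c \<cdot> g = Id \<T> B \<cdot> b" by metis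
  then show thesis using that id_left[OF b(1)] by simp
qed

text \<open>The morphism axiom supplies a third component, while here the first is missing. Both
  triangles are therefore rotated, which makes the suspended first objects the third ones; full
  faithfulness of the suspension then brings the completion back.\<close>

lemma weak_kernel:
  assumes t: "tri X f Y g Z h" and a: "a \<in> A \<leadsto> Y" "g \<cdot> a = Zero \<T> A Z"
  obtains c where "c \<in> A \<leadsto> X" "f \<cdot> c = a"
proof -
  obtain N where N: "zero_object \<T> N" using zero_object_exists by blast
  note A = homD(4)[OF a(1)]
  have z: "Zero \<T> N Z \<in> N \<leadsto> Z" "Zero \<T> A N \<in> A \<leadsto> N"
    using zero_closed triD(7)[OF t] zero_object_hom(1)[OF N] A by auto
  have e: "Zero \<T> N Z \<cdot> Zero \<T> A N = g \<cdot> a" using a comp_zero_right[OF z(1) A] by simp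
  obtain c where c: "c \<in> \<Sigma>\<^sub>0 A \<leadsto> \<Sigma>\<^sub>0 X" "\<Sigma>\<^sub>1 a \<cdot> neg \<T> (\<Sigma>\<^sub>1 (Id \<T> A)) = neg \<T> (\<Sigma>\<^sub>1 f) \<cdot> c"
    using tri_morphism[OF tri_rotate[OF tri_id[OF A N]] tri_rotate[OF t] a(1) z(1) e] by metis
  obtain c' where c': "c' \<in> A \<leadsto> X" "\<Sigma>\<^sub>1 c' = c" using susp_full[OF c(1) A triD(5)[OF t]] by metis
  have fc: "f \<cdot> c' \<in> A \<leadsto> Y" using comp_closed[OF c'(1) triD(2)[OF t]] .
  have "neg \<T> (\<Sigma>\<^sub>1 a) = neg \<T> (\<Sigma>\<^sub>1 (f \<cdot> c'))"
    using c(2) comp_neg_right[OF susp(3)[OF id_closed[OF A]] susp(3)[OF a(1)]]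
      comp_neg_left[OF c(1) susp(3)[OF triD(2)[OF t]]] susp(2)[OF A] id_right[OF susp(3)[OF a(1)]]
      susp(4)[OF c'(1) triD(2)[OF t]] c'(2) by simp
  then have "\<Sigma>\<^sub>1 a = \<Sigma>\<^sub>1 (f \<cdot> c')" using neg_neg[OF susp(3)[OF a(1)]] neg_neg[OF susp(3)[OF fc]] by metis
  then show thesis using that c'(1) susp_faithful[OF a(1) fc] by simp
qed

lemma octahedron:
  assumes t: "tri X f Y f\<^sub>2 A f\<^sub>3" and t': "tri Y g Z g\<^sub>2 B g\<^sub>3" and t'': "tri X (g \<cdot> f) Z h\<^sub>2 D h\<^sub>3"
  obtains d\<^sub>1 d\<^sub>2 where "tri A d\<^sub>1 D d\<^sub>2 B (\<Sigma>\<^sub>1 f\<^sub>2 \<cdot> g\<^sub>3)" "d\<^sub>1 \<cdot> f\<^sub>2 = h\<^sub>2 \<cdot> g" "h\<^sub>3 \<cdot> d\<^sub>1 = f\<^sub>3"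
    "d\<^sub>2 \<cdot> h\<^sub>2 = g\<^sub>2" "g\<^sub>3 \<cdot> d\<^sub>2 = \<Sigma>\<^sub>1 f \<cdot> h\<^sub>3"
proof -
  obtain d\<^sub>1 d\<^sub>2 d\<^sub>3 where d: "d\<^sub>1 \<in> A \<leadsto> D" "d\<^sub>2 \<in> D \<leadsto> B" "(d\<^sub>1, d\<^sub>2, d\<^sub>3) \<in> Dist \<T>"
    "d\<^sub>1 \<cdot> f\<^sub>2 = h\<^sub>2 \<cdot> g" "h\<^sub>3 \<cdot> d\<^sub>1 = f\<^sub>3" "d\<^sub>2 \<cdot> h\<^sub>2 = g\<^sub>2" "g\<^sub>3 \<cdot> d\<^sub>2 = \<Sigma>\<^sub>1 f \<cdot> h\<^sub>3" "d\<^sub>3 = \<Sigma>\<^sub>1 f\<^sub>2 \<cdot> g\<^sub>3"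
    using octahedral[OF triD(1)[OF t] triD(1)[OF t'] _ triD(1)[OF t'']]
      tri_dom_cod[OF t] tri_dom_cod[OF t'] tri_dom_cod[OF t''] by auto
  have "tri A d\<^sub>1 D d\<^sub>2 B (\<Sigma>\<^sub>1 f\<^sub>2 \<cdot> g\<^sub>3)"
    using d comp_closed[OF triD(4)[OF t'] susp(3)[OF triD(3)[OF t]]] unfolding tri_def by auto
  then show thesis using that d by blast
qed

text \<open>Rotating backwards needs an object whose suspension is Z, but Z is only isomorphic to
  \<open>\<Sigma>\<^sub>0 (\<Omega>\<^sub>0 Z)\<close>. The triangle is transported along
  \<open>eps' Z\<close> beforehand, and the sign of \<open>i\<close> cancels the one introduced by
  rotation.\<close>

lemma tri_desusp:
  assumes t: "tri X f Y g Z h"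
  obtains i where "\<Sigma>\<^sub>1 i = neg \<T> (h \<cdot> eps Z)" "tri (\<Omega>\<^sub>0 Z) i X f Y (eps' Z \<cdot> g)"
proof -
  note o = triD(5-7)[OF t] and f = triD(2)[OF t]
  have h: "h \<cdot> eps Z \<in> \<Sigma>\<^sub>0 (\<Omega>\<^sub>0 Z) \<leadsto> \<Sigma>\<^sub>0 X" using comp_closed[OF eps_hom[OF o(3)] triD(4)[OF t]] .
  obtain i where i: "i \<in> \<Omega>\<^sub>0 Z \<leadsto> X" "\<Sigma>\<^sub>1 i = neg \<T> (h \<cdot> eps Z)"
    using susp_full[OF neg_closed[OF h] desusp(1)[OF o(3)] o(1)] .
  have gi: "eps' Z \<cdot> g \<in> Y \<leadsto> \<Sigma>\<^sub>0 (\<Omega>\<^sub>0 Z)" using comp_closed[OF triD(3)[OF t] eps'(1)[OF o(3)]] .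
  have "tri X f Y (eps' Z \<cdot> g) (\<Sigma>\<^sub>0 (\<Omega>\<^sub>0 Z)) (h \<cdot> eps Z)"
  proof (rule tri_iso[OF t f gi h id_closed[OF o(1)] id_closed[OF o(2)] eps'(1)[OF o(3)]
        iso_id[OF o(1)] iso_id[OF o(2)] eps'(4)[OF o(3)]])
    show "\<Sigma>\<^sub>1 (Id \<T> X) \<cdot> h = h \<cdot> eps Z \<cdot> eps' Z"
      using comp_assoc[OF eps'(1)[OF o(3)] eps_hom[OF o(3)] triD(4)[OF t]] eps'(3)[OF o(3)]
        susp(2)[OF o(1)] id_left[OF triD(4)[OF t]] id_right[OF triD(4)[OF t]] by simp
  qed (use id_left[OF f] id_right[OF f] id_right[OF gi] in simp_all)
  then have "tri (\<Omega>\<^sub>0 Z) i X f Y (eps' Z \<cdot> g)"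
    using i neg_neg[OF h] by - (rule tri_unrotate, simp_all)
  then show thesis using that i(2) by blast
qed

lemma tri_fiber:
  assumes f: "f \<in> X \<leadsto> Y" obtains W i k where "tri W i X f Y k"
  using tri_exists[OF f] tri_desusp by metis

text \<open>
  Exact triangles \<open>\<Sigma>\<^sup>-Y \<rightarrow> W \<rightarrow> X \<rightarrow> Y\<close>, the last object being identified with \<open>\<Sigma>\<Sigma>\<^sup>-Y\<close>.
\<close>

definition dtri :: "'o \<Rightarrow> 'm \<Rightarrow> 'o \<Rightarrow> 'm \<Rightarrow> 'o \<Rightarrow> 'm \<Rightarrow> bool" where
  "dtri Y l W i X s \<longleftrightarrow> s \<in> X \<leadsto> Y \<and> tri (\<Omega>\<^sub>0 Y) l W i X (eps' Y \<cdot> s)"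

lemma dtriD:
  assumes "dtri Y l W i X s"
  shows "l \<in> \<Omega>\<^sub>0 Y \<leadsto> W" "i \<in> W \<leadsto> X" "s \<in> X \<leadsto> Y" "tri (\<Omega>\<^sub>0 Y) l W i X (eps' Y \<cdot> s)"
    "Y \<in> Obj \<T>" "W \<in> Obj \<T>" "X \<in> Obj \<T>"
  using assms triD[of "\<Omega>\<^sub>0 Y" l W i X "eps' Y \<cdot> s"] homD(5)[of s X Y] unfolding dtri_def by auto

lemma dtri_tri:
  assumes "dtri Y l W i X s" shows "tri W i X s Y (neg \<T> (\<Sigma>\<^sub>1 l) \<cdot> eps' Y)"
proof -
  note D = dtriD[OF assms]
  note Y = D(5)
  note r = tri_rotate[OF D(4)]
  have k: "neg \<T> (\<Sigma>\<^sub>1 l) \<cdot> eps' Y \<in> Y \<leadsto> \<Sigma>\<^sub>0 W" using comp_closed[OF eps'(1)[OF Y] triD(4)[OF r]] .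
  show ?thesis
  proof (rule tri_iso[OF r D(2,3) k id_closed[OF D(6)] id_closed[OF D(7)] eps_hom[OF Y]
        iso_id[OF D(6)] iso_id[OF D(7)] eps_iso[OF Y]])
    show "Id \<T> X \<cdot> i = i \<cdot> Id \<T> W" using id_left[OF D(2)] id_right[OF D(2)] by simp
    show "eps Y \<cdot> (eps' Y \<cdot> s) = s \<cdot> Id \<T> X"
      using eps_cancel(1)[OF D(3)] id_right[OF D(3)] by simp
    show "\<Sigma>\<^sub>1 (Id \<T> W) \<cdot> neg \<T> (\<Sigma>\<^sub>1 l) = neg \<T> (\<Sigma>\<^sub>1 l) \<cdot> eps' Y \<cdot> eps Y"
      using comp_assoc[OF eps_hom[OF Y] eps'(1)[OF Y] triD(4)[OF r]] eps'(2)[OF Y]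
        susp(2)[OF D(6)] id_left[OF triD(4)[OF r]] id_right[OF triD(4)[OF r]] by simp
  qed
qed

lemma tri_dtri:
  assumes t: "tri W i X s Y k"
  obtains l where "dtri Y l W i X s"
proof -
  note o = triD(5-7)[OF t]
  have s: "eps' Y \<cdot> s \<in> X \<leadsto> \<Sigma>\<^sub>0 (\<Omega>\<^sub>0 Y)" using comp_closed[OF triD(3)[OF t] eps'(1)[OF o(3)]] .
  have k: "k \<cdot> eps Y \<in> \<Sigma>\<^sub>0 (\<Omega>\<^sub>0 Y) \<leadsto> \<Sigma>\<^sub>0 W" using comp_closed[OF eps_hom[OF o(3)] triD(4)[OF t]] .
  obtain l where l: "l \<in> \<Omega>\<^sub>0 Y \<leadsto> W" "\<Sigma>\<^sub>1 l = neg \<T> (k \<cdot> eps Y)"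
    using susp_full[OF neg_closed[OF k] desusp(1)[OF o(3)] o(1)] .
  have "tri W i X (eps' Y \<cdot> s) (\<Sigma>\<^sub>0 (\<Omega>\<^sub>0 Y)) (k \<cdot> eps Y)"
  proof (rule tri_iso[OF t triD(2)[OF t] s k id_closed[OF o(1)] id_closed[OF o(2)] eps'(1)[OF o(3)]
        iso_id[OF o(1)] iso_id[OF o(2)] eps'(4)[OF o(3)]])
    show "\<Sigma>\<^sub>1 (Id \<T> W) \<cdot> k = k \<cdot> eps Y \<cdot> eps' Y"
      using comp_assoc[OF eps'(1)[OF o(3)] eps_hom[OF o(3)] triD(4)[OF t]] eps'(3)[OF o(3)]
        susp(2)[OF o(1)] id_left[OF triD(4)[OF t]] id_right[OF triD(4)[OF t]] by simp
  qed (use id_left[OF triD(2)[OF t]] id_right[OF triD(2)[OF t]] id_right[OF s] in simp_all)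
  then have "tri (\<Omega>\<^sub>0 Y) l W i X (eps' Y \<cdot> s)"
    using l neg_neg[OF k] by - (rule tri_unrotate, simp_all)
  then show thesis using that triD(3)[OF t] unfolding dtri_def by blast
qed

lemma dtri_complete:
  assumes l: "l \<in> \<Omega>\<^sub>0 Y \<leadsto> W" and Y: "Y \<in> Obj \<T>"
  obtains i X s where "dtri Y l W i X s"
proof -
  obtain i X j where t: "tri (\<Omega>\<^sub>0 Y) l W i X j" using tri_exists[OF l] .
  note j = triD(4)[OF t]
  have "eps' Y \<cdot> (eps Y \<cdot> j) = j"
    using comp_assoc[OF j eps_hom[OF Y] eps'(1)[OF Y]] eps'(2)[OF Y] id_left[OF j] by simp
  then have "dtri Y l W i X (eps Y \<cdot> j)" unfolding dtri_def using t comp_closed[OF j eps_hom[OF Y]] by simp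
  then show thesis by (rule that)
qed

text \<open>The given square sits at \<open>X \<rightarrow> Y\<close>, so two rotations make the
  missing component at W the third one, up to a suspension removed by full faithfulness. Naturality
  of \<open>eps'\<close> puts \<open>\<Omega>\<^sub>1 f\<close> into the square.\<close>

lemma dtri_morphism:
  assumes d: "dtri Y l W i X s" and d': "dtri Y' l' W' i' X' s'"
    and f: "f \<in> Y \<leadsto> Y'" "f\<^sub>0 \<in> X \<leadsto> X'" "s' \<cdot> f\<^sub>0 = f \<cdot> s"
  obtains g where "g \<in> W \<leadsto> W'" "i' \<cdot> g = f\<^sub>0 \<cdot> i" "l' \<cdot> \<Omega>\<^sub>1 f = g \<cdot> l"
proof -
  note D = dtriD[OF d] and D' = dtriD[OF d']
  note e = eps'(1)[OF D(5)] and e' = eps'(1)[OF D'(5)]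
  note F = susp(3)[OF desusp(3)[OF f(1)]]
  have n: "eps' Y' \<cdot> f = \<Sigma>\<^sub>1 (\<Omega>\<^sub>1 f) \<cdot> eps' Y"
  proof (rule iso_cancel_left[OF eps_iso[OF D'(5)] eps_hom[OF D'(5)]])
    show "eps' Y' \<cdot> f \<in> Y \<leadsto> \<Sigma>\<^sub>0 (\<Omega>\<^sub>0 Y')" using comp_closed[OF f(1) e'] .
    show "\<Sigma>\<^sub>1 (\<Omega>\<^sub>1 f) \<cdot> eps' Y \<in> Y \<leadsto> \<Sigma>\<^sub>0 (\<Omega>\<^sub>0 Y')" using comp_closed[OF e F] .
    show "eps Y' \<cdot> (eps' Y' \<cdot> f) = eps Y' \<cdot> (\<Sigma>\<^sub>1 (\<Omega>\<^sub>1 f) \<cdot> eps' Y)"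
      using comp_assoc[OF f(1) e' eps_hom[OF D'(5)]] comp_assoc[OF e F eps_hom[OF D'(5)]]
        comp_assoc[OF e eps_hom[OF D(5)] f(1)] eps_natural[OF f(1)] eps'(3)[OF D(5)] eps'(3)[OF D'(5)]
        id_left[OF f(1)] id_right[OF f(1)] by simp
  qed
  note r = tri_rotate[OF tri_rotate[OF D(4)]] and r' = tri_rotate[OF tri_rotate[OF D'(4)]]
  have "\<Sigma>\<^sub>1 (\<Omega>\<^sub>1 f) \<cdot> (eps' Y \<cdot> s) = eps' Y' \<cdot> s' \<cdot> f\<^sub>0"
    using comp_assoc[OF D(3) e F] comp_assoc[OF f(2) D'(3) e'] comp_assoc[OF D(3) f(1) e'] n f(3) by simp
  then obtain c where c: "c \<in> \<Sigma>\<^sub>0 W \<leadsto> \<Sigma>\<^sub>0 W'"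
    "c \<cdot> neg \<T> (\<Sigma>\<^sub>1 l) = neg \<T> (\<Sigma>\<^sub>1 l') \<cdot> \<Sigma>\<^sub>1 (\<Omega>\<^sub>1 f)"
    "\<Sigma>\<^sub>1 f\<^sub>0 \<cdot> neg \<T> (\<Sigma>\<^sub>1 i) = neg \<T> (\<Sigma>\<^sub>1 i') \<cdot> c"
    using tri_morphism[OF r r' f(2) F] by metis
  obtain g where g: "g \<in> W \<leadsto> W'" "\<Sigma>\<^sub>1 g = c" using susp_full[OF c(1) D(6) D'(6)] .
  have "neg \<T> (\<Sigma>\<^sub>1 (g \<cdot> l)) = neg \<T> (\<Sigma>\<^sub>1 (l' \<cdot> \<Omega>\<^sub>1 f))"
    using c(2) g(2) susp(4)[OF D(1) g(1)] susp(4)[OF desusp(3)[OF f(1)] D'(1)]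
      comp_neg_right[OF susp(3)[OF D(1)] c(1)] comp_neg_left[OF F susp(3)[OF D'(1)]] by simp
  then have "\<Sigma>\<^sub>1 (g \<cdot> l) = \<Sigma>\<^sub>1 (l' \<cdot> \<Omega>\<^sub>1 f)"
    by (rule neg_inj[OF susp(3)[OF comp_closed[OF D(1) g(1)]]
        susp(3)[OF comp_closed[OF desusp(3)[OF f(1)] D'(1)]]])
  then have 1: "g \<cdot> l = l' \<cdot> \<Omega>\<^sub>1 f"
    by (rule susp_faithful[OF comp_closed[OF D(1) g(1)] comp_closed[OF desusp(3)[OF f(1)] D'(1)]])
  have "neg \<T> (\<Sigma>\<^sub>1 (f\<^sub>0 \<cdot> i)) = neg \<T> (\<Sigma>\<^sub>1 (i' \<cdot> g))"
    using c(3) g(2) susp(4)[OF D(2) f(2)] susp(4)[OF g(1) D'(2)]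
      comp_neg_right[OF susp(3)[OF D(2)] susp(3)[OF f(2)]] comp_neg_left[OF c(1) susp(3)[OF D'(2)]] by simp
  then have "\<Sigma>\<^sub>1 (f\<^sub>0 \<cdot> i) = \<Sigma>\<^sub>1 (i' \<cdot> g)"
    by (rule neg_inj[OF susp(3)[OF comp_closed[OF D(2) f(2)]] susp(3)[OF comp_closed[OF g(1) D'(2)]]])
  then have 2: "f\<^sub>0 \<cdot> i = i' \<cdot> g"
    by (rule susp_faithful[OF comp_closed[OF D(2) f(2)] comp_closed[OF g(1) D'(2)]])
  show thesis using that[OF g(1)] 1 2 by simp
qed

text \<open>A split monomorphism has zero connecting arrow:
  \<open>\<Sigma>\<^sub>1 i \<cdot> h\<close> vanishes by rotation, and composing with
  \<open>\<Sigma>\<^sub>1 p\<close> leaves \<open>h\<close>. Hence the identity of Z lifts along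
  \<open>g\<close>.\<close>

lemma split_mono_section:
  assumes t: "tri X i W g Z h" and p: "p \<in> W \<leadsto> X" and pi: "p \<cdot> i = Id \<T> X"
  obtains j where "j \<in> Z \<leadsto> W" "g \<cdot> j = Id \<T> Z"
proof -
  note o = triD(5-7)[OF t] and i = triD(2)[OF t] and h = triD(4)[OF t]
  have "neg \<T> (\<Sigma>\<^sub>1 i) \<cdot> h = Zero \<T> Z (\<Sigma>\<^sub>0 W)" using tri_comp_zero(2)[OF tri_rotate[OF t]] .
  then have "\<Sigma>\<^sub>1 i \<cdot> h = Zero \<T> Z (\<Sigma>\<^sub>0 W)"
    using comp_neg_left[OF h susp(3)[OF i]] neg_neg[OF comp_closed[OF h susp(3)[OF i]]]
      neg_zero[OF o(3) susp(1)[OF o(2)]] by simp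
  then have "\<Sigma>\<^sub>1 p \<cdot> (\<Sigma>\<^sub>1 i \<cdot> h) = Zero \<T> Z (\<Sigma>\<^sub>0 X)" using comp_zero_right[OF susp(3)[OF p] o(3)] by simp
  then have "h = Zero \<T> Z (\<Sigma>\<^sub>0 X)"
    using comp_assoc[OF h susp(3)[OF i] susp(3)[OF p]] susp(4)[OF i p] pi susp(2)[OF o(1)] id_left[OF h] by simp
  then have "h \<cdot> Id \<T> Z = Zero \<T> Z (\<Sigma>\<^sub>0 X)" using id_right[OF h] by simp
  then show thesis using weak_kernel[OF tri_rotate[OF t] id_closed[OF o(3)]] that by metis
qed

text \<open>\<open>Thick\<close> speaks of biproducts, whereas the arguments produce retracts. The
  complement of the retract X is the cone of \<open>i\<close>.\<close>

lemma retract_biproduct: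
  assumes i: "i \<in> X \<leadsto> W" and p: "p \<in> W \<leadsto> X" and pi: "p \<cdot> i = Id \<T> X"
  obtains Z where "is_biproduct \<T> X Z W"
proof -
  obtain g Z h where t: "tri X i W g Z h" using tri_exists[OF i] .
  note o = triD(5-7)[OF t] and g = triD(3)[OF t]
  obtain j where j: "j \<in> Z \<leadsto> W" "g \<cdot> j = Id \<T> Z" using split_mono_section[OF t p pi] .
  have pj: "p \<cdot> j \<in> Z \<leadsto> X" using comp_closed[OF j(1) p] .
  have ipj: "i \<cdot> (p \<cdot> j) \<in> Z \<leadsto> W" using comp_closed[OF pj i] .
  \<comment> \<open>Subtracting the component in X makes the section orthogonal to
    \<open>p\<close>.\<close>
  define j' where "j' = j \<^bold>- i \<cdot> (p \<cdot> j)"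
  have j': "j' \<in> Z \<leadsto> W" unfolding j'_def using minus_closed[OF j(1) ipj] .
  have gi: "g \<cdot> i = Zero \<T> X Z" using tri_comp_zero(1)[OF t] .
  have gj': "g \<cdot> j' = Id \<T> Z"
    unfolding j'_def comp_minus_right[OF j(1) ipj g]
    using comp_assoc[OF pj i g] gi comp_zero_left[OF pj o(3)] j(2) neg_zero[OF o(3) o(3)]
      add_zero[OF id_closed[OF o(3)]] by simp
  have pj': "p \<cdot> j' = Zero \<T> Z X"
    unfolding j'_def comp_minus_right[OF j(1) ipj p]
    using comp_assoc[OF pj i p] pi id_left[OF pj] add_neg[OF pj] by simp
  have ip: "i \<cdot> p \<in> W \<leadsto> W" and jg: "j' \<cdot> g \<in> W \<leadsto> W" using comp_closed[OF p i] comp_closed[OF g j'] by simp_all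
  \<comment> \<open>The defect of the biproduct identity is killed by \<open>g\<close>, so it has
    the form \<open>i \<cdot> c\<close>; it is also killed by \<open>p\<close>, so \<open>c\<close>
    is zero.\<close>
  define e where "e = Id \<T> W \<^bold>- (i \<cdot> p \<^bold>+ j' \<cdot> g)"
  note s = add_closed[OF ip jg] and w = id_closed[OF o(2)]
  have e: "e \<in> W \<leadsto> W" unfolding e_def using minus_closed[OF w s] .
  have "g \<cdot> (i \<cdot> p \<^bold>+ j' \<cdot> g) = g"
    using comp_add_right[OF ip jg g] comp_assoc[OF p i g] comp_assoc[OF g j' g] gi gj'
      comp_zero_left[OF p o(3)] id_left[OF g] zero_add[OF g] by simp
  then have "g \<cdot> e = Zero \<T> W Z"
    unfolding e_def comp_minus_right[OF w s g] using id_right[OF g] add_neg[OF g] by simp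
  then obtain c where c: "c \<in> W \<leadsto> X" "i \<cdot> c = e" using weak_kernel[OF t e] by metis
  have "p \<cdot> (i \<cdot> p \<^bold>+ j' \<cdot> g) = p"
    using comp_add_right[OF ip jg p] comp_assoc[OF p i p] comp_assoc[OF g j' p] pi pj'
      comp_zero_left[OF g o(1)] id_left[OF p] add_zero[OF p] by simp
  then have "p \<cdot> e = Zero \<T> W X"
    unfolding e_def comp_minus_right[OF w s p] using id_right[OF p] add_neg[OF p] by simp
  then have "c = Zero \<T> W X" using comp_assoc[OF c(1) i p] c pi id_left[OF c(1)] by simp
  then have "e = Zero \<T> W W" using c comp_zero_right[OF i o(2)] by simp
  then have "Id \<T> W = i \<cdot> p \<^bold>+ j' \<cdot> g" using minus_eq_zero[OF w s] unfolding e_def by simp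
  then have "is_biproduct \<T> X Z W"
    unfolding is_biproduct_def using o i j' p g pi gj' pj' gi by metis
  then show thesis using that by blast
qed

end

section \<open>Thick subcategories\<close>

context triangulated_category
begin

lemma thick_obj: "\<U> \<in> Thick \<T> \<Longrightarrow> X \<in> \<U> \<Longrightarrow> X \<in> Obj \<T>"
  unfolding Thick_def triangulated_subcat_def by blast

lemma thick_susp: "\<U> \<in> Thick \<T> \<Longrightarrow> X \<in> \<U> \<Longrightarrow> \<Sigma>\<^sub>0 X \<in> \<U>"
  unfolding Thick_def triangulated_subcat_def by blast

lemma thick_desusp: "\<U> \<in> Thick \<T> \<Longrightarrow> X \<in> \<U> \<Longrightarrow> \<Omega>\<^sub>0 X \<in> \<U>"
  unfolding Thick_def triangulated_subcat_def by blast

lemma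
  assumes U: "\<U> \<in> Thick \<T>" and t: "tri X f Y g Z h"
  shows thick_cone: "X \<in> \<U> \<Longrightarrow> Y \<in> \<U> \<Longrightarrow> Z \<in> \<U>"
    and thick_ext: "X \<in> \<U> \<Longrightarrow> Z \<in> \<U> \<Longrightarrow> Y \<in> \<U>"
    and thick_fiber: "Y \<in> \<U> \<Longrightarrow> Z \<in> \<U> \<Longrightarrow> X \<in> \<U>"
proof -
  have "(Dom \<T> f \<in> \<U> \<and> Cod \<T> f \<in> \<U> \<longrightarrow> Cod \<T> g \<in> \<U>) \<and> (Dom \<T> f \<in> \<U> \<and> Cod \<T> g \<in> \<U> \<longrightarrow> Cod \<T> f \<in> \<U>) \<and>
      (Cod \<T> f \<in> \<U> \<and> Cod \<T> g \<in> \<U> \<longrightarrow> Dom \<T> f \<in> \<U>)"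
    using U triD(1)[OF t] unfolding Thick_def triangulated_subcat_def by blast
  then show "X \<in> \<U> \<Longrightarrow> Y \<in> \<U> \<Longrightarrow> Z \<in> \<U>" "X \<in> \<U> \<Longrightarrow> Z \<in> \<U> \<Longrightarrow> Y \<in> \<U>" "Y \<in> \<U> \<Longrightarrow> Z \<in> \<U> \<Longrightarrow> X \<in> \<U>"
    using tri_dom_cod[OF t] by simp_all
qed

lemma thick_retract:
  assumes "\<U> \<in> Thick \<T>" "i \<in> X \<leadsto> W" "p \<in> W \<leadsto> X" "p \<cdot> i = Id \<T> X" "W \<in> \<U>"
  shows "X \<in> \<U>"
  using retract_biproduct[OF assms(2-4)] assms(1,5) unfolding Thick_def by blast

lemma thick_zero:
  assumes U: "\<U> \<in> Thick \<T>" and Z: "zero_object \<T> Z"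
  shows "Z \<in> \<U>"
proof -
  obtain W where W: "W \<in> \<U>" using U unfolding Thick_def triangulated_subcat_def by blast
  note o = zero_object_hom(1)[OF Z] thick_obj[OF U W]
  have "Zero \<T> W Z \<cdot> Zero \<T> Z W = Id \<T> Z"
    using zero_object_hom(2)[OF Z id_closed[OF o(1)]]
      zero_object_hom(2)[OF Z comp_closed[OF zero_closed[OF o] zero_closed[OF o(2,1)]]] by simp
  then show ?thesis using thick_retract[OF U zero_closed[OF o] zero_closed[OF o(2,1)] _ W] by blast
qed

text \<open>Closure under extensions is enough: in the presence of closure under suspension and its
  quasi-inverse, rotation in either direction turns cones and fibres into middle terms.\<close>

lemma thickI:
  assumes obj: "\<S> \<subseteq> Obj \<T>" and zero: "Z \<in> \<S>" "zero_object \<T> Z"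
    and susp: "\<And>X. X \<in> \<S> \<Longrightarrow> \<Sigma>\<^sub>0 X \<in> \<S>" and desusp: "\<And>X. X \<in> \<S> \<Longrightarrow> \<Omega>\<^sub>0 X \<in> \<S>"
    and ext: "\<And>X f Y g Z h. tri X f Y g Z h \<Longrightarrow> X \<in> \<S> \<Longrightarrow> Z \<in> \<S> \<Longrightarrow> Y \<in> \<S>"
    and retract: "\<And>X i W p. i \<in> X \<leadsto> W \<Longrightarrow> p \<in> W \<leadsto> X \<Longrightarrow> p \<cdot> i = Id \<T> X \<Longrightarrow> W \<in> \<S> \<Longrightarrow> X \<in> \<S>"
  shows "\<S> \<in> Thick \<T>"
proof -
  have d: "(X \<in> \<S> \<and> Y \<in> \<S> \<longrightarrow> Z \<in> \<S>) \<and> (X \<in> \<S> \<and> Z \<in> \<S> \<longrightarrow> Y \<in> \<S>) \<and> (Y \<in> \<S> \<and> Z \<in> \<S> \<longrightarrow> X \<in> \<S>)"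
    if t: "tri X f Y g Z h" for X f Y g Z h
  proof -
    obtain l where l: "dtri Z l X f Y g" using tri_dtri[OF t] .
    show ?thesis using ext[OF t] ext[OF tri_rotate[OF t]] ext[OF dtriD(4)[OF l]] susp desusp by blast
  qed
  have "triangulated_subcat \<T> \<S>"
    unfolding triangulated_subcat_def using obj zero susp desusp d[OF dist_tri] by blast
  moreover have "X \<in> \<S>" if "is_biproduct \<T> X Y B" "B \<in> \<S>" for X Y B
    using that retract unfolding is_biproduct_def by blast
  ultimately show ?thesis unfolding Thick_def by blast
qed

section \<open>Intersections, joins and unions of chains of thick subcategories\<close>

lemma Obj_thick: "Obj \<T> \<in> Thick \<T>"
proof -
  obtain Z where "zero_object \<T> Z" using zero_object_exists by blast
  then show ?thesis using zero_object_hom(1)[of Z] susp(1) desusp(1) triD(6) homD(4)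
    by (intro thickI[of _ Z]) blast+
qed

lemma thick_Inter:
  assumes A: "A \<subseteq> Thick \<T>" "A \<noteq> {}" shows "\<Inter>A \<in> Thick \<T>"
proof -
  obtain Z where Z: "zero_object \<T> Z" using zero_object_exists by blast
  show ?thesis
  proof (rule thickI[OF _ _ Z])
    show "\<Inter>A \<subseteq> Obj \<T>" using A thick_obj by blast
    show "Z \<in> \<Inter>A" using A thick_zero[OF _ Z] by blast
    show "\<Sigma>\<^sub>0 X \<in> \<Inter>A" "\<Omega>\<^sub>0 X \<in> \<Inter>A" if "X \<in> \<Inter>A" for X using that A thick_susp thick_desusp by blast+
    show "Y \<in> \<Inter>A" if "tri X f Y g Z h" "X \<in> \<Inter>A" "Z \<in> \<Inter>A" for X f Y g Z h
      using that A thick_ext[OF _ that(1)] by blast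
    show "X \<in> \<Inter>A" if "i \<in> X \<leadsto> W" "p \<in> W \<leadsto> X" "p \<cdot> i = Id \<T> X" "W \<in> \<Inter>A" for X i W p
      using that(4) A thick_retract[OF _ that(1-3)] by blast
  qed
qed

lemma thick_Int: "\<U> \<in> Thick \<T> \<Longrightarrow> \<V> \<in> Thick \<T> \<Longrightarrow> \<U> \<inter> \<V> \<in> Thick \<T>"
  using thick_Inter[of "{\<U>, \<V>}"] by simp

lemma thick_join:
  assumes A: "A \<subseteq> Thick \<T>"
  shows thick_join_closed: "thick_join \<T> A \<in> Thick \<T>"
    and thick_join_upper: "\<U> \<in> A \<Longrightarrow> \<U> \<subseteq> thick_join \<T> A"
    and thick_join_least: "\<W> \<in> Thick \<T> \<Longrightarrow> (\<And>\<U>. \<U> \<in> A \<Longrightarrow> \<U> \<subseteq> \<W>) \<Longrightarrow> thick_join \<T> A \<subseteq> \<W>"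
proof -
  have "Obj \<T> \<in> {\<W> \<in> Thick \<T>. \<Union>A \<subseteq> \<W>}" using Obj_thick A thick_obj by blast
  then show "thick_join \<T> A \<in> Thick \<T>" unfolding thick_join_def by (intro thick_Inter) blast+
qed (unfold thick_join_def, blast+)

lemma thick_meet_pair:
  "\<U> \<in> Thick \<T> \<Longrightarrow> thick_meet \<T> {\<U>, \<V>} = \<U> \<inter> \<V>"
  unfolding thick_meet_def using thick_obj by auto

lemma thick_chain_Union:
  assumes "C \<subseteq> Thick \<T>" "C \<noteq> {}" "\<And>\<U> \<V>. \<U> \<in> C \<Longrightarrow> \<V> \<in> C \<Longrightarrow> \<U> \<subseteq> \<V> \<or> \<V> \<subseteq> \<U>"
  shows "\<Union>C \<in> Thick \<T>"
proof -
  obtain Z where Z: "zero_object \<T> Z" using zero_object_exists by blast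
  have C: "\<U> \<in> Thick \<T>" if "\<U> \<in> C" for \<U> using that assms(1) by blast
  show ?thesis
  proof (rule thickI[OF _ _ Z])
    show "\<Union>C \<subseteq> Obj \<T>" using C thick_obj by blast
    show "Z \<in> \<Union>C" using C assms(2) thick_zero[OF _ Z] by blast
    show "\<Sigma>\<^sub>0 X \<in> \<Union>C" "\<Omega>\<^sub>0 X \<in> \<Union>C" if "X \<in> \<Union>C" for X
      using that thick_susp[OF C] thick_desusp[OF C] by blast+
    show "Y \<in> \<Union>C" if t: "tri X f Y g Z h" "X \<in> \<Union>C" "Z \<in> \<Union>C" for X f Y g Z h
    proof -
      obtain \<U> where U: "\<U> \<in> C" "X \<in> \<U>" "Z \<in> \<U>" using t assms(3) by blast
      then show ?thesis using thick_ext[OF C[OF U(1)] t(1)] by blast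
    qed
    show "X \<in> \<Union>C" if "i \<in> X \<leadsto> W" "p \<in> W \<leadsto> X" "p \<cdot> i = Id \<T> X" "W \<in> \<Union>C" for X i W p
      using that(4) thick_retract[OF C that(1-3)] by blast
  qed
qed

text \<open>The cone Z of the inclusion of X is a retract of Y, so B is an extension of two members.
  The equation \<open>g \<cdot> j \<cdot> k = Id \<T> Z\<close> is checked after composition with
  \<open>g\<close>, which is a split epimorphism.\<close>

lemma thick_biproduct:
  assumes U: "\<U> \<in> Thick \<T>" "X \<in> \<U>" "Y \<in> \<U>" and b: "is_biproduct \<T> X Y B"
  shows "B \<in> \<U>"
proof -
  obtain i j p r where B: "i \<in> X \<leadsto> B" "j \<in> Y \<leadsto> B" "p \<in> B \<leadsto> X" "r \<in> B \<leadsto> Y"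
    "p \<cdot> i = Id \<T> X" "r \<cdot> i = Zero \<T> X Y" "i \<cdot> p \<^bold>+ j \<cdot> r = Id \<T> B"
    using b unfolding is_biproduct_def by blast
  obtain g Z h where t: "tri X i B g Z h" using tri_exists[OF B(1)] .
  note o = triD(5-7)[OF t] and g = triD(3)[OF t]
  obtain k where k: "k \<in> Z \<leadsto> Y" "k \<cdot> g = r" using weak_cokernel[OF t B(4,6)] .
  have jr: "j \<cdot> r \<in> B \<leadsto> B" and ip: "i \<cdot> p \<in> B \<leadsto> B" and gj: "g \<cdot> j \<in> Y \<leadsto> Z"
    using comp_closed[OF B(4,2)] comp_closed[OF B(3,1)] comp_closed[OF B(2) g] by simp_all
  have gjk: "g \<cdot> j \<cdot> k \<in> Z \<leadsto> Z" using comp_closed[OF k(1) gj] .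
  have "g \<cdot> (i \<cdot> p) = Zero \<T> B Z"
    using comp_assoc[OF B(3,1) g] tri_comp_zero(1)[OF t] comp_zero_left[OF B(3) o(3)] by simp
  then have "g \<cdot> (j \<cdot> r) = g"
    using comp_add_right[OF ip jr g] B(7) id_right[OF g] zero_add[OF comp_closed[OF jr g]] by simp
  then have e: "g \<cdot> j \<cdot> k \<cdot> g = g"
    using comp_assoc[OF g k(1) gj] comp_assoc[OF B(4,2) g] k(2) by simp
  define e where "e = g \<cdot> j \<cdot> k \<^bold>- Id \<T> Z"
  have e_hom: "e \<in> Z \<leadsto> Z" unfolding e_def using minus_closed[OF gjk id_closed[OF o(3)]] .
  have eg: "e \<cdot> g = Zero \<T> B Z"
    unfolding e_def comp_minus_left[OF g gjk id_closed[OF o(3)]] using e id_left[OF g] add_neg[OF g] by simp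
  obtain s where s: "s \<in> Z \<leadsto> B" "g \<cdot> s = Id \<T> Z" using split_mono_section[OF t B(3,5)] .
  have "e = e \<cdot> (g \<cdot> s)" using s(2) id_right[OF e_hom] by simp
  also have "\<dots> = Zero \<T> Z Z"
    using comp_assoc[OF s(1) g e_hom] eg comp_zero_left[OF s(1) o(3)] by simp
  finally have "g \<cdot> j \<cdot> k = Id \<T> Z" using minus_eq_zero[OF gjk id_closed[OF o(3)]] e_def by simp
  then have "Z \<in> \<U>" using thick_retract[OF U(1) k(1) gj _ U(3)] by simp
  then show ?thesis using thick_ext[OF U(1) t U(2)] by simp
qed

subsection \<open>Morphisms factoring through a subcategory\<close>

lemma factors_iff:
  "f \<in> X \<leadsto> Y \<Longrightarrow> factors_through \<T> f \<N> \<longleftrightarrow> (\<exists>W \<in> \<N>. \<exists>u \<in> X \<leadsto> W. \<exists>v \<in> W \<leadsto> Y. f = v \<cdot> u)"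
  unfolding factors_through_def using homD(2,3)[of f X Y] by simp

lemma factorsI:
  assumes "W \<in> \<N>" "u \<in> X \<leadsto> W" "v \<in> W \<leadsto> Y" shows "factors_through \<T> (v \<cdot> u) \<N>"
  using factors_iff[OF comp_closed[OF assms(2,3)]] assms by blast

lemma factorsE:
  assumes "factors_through \<T> f \<N>" "f \<in> X \<leadsto> Y"
  obtains W u v where "W \<in> \<N>" "u \<in> X \<leadsto> W" "v \<in> W \<leadsto> Y" "f = v \<cdot> u"
  using assms factors_iff by blast

lemma factors_pre:
  assumes "factors_through \<T> f \<N>" "f \<in> X \<leadsto> Y" "a \<in> A \<leadsto> X"
  shows "factors_through \<T> (f \<cdot> a) \<N>"
proof -
  obtain W u v where W: "W \<in> \<N>" "u \<in> X \<leadsto> W" "v \<in> W \<leadsto> Y" "f = v \<cdot> u" using factorsE[OF assms(1,2)] .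
  then show ?thesis using factorsI[OF W(1) comp_closed[OF assms(3) W(2)] W(3)] comp_assoc[OF assms(3) W(2,3)] by simp
qed

lemma factors_post:
  assumes "factors_through \<T> f \<N>" "f \<in> X \<leadsto> Y" "b \<in> Y \<leadsto> B"
  shows "factors_through \<T> (b \<cdot> f) \<N>"
proof -
  obtain W u v where W: "W \<in> \<N>" "u \<in> X \<leadsto> W" "v \<in> W \<leadsto> Y" "f = v \<cdot> u" using factorsE[OF assms(1,2)] .
  then show ?thesis using factorsI[OF W(1,2) comp_closed[OF W(3) assms(3)]] comp_assoc[OF W(2,3) assms(3)] by simp
qed

lemma factors_mono: "factors_through \<T> f \<N> \<Longrightarrow> \<N> \<subseteq> \<N>' \<Longrightarrow> factors_through \<T> f \<N>'"
  unfolding factors_through_def by blast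

lemma factors_add:
  assumes N: "\<N> \<in> Thick \<T>" and f: "f \<in> X \<leadsto> Y" "factors_through \<T> f \<N>"
    and g: "g \<in> X \<leadsto> Y" "factors_through \<T> g \<N>"
  shows "factors_through \<T> (f \<^bold>+ g) \<N>"
proof -
  obtain W u v where W: "W \<in> \<N>" "u \<in> X \<leadsto> W" "v \<in> W \<leadsto> Y" "f = v \<cdot> u" using factorsE[OF f(2,1)] .
  obtain P x y where P: "P \<in> \<N>" "x \<in> X \<leadsto> P" "y \<in> P \<leadsto> Y" "g = y \<cdot> x" using factorsE[OF g(2,1)] .
  obtain B where B: "is_biproduct \<T> W P B" using biproduct_exists homD(5) W(2) P(2) by blast
  obtain i j p r where b: "i \<in> W \<leadsto> B" "j \<in> P \<leadsto> B" "p \<in> B \<leadsto> W" "r \<in> B \<leadsto> P"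
    "p \<cdot> i = Id \<T> W" "r \<cdot> j = Id \<T> P" "p \<cdot> j = Zero \<T> P W" "r \<cdot> i = Zero \<T> W P"
    using B unfolding is_biproduct_def by blast
  note iu = comp_closed[OF W(2) b(1)] and jx = comp_closed[OF P(2) b(2)]
    and vp = comp_closed[OF b(3) W(3)] and yr = comp_closed[OF b(4) P(3)]
  note s = add_closed[OF iu jx]
  have "p \<cdot> (i \<cdot> u \<^bold>+ j \<cdot> x) = u"
    using comp_add_right[OF iu jx b(3)] comp_assoc[OF W(2) b(1,3)] comp_assoc[OF P(2) b(2,3)] b(5,7)
      id_left[OF W(2)] comp_zero_left[OF P(2) homD(5)[OF W(2)]] add_zero[OF W(2)] by simp
  then have 1: "v \<cdot> p \<cdot> (i \<cdot> u \<^bold>+ j \<cdot> x) = f" using comp_assoc[OF s b(3) W(3)] W(4) by simp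
  have "r \<cdot> (i \<cdot> u \<^bold>+ j \<cdot> x) = x"
    using comp_add_right[OF iu jx b(4)] comp_assoc[OF W(2) b(1,4)] comp_assoc[OF P(2) b(2,4)] b(6,8)
      id_left[OF P(2)] comp_zero_left[OF W(2) homD(5)[OF P(2)]] zero_add[OF P(2)] by simp
  then have 2: "y \<cdot> r \<cdot> (i \<cdot> u \<^bold>+ j \<cdot> x) = g" using comp_assoc[OF s b(4) P(3)] P(4) by simp
  show ?thesis
    using factorsI[OF thick_biproduct[OF N W(1) P(1) B] s add_closed[OF vp yr]]
      comp_add_left[OF s vp yr] 1 2 by simp
qed

lemma factors_susp:
  assumes N: "\<N> \<in> Thick \<T>" and f: "f \<in> X \<leadsto> Y"
  shows "factors_through \<T> (\<Sigma>\<^sub>1 f) \<N> \<longleftrightarrow> factors_through \<T> f \<N>"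
proof
  assume "factors_through \<T> f \<N>"
  then obtain W u v where W: "W \<in> \<N>" "u \<in> X \<leadsto> W" "v \<in> W \<leadsto> Y" "f = v \<cdot> u" using factorsE[OF _ f] by blast
  then show "factors_through \<T> (\<Sigma>\<^sub>1 f) \<N>"
    using factorsI[OF thick_susp[OF N W(1)] susp(3)[OF W(2)] susp(3)[OF W(3)]] susp(4)[OF W(2,3)] by simp
next
  assume "factors_through \<T> (\<Sigma>\<^sub>1 f) \<N>"
  then obtain W u v where W: "W \<in> \<N>" "u \<in> \<Sigma>\<^sub>0 X \<leadsto> W" "v \<in> W \<leadsto> \<Sigma>\<^sub>0 Y" "\<Sigma>\<^sub>1 f = v \<cdot> u"
    using factorsE[OF _ susp(3)[OF f]] by blast
  note o = homD(4,5)[OF f] homD(5)[OF W(2)]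
  note e = eps_hom[OF o(3)] and e' = eps'(1)[OF o(3)]
  obtain u' where u': "u' \<in> X \<leadsto> \<Omega>\<^sub>0 W" "\<Sigma>\<^sub>1 u' = eps' W \<cdot> u"
    using susp_full[OF comp_closed[OF W(2) e'] o(1) desusp(1)[OF o(3)]] .
  obtain v' where v': "v' \<in> \<Omega>\<^sub>0 W \<leadsto> Y" "\<Sigma>\<^sub>1 v' = v \<cdot> eps W"
    using susp_full[OF comp_closed[OF e W(3)] desusp(1)[OF o(3)] o(2)] .
  have "\<Sigma>\<^sub>1 (v' \<cdot> u') = \<Sigma>\<^sub>1 f"
    using susp(4)[OF u'(1) v'(1)] u'(2) v'(2) W(4) comp_assoc[OF comp_closed[OF W(2) e'] e W(3)]
      comp_assoc[OF W(2) e' e] eps'(3)[OF o(3)] id_left[OF W(2)] by simp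
  then have "v' \<cdot> u' = f" using susp_faithful[OF comp_closed[OF u'(1) v'(1)] f] by simp
  then show "factors_through \<T> f \<N>" using factorsI[OF thick_desusp[OF N W(1)] u'(1) v'(1)] by simp
qed

text \<open>If \<N> consists of the zero objects, this is the left orthogonal of \<V>; in general it
  is orthogonality modulo the morphisms that factor through \<N>. \<open>fac_left\<close> is the
  analogue of the right orthogonal.\<close>

definition fac_right :: "'o set \<Rightarrow> 'o set \<Rightarrow> 'o set" where
  "fac_right \<N> \<V> = {X \<in> Obj \<T>. \<forall>Y \<in> \<V>. \<forall>f \<in> X \<leadsto> Y. factors_through \<T> f \<N>}"

definition fac_left :: "'o set \<Rightarrow> 'o set \<Rightarrow> 'o set" where
  "fac_left \<N> \<V> = {X \<in> Obj \<T>. \<forall>Y \<in> \<V>. \<forall>f \<in> Y \<leadsto> X. factors_through \<T> f \<N>}"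

lemma fac_rightD: "\<U> \<subseteq> fac_right \<N> \<V> \<Longrightarrow> X \<in> \<U> \<Longrightarrow> Y \<in> \<V> \<Longrightarrow> f \<in> X \<leadsto> Y \<Longrightarrow> factors_through \<T> f \<N>"
  unfolding fac_right_def by blast

lemma fac_leftD: "\<U> \<subseteq> fac_left \<N> \<V> \<Longrightarrow> X \<in> \<U> \<Longrightarrow> Y \<in> \<V> \<Longrightarrow> f \<in> Y \<leadsto> X \<Longrightarrow> factors_through \<T> f \<N>"
  unfolding fac_left_def by blast

text \<open>The substance is closure under extensions: a morphism on the middle term is reduced to
  the two outer terms one after the other, and the error left at each stage factors through
  \<N>.\<close>

lemma fac_right_thick:
  assumes N: "\<N> \<in> Thick \<T>" and V: "\<V> \<in> Thick \<T>" and NV: "\<N> \<subseteq> \<V>"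
  shows "fac_right \<N> \<V> \<in> Thick \<T>"
proof -
  obtain Z where Z: "zero_object \<T> Z" using zero_object_exists by blast
  show ?thesis
  proof (rule thickI[OF _ _ Z])
    show "fac_right \<N> \<V> \<subseteq> Obj \<T>" unfolding fac_right_def by blast
    have "factors_through \<T> f \<N>" if "f \<in> Z \<leadsto> Y" for f Y
      using factorsI[OF thick_zero[OF N Z] id_closed[OF zero_object_hom(1)[OF Z]] that] id_right[OF that] by simp
    then show "Z \<in> fac_right \<N> \<V>" using zero_object_hom(1)[OF Z] unfolding fac_right_def by blast
  next
    fix X assume X: "X \<in> fac_right \<N> \<V>"
    then have o: "X \<in> Obj \<T>" unfolding fac_right_def by blast
    have F: "factors_through \<T> f \<N>" if "f \<in> X \<leadsto> Y" "Y \<in> \<V>" for f Y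
      using X that unfolding fac_right_def by blast
    have "factors_through \<T> f \<N>" if Y: "Y \<in> \<V>" and f: "f \<in> \<Sigma>\<^sub>0 X \<leadsto> Y" for f Y
    proof -
      note oY = homD(5)[OF f]
      note e = comp_closed[OF f eps'(1)[OF oY]]
      obtain f' where f': "f' \<in> X \<leadsto> \<Omega>\<^sub>0 Y" "\<Sigma>\<^sub>1 f' = eps' Y \<cdot> f" using susp_full[OF e o desusp(1)[OF oY]] .
      have "factors_through \<T> (eps' Y \<cdot> f) \<N>"
        using F[OF f'(1) thick_desusp[OF V Y]] factors_susp[OF N f'(1)] f'(2) by simp
      then show ?thesis using factors_post[OF _ e eps_hom[OF oY]] eps_cancel(1)[OF f] by simp
    qed
    then show "\<Sigma>\<^sub>0 X \<in> fac_right \<N> \<V>" using susp(1)[OF o] unfolding fac_right_def by blast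
    have "factors_through \<T> f \<N>" if Y: "Y \<in> \<V>" and f: "f \<in> \<Omega>\<^sub>0 X \<leadsto> Y" for f Y
    proof -
      note e = comp_closed[OF eps'(1)[OF o] susp(3)[OF f]]
      have "factors_through \<T> (\<Sigma>\<^sub>1 f \<cdot> eps' X \<cdot> eps X) \<N>"
        using factors_pre[OF F[OF e thick_susp[OF V Y]] e eps_hom[OF o]] .
      then show ?thesis
        using comp_assoc[OF eps_hom[OF o] eps'(1)[OF o] susp(3)[OF f]] eps'(2)[OF o] id_right[OF susp(3)[OF f]]
          factors_susp[OF N f] by simp
    qed
    then show "\<Omega>\<^sub>0 X \<in> fac_right \<N> \<V>" using desusp(1)[OF o] unfolding fac_right_def by blast
  next
    fix X\<^sub>1 a X b X\<^sub>2 c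
    assume t: "tri X\<^sub>1 a X b X\<^sub>2 c" and X1: "X\<^sub>1 \<in> fac_right \<N> \<V>" and X2: "X\<^sub>2 \<in> fac_right \<N> \<V>"
    note a = triD(2)[OF t] and b = triD(3)[OF t]
    have "factors_through \<T> f \<N>" if Y: "Y \<in> \<V>" and f: "f \<in> X \<leadsto> Y" for f Y
    proof -
      have fa: "f \<cdot> a \<in> X\<^sub>1 \<leadsto> Y" using comp_closed[OF a f] .
      then have "factors_through \<T> (f \<cdot> a) \<N>" using X1 Y unfolding fac_right_def by blast
      then obtain W u v where W: "W \<in> \<N>" "u \<in> X\<^sub>1 \<leadsto> W" "v \<in> W \<leadsto> Y" "f \<cdot> a = v \<cdot> u" using factorsE[OF _ fa] by metis
      obtain g Y' h where t': "tri W v Y g Y' h" using tri_exists[OF W(3)] .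
      note g = triD(3)[OF t'] and h = triD(4)[OF t']
      \<comment> \<open>This is where \<N> \<subseteq> \<V> matters: the target stays in \<V> after
        W is divided out, so the hypothesis on the second outer object applies to the induced
        morphism \<open>k\<close>.\<close>
      have Y': "Y' \<in> \<V>" using thick_cone[OF V t'] W(1) NV Y by blast
      have "g \<cdot> f \<cdot> a = Zero \<T> X\<^sub>1 Y'"
        using comp_assoc[OF a f g] W(4) comp_assoc[OF W(2,3) g] tri_comp_zero(1)[OF t']
          comp_zero_left[OF W(2) homD(5)[OF g]] by simp
      then obtain k where k: "k \<in> X\<^sub>2 \<leadsto> Y'" "k \<cdot> b = g \<cdot> f" using weak_cokernel[OF t comp_closed[OF f g]] by metis
      then have "factors_through \<T> k \<N>" using X2 Y' unfolding fac_right_def by blast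
      then obtain W\<^sub>2 u\<^sub>2 v\<^sub>2 where W2: "W\<^sub>2 \<in> \<N>" "u\<^sub>2 \<in> X\<^sub>2 \<leadsto> W\<^sub>2" "v\<^sub>2 \<in> W\<^sub>2 \<leadsto> Y'" "k = v\<^sub>2 \<cdot> u\<^sub>2"
        using factorsE[OF _ k(1)] by metis
      have hv: "h \<cdot> v\<^sub>2 \<in> W\<^sub>2 \<leadsto> \<Sigma>\<^sub>0 W" using comp_closed[OF W2(3) h] .
      \<comment> \<open>The object \<open>W\<^sub>2\<close> maps to Y' but need not map to Y. The
        fibre P of the obstruction \<open>h \<cdot> v\<^sub>2\<close> does, it is still in \<N>, and
        the morphism from X lifts to it.\<close>
      obtain P p k' where t2: "tri P p W\<^sub>2 (h \<cdot> v\<^sub>2) (\<Sigma>\<^sub>0 W) k'" using tri_fiber[OF hv] .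
      note p = triD(2)[OF t2]
      have P: "P \<in> \<N>" using thick_fiber[OF N t2 W2(1) thick_susp[OF N W(1)]] .
      have ub: "u\<^sub>2 \<cdot> b \<in> X \<leadsto> W\<^sub>2" using comp_closed[OF b W2(2)] .
      have vub: "v\<^sub>2 \<cdot> (u\<^sub>2 \<cdot> b) = g \<cdot> f" using comp_assoc[OF b W2(2,3)] W2(4) k(2) by simp
      have "h \<cdot> v\<^sub>2 \<cdot> (u\<^sub>2 \<cdot> b) = Zero \<T> X (\<Sigma>\<^sub>0 W)"
        using comp_assoc[OF ub W2(3) h] vub comp_assoc[OF f g h] tri_comp_zero(2)[OF t']
          comp_zero_left[OF f homD(5)[OF h]] by simp
      then obtain x where x: "x \<in> X \<leadsto> P" "p \<cdot> x = u\<^sub>2 \<cdot> b" using weak_kernel[OF t2 ub] by metis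
      have vp: "v\<^sub>2 \<cdot> p \<in> P \<leadsto> Y'" using comp_closed[OF p W2(3)] .
      have "h \<cdot> (v\<^sub>2 \<cdot> p) = Zero \<T> P (\<Sigma>\<^sub>0 W)" using comp_assoc[OF p W2(3) h] tri_comp_zero(1)[OF t2] by simp
      then obtain y where y: "y \<in> P \<leadsto> Y" "g \<cdot> y = v\<^sub>2 \<cdot> p" using weak_kernel[OF tri_rotate[OF t'] vp] by metis
      have yx: "y \<cdot> x \<in> X \<leadsto> Y" using comp_closed[OF x(1) y(1)] .
      have "g \<cdot> (y \<cdot> x) = g \<cdot> f"
        using comp_assoc[OF x(1) y(1) g] y(2) comp_assoc[OF x(1) p W2(3)] x(2) vub by simp
      \<comment> \<open>The two morphisms agree after \<open>g\<close>, so their difference factors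
        through W, and \<open>f\<close> becomes a sum of two morphisms factoring through
        \<N>.\<close>
      then have "g \<cdot> (f \<^bold>- y \<cdot> x) = Zero \<T> X Y'"
        using comp_minus_right[OF f yx g] add_neg[OF comp_closed[OF f g]] by simp
      then obtain w where w: "w \<in> X \<leadsto> W" "v \<cdot> w = f \<^bold>- y \<cdot> x" using weak_kernel[OF t' minus_closed[OF f yx]] by metis
      have "f = v \<cdot> w \<^bold>+ y \<cdot> x"
        using w(2) add_assoc[OF f neg_closed[OF yx] yx] neg_add[OF yx] add_zero[OF f] by simp
      then show ?thesis
        using factors_add[OF N comp_closed[OF w(1) W(3)] factorsI[OF W(1) w(1) W(3)] yx factorsI[OF P x(1) y(1)]]
        by simp
    qed
    then show "X \<in> fac_right \<N> \<V>" using triD(6)[OF t] unfolding fac_right_def by blast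
  next
    fix X i W p assume i: "i \<in> X \<leadsto> W" "p \<in> W \<leadsto> X" "p \<cdot> i = Id \<T> X" and W: "W \<in> fac_right \<N> \<V>"
    have "factors_through \<T> f \<N>" if Y: "Y \<in> \<V>" and f: "f \<in> X \<leadsto> Y" for f Y
    proof -
      have fp: "f \<cdot> p \<in> W \<leadsto> Y" using comp_closed[OF i(2) f] .
      then have "factors_through \<T> (f \<cdot> p) \<N>" using W Y unfolding fac_right_def by blast
      then show ?thesis using factors_pre[OF _ fp i(1)] comp_assoc[OF i(1,2) f] i(3) id_right[OF f] by simp
    qed
    then show "X \<in> fac_right \<N> \<V>" using homD(4)[OF i(1)] unfolding fac_right_def by blast
  qed
qed

text \<open>The dual construction, with cones and fibres exchanged. The triangle on the fibre of
  \<open>u\<close> has to be continued to the left, to \<open>\<Omega>\<^sub>0 W\<close>, which is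
  why \<open>dtri\<close> enters.\<close>

lemma fac_left_thick:
  assumes N: "\<N> \<in> Thick \<T>" and V: "\<V> \<in> Thick \<T>" and NV: "\<N> \<subseteq> \<V>"
  shows "fac_left \<N> \<V> \<in> Thick \<T>"
proof -
  obtain Z where Z: "zero_object \<T> Z" using zero_object_exists by blast
  show ?thesis
  proof (rule thickI[OF _ _ Z])
    show "fac_left \<N> \<V> \<subseteq> Obj \<T>" unfolding fac_left_def by blast
    have "factors_through \<T> f \<N>" if "f \<in> Y \<leadsto> Z" for f Y
      using factorsI[OF thick_zero[OF N Z] that id_closed[OF zero_object_hom(1)[OF Z]]] id_left[OF that] by simp
    then show "Z \<in> fac_left \<N> \<V>" using zero_object_hom(1)[OF Z] unfolding fac_left_def by blast
  next
    fix X assume X: "X \<in> fac_left \<N> \<V>"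
    then have o: "X \<in> Obj \<T>" unfolding fac_left_def by blast
    have F: "factors_through \<T> f \<N>" if "f \<in> Y \<leadsto> X" "Y \<in> \<V>" for f Y
      using X that unfolding fac_left_def by blast
    have "factors_through \<T> f \<N>" if Y: "Y \<in> \<V>" and f: "f \<in> Y \<leadsto> \<Sigma>\<^sub>0 X" for f Y
    proof -
      note oY = homD(4)[OF f]
      note e = comp_closed[OF eps_hom[OF oY] f]
      obtain f' where f': "f' \<in> \<Omega>\<^sub>0 Y \<leadsto> X" "\<Sigma>\<^sub>1 f' = f \<cdot> eps Y" using susp_full[OF e desusp(1)[OF oY] o] .
      have "factors_through \<T> (f \<cdot> eps Y) \<N>"
        using F[OF f'(1) thick_desusp[OF V Y]] factors_susp[OF N f'(1)] f'(2) by simp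
      then show ?thesis using factors_pre[OF _ e eps'(1)[OF oY]] eps_cancel(2)[OF f] by simp
    qed
    then show "\<Sigma>\<^sub>0 X \<in> fac_left \<N> \<V>" using susp(1)[OF o] unfolding fac_left_def by blast
    have "factors_through \<T> f \<N>" if Y: "Y \<in> \<V>" and f: "f \<in> Y \<leadsto> \<Omega>\<^sub>0 X" for f Y
    proof -
      note e = comp_closed[OF susp(3)[OF f] eps_hom[OF o]]
      have "factors_through \<T> (eps' X \<cdot> (eps X \<cdot> \<Sigma>\<^sub>1 f)) \<N>"
        using factors_post[OF F[OF e thick_susp[OF V Y]] e eps'(1)[OF o]] .
      then show ?thesis
        using comp_assoc[OF susp(3)[OF f] eps_hom[OF o] eps'(1)[OF o]] eps'(2)[OF o] id_left[OF susp(3)[OF f]]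
          factors_susp[OF N f] by simp
    qed
    then show "\<Omega>\<^sub>0 X \<in> fac_left \<N> \<V>" using desusp(1)[OF o] unfolding fac_left_def by blast
  next
    fix X\<^sub>1 a X b X\<^sub>2 c
    assume t: "tri X\<^sub>1 a X b X\<^sub>2 c" and X1: "X\<^sub>1 \<in> fac_left \<N> \<V>" and X2: "X\<^sub>2 \<in> fac_left \<N> \<V>"
    note a = triD(2)[OF t] and b = triD(3)[OF t]
    have "factors_through \<T> f \<N>" if Y: "Y \<in> \<V>" and f: "f \<in> Y \<leadsto> X" for f Y
    proof -
      have bf: "b \<cdot> f \<in> Y \<leadsto> X\<^sub>2" using comp_closed[OF f b] .
      then have "factors_through \<T> (b \<cdot> f) \<N>" using X2 Y unfolding fac_left_def by blast
      then obtain W u v where W: "W \<in> \<N>" "u \<in> Y \<leadsto> W" "v \<in> W \<leadsto> X\<^sub>2" "b \<cdot> f = v \<cdot> u" using factorsE[OF _ bf] by metis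
      obtain Y' g h where t': "tri Y' g Y u W h" using tri_fiber[OF W(2)] .
      obtain l where l: "dtri W l Y' g Y u" using tri_dtri[OF t'] .
      note g = triD(2)[OF t'] and d = dtriD(4)[OF l] and l = dtriD(1)[OF l]
      have Y': "Y' \<in> \<V>" using thick_fiber[OF V t' Y] W(1) NV by blast
      have "b \<cdot> (f \<cdot> g) = Zero \<T> Y' X\<^sub>2"
        using comp_assoc[OF g f b] W(4) comp_assoc[OF g W(2,3)] tri_comp_zero(1)[OF t']
          comp_zero_right[OF W(3) homD(4)[OF g]] by simp
      then obtain k where k: "k \<in> Y' \<leadsto> X\<^sub>1" "a \<cdot> k = f \<cdot> g" using weak_kernel[OF t comp_closed[OF g f]] by metis
      then have "factors_through \<T> k \<N>" using X1 Y' unfolding fac_left_def by blast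
      then obtain W\<^sub>2 u\<^sub>2 v\<^sub>2 where W2: "W\<^sub>2 \<in> \<N>" "u\<^sub>2 \<in> Y' \<leadsto> W\<^sub>2" "v\<^sub>2 \<in> W\<^sub>2 \<leadsto> X\<^sub>1" "k = v\<^sub>2 \<cdot> u\<^sub>2"
        using factorsE[OF _ k(1)] by metis
      have ul: "u\<^sub>2 \<cdot> l \<in> \<Omega>\<^sub>0 W \<leadsto> W\<^sub>2" using comp_closed[OF l W2(2)] .
      obtain p P q where t2: "tri (\<Omega>\<^sub>0 W) (u\<^sub>2 \<cdot> l) W\<^sub>2 p P q" using tri_exists[OF ul] .
      note p = triD(3)[OF t2]
      have P: "P \<in> \<N>" using thick_cone[OF N t2 thick_desusp[OF N W(1)] W2(1)] .
      have av: "a \<cdot> v\<^sub>2 \<in> W\<^sub>2 \<leadsto> X" using comp_closed[OF W2(3) a] .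
      have avu: "a \<cdot> v\<^sub>2 \<cdot> u\<^sub>2 = f \<cdot> g" using comp_assoc[OF W2(2,3) a] W2(4) k(2) by simp
      have "a \<cdot> v\<^sub>2 \<cdot> (u\<^sub>2 \<cdot> l) = Zero \<T> (\<Omega>\<^sub>0 W) X"
        using comp_assoc[OF l W2(2) av] avu comp_assoc[OF l g f] tri_comp_zero(1)[OF d]
          comp_zero_right[OF f homD(4)[OF l]] by simp
      then obtain x where x: "x \<in> P \<leadsto> X" "x \<cdot> p = a \<cdot> v\<^sub>2" using weak_cokernel[OF t2 av] by metis
      have pu: "p \<cdot> u\<^sub>2 \<in> Y' \<leadsto> P" using comp_closed[OF W2(2) p] .
      have "p \<cdot> u\<^sub>2 \<cdot> l = Zero \<T> (\<Omega>\<^sub>0 W) P" using comp_assoc[OF l W2(2) p] tri_comp_zero(1)[OF t2] by simp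
      then obtain y where y: "y \<in> Y \<leadsto> P" "y \<cdot> g = p \<cdot> u\<^sub>2" using weak_cokernel[OF d pu] by metis
      have xy: "x \<cdot> y \<in> Y \<leadsto> X" using comp_closed[OF y(1) x(1)] .
      have "x \<cdot> y \<cdot> g = f \<cdot> g"
        using comp_assoc[OF g y(1) x(1)] y(2) comp_assoc[OF W2(2) p x(1)] x(2) avu by simp
      then have "(f \<^bold>- x \<cdot> y) \<cdot> g = Zero \<T> Y' X"
        using comp_minus_left[OF g f xy] add_neg[OF comp_closed[OF g f]] by simp
      then obtain w where w: "w \<in> W \<leadsto> X" "w \<cdot> u = f \<^bold>- x \<cdot> y" using weak_cokernel[OF t' minus_closed[OF f xy]] by metis
      have "f = w \<cdot> u \<^bold>+ x \<cdot> y"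
        using w(2) add_assoc[OF f neg_closed[OF xy] xy] neg_add[OF xy] add_zero[OF f] by simp
      then show ?thesis
        using factors_add[OF N comp_closed[OF W(2) w(1)] factorsI[OF W(1,2) w(1)] xy factorsI[OF P y(1) x(1)]]
        by simp
    qed
    then show "X \<in> fac_left \<N> \<V>" using triD(6)[OF t] unfolding fac_left_def by blast
  next
    fix X i W p assume i: "i \<in> X \<leadsto> W" "p \<in> W \<leadsto> X" "p \<cdot> i = Id \<T> X" and W: "W \<in> fac_left \<N> \<V>"
    have "factors_through \<T> f \<N>" if Y: "Y \<in> \<V>" and f: "f \<in> Y \<leadsto> X" for f Y
    proof -
      have if': "i \<cdot> f \<in> Y \<leadsto> W" using comp_closed[OF f i(1)] .
      then have "factors_through \<T> (i \<cdot> f) \<N>" using W Y unfolding fac_left_def by blast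
      then show ?thesis using factors_post[OF _ if' i(2)] comp_assoc[OF f i(1,2)] i(3) id_left[OF f] by simp
    qed
    then show "X \<in> fac_left \<N> \<V>" using homD(4)[OF i(1)] unfolding fac_left_def by blast
  qed
qed

lemma commuting_iff:
  assumes "\<U> \<in> Thick \<T>"
  shows "commuting \<T> \<U> \<V> \<longleftrightarrow> \<U> \<subseteq> fac_right (\<U> \<inter> \<V>) \<V> \<and> \<U> \<subseteq> fac_left (\<U> \<inter> \<V>) \<V>"
  unfolding commuting_def thick_meet_pair[OF assms] fac_right_def fac_left_def
  using thick_obj[OF assms] by blast

lemma commuting_sym: "commuting \<T> \<U> \<V> \<Longrightarrow> commuting \<T> \<V> \<U>"
  unfolding commuting_def by (auto simp: insert_commute)

lemma fac_mono: "\<N> \<subseteq> \<N>' \<Longrightarrow> fac_right \<N> \<V> \<subseteq> fac_right \<N>' \<V>" "\<N> \<subseteq> \<N>' \<Longrightarrow> fac_left \<N> \<V> \<subseteq> fac_left \<N>' \<V>"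
  unfolding fac_right_def fac_left_def using factors_mono by blast+

lemma commuting_join:
  assumes A: "A \<subseteq> Thick \<T>" and V: "\<V> \<in> Thick \<T>" and c: "\<And>\<U>. \<U> \<in> A \<Longrightarrow> commuting \<T> \<U> \<V>"
  shows "commuting \<T> (thick_join \<T> A) \<V>"
    and "thick_join \<T> A \<inter> \<V> \<subseteq> thick_join \<T> ((\<lambda>\<U>. \<U> \<inter> \<V>) ` A)"
proof -
  note J = thick_join_closed[OF A]
  have c: "\<U> \<subseteq> fac_right \<N> \<V>" "\<U> \<subseteq> fac_left \<N> \<V>" if "\<U> \<in> A" "\<U> \<inter> \<V> \<subseteq> \<N>" for \<U> \<N>
    using c[OF that(1)] commuting_iff[of \<U> \<V>] fac_mono[OF that(2)] A that(1) by blast+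
  have s: "\<U> \<inter> \<V> \<subseteq> thick_join \<T> A \<inter> \<V>" if "\<U> \<in> A" for \<U> using thick_join_upper[OF A that] by blast
  show "commuting \<T> (thick_join \<T> A) \<V>"
    unfolding commuting_iff[OF J]
    using thick_join_least[OF A fac_right_thick[OF thick_Int[OF J V] V Int_lower2]]
      thick_join_least[OF A fac_left_thick[OF thick_Int[OF J V] V Int_lower2]] c[OF _ s] by blast
  let ?N = "thick_join \<T> ((\<lambda>\<U>. \<U> \<inter> \<V>) ` A)"
  have A': "(\<lambda>\<U>. \<U> \<inter> \<V>) ` A \<subseteq> Thick \<T>" using A thick_Int[OF _ V] by blast
  note N = thick_join_closed[OF A']
  have "?N \<subseteq> \<V>" using thick_join_least[OF A' V] by blast
  then have F: "thick_join \<T> A \<subseteq> fac_right ?N \<V>"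
    using thick_join_least[OF A fac_right_thick[OF N V]] c(1) thick_join_upper[OF A'] by blast
  show "thick_join \<T> A \<inter> \<V> \<subseteq> ?N"
  proof
    fix X assume X: "X \<in> thick_join \<T> A \<inter> \<V>"
    then have "X \<in> fac_right ?N \<V>" using F by blast
    then have o: "X \<in> Obj \<T>" and "factors_through \<T> (Id \<T> X) ?N"
      using X id_closed[of X] unfolding fac_right_def by blast+
    then obtain W u v where W: "W \<in> ?N" "u \<in> X \<leadsto> W" "v \<in> W \<leadsto> X" "Id \<T> X = v \<cdot> u"
      using factorsE[OF _ id_closed[OF o]] by metis
    show "X \<in> ?N" using thick_retract[OF N W(2,3) W(4)[symmetric] W(1)] .
  qed
qed

end

section \<open>Frames of sets\<close>

lemma inclusion_order_simps [simp]:
  "carrier (inclusion_order Z) = Z" "x \<sqsubseteq>\<^bsub>inclusion_order Z\<^esub> y \<longleftrightarrow> x \<subseteq> y" "x .=\<^bsub>inclusion_order Z\<^esub> y \<longleftrightarrow> x = y"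
  by (simp_all add: inclusion_order_def)

lemma two_simps [simp]:
  "carrier two = UNIV" "x \<sqsubseteq>\<^bsub>two\<^esub> y \<longleftrightarrow> (x \<longrightarrow> y)" "x .=\<^bsub>two\<^esub> y \<longleftrightarrow> x = y"
  by (auto simp add: two_def)

lemma two_Sup: "\<Squnion>\<^bsub>two\<^esub>A = (\<exists>a \<in> A. a)"
  unfolding sup_def by (rule some_equality) (auto simp: least_def Upper_def)

lemma two_inf: "x \<sqinter>\<^bsub>two\<^esub> y = (x \<and> y)"
  unfolding meet_def inf_def by (rule some_equality) (auto simp: greatest_def Lower_def)

lemma two_top: "\<top>\<^bsub>two\<^esub> = True"
  unfolding top_def by (rule some_equality) (auto simp: greatest_def Lower_def)

text \<open>Finite meets are intersections, but joins are an abstract operation J, and infinite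
  meets are obtained as joins of lower bounds. The condition \<open>chain\<close> makes Zorn's lemma
  applicable.\<close>

locale set_frame =
  fixes Z :: "'a set set" and J :: "'a set set \<Rightarrow> 'a set" and T :: "'a set"
  assumes join_closed: "A \<subseteq> Z \<Longrightarrow> J A \<in> Z"
    and join_upper: "A \<subseteq> Z \<Longrightarrow> U \<in> A \<Longrightarrow> U \<subseteq> J A"
    and join_least: "A \<subseteq> Z \<Longrightarrow> W \<in> Z \<Longrightarrow> (\<And>U. U \<in> A \<Longrightarrow> U \<subseteq> W) \<Longrightarrow> J A \<subseteq> W"
    and top_closed: "T \<in> Z" and top_greatest: "U \<in> Z \<Longrightarrow> U \<subseteq> T"
    and Int_closed: "U \<in> Z \<Longrightarrow> V \<in> Z \<Longrightarrow> U \<inter> V \<in> Z"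
    and distrib: "A \<subseteq> Z \<Longrightarrow> V \<in> Z \<Longrightarrow> J A \<inter> V \<subseteq> J ((\<lambda>U. U \<inter> V) ` A)"
    and chain: "C \<subseteq> Z \<Longrightarrow> C \<noteq> {} \<Longrightarrow> (\<And>U V. U \<in> C \<Longrightarrow> V \<in> C \<Longrightarrow> U \<subseteq> V \<or> V \<subseteq> U) \<Longrightarrow> J C \<subseteq> \<Union>C"
begin

abbreviation "F \<equiv> inclusion_order Z"

lemma least_iff: "A \<subseteq> Z \<Longrightarrow> least F x (Upper F A) \<longleftrightarrow>
    x \<in> Z \<and> (\<forall>U \<in> A. U \<subseteq> x) \<and> (\<forall>W \<in> Z. (\<forall>U \<in> A. U \<subseteq> W) \<longrightarrow> x \<subseteq> W)"
  unfolding least_def Upper_def by (simp add: subset_iff) blast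

lemma greatest_iff: "A \<subseteq> Z \<Longrightarrow> greatest F x (Lower F A) \<longleftrightarrow>
    x \<in> Z \<and> (\<forall>U \<in> A. x \<subseteq> U) \<and> (\<forall>W \<in> Z. (\<forall>U \<in> A. W \<subseteq> U) \<longrightarrow> W \<subseteq> x)"
  unfolding greatest_def Lower_def by (simp add: subset_iff) blast

lemma least_join: "A \<subseteq> Z \<Longrightarrow> least F (J A) (Upper F A)"
  by (simp add: least_iff join_closed join_upper join_least)

lemma complete_lattice: "complete_lattice F"
proof -
  interpret partial_order F by unfold_locales (auto simp: fun_eq_iff)
  show ?thesis
  proof
    show "\<exists>s. least F s (Upper F A)" if "A \<subseteq> carrier F" for A using least_join that by auto
    show "\<exists>i. greatest F i (Lower F A)" if "A \<subseteq> carrier F" for A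
    proof -
      let ?B = "{W \<in> Z. \<forall>a \<in> A. W \<subseteq> a}"
      have B: "?B \<subseteq> Z" by blast
      have "J ?B \<subseteq> a" if "a \<in> A" for a
        using join_least[OF B, of a] that \<open>A \<subseteq> carrier F\<close> by auto
      then have "greatest F (J ?B) (Lower F A)"
        using join_closed[OF B] join_upper[OF B] \<open>A \<subseteq> carrier F\<close> by (simp add: greatest_iff)
      then show ?thesis by blast
    qed
  qed
qed

lemma Sup_eq: "A \<subseteq> Z \<Longrightarrow> \<Squnion>\<^bsub>F\<^esub>A = J A"
  unfolding sup_def
proof (rule some_equality[where P = "\<lambda>x. least F x (Upper F A)"])
  show "A \<subseteq> Z \<Longrightarrow> least F (J A) (Upper F A)" by (rule least_join)
  show "x = J A" if "A \<subseteq> Z" "least F x (Upper F A)" for x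
    using that least_join[OF that(1)] by (simp add: least_iff subset_antisym)
qed

lemma inf_eq: "U \<in> Z \<Longrightarrow> V \<in> Z \<Longrightarrow> U \<sqinter>\<^bsub>F\<^esub> V = U \<inter> V"
  unfolding meet_def inf_def
proof (rule some_equality[where P = "\<lambda>x. greatest F x (Lower F {U, V})"])
  assume UV: "U \<in> Z" "V \<in> Z"
  then show "greatest F (U \<inter> V) (Lower F {U, V})" using Int_closed by (simp add: greatest_iff)
  show "x = U \<inter> V" if "greatest F x (Lower F {U, V})" for x
    using that UV Int_closed[OF UV] by (simp add: greatest_iff) blast
qed

lemma top_eq: "\<top>\<^bsub>F\<^esub> = T"
  unfolding top_def using top_closed top_greatest
  by (intro some_equality) (auto simp: greatest_def Lower_def)

lemma distrib_eq:
  assumes A: "A \<subseteq> Z" and V: "V \<in> Z" shows "J ((\<lambda>U. U \<inter> V) ` A) = J A \<inter> V"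
proof
  have "(\<lambda>U. U \<inter> V) ` A \<subseteq> Z" using A V Int_closed by blast
  then show "J ((\<lambda>U. U \<inter> V) ` A) \<subseteq> J A \<inter> V"
    by (rule join_least[OF _ Int_closed[OF join_closed[OF A] V]]) (use join_upper[OF A] in blast)
qed (rule distrib[OF A V])

lemma frame: "frame F"
proof -
  have "\<Squnion>\<^bsub>F\<^esub>((\<lambda>x. x \<sqinter>\<^bsub>F\<^esub> V) ` A) = (\<Squnion>\<^bsub>F\<^esub>A) \<sqinter>\<^bsub>F\<^esub> V" if A: "A \<subseteq> Z" "V \<in> Z" for A V
  proof -
    have "(\<lambda>x. x \<sqinter>\<^bsub>F\<^esub> V) ` A = (\<lambda>U. U \<inter> V) ` A" using that inf_eq by (intro image_cong) auto
    moreover have "(\<lambda>U. U \<inter> V) ` A \<subseteq> Z" using A Int_closed by blast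
    ultimately show ?thesis
      using Sup_eq[of "(\<lambda>U. U \<inter> V) ` A"] Sup_eq[OF A(1)] inf_eq[OF join_closed[OF A(1)] A(2)] distrib_eq[OF A] by simp
  qed
  then show ?thesis unfolding frame_def using complete_lattice by simp
qed

section \<open>Points, prime elements and spatiality\<close>

lemma points_iff:
  "p \<in> points F \<longleftrightarrow> p \<in> extensional Z \<and> p T \<and> (\<forall>U \<in> Z. \<forall>V \<in> Z. p (U \<inter> V) \<longleftrightarrow> p U \<and> p V) \<and>
    (\<forall>A. A \<subseteq> Z \<longrightarrow> p (J A) \<longleftrightarrow> (\<exists>U \<in> A. p U))"
  unfolding points_def frame_morphism_def by (auto simp: two_Sup two_inf two_top top_eq inf_eq Sup_eq)

text \<open>Prime elements of a frame give its points: joins are preserved automatically,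
  preservation of binary meets is primality, and preservation of the top element says that W is
  proper.\<close>

lemma prime_point:
  assumes W: "W \<in> Z" "\<not> T \<subseteq> W"
    and prime: "\<And>U V. U \<in> Z \<Longrightarrow> V \<in> Z \<Longrightarrow> U \<inter> V \<subseteq> W \<Longrightarrow> U \<subseteq> W \<or> V \<subseteq> W"
  shows "restrict (\<lambda>U. \<not> U \<subseteq> W) Z \<in> points F"
proof -
  have "J A \<subseteq> W \<longleftrightarrow> (\<forall>U \<in> A. U \<subseteq> W)" if "A \<subseteq> Z" for A
    using join_upper[OF that] join_least[OF that W(1)] by blast
  moreover have "U \<inter> V \<subseteq> W \<longleftrightarrow> U \<subseteq> W \<or> V \<subseteq> W" if "U \<in> Z" "V \<in> Z" for U V
    using prime[OF that] by blast
  ultimately show ?thesis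
    unfolding points_iff using W(2) top_closed by (auto simp: Int_closed join_closed subset_iff[of _ Z])
qed

text \<open>
  A member of \<open>Z\<close> that is maximal among those containing \<open>V\<close> but not the element \<open>x\<close> is prime,
  and it exists since joins of chains are unions.
\<close>

lemma separating_point:
  assumes U: "U \<in> Z" and V: "V \<in> Z" and x: "x \<in> U" "x \<notin> V"
  obtains p where "p \<in> points F" "p U" "\<not> p V"
proof -
  let ?S = "{W \<in> Z. V \<subseteq> W \<and> x \<notin> W}"
  have "\<exists>M \<in> ?S. \<forall>X \<in> ?S. M \<subseteq> X \<longrightarrow> X = M"
  proof (rule subset_Zorn_nonempty)
    show "?S \<noteq> {}" using V x by blast
    fix C assume False: "C \<noteq> {}" and C: "subset.chain ?S C"
    have CZ: "C \<subseteq> Z" and CS: "\<And>X. X \<in> C \<Longrightarrow> V \<subseteq> X \<and> x \<notin> X" using C unfolding subset.chain_def by blast+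
    have "J C \<subseteq> \<Union>C" using chain[OF CZ False] C unfolding subset.chain_def by blast
    moreover have "\<Union>C \<subseteq> J C" using join_upper[OF CZ] by blast
    ultimately show "\<Union>C \<in> ?S" using join_closed[OF CZ] CS False by auto
  qed
  then obtain W where W': "W \<in> ?S" "\<forall>X \<in> ?S. W \<subseteq> X \<longrightarrow> X = W" by (elim bexE)
  then have W: "W \<in> Z" "V \<subseteq> W" "x \<notin> W" by simp_all
  have max: "W = X" if "X \<in> Z" "V \<subseteq> X" "x \<notin> X" "W \<subseteq> X" for X using bspec[OF W'(2), of X] that by simp
  have T: "\<not> T \<subseteq> W" using x(1) top_greatest[OF U] W(3) by blast
  have "A \<subseteq> W \<or> B \<subseteq> W" if A: "A \<in> Z" and B: "B \<in> Z" and AB: "A \<inter> B \<subseteq> W" for A B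
  proof (rule ccontr)
    assume n: "\<not> (A \<subseteq> W \<or> B \<subseteq> W)"
    \<comment> \<open>By maximality, joining W with anything not below it captures
      \<open>x\<close>.\<close>
    have *: "x \<in> J {W, D}" if "D \<in> Z" "\<not> D \<subseteq> W" for D
    proof (rule ccontr)
      have WD: "{W, D} \<subseteq> Z" using W that by blast
      assume "x \<notin> J {W, D}"
      then have "W = J {W, D}" using max[OF join_closed[OF WD]] join_upper[OF WD] W(2) by blast
      then show False using join_upper[OF WD, of D] that by blast
    qed
    have WA: "{W, A} \<subseteq> Z" and WB: "{W, B} \<subseteq> Z" using W A B by blast+
    have W': "J {W, B} \<inter> W \<subseteq> W" by blast
    have 1: "J {W, B} \<inter> A \<subseteq> W"
    proof -
      have s: "(\<lambda>U. U \<inter> A) ` {W, B} \<subseteq> Z" using WB A Int_closed by blast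
      have "J ((\<lambda>U. U \<inter> A) ` {W, B}) \<subseteq> W" by (rule join_least[OF s W(1)]) (use AB in blast)
      then show ?thesis using distrib[OF WB A] by blast
    qed
    \<comment> \<open>Distributivity, applied once in each argument, bounds the meet of the two
      joins by W. As \<open>x\<close> lies in both joins, it would lie in W.\<close>
    have 2: "J {W, A} \<inter> J {W, B} \<subseteq> W"
    proof -
      have s: "(\<lambda>U. U \<inter> J {W, B}) ` {W, A} \<subseteq> Z" using WA join_closed[OF WB] Int_closed by blast
      have "J ((\<lambda>U. U \<inter> J {W, B}) ` {W, A}) \<subseteq> W" by (rule join_least[OF s W(1)]) (use 1 in blast)
      then show ?thesis using distrib[OF WA join_closed[OF WB]] by blast
    qed
    then show False using *[OF A] *[OF B] n W(3) by blast
  qed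
  from prime_point[OF W(1) T this] show thesis
    by (rule that) (use U V W x in auto)
qed

text \<open>\<open>Pt\<close> is built with \<open>topology\<close>, which returns the given family
  only if that family is a topology. Intersections and unions of basic sets are computed from meets
  and joins, which points preserve.\<close>

lemma open_Pt: "openin (Pt F) W \<longleftrightarrow> W \<in> point_open F ` Z"
proof -
  have Int: "point_open F U \<inter> point_open F V = point_open F (U \<inter> V)" if "U \<in> Z" "V \<in> Z" for U V
    using that unfolding point_open_def points_iff by blast
  have Un: "\<Union>(point_open F ` A) = point_open F (J A)" if "A \<subseteq> Z" for A
    using that unfolding point_open_def points_iff by blast
  have "istopology (\<lambda>W. W \<in> point_open F ` Z)"
    unfolding istopology_def
  proof (intro conjI allI impI)
    fix S T assume "S \<in> point_open F ` Z" "T \<in> point_open F ` Z"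
    then obtain U V where UV: "U \<in> Z" "V \<in> Z" "S = point_open F U" "T = point_open F V" by blast
    then show "S \<inter> T \<in> point_open F ` Z" using Int[OF UV(1,2)] Int_closed[OF UV(1,2)] by blast
  next
    fix K assume "\<forall>k \<in> K. k \<in> point_open F ` Z"
    then have "K \<subseteq> point_open F ` Z" by blast
    then obtain A where A: "A \<subseteq> Z" "K = point_open F ` A" by (auto simp: subset_image_iff)
    then show "\<Union>K \<in> point_open F ` Z" using Un[OF A(1)] join_closed[OF A(1)] by blast
  qed
  then show ?thesis unfolding Pt_def by (simp add: topology_inverse')
qed

theorem spatial: "spatial_frame F"
proof -
  have sep: "U \<subseteq> V \<longleftrightarrow> point_open F U \<subseteq> point_open F V" if UV: "U \<in> Z" "V \<in> Z" for U V
  proof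
    assume s: "U \<subseteq> V"
    then have "U \<inter> V = U" by blast
    then show "point_open F U \<subseteq> point_open F V" using UV unfolding point_open_def points_iff by force
  next
    assume s: "point_open F U \<subseteq> point_open F V"
    show "U \<subseteq> V"
    proof
      fix x assume "x \<in> U"
      then show "x \<in> V" using separating_point[OF UV, of x] s unfolding point_open_def by blast
    qed
  qed
  have "inj_on (point_open F) Z" by (rule inj_onI) (use sep in blast)
  then have "bij_betw (point_open F) Z {W. openin (Pt F) W}"
    unfolding bij_betw_def open_Pt by blast
  then show ?thesis unfolding spatial_frame_def using frame sep by simp
qed

end

section \<open>The centre\<close>

context triangulated_category
begin

context
  fixes L :: "'o set set"
  assumes L: "thick_sublattice \<T> L" and LJ: "closed_under_joins \<T> L" and LO: "Obj \<T> \<in> L"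
begin

lemma sublattice_thick: "\<U> \<in> L \<Longrightarrow> \<U> \<in> Thick \<T>"
  using L unfolding thick_sublattice_def by blast

lemma sublattice_Int:
  assumes "\<U> \<in> L" "\<V> \<in> L" shows "\<U> \<inter> \<V> \<in> L"
  using L assms thick_meet_pair[OF sublattice_thick[OF assms(1)], of \<V>]
  unfolding thick_sublattice_def by (metis empty_subsetI finite.emptyI finite.insertI insert_subset)

lemma centreD: "\<U> \<in> centre \<T> L \<Longrightarrow> \<U> \<in> L" "\<U> \<in> centre \<T> L \<Longrightarrow> \<V> \<in> L \<Longrightarrow> commuting \<T> \<U> \<V>"
  unfolding centre_def by blast+

lemma centre_join: "A \<subseteq> centre \<T> L \<Longrightarrow> thick_join \<T> A \<in> centre \<T> L"
proof -
  assume A: "A \<subseteq> centre \<T> L"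
  then have AL: "A \<subseteq> L" using centreD(1) by blast
  then have At: "A \<subseteq> Thick \<T>" using sublattice_thick by blast
  have "commuting \<T> (thick_join \<T> A) \<V>" if "\<V> \<in> L" for \<V>
    using commuting_join(1)[OF At sublattice_thick[OF that]] centreD(2)[OF _ that] A by blast
  then show ?thesis using LJ AL unfolding centre_def closed_under_joins_def by blast
qed

lemma Obj_centre: "Obj \<T> \<in> centre \<T> L"
proof -
  have "\<V> \<subseteq> Obj \<T>" if "\<V> \<in> L" for \<V> using thick_obj[OF sublattice_thick[OF that]] by blast
  moreover have "factors_through \<T> f \<V>" if "f \<in> X \<leadsto> Y" "X \<in> \<V> \<or> Y \<in> \<V>" for f X Y \<V>
    using that factorsI[OF _ that(1) id_closed] factorsI[OF _ id_closed that(1)] id_left[OF that(1)]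
      id_right[OF that(1)] homD(4,5)[OF that(1)] by metis
  ultimately show ?thesis
    unfolding centre_def commuting_def thick_meet_def using LO
    by (auto simp: inf_absorb2)
qed

text \<open>A morphism is factored twice: centrality of \<U> gives an intermediate object in \<U>
  \<inter> \<W>, and centrality of \<V> is then applied to the member \<U> \<inter> \<W> of L
  instead of \<W>.\<close>

lemma centre_Int:
  assumes U: "\<U> \<in> centre \<T> L" and V: "\<V> \<in> centre \<T> L" shows "\<U> \<inter> \<V> \<in> centre \<T> L"
proof -
  note UL = centreD(1)[OF U] and VL = centreD(1)[OF V]
  note UVL = sublattice_Int[OF UL VL]
  have "commuting \<T> (\<U> \<inter> \<V>) \<W>" if W: "\<W> \<in> L" for \<W>
  proof -
    have UW: "\<U> \<inter> \<W> \<in> L" using sublattice_Int[OF UL W] .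
    have cU: "\<U> \<subseteq> fac_right (\<U> \<inter> \<W>) \<W>" "\<U> \<subseteq> fac_left (\<U> \<inter> \<W>) \<W>"
      using centreD(2)[OF U W] commuting_iff[OF sublattice_thick[OF UL]] by blast+
    have cV: "\<V> \<subseteq> fac_right (\<V> \<inter> (\<U> \<inter> \<W>)) (\<U> \<inter> \<W>)" "\<V> \<subseteq> fac_left (\<V> \<inter> (\<U> \<inter> \<W>)) (\<U> \<inter> \<W>)"
      using centreD(2)[OF V UW] commuting_iff[OF sublattice_thick[OF VL]] by blast+
    have e: "\<V> \<inter> (\<U> \<inter> \<W>) = \<U> \<inter> \<V> \<inter> \<W>" by blast
    have "factors_through \<T> f (\<U> \<inter> \<V> \<inter> \<W>)" if X: "X \<in> \<U>" "X \<in> \<V>" "Y \<in> \<W>" and f: "f \<in> X \<leadsto> Y" for X Y f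
    proof -
      have "factors_through \<T> f (\<U> \<inter> \<W>)" using fac_rightD[OF cU(1) X(1,3) f] .
      then obtain W u v where W: "W \<in> \<U> \<inter> \<W>" "u \<in> X \<leadsto> W" "v \<in> W \<leadsto> Y" "f = v \<cdot> u" using factorsE[OF _ f] by metis
      have "factors_through \<T> u (\<U> \<inter> \<V> \<inter> \<W>)" using fac_rightD[OF cV(1) X(2) W(1,2)] e by simp
      then show ?thesis using factors_post[OF _ W(2,3)] W(4) by simp
    qed
    moreover have "factors_through \<T> f (\<U> \<inter> \<V> \<inter> \<W>)" if X: "X \<in> \<U>" "X \<in> \<V>" "Y \<in> \<W>" and f: "f \<in> Y \<leadsto> X" for X Y f
    proof -
      have "factors_through \<T> f (\<U> \<inter> \<W>)" using fac_leftD[OF cU(2) X(1,3) f] .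
      then obtain W u v where W: "W \<in> \<U> \<inter> \<W>" "u \<in> Y \<leadsto> W" "v \<in> W \<leadsto> X" "f = v \<cdot> u" using factorsE[OF _ f] by metis
      have "factors_through \<T> v (\<U> \<inter> \<V> \<inter> \<W>)" using fac_leftD[OF cV(2) X(2) W(1,3)] e by simp
      then show ?thesis using factors_pre[OF _ W(3,2)] W(4) by simp
    qed
    ultimately show ?thesis
      unfolding commuting_def thick_meet_pair[OF sublattice_thick[OF UVL]] by blast
  qed
  then show ?thesis using UVL unfolding centre_def by blast
qed

lemma centre_thick: "centre \<T> L \<subseteq> Thick \<T>"
  using centreD sublattice_thick by blast

lemma centre_meet:
  assumes "finite A" "A \<subseteq> centre \<T> L" shows "thick_meet \<T> A \<in> centre \<T> L"
  using assms
proof (induction rule: finite_induct)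
  case empty
  then show ?case using Obj_centre by (simp add: thick_meet_def)
next
  case (insert \<U> A)
  have "thick_meet \<T> (insert \<U> A) = \<U> \<inter> thick_meet \<T> A" unfolding thick_meet_def by blast
  then show ?case using insert centre_Int[of \<U> "thick_meet \<T> A"] by simp
qed

lemma centre_sublattice: "thick_sublattice \<T> (centre \<T> L)" "closed_under_joins \<T> (centre \<T> L)"
  unfolding thick_sublattice_def closed_under_joins_def using centre_thick centre_meet centre_join by blast+

lemma centre_spatial: "spatial_frame (inclusion_order (centre \<T> L))"
proof (rule set_frame.spatial)
  show "set_frame (centre \<T> L) (thick_join \<T>) (Obj \<T>)"
  proof
    fix A assume "A \<subseteq> centre \<T> L"
    then have A: "A \<subseteq> Thick \<T>" "A \<subseteq> centre \<T> L" using centre_thick by blast+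
    show "thick_join \<T> A \<in> centre \<T> L" using centre_join[OF A(2)] .
    show "\<U> \<subseteq> thick_join \<T> A" if "\<U> \<in> A" for \<U> using thick_join_upper[OF A(1) that] .
    show "thick_join \<T> A \<subseteq> \<W>" if "\<W> \<in> centre \<T> L" "\<And>\<U>. \<U> \<in> A \<Longrightarrow> \<U> \<subseteq> \<W>" for \<W>
      using thick_join_least[OF A(1)] that centre_thick by blast
    show "thick_join \<T> A \<inter> \<V> \<subseteq> thick_join \<T> ((\<lambda>\<U>. \<U> \<inter> \<V>) ` A)" if "\<V> \<in> centre \<T> L" for \<V>
      using commuting_join(2)[OF A(1)] that centre_thick A(2) centreD by blast
    show "thick_join \<T> A \<subseteq> \<Union>A"
      if "A \<noteq> {}" "\<And>\<U> \<V>. \<U> \<in> A \<Longrightarrow> \<V> \<in> A \<Longrightarrow> \<U> \<subseteq> \<V> \<or> \<V> \<subseteq> \<U>"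
      using thick_join_least[OF A(1) thick_chain_Union[OF A(1) that]] by blast
  next
    show "Obj \<T> \<in> centre \<T> L" using Obj_centre .
    show "\<U> \<subseteq> Obj \<T>" if "\<U> \<in> centre \<T> L" for \<U> using thick_obj that centre_thick by blast
    show "\<U> \<inter> \<V> \<in> centre \<T> L" if "\<U> \<in> centre \<T> L" "\<V> \<in> centre \<T> L" for \<U> \<V> using centre_Int[OF that] .
  qed
qed

end

end

section \<open>Calculus of fractions\<close>

context triangulated_category
begin

abbreviation denoms :: "'o set \<Rightarrow> 'o \<Rightarrow> 'o \<Rightarrow> 'm set" where
  "denoms \<S> X Y \<equiv> (X \<leadsto> Y) \<inter> cone_in \<T> \<S>"

section \<open>Ore conditions for the morphisms with cone in a thick subcategory\<close>

lemma denomsI: "tri X s Y g C h \<Longrightarrow> C \<in> \<S> \<Longrightarrow> s \<in> denoms \<S> X Y"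
  using triD(1,2)[of X s Y g C h] tri_dom_cod(4)[of X s Y g C h] unfolding cone_in_def by auto

lemma denomsE:
  assumes "s \<in> denoms \<S> X Y" obtains g C h where "tri X s Y g C h" "C \<in> \<S>"
proof -
  obtain g h where "(s, g, h) \<in> Dist \<T>" "Cod \<T> g \<in> \<S>" using assms unfolding cone_in_def by blast
  then show thesis using that dist_tri[of s g h] homD(2,3)[of s X Y] assms by auto
qed

lemma cone_in_denoms: "s \<in> cone_in \<T> \<S> \<Longrightarrow> s \<in> denoms \<S> (Dom \<T> s) (Cod \<T> s)"
  using dist_tri triD(2) unfolding cone_in_def by blast

lemma denoms_mono: "\<S> \<subseteq> \<S>' \<Longrightarrow> denoms \<S> X Y \<subseteq> denoms \<S>' X Y"
  unfolding cone_in_def by blast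

lemma denoms_obj: "s \<in> denoms \<S> X Y \<Longrightarrow> X \<in> Obj \<T>" "s \<in> denoms \<S> X Y \<Longrightarrow> Y \<in> Obj \<T>"
  using homD(4,5) by blast+

context
  fixes \<S> assumes S: "\<S> \<in> Thick \<T>"
begin

lemma denoms_fiberI: "tri W i X s Y k \<Longrightarrow> W \<in> \<S> \<Longrightarrow> s \<in> denoms \<S> X Y"
  using denomsI[OF tri_rotate] thick_susp[OF S] by blast

lemma denoms_fiberE:
  assumes "s \<in> denoms \<S> X Y" obtains W i k where "tri W i X s Y k" "W \<in> \<S>"
proof -
  obtain g C h where t: "tri X s Y g C h" "C \<in> \<S>" using denomsE[OF assms] .
  obtain i where "tri (\<Omega>\<^sub>0 C) i X s Y (eps' C \<cdot> g)" using tri_desusp[OF t(1)] .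
  then show thesis using that thick_desusp[OF S t(2)] by blast
qed

lemma denoms_id: "X \<in> Obj \<T> \<Longrightarrow> Id \<T> X \<in> denoms \<S> X X"
  using zero_object_exists denomsI[OF tri_id] thick_zero[OF S] by blast

lemma denoms_zero: "Z \<in> \<S> \<Longrightarrow> zero_object \<T> N \<Longrightarrow> Zero \<T> N Z \<in> denoms \<S> N Z"
  using denomsI[OF tri_zero_left] thick_obj[OF S] by blast

text \<open>By the octahedral axiom the cone of the composite is an extension of the two
  cones.\<close>

lemma denoms_comp:
  assumes s: "s \<in> denoms \<S> X Y" and t: "t \<in> denoms \<S> Y Z" shows "t \<cdot> s \<in> denoms \<S> X Z"
proof -
  obtain s\<^sub>2 A s\<^sub>3 where A: "tri X s Y s\<^sub>2 A s\<^sub>3" "A \<in> \<S>" using denomsE[OF s] .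
  obtain t\<^sub>2 B t\<^sub>3 where B: "tri Y t Z t\<^sub>2 B t\<^sub>3" "B \<in> \<S>" using denomsE[OF t] .
  have ts: "t \<cdot> s \<in> X \<leadsto> Z" using comp_closed s t by blast
  obtain h\<^sub>2 D h\<^sub>3 where D: "tri X (t \<cdot> s) Z h\<^sub>2 D h\<^sub>3" using tri_exists[OF ts] .
  obtain d\<^sub>1 d\<^sub>2 where "tri A d\<^sub>1 D d\<^sub>2 B (\<Sigma>\<^sub>1 s\<^sub>2 \<cdot> t\<^sub>3)" using octahedron[OF A(1) B(1) D] .
  then have "D \<in> \<S>" using thick_ext[OF S] A(2) B(2) by blast
  then show ?thesis using denomsI[OF D] by blast
qed

text \<open>Choosing \<open>s'\<close> as the fibre of \<open>\<kappa> \<cdot> f\<close> gives it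
  the same cone C as \<open>s\<close>, and makes \<open>f \<cdot> s'\<close> vanish after
  \<open>\<kappa>\<close>, so that it lifts along \<open>s\<close>.\<close>

lemma denoms_pullback:
  assumes s: "s \<in> denoms \<S> Y' Y" and f: "f \<in> X \<leadsto> Y"
  obtains X' s' f' where "s' \<in> denoms \<S> X' X" "f' \<in> X' \<leadsto> Y'" "s \<cdot> f' = f \<cdot> s'"
proof -
  obtain \<kappa> C h where t: "tri Y' s Y \<kappa> C h" "C \<in> \<S>" using denomsE[OF s] .
  note k = triD(3)[OF t(1)]
  obtain X' s' h' where t': "tri X' s' X (\<kappa> \<cdot> f) C h'" using tri_fiber[OF comp_closed[OF f k]] .
  note s' = triD(2)[OF t']
  have "\<kappa> \<cdot> (f \<cdot> s') = Zero \<T> X' C" using tri_comp_zero(1)[OF t'] comp_assoc[OF s' f k] by simp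
  then obtain f' where "f' \<in> X' \<leadsto> Y'" "s \<cdot> f' = f \<cdot> s'" using weak_kernel[OF t(1) comp_closed[OF s' f]] by metis
  then show thesis using that denomsI[OF t' t(2)] by blast
qed

text \<open>The difference of \<open>f\<close> and \<open>g\<close> factors through the fibre W of
  \<open>s\<close>. The fibre of the resulting morphism to W equalises \<open>f\<close> and
  \<open>g\<close>, and its cone is W.\<close>

lemma denoms_cancel:
  assumes s: "s \<in> denoms \<S> Y Z" and f: "f \<in> X \<leadsto> Y" "g \<in> X \<leadsto> Y" "s \<cdot> f = s \<cdot> g"
  obtains X' r where "r \<in> denoms \<S> X' X" "f \<cdot> r = g \<cdot> r"
proof -
  obtain W i k where t: "tri W i Y s Z k" "W \<in> \<S>" using denoms_fiberE[OF s] .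
  note s = triD(3)[OF t(1)] and i = triD(2)[OF t(1)]
  have "s \<cdot> (f \<^bold>- g) = Zero \<T> X Z"
    using comp_minus_right[OF f(1,2) s] f(3) add_neg[OF comp_closed[OF f(2) s]] by simp
  then obtain c where c: "c \<in> X \<leadsto> W" "i \<cdot> c = f \<^bold>- g" using weak_kernel[OF t(1) minus_closed[OF f(1,2)]] by metis
  obtain X' r h where r: "tri X' r X c W h" using tri_fiber[OF c(1)] .
  note r' = triD(2)[OF r]
  have "(f \<^bold>- g) \<cdot> r = Zero \<T> X' Y"
    using comp_assoc[OF r' c(1) i] c(2) tri_comp_zero(1)[OF r] comp_zero_right[OF i triD(5)[OF r]] by simp
  then have "f \<cdot> r = g \<cdot> r"
    using comp_minus_left[OF r' f(1,2)] minus_eq_zero[OF comp_closed[OF r' f(1)] comp_closed[OF r' f(2)]] by simp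
  then show thesis using that denomsI[OF r t(2)] by blast
qed

lemma denoms_ore:
  assumes s: "s \<in> denoms \<S> A Y" and s': "s' \<in> denoms \<S> B Y"
  obtains W u v where "u \<in> W \<leadsto> A" "v \<in> W \<leadsto> B" "s \<cdot> u = s' \<cdot> v" "s \<cdot> u \<in> denoms \<S> W Y"
proof -
  obtain W v u where "v \<in> denoms \<S> W B" "u \<in> W \<leadsto> A" "s \<cdot> u = s' \<cdot> v" using denoms_pullback[OF s] s' by blast
  then show thesis using that denoms_comp[OF _ s'] by auto
qed

text \<open>Two spans that witness the same comparison of denominators need a common refinement. A
  common denominator makes them agree only after \<open>s\<close> and after \<open>s'\<close>, so
  each leg is equalised by a further denominator.\<close>

lemma spans_common:
  assumes s: "s \<in> denoms \<S> A Y" and s': "s' \<in> denoms \<S> B Y"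
    and u: "u \<in> W \<leadsto> A" "v \<in> W \<leadsto> B" "s \<cdot> u = s' \<cdot> v" "s \<cdot> u \<in> cone_in \<T> \<S>"
    and u': "u' \<in> W' \<leadsto> A" "v' \<in> W' \<leadsto> B" "s \<cdot> u' = s' \<cdot> v'" "s \<cdot> u' \<in> cone_in \<T> \<S>"
  obtains V w w' where "w \<in> V \<leadsto> W" "w' \<in> V \<leadsto> W'" "u \<cdot> w = u' \<cdot> w'" "v \<cdot> w = v' \<cdot> w'"
    "s \<cdot> (u \<cdot> w) \<in> denoms \<S> V Y"
proof -
  have h: "s \<in> A \<leadsto> Y" "s' \<in> B \<leadsto> Y" using s s' by blast+
  have su: "s \<cdot> u \<in> denoms \<S> W Y" "s \<cdot> u' \<in> denoms \<S> W' Y"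
    using u u' comp_closed[OF u(1) h(1)] comp_closed[OF u'(1) h(1)] by blast+
  obtain V\<^sub>1 p q where p: "p \<in> V\<^sub>1 \<leadsto> W" "q \<in> V\<^sub>1 \<leadsto> W'" "s \<cdot> u \<cdot> p = s \<cdot> u' \<cdot> q" "s \<cdot> u \<cdot> p \<in> denoms \<S> V\<^sub>1 Y"
    using denoms_ore[OF su] .
  note up = comp_closed[OF p(1) u(1)] and uq = comp_closed[OF p(2) u'(1)]
    and vp = comp_closed[OF p(1) u(2)] and vq = comp_closed[OF p(2) u'(2)]
  have "s \<cdot> (u \<cdot> p) = s \<cdot> (u' \<cdot> q)" using p(3) comp_assoc[OF p(1) u(1) h(1)] comp_assoc[OF p(2) u'(1) h(1)] by simp
  then obtain V\<^sub>2 r where r: "r \<in> denoms \<S> V\<^sub>2 V\<^sub>1" "u \<cdot> p \<cdot> r = u' \<cdot> q \<cdot> r" using denoms_cancel[OF s up uq] by metis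
  then have rh: "r \<in> V\<^sub>2 \<leadsto> V\<^sub>1" by blast
  have "s' \<cdot> (v \<cdot> p) = s' \<cdot> (v' \<cdot> q)"
    using p(3) comp_assoc[OF p(1) u(2) h(2)] comp_assoc[OF p(2) u'(2) h(2)] u(3) u'(3) by simp
  then obtain V\<^sub>3 r' where r': "r' \<in> denoms \<S> V\<^sub>3 V\<^sub>1" "v \<cdot> p \<cdot> r' = v' \<cdot> q \<cdot> r'" using denoms_cancel[OF s' vp vq] by metis
  obtain V x y where x: "x \<in> V \<leadsto> V\<^sub>2" "r \<cdot> x = r' \<cdot> y" "y \<in> V \<leadsto> V\<^sub>3" "r \<cdot> x \<in> denoms \<S> V V\<^sub>1"
    using denoms_ore[OF r(1) r'(1)] by metis
  have rx: "r \<cdot> x \<in> V \<leadsto> V\<^sub>1" using x(4) by blast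
  have r'h: "r' \<in> V\<^sub>3 \<leadsto> V\<^sub>1" using r'(1) by blast
  have 1: "u \<cdot> (p \<cdot> (r \<cdot> x)) = u' \<cdot> (q \<cdot> (r \<cdot> x))"
    using comp_assoc[OF rx p(1) u(1)] comp_assoc[OF rx p(2) u'(1)] comp_assoc[OF x(1) rh up]
      comp_assoc[OF x(1) rh uq] r(2) by simp
  have 2: "v \<cdot> (p \<cdot> (r \<cdot> x)) = v' \<cdot> (q \<cdot> (r \<cdot> x))"
    using comp_assoc[OF rx p(1) u(2)] comp_assoc[OF rx p(2) u'(2)] comp_assoc[OF x(3) r'h vp]
      comp_assoc[OF x(3) r'h vq] r'(2) x(2) by simp
  have "s \<cdot> (u \<cdot> (p \<cdot> (r \<cdot> x))) = s \<cdot> u \<cdot> p \<cdot> (r \<cdot> x)"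
    using comp_assoc[OF comp_closed[OF rx p(1)] u(1) h(1)] comp_assoc[OF rx p(1), of "s \<cdot> u" Y] su(1) by simp
  then show thesis
    using that[OF comp_closed[OF rx p(1)] comp_closed[OF rx p(2)] 1 2] denoms_comp[OF x(4) p(4)] by simp
qed

end

text \<open>
  For a presheaf of sets with values \<open>D\<close> and restriction maps \<open>R\<close>, its localisation at \<open>Y\<close> is the
  colimit of the sets \<open>D X\<close> over the \<open>s: X \<rightarrow> Y\<close> in \<open>cone_in \<T> \<S>\<close>; \<open>lrel\<close> is equality of
  elements of this colimit. Both fractions and germs are instances.
\<close>

definition set_presheaf :: "('o \<Rightarrow> 'a set) \<Rightarrow> ('m \<Rightarrow> 'a \<Rightarrow> 'a) \<Rightarrow> bool" where
  "set_presheaf D R \<longleftrightarrow>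
    (\<forall>X Y. \<forall>f \<in> X \<leadsto> Y. \<forall>y \<in> D Y. R f y \<in> D X) \<and>
    (\<forall>X Y Z. \<forall>f \<in> X \<leadsto> Y. \<forall>g \<in> Y \<leadsto> Z. \<forall>z \<in> D Z. R (g \<cdot> f) z = R f (R g z)) \<and>
    (\<forall>X \<in> Obj \<T>. \<forall>x \<in> D X. R (Id \<T> X) x = x)"

definition lrel :: "'o set \<Rightarrow> ('m \<Rightarrow> 'a \<Rightarrow> 'a) \<Rightarrow> 'm \<Rightarrow> 'a \<Rightarrow> 'm \<Rightarrow> 'a \<Rightarrow> bool" where
  "lrel \<S> R s y s' y' \<longleftrightarrow> (\<exists>W. \<exists>u \<in> W \<leadsto> Dom \<T> s. \<exists>v \<in> W \<leadsto> Dom \<T> s'.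
    s \<cdot> u = s' \<cdot> v \<and> R u y = R v y' \<and> s \<cdot> u \<in> cone_in \<T> \<S>)"

lemma set_presheafD:
  assumes "set_presheaf D R"
  shows "f \<in> X \<leadsto> Y \<Longrightarrow> y \<in> D Y \<Longrightarrow> R f y \<in> D X"
    "f \<in> X \<leadsto> Y \<Longrightarrow> g \<in> Y \<leadsto> Z \<Longrightarrow> z \<in> D Z \<Longrightarrow> R (g \<cdot> f) z = R f (R g z)"
    "X \<in> Obj \<T> \<Longrightarrow> x \<in> D X \<Longrightarrow> R (Id \<T> X) x = x"
  using assms unfolding set_presheaf_def by blast+

lemma set_presheaf_hom: "set_presheaf (\<lambda>A. A \<leadsto> X) (\<lambda>u f. f \<cdot> u)"
  unfolding set_presheaf_def using comp_closed comp_assoc[symmetric] id_right by blast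

lemma lrelI:
  assumes "s \<in> A \<leadsto> Y" "s' \<in> B \<leadsto> Y" "u \<in> W \<leadsto> A" "v \<in> W \<leadsto> B" "s \<cdot> u = s' \<cdot> v" "s \<cdot> u \<in> cone_in \<T> \<S>"
    "R u y = R v y'"
  shows "lrel \<S> R s y s' y'"
  using assms homD(2)[OF assms(1)] homD(2)[OF assms(2)] unfolding lrel_def by blast

lemma lrelE:
  assumes "lrel \<S> R s y s' y'" "s \<in> A \<leadsto> Y" "s' \<in> B \<leadsto> Y"
  obtains W u v where "u \<in> W \<leadsto> A" "v \<in> W \<leadsto> B" "s \<cdot> u = s' \<cdot> v" "s \<cdot> u \<in> denoms \<S> W Y" "R u y = R v y'"
proof -
  obtain W u v where *: "u \<in> W \<leadsto> A" "v \<in> W \<leadsto> B" "s \<cdot> u = s' \<cdot> v" "s \<cdot> u \<in> cone_in \<T> \<S>" "R u y = R v y'"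
    using assms homD(2)[OF assms(2)] homD(2)[OF assms(3)] unfolding lrel_def by auto
  then show thesis using that comp_closed[OF *(1) assms(2)] by blast
qed

lemma lrel_mono: "\<S> \<subseteq> \<S>' \<Longrightarrow> lrel \<S> R s y s' y' \<Longrightarrow> lrel \<S>' R s y s' y'"
  unfolding lrel_def cone_in_def by blast

lemma lrel_sym: "lrel \<S> R s y s' y' \<Longrightarrow> lrel \<S> R s' y' s y"
  unfolding lrel_def by metis

context
  fixes \<S> D R assumes S: "\<S> \<in> Thick \<T>" and D: "set_presheaf D R"
begin

lemma lrel_refine:
  assumes s: "s \<in> A \<leadsto> Y" and u: "u \<in> W \<leadsto> A" "s \<cdot> u \<in> cone_in \<T> \<S>" and y: "y \<in> D A"
  shows "lrel \<S> R s y (s \<cdot> u) (R u y)"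
proof (rule lrelI[OF s comp_closed[OF u(1) s] u(1) id_closed[OF homD(4)[OF u(1)]] _ u(2)])
  show "s \<cdot> u = s \<cdot> u \<cdot> Id \<T> W" using id_right[OF comp_closed[OF u(1) s]] by simp
  show "R u y = R (Id \<T> W) (R u y)"
    using set_presheafD(3)[OF D homD(4)[OF u(1)] set_presheafD(1)[OF D u(1) y]] by simp
qed

lemma lrel_refl: "s \<in> denoms \<S> A Y \<Longrightarrow> lrel \<S> R s y s y"
  using lrelI[of s A Y s A "Id \<T> A" A "Id \<T> A" \<S> R y y] id_closed[of A] id_right[of s A Y] homD(4)[of s A Y]
  by auto

lemma lrel_trans:
  assumes s: "s \<in> A \<leadsto> Y" "s' \<in> denoms \<S> B Y" "s'' \<in> C \<leadsto> Y" and y: "y \<in> D A" "y' \<in> D B" "y'' \<in> D C"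
    and r: "lrel \<S> R s y s' y'" "lrel \<S> R s' y' s'' y''"
  shows "lrel \<S> R s y s'' y''"
proof -
  have s': "s' \<in> B \<leadsto> Y" using s(2) by blast
  obtain W u v where u: "u \<in> W \<leadsto> A" "v \<in> W \<leadsto> B" "s \<cdot> u = s' \<cdot> v" "s \<cdot> u \<in> denoms \<S> W Y" "R u y = R v y'"
    using lrelE[OF r(1) s(1) s'] .
  obtain W' u' v' where u': "u' \<in> W' \<leadsto> B" "v' \<in> W' \<leadsto> C" "s' \<cdot> u' = s'' \<cdot> v'" "s' \<cdot> u' \<in> denoms \<S> W' Y" "R u' y' = R v' y''"
    using lrelE[OF r(2) s' s(3)] .
  obtain V\<^sub>1 p q where p: "p \<in> V\<^sub>1 \<leadsto> W" "q \<in> V\<^sub>1 \<leadsto> W'" "s \<cdot> u \<cdot> p = s' \<cdot> u' \<cdot> q" "s \<cdot> u \<cdot> p \<in> denoms \<S> V\<^sub>1 Y"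
    using denoms_ore[OF S u(4) u'(4)] .
  note vp = comp_closed[OF p(1) u(2)] and uq = comp_closed[OF p(2) u'(1)]
  have "s' \<cdot> (v \<cdot> p) = s' \<cdot> (u' \<cdot> q)"
    using p(3) u(3) comp_assoc[OF p(1) u(2) s'] comp_assoc[OF p(2) u'(1) s'] by simp
  then obtain V r where r: "r \<in> denoms \<S> V V\<^sub>1" "v \<cdot> p \<cdot> r = u' \<cdot> q \<cdot> r" using denoms_cancel[OF S s(2) vp uq] by metis
  then have rh: "r \<in> V \<leadsto> V\<^sub>1" by blast
  note pr = comp_closed[OF rh p(1)] and qr = comp_closed[OF rh p(2)]
  have sur: "s \<cdot> (u \<cdot> (p \<cdot> r)) = s \<cdot> u \<cdot> p \<cdot> r"
    using comp_assoc[OF pr u(1) s(1)] comp_assoc[OF rh p(1) comp_closed[OF u(1) s(1)]] by simp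
  show ?thesis
  proof (rule lrelI[OF s(1,3) comp_closed[OF pr u(1)] comp_closed[OF qr u'(2)]])
    show "s \<cdot> (u \<cdot> (p \<cdot> r)) = s'' \<cdot> (v' \<cdot> (q \<cdot> r))"
      using sur p(3) comp_assoc[OF qr u'(2) s(3)] comp_assoc[OF rh p(2) comp_closed[OF u'(1) s']] u'(3) by simp
    show "s \<cdot> (u \<cdot> (p \<cdot> r)) \<in> cone_in \<T> \<S>" using sur denoms_comp[OF S r(1) p(4)] by simp
    show "R (u \<cdot> (p \<cdot> r)) y = R (v' \<cdot> (q \<cdot> r)) y''"
      using set_presheafD(2)[OF D pr u(1) y(1)] set_presheafD(2)[OF D qr u'(2) y(3)]
        set_presheafD(2)[OF D pr u(2) y(2)] set_presheafD(2)[OF D qr u'(1) y(2)] u(5) u'(5)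
        comp_assoc[OF rh p(1) u(2)] comp_assoc[OF rh p(2) u'(1)] r(2) by simp
  qed
qed

text \<open>Sums need one span that witnesses two relations at once, possibly for different
  presheaves; \<open>spans_common\<close> supplies it.\<close>

lemma lrel_pair:
  fixes D' R' assumes D': "set_presheaf D' R'"
    and s: "s \<in> denoms \<S> A Y" "s' \<in> denoms \<S> B Y"
    and y: "y \<in> D A" "y' \<in> D B" "lrel \<S> R s y s' y'"
    and z: "z \<in> D' A" "z' \<in> D' B" "lrel \<S> R' s z s' z'"
  obtains W u v where "u \<in> W \<leadsto> A" "v \<in> W \<leadsto> B" "s \<cdot> u = s' \<cdot> v" "s \<cdot> u \<in> denoms \<S> W Y"
    "R u y = R v y'" "R' u z = R' v z'"
proof -
  have sh: "s \<in> A \<leadsto> Y" "s' \<in> B \<leadsto> Y" using s by blast+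
  obtain W u v where u: "u \<in> W \<leadsto> A" "v \<in> W \<leadsto> B" "s \<cdot> u = s' \<cdot> v" "s \<cdot> u \<in> denoms \<S> W Y" "R u y = R v y'"
    using lrelE[OF y(3) sh] .
  obtain W' u' v' where u': "u' \<in> W' \<leadsto> A" "v' \<in> W' \<leadsto> B" "s \<cdot> u' = s' \<cdot> v'" "s \<cdot> u' \<in> denoms \<S> W' Y" "R' u' z = R' v' z'"
    using lrelE[OF z(3) sh] .
  obtain V w w' where w: "w \<in> V \<leadsto> W" "w' \<in> V \<leadsto> W'" "u \<cdot> w = u' \<cdot> w'" "v \<cdot> w = v' \<cdot> w'" "s \<cdot> (u \<cdot> w) \<in> denoms \<S> V Y"
    using spans_common[OF S s u(1-3) _ u'(1-3)] u(4) u'(4) by blast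
  show thesis
  proof (rule that[OF comp_closed[OF w(1) u(1)] comp_closed[OF w(1) u(2)] _ w(5)])
    show "s \<cdot> (u \<cdot> w) = s' \<cdot> (v \<cdot> w)" using comp_assoc[OF w(1) u(1) sh(1)] comp_assoc[OF w(1) u(2) sh(2)] u(3) by simp
    show "R (u \<cdot> w) y = R (v \<cdot> w) y'"
      using set_presheafD(2)[OF D w(1) u(1) y(1)] set_presheafD(2)[OF D w(1) u(2) y(2)] u(5) by simp
    show "R' (u \<cdot> w) z = R' (v \<cdot> w) z'"
      using set_presheafD(2)[OF D' w(2) u'(1) z(1)] set_presheafD(2)[OF D' w(2) u'(2) z(2)] u'(5) w(3,4) by simp
  qed
qed

text \<open>This yields well-definedness both of composition of fractions, with Hom into an object
  as presheaf, and of restriction of germs, with F as presheaf. The fraction, the element and the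
  completing square may all change simultaneously.\<close>

lemma lrel_pull:
  assumes t: "t \<in> denoms \<S> B X" "t' \<in> denoms \<S> B' X" "y \<in> D B" "y' \<in> D B'" "lrel \<S> R t y t' y'"
    and s: "s \<in> denoms \<S> A Y" "s' \<in> denoms \<S> A' Y" "f \<in> A \<leadsto> X" "f' \<in> A' \<leadsto> X"
      "lrel \<S> (\<lambda>u g. g \<cdot> u) s f s' f'"
    and u: "u \<in> denoms \<S> P A" "v \<in> P \<leadsto> B" "f \<cdot> u = t \<cdot> v"
    and u': "u' \<in> denoms \<S> P' A'" "v' \<in> P' \<leadsto> B'" "f' \<cdot> u' = t' \<cdot> v'"
  shows "lrel \<S> R (s \<cdot> u) (R v y) (s' \<cdot> u') (R v' y')"
proof -
  have h: "t \<in> B \<leadsto> X" "t' \<in> B' \<leadsto> X" "s \<in> A \<leadsto> Y" "s' \<in> A' \<leadsto> Y" "u \<in> P \<leadsto> A" "u' \<in> P' \<leadsto> A'"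
    using t s u u' by blast+
  obtain W a b where a: "a \<in> W \<leadsto> A" "b \<in> W \<leadsto> A'" "s \<cdot> a = s' \<cdot> b" "s \<cdot> a \<in> denoms \<S> W Y" "f \<cdot> a = f' \<cdot> b"
    using lrelE[OF s(5) h(3,4)] .
  obtain V c d where c: "c \<in> V \<leadsto> B" "d \<in> V \<leadsto> B'" "t \<cdot> c = t' \<cdot> d" "t \<cdot> c \<in> denoms \<S> V X" "R c y = R d y'"
    using lrelE[OF t(5) h(1,2)] .
  \<comment> \<open>Pulling back along both legs of W, the witness for the fractions, brings the two
    completing squares over one object \<open>Q\<^sub>1\<close>.\<close>
  obtain Q\<^sub>0 a\<^sub>1 u\<^sub>1 where q0: "u\<^sub>1 \<in> Q\<^sub>0 \<leadsto> P" "a\<^sub>1 \<in> denoms \<S> Q\<^sub>0 W" "u \<cdot> u\<^sub>1 = a \<cdot> a\<^sub>1"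
    using denoms_pullback[OF S u(1) a(1)] by metis
  have a1: "a\<^sub>1 \<in> Q\<^sub>0 \<leadsto> W" using q0 by blast
  note ba1 = comp_closed[OF a1 a(2)]
  obtain Q\<^sub>1 r u\<^sub>1' where q1: "u\<^sub>1' \<in> Q\<^sub>1 \<leadsto> P'" "r \<in> denoms \<S> Q\<^sub>1 Q\<^sub>0" "u' \<cdot> u\<^sub>1' = b \<cdot> a\<^sub>1 \<cdot> r"
    using denoms_pullback[OF S u'(1) ba1] by metis
  have r: "r \<in> Q\<^sub>1 \<leadsto> Q\<^sub>0" using q1 by blast
  define \<alpha> where "\<alpha> = u\<^sub>1 \<cdot> r"
  define \<omega> where "\<omega> = a\<^sub>1 \<cdot> r"
  have al: "\<alpha> \<in> Q\<^sub>1 \<leadsto> P" and om: "\<omega> \<in> Q\<^sub>1 \<leadsto> W" and omd: "\<omega> \<in> denoms \<S> Q\<^sub>1 W"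
    unfolding \<alpha>_def \<omega>_def using comp_closed[OF r q0(1)] comp_closed[OF r a1] denoms_comp[OF S q1(2) q0(2)] by auto
  have ua: "u \<cdot> \<alpha> = a \<cdot> \<omega>" unfolding \<alpha>_def \<omega>_def
    using comp_assoc[OF r q0(1) h(5)] comp_assoc[OF r a1 a(1)] q0(3) by simp
  have ub: "u' \<cdot> u\<^sub>1' = b \<cdot> \<omega>" unfolding \<omega>_def using comp_assoc[OF r a1 a(2)] q1(3) by simp
  note va = comp_closed[OF al u(2)] and vb = comp_closed[OF q1(1) u'(2)]
  have tv: "t \<cdot> (v \<cdot> \<alpha>) = t' \<cdot> (v' \<cdot> u\<^sub>1')"
    using comp_assoc[OF al u(2) h(1)] comp_assoc[OF al h(5) s(3)] comp_assoc[OF om a(1) s(3)]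
      comp_assoc[OF q1(1) u'(2) h(2)] comp_assoc[OF q1(1) h(6) s(4)] comp_assoc[OF om a(2) s(4)]
      u(3) u'(3) ua ub a(5) by simp
  \<comment> \<open>Next comes V, the witness for the elements. The morphisms to B and B' obtained
    from it agree with the earlier ones only after \<open>t\<close> and \<open>t'\<close>; the two
    cancellations below repair this.\<close>
  obtain Q\<^sub>2 r\<^sub>2 e where q2: "r\<^sub>2 \<in> denoms \<S> Q\<^sub>2 Q\<^sub>1" "e \<in> Q\<^sub>2 \<leadsto> V" "t \<cdot> c \<cdot> e = t \<cdot> (v \<cdot> \<alpha>) \<cdot> r\<^sub>2"
    using denoms_pullback[OF S c(4) comp_closed[OF va h(1)]] by metis
  have r2: "r\<^sub>2 \<in> Q\<^sub>2 \<leadsto> Q\<^sub>1" using q2 by blast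
  note ce = comp_closed[OF q2(2) c(1)] and de = comp_closed[OF q2(2) c(2)]
    and var = comp_closed[OF r2 va] and vbr = comp_closed[OF r2 vb]
  have 1: "t \<cdot> (c \<cdot> e) = t \<cdot> (v \<cdot> \<alpha> \<cdot> r\<^sub>2)"
    using q2(3) comp_assoc[OF q2(2) c(1) h(1)] comp_assoc[OF r2 va h(1)] by simp
  have "t' \<cdot> (d \<cdot> e) = t' \<cdot> (v' \<cdot> u\<^sub>1' \<cdot> r\<^sub>2)"
    using q2(3) comp_assoc[OF q2(2) c(2) h(2)] comp_assoc[OF r2 vb h(2)] c(3) tv by simp
  then obtain Q\<^sub>4 r\<^sub>4 where q4: "r\<^sub>4 \<in> denoms \<S> Q\<^sub>4 Q\<^sub>2" "d \<cdot> e \<cdot> r\<^sub>4 = v' \<cdot> u\<^sub>1' \<cdot> r\<^sub>2 \<cdot> r\<^sub>4"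
    using denoms_cancel[OF S t(2) de vbr] by metis
  obtain Q\<^sub>3 r\<^sub>3 where q3: "r\<^sub>3 \<in> denoms \<S> Q\<^sub>3 Q\<^sub>2" "c \<cdot> e \<cdot> r\<^sub>3 = v \<cdot> \<alpha> \<cdot> r\<^sub>2 \<cdot> r\<^sub>3"
    using denoms_cancel[OF S t(1) ce var 1] by metis
  obtain Q x z where q: "x \<in> Q \<leadsto> Q\<^sub>3" "z \<in> Q \<leadsto> Q\<^sub>4" "r\<^sub>3 \<cdot> x = r\<^sub>4 \<cdot> z" "r\<^sub>3 \<cdot> x \<in> denoms \<S> Q Q\<^sub>2"
    using denoms_ore[OF S q3(1) q4(1)] .
  have r34: "r\<^sub>3 \<in> Q\<^sub>3 \<leadsto> Q\<^sub>2" "r\<^sub>4 \<in> Q\<^sub>4 \<leadsto> Q\<^sub>2" "r\<^sub>3 \<cdot> x \<in> Q \<leadsto> Q\<^sub>2" using q3 q4 q by blast+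
  define \<rho> where "\<rho> = r\<^sub>3 \<cdot> x"
  have rho: "\<rho> \<in> Q \<leadsto> Q\<^sub>2" using r34(3) by (simp add: \<rho>_def)
  have cer: "c \<cdot> e \<cdot> \<rho> = v \<cdot> \<alpha> \<cdot> r\<^sub>2 \<cdot> \<rho>"
    unfolding \<rho>_def using comp_assoc[OF q(1) r34(1) ce] comp_assoc[OF q(1) r34(1) var] q3(2) by simp
  have der: "d \<cdot> e \<cdot> \<rho> = v' \<cdot> u\<^sub>1' \<cdot> r\<^sub>2 \<cdot> \<rho>"
    unfolding \<rho>_def q(3) using comp_assoc[OF q(2) r34(2) de] comp_assoc[OF q(2) r34(2) vbr] q4(2) by simp
  note rr = comp_closed[OF rho r2]
  note su = comp_closed[OF h(5,3)] and su' = comp_closed[OF h(6,4)]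
  have sua: "s \<cdot> u \<cdot> (\<alpha> \<cdot> (r\<^sub>2 \<cdot> \<rho>)) = s \<cdot> a \<cdot> (\<omega> \<cdot> (r\<^sub>2 \<cdot> \<rho>))"
    using comp_assoc[OF comp_closed[OF rr al] h(5,3)] comp_assoc[OF rr al h(5)] ua
      comp_assoc[OF comp_closed[OF rr om] a(1) h(3)] comp_assoc[OF rr om a(1)] by simp
  show ?thesis
  proof (rule lrelI[OF su su' comp_closed[OF rr al] comp_closed[OF rr q1(1)]])
    show "s \<cdot> u \<cdot> (\<alpha> \<cdot> (r\<^sub>2 \<cdot> \<rho>)) = s' \<cdot> u' \<cdot> (u\<^sub>1' \<cdot> (r\<^sub>2 \<cdot> \<rho>))"
      unfolding sua a(3)
      using comp_assoc[OF comp_closed[OF rr q1(1)] h(6,4)] comp_assoc[OF rr q1(1) h(6)] ub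
        comp_assoc[OF comp_closed[OF rr om] a(2) h(4)] comp_assoc[OF rr om a(2)] by simp
    have "r\<^sub>2 \<cdot> \<rho> \<in> denoms \<S> Q Q\<^sub>1" using denoms_comp[OF S q(4) q2(1)] by (simp add: \<rho>_def)
    from denoms_comp[OF S denoms_comp[OF S this omd] a(4)]
    show "s \<cdot> u \<cdot> (\<alpha> \<cdot> (r\<^sub>2 \<cdot> \<rho>)) \<in> cone_in \<T> \<S>" unfolding sua by blast
    have "R (\<alpha> \<cdot> (r\<^sub>2 \<cdot> \<rho>)) (R v y) = R (c \<cdot> e \<cdot> \<rho>) y"
      using set_presheafD(2)[OF D comp_closed[OF rr al] u(2) t(3)] comp_assoc[OF rr al u(2)]
        comp_assoc[OF rho r2 va] cer by simp
    moreover have "R (u\<^sub>1' \<cdot> (r\<^sub>2 \<cdot> \<rho>)) (R v' y') = R (d \<cdot> e \<cdot> \<rho>) y'"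
      using set_presheafD(2)[OF D comp_closed[OF rr q1(1)] u'(2) t(4)] comp_assoc[OF rr q1(1) u'(2)]
        comp_assoc[OF rho r2 vb] der by simp
    moreover have "R (c \<cdot> e \<cdot> \<rho>) y = R (d \<cdot> e \<cdot> \<rho>) y'"
      using comp_assoc[OF rho q2(2) c(1)] comp_assoc[OF rho q2(2) c(2)]
        set_presheafD(2)[OF D comp_closed[OF rho q2(2)] c(1) t(3)]
        set_presheafD(2)[OF D comp_closed[OF rho q2(2)] c(2) t(4)] c(5) by simp
    ultimately show "R (\<alpha> \<cdot> (r\<^sub>2 \<cdot> \<rho>)) (R v y) = R (u\<^sub>1' \<cdot> (r\<^sub>2 \<cdot> \<rho>)) (R v' y')" by simp
  qed
qed

end

end

section \<open>Cohomological functors and their localisations\<close>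

text \<open>Operations on classes are unions over representatives. Their well-definedness means that
  the union runs over copies of a single set, of which at least one is present.\<close>

lemma Union_eqI: "x \<in> A \<Longrightarrow> (\<And>x. x \<in> A \<Longrightarrow> x = E) \<Longrightarrow> \<Union>A = E"
  by blast

context triangulated_category
begin

abbreviation el :: "('o, 'm, 'g) presheaf \<Rightarrow> 'o \<Rightarrow> 'g set" where
  "el F X \<equiv> carrier (Val F X)"

section \<open>Values and restriction maps of cohomological functors\<close>

lemma
  assumes F: "cohomological \<T> F"
  shows val_group: "X \<in> Obj \<T> \<Longrightarrow> comm_group (Val F X)"
    and res_id: "x \<in> el F X \<Longrightarrow> X \<in> Obj \<T> \<Longrightarrow> Res F (Id \<T> X) x = x"
    and res_hom: "f \<in> X \<leadsto> Y \<Longrightarrow> Res F f \<in> hom (Val F Y) (Val F X)"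
    and res_closed: "f \<in> X \<leadsto> Y \<Longrightarrow> y \<in> el F Y \<Longrightarrow> Res F f y \<in> el F X"
    and res_mult: "f \<in> X \<leadsto> Y \<Longrightarrow> y \<in> el F Y \<Longrightarrow> y' \<in> el F Y \<Longrightarrow>
      Res F f (y \<otimes>\<^bsub>Val F Y\<^esub> y') = Res F f y \<otimes>\<^bsub>Val F X\<^esub> Res F f y'"
    and res_comp: "f \<in> X \<leadsto> Y \<Longrightarrow> g \<in> Y \<leadsto> Z \<Longrightarrow> z \<in> el F Z \<Longrightarrow> Res F (g \<cdot> f) z = Res F f (Res F g z)"
    and res_add: "f \<in> X \<leadsto> Y \<Longrightarrow> g \<in> X \<leadsto> Y \<Longrightarrow> y \<in> el F Y \<Longrightarrow>
      Res F (f \<^bold>+ g) y = Res F f y \<otimes>\<^bsub>Val F X\<^esub> Res F g y"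
proof -
  show 1: "f \<in> X \<leadsto> Y \<Longrightarrow> Res F f \<in> hom (Val F Y) (Val F X)"
    using F unfolding cohomological_def by simp
  then show "f \<in> X \<leadsto> Y \<Longrightarrow> y \<in> el F Y \<Longrightarrow> Res F f y \<in> el F X"
    "f \<in> X \<leadsto> Y \<Longrightarrow> y \<in> el F Y \<Longrightarrow> y' \<in> el F Y \<Longrightarrow>
      Res F f (y \<otimes>\<^bsub>Val F Y\<^esub> y') = Res F f y \<otimes>\<^bsub>Val F X\<^esub> Res F f y'"
    unfolding hom_def by blast+
  show "X \<in> Obj \<T> \<Longrightarrow> comm_group (Val F X)" "x \<in> el F X \<Longrightarrow> X \<in> Obj \<T> \<Longrightarrow> Res F (Id \<T> X) x = x"
    using F unfolding cohomological_def by simp_all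
  show "f \<in> X \<leadsto> Y \<Longrightarrow> g \<in> Y \<leadsto> Z \<Longrightarrow> z \<in> el F Z \<Longrightarrow> Res F (g \<cdot> f) z = Res F f (Res F g z)"
    using F unfolding cohomological_def by simp
  show "f \<in> X \<leadsto> Y \<Longrightarrow> g \<in> X \<leadsto> Y \<Longrightarrow> y \<in> el F Y \<Longrightarrow>
      Res F (f \<^bold>+ g) y = Res F f y \<otimes>\<^bsub>Val F X\<^esub> Res F g y"
    using F unfolding cohomological_def by simp
qed

lemma res_one:
  assumes F: "cohomological \<T> F" and f: "f \<in> X \<leadsto> Y"
  shows "Res F f \<one>\<^bsub>Val F Y\<^esub> = \<one>\<^bsub>Val F X\<^esub>"
  using hom_one[OF res_hom[OF F f]] val_group[OF F homD(4)[OF f]] val_group[OF F homD(5)[OF f]]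
  by (simp add: comm_group_def)

lemma res_inv:
  assumes F: "cohomological \<T> F" and f: "f \<in> X \<leadsto> Y" and y: "y \<in> el F Y"
  shows "Res F f (inv\<^bsub>Val F Y\<^esub> y) = inv\<^bsub>Val F X\<^esub> (Res F f y)"
proof -
  interpret group_hom "Val F Y" "Val F X" "Res F f"
    using res_hom[OF F f] val_group[OF F homD(4)[OF f]] val_group[OF F homD(5)[OF f]]
    by (simp add: comm_group_def group_hom_def group_hom_axioms_def)
  show ?thesis using hom_inv[OF y] .
qed

lemma res_zero:
  assumes F: "cohomological \<T> F" and o: "X \<in> Obj \<T>" "Y \<in> Obj \<T>" and y: "y \<in> el F Y"
  shows "Res F (Zero \<T> X Y) y = \<one>\<^bsub>Val F X\<^esub>"
proof -
  interpret comm_group "Val F X" by (rule val_group[OF F o(1)])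
  note z = zero_closed[OF o]
  have "Res F (Zero \<T> X Y) y \<otimes>\<^bsub>Val F X\<^esub> Res F (Zero \<T> X Y) y = Res F (Zero \<T> X Y) y"
    using res_add[OF F z z y] zero_add[OF z] by simp
  then show ?thesis using r_cancel_one[OF res_closed[OF F z y] res_closed[OF F z y]] by simp
qed

lemma res_exact:
  assumes F: "cohomological \<T> F" and t: "tri X f Y g Z h" and y: "y \<in> el F Y" "Res F f y = \<one>\<^bsub>Val F X\<^esub>"
  obtains z where "z \<in> el F Z" "Res F g z = y"
proof -
  have "y \<in> kernel (Val F (Cod \<T> f)) (Val F (Dom \<T> f)) (Res F f)"
    using y tri_dom_cod[OF t] by (simp add: kernel_def)
  then have "y \<in> Res F g ` carrier (Val F (Cod \<T> g))"
    using F triD(1)[OF t] unfolding cohomological_def by blast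
  then show thesis using that tri_dom_cod[OF t] by auto
qed

lemma res_comp_one:
  assumes F: "cohomological \<T> F" and t: "tri X f Y g Z h" and z: "z \<in> el F Z"
  shows "Res F f (Res F g z) = \<one>\<^bsub>Val F X\<^esub>"
  using res_comp[OF F triD(2,3)[OF t] z] tri_comp_zero(1)[OF t] res_zero[OF F triD(5,7)[OF t] z] by simp

lemma set_presheaf_res: "cohomological \<T> F \<Longrightarrow> set_presheaf (el F) (Res F)"
  unfolding set_presheaf_def by (simp add: res_closed res_comp res_id)

subsection \<open>Fractions\<close>

abbreviation precomp :: "'m \<Rightarrow> 'm \<Rightarrow> 'm" where "precomp \<equiv> \<lambda>u f. f \<cdot> u"

context
  fixes \<S> assumes S: "\<S> \<in> Thick \<T>"
begin

abbreviation "quot \<equiv> verdier_quotient \<T> \<S>"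

lemma fractions_iff: "(s, f) \<in> fractions \<T> \<S> \<longleftrightarrow> (\<exists>A X Y. s \<in> denoms \<S> A Y \<and> f \<in> A \<leadsto> X)"
proof
  assume "(s, f) \<in> fractions \<T> \<S>"
  then have "s \<in> cone_in \<T> \<S>" "f \<in> Arr \<T>" "Dom \<T> s = Dom \<T> f" unfolding fractions_def by simp_all
  then show "\<exists>A X Y. s \<in> denoms \<S> A Y \<and> f \<in> A \<leadsto> X" using cone_in_denoms[of s \<S>] arr_hom[of f] by auto
qed (auto simp: fractions_def Hom_def)

lemma frac_mem:
  assumes s: "s \<in> denoms \<S> A Y" and f: "f \<in> A \<leadsto> X"
  shows "(s', f') \<in> frac \<T> \<S> s f \<longleftrightarrow>
    (\<exists>B. s' \<in> denoms \<S> B Y \<and> f' \<in> B \<leadsto> X \<and> lrel \<S> precomp s f s' f')" (is "_ \<longleftrightarrow> ?R")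
proof -
  have d: "Dom \<T> s = A" "Cod \<T> s = Y" "Cod \<T> f = X" using s f homD(2,3) by blast+
  have sf: "(s, f) \<in> fractions \<T> \<S>" using s f fractions_iff by blast
  show ?thesis
  proof
    assume "(s', f') \<in> frac \<T> \<S> s f"
    then have *: "(s', f') \<in> fractions \<T> \<S>" "Y = Cod \<T> s'" "X = Cod \<T> f'" "lrel \<S> precomp s f s' f'"
      unfolding frac_def frac_equiv_def lrel_def by (simp_all add: d)
    obtain B X' Y' where B: "s' \<in> denoms \<S> B Y'" "f' \<in> B \<leadsto> X'" using *(1) fractions_iff by blast
    then have "Y' = Y" "X' = X" using *(2,3) homD(3) by blast+
    then show ?R using B *(4) by blast
  next
    assume ?R
    then obtain B where B: "s' \<in> denoms \<S> B Y" "f' \<in> B \<leadsto> X" "lrel \<S> precomp s f s' f'" by blast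
    then have "(s', f') \<in> fractions \<T> \<S>" "Cod \<T> s' = Y" "Cod \<T> f' = X" using fractions_iff homD(3) by blast+
    then show "(s', f') \<in> frac \<T> \<S> s f"
      using B(3) sf unfolding frac_def frac_equiv_def lrel_def by (simp add: d)
  qed
qed

lemma frac_self: "s \<in> denoms \<S> A Y \<Longrightarrow> f \<in> A \<leadsto> X \<Longrightarrow> (s, f) \<in> frac \<T> \<S> s f"
  using frac_mem lrel_refl[OF S set_presheaf_hom] by blast

lemma frac_eqI:
  assumes s: "s \<in> denoms \<S> A Y" "f \<in> A \<leadsto> X" and s': "s' \<in> denoms \<S> B Y" "f' \<in> B \<leadsto> X"
    and r: "lrel \<S> precomp s f s' f'"
  shows "frac \<T> \<S> s f = frac \<T> \<S> s' f'"
proof -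
  have tr: "lrel \<S> precomp a k c m" if "a \<in> denoms \<S> A Y" "k \<in> A \<leadsto> X" "b \<in> denoms \<S> B Y" "l \<in> B \<leadsto> X"
    "c \<in> denoms \<S> E Y" "m \<in> E \<leadsto> X" "lrel \<S> precomp a k b l" "lrel \<S> precomp b l c m" for A B E a b c k l m
    using lrel_trans[OF S set_presheaf_hom _ that(3) _ that(2,4,6,7,8)] that by blast
  have "(a, k) \<in> frac \<T> \<S> s f \<longleftrightarrow> (a, k) \<in> frac \<T> \<S> s' f'" for a k
    unfolding frac_mem[OF s] frac_mem[OF s'] using tr[OF s' s] tr[OF s s'] r lrel_sym[OF r] by blast
  then show ?thesis by auto
qed

lemma quot_dom_cod:
  assumes s: "s \<in> denoms \<S> A Y" "f \<in> A \<leadsto> X"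
  shows "Dom quot (frac \<T> \<S> s f) = Y" "Cod quot (frac \<T> \<S> s f) = X"
proof -
  have *: "Cod \<T> s' = Y" "Cod \<T> f' = X" if "(s', f') \<in> frac \<T> \<S> s f" for s' f'
    using that frac_mem[OF s] homD(3) by blast+
  show "Dom quot (frac \<T> \<S> s f) = Y"
    unfolding verdier_quotient_def using frac_self[OF s] *(1)
    by (simp, intro the_equality bexI[of _ "(s, f)"]) auto
  show "Cod quot (frac \<T> \<S> s f) = X"
    unfolding verdier_quotient_def using frac_self[OF s] *(2)
    by (simp, intro the_equality bexI[of _ "(s, f)"]) auto
qed

lemma quot_hom_iff:
  "\<phi> \<in> Hom quot Y X \<longleftrightarrow> (\<exists>A s f. s \<in> denoms \<S> A Y \<and> f \<in> A \<leadsto> X \<and> \<phi> = frac \<T> \<S> s f)"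
proof -
  have "\<phi> \<in> Arr quot \<longleftrightarrow> (\<exists>s f. (s, f) \<in> fractions \<T> \<S> \<and> \<phi> = frac \<T> \<S> s f)"
    unfolding verdier_quotient_def frac_def quotient_def by auto
  note arr = this
  show ?thesis
  proof
    assume "\<phi> \<in> Hom quot Y X"
    then have \<phi>: "\<phi> \<in> Arr quot" "Dom quot \<phi> = Y" "Cod quot \<phi> = X" unfolding Hom_def[of quot] by simp_all
    obtain s f where s: "(s, f) \<in> fractions \<T> \<S>" "\<phi> = frac \<T> \<S> s f" using \<phi>(1) arr by blast
    obtain A X' Y' where A: "s \<in> denoms \<S> A Y'" "f \<in> A \<leadsto> X'" using s(1) fractions_iff by blast
    have "Y' = Y" "X' = X" using quot_dom_cod[OF A] s(2) \<phi>(2,3) by simp_all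
    then show "\<exists>A s f. s \<in> denoms \<S> A Y \<and> f \<in> A \<leadsto> X \<and> \<phi> = frac \<T> \<S> s f" using A s(2) by blast
  next
    assume "\<exists>A s f. s \<in> denoms \<S> A Y \<and> f \<in> A \<leadsto> X \<and> \<phi> = frac \<T> \<S> s f"
    then obtain A s f where A: "s \<in> denoms \<S> A Y" "f \<in> A \<leadsto> X" "\<phi> = frac \<T> \<S> s f" by blast
    have "\<phi> \<in> Arr quot" using arr A fractions_iff by blast
    then show "\<phi> \<in> Hom quot Y X" unfolding Hom_def[of quot] using quot_dom_cod[OF A(1,2)] A(3) by simp
  qed
qed

lemma quot_comp:
  assumes s: "s \<in> denoms \<S> A Y" "f \<in> A \<leadsto> X" and t: "t \<in> denoms \<S> B X" "g \<in> B \<leadsto> Z"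
    and u: "u \<in> denoms \<S> P A" "v \<in> P \<leadsto> B" "f \<cdot> u = t \<cdot> v"
  shows "Comp quot (frac \<T> \<S> t g) (frac \<T> \<S> s f) = frac \<T> \<S> (s \<cdot> u) (g \<cdot> v)"
proof -
  have "Comp quot (frac \<T> \<S> t g) (frac \<T> \<S> s f) = \<Union>{frac \<T> \<S> (Comp \<T> s' u) (Comp \<T> g' v) | s' f' t' g' u v.
        (s', f') \<in> frac \<T> \<S> s f \<and> (t', g') \<in> frac \<T> \<S> t g \<and> u \<in> cone_in \<T> \<S> \<and> v \<in> Arr \<T> \<and>
        Cod \<T> u = Dom \<T> f' \<and> Cod \<T> v = Dom \<T> t' \<and> Dom \<T> u = Dom \<T> v \<and> Comp \<T> f' u = Comp \<T> t' v}"
    by (simp add: verdier_quotient_def)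
  also have "\<dots> = frac \<T> \<S> (s \<cdot> u) (g \<cdot> v)"
  proof (rule Union_eqI)
    have "u \<in> cone_in \<T> \<S>" "v \<in> Arr \<T>" "Cod \<T> u = Dom \<T> f" "Cod \<T> v = Dom \<T> t" "Dom \<T> u = Dom \<T> v"
      using u s t unfolding Hom_def by auto
    then show "frac \<T> \<S> (s \<cdot> u) (g \<cdot> v) \<in> {frac \<T> \<S> (Comp \<T> s' u) (Comp \<T> g' v) | s' f' t' g' u v.
        (s', f') \<in> frac \<T> \<S> s f \<and> (t', g') \<in> frac \<T> \<S> t g \<and> u \<in> cone_in \<T> \<S> \<and> v \<in> Arr \<T> \<and>
        Cod \<T> u = Dom \<T> f' \<and> Cod \<T> v = Dom \<T> t' \<and> Dom \<T> u = Dom \<T> v \<and> Comp \<T> f' u = Comp \<T> t' v}"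
      using frac_self[OF s] frac_self[OF t] u(3) by blast
  next
    fix z assume "z \<in> {frac \<T> \<S> (Comp \<T> s' u) (Comp \<T> g' v) | s' f' t' g' u v.
        (s', f') \<in> frac \<T> \<S> s f \<and> (t', g') \<in> frac \<T> \<S> t g \<and> u \<in> cone_in \<T> \<S> \<and> v \<in> Arr \<T> \<and>
        Cod \<T> u = Dom \<T> f' \<and> Cod \<T> v = Dom \<T> t' \<and> Dom \<T> u = Dom \<T> v \<and> Comp \<T> f' u = Comp \<T> t' v}"
    then obtain s' f' t' g' u' v' where z: "z = frac \<T> \<S> (s' \<cdot> u') (g' \<cdot> v')"
      and sf: "(s', f') \<in> frac \<T> \<S> s f" and tg: "(t', g') \<in> frac \<T> \<S> t g"
      and u': "u' \<in> cone_in \<T> \<S>" "v' \<in> Arr \<T>" "Cod \<T> u' = Dom \<T> f'" "Cod \<T> v' = Dom \<T> t'" "Dom \<T> u' = Dom \<T> v'"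
        "f' \<cdot> u' = t' \<cdot> v'" by blast
    obtain A' where A': "s' \<in> denoms \<S> A' Y" "f' \<in> A' \<leadsto> X" "lrel \<S> precomp s f s' f'" using sf frac_mem[OF s] by blast
    obtain B' where B': "t' \<in> denoms \<S> B' X" "g' \<in> B' \<leadsto> Z" "lrel \<S> precomp t g t' g'" using tg frac_mem[OF t] by blast
    have d: "Dom \<T> f' = A'" "Dom \<T> t' = B'" using A' B' homD(2) by blast+
    have u'd: "u' \<in> denoms \<S> (Dom \<T> u') A'" using cone_in_denoms[OF u'(1)] u'(3) d(1) by simp
    have v'h: "v' \<in> Dom \<T> u' \<leadsto> B'" using arr_hom[OF u'(2)] u'(4,5) d(2) by simp
    have "lrel \<S> precomp (s \<cdot> u) (g \<cdot> v) (s' \<cdot> u') (g' \<cdot> v')"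
      using lrel_pull[OF S set_presheaf_hom t(1) B'(1) t(2) B'(2,3) s(1) A'(1) s(2) A'(2,3) u u'd v'h u'(6)] .
    then have "frac \<T> \<S> (s \<cdot> u) (g \<cdot> v) = frac \<T> \<S> (s' \<cdot> u') (g' \<cdot> v')"
      by (rule frac_eqI[OF denoms_comp[OF S u(1) s(1)] comp_closed[OF u(2) t(2)]
            denoms_comp[OF S u'd A'(1)] comp_closed[OF v'h B'(2)]])
    then show "z = frac \<T> \<S> (s \<cdot> u) (g \<cdot> v)" using z by simp
  qed
  finally show ?thesis .
qed

lemma quot_add:
  assumes s: "s \<in> denoms \<S> A Y" and f: "f \<in> A \<leadsto> X" and g: "g \<in> A \<leadsto> X"
  shows "Add quot (frac \<T> \<S> s f) (frac \<T> \<S> s g) = frac \<T> \<S> s (f \<^bold>+ g)"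
proof -
  have "Add quot (frac \<T> \<S> s f) (frac \<T> \<S> s g) =
      \<Union>{frac \<T> \<S> s' (f' \<^bold>+ g') | s' f' g'. (s', f') \<in> frac \<T> \<S> s f \<and> (s', g') \<in> frac \<T> \<S> s g}"
    by (simp add: verdier_quotient_def)
  also have "\<dots> = frac \<T> \<S> s (f \<^bold>+ g)"
  proof (rule Union_eqI)
    show "frac \<T> \<S> s (f \<^bold>+ g) \<in> {frac \<T> \<S> s' (f' \<^bold>+ g') | s' f' g'. (s', f') \<in> frac \<T> \<S> s f \<and> (s', g') \<in> frac \<T> \<S> s g}"
      using frac_self[OF s f] frac_self[OF s g] by blast
  next
    fix z assume "z \<in> {frac \<T> \<S> s' (f' \<^bold>+ g') | s' f' g'. (s', f') \<in> frac \<T> \<S> s f \<and> (s', g') \<in> frac \<T> \<S> s g}"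
    then obtain s' f' g' where z: "z = frac \<T> \<S> s' (f' \<^bold>+ g')"
      and sf: "(s', f') \<in> frac \<T> \<S> s f" and sg: "(s', g') \<in> frac \<T> \<S> s g" by blast
    obtain A' where A': "s' \<in> denoms \<S> A' Y" "f' \<in> A' \<leadsto> X" "lrel \<S> precomp s f s' f'" using sf frac_mem[OF s f] by blast
    obtain A'' where A'': "s' \<in> denoms \<S> A'' Y" "g' \<in> A'' \<leadsto> X" "lrel \<S> precomp s g s' g'" using sg frac_mem[OF s g] by blast
    have "A'' = A'" using A'(1) A''(1) homD(2) by blast
    then have g': "g' \<in> A' \<leadsto> X" using A'' by blast
    have h: "s \<in> A \<leadsto> Y" "s' \<in> A' \<leadsto> Y" using s A' by blast+
    obtain W u v where w: "u \<in> W \<leadsto> A" "v \<in> W \<leadsto> A'" "s \<cdot> u = s' \<cdot> v" "s \<cdot> u \<in> denoms \<S> W Y"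
        "f \<cdot> u = f' \<cdot> v" "g \<cdot> u = g' \<cdot> v"
      using lrel_pair[OF S set_presheaf_hom set_presheaf_hom s A'(1) f A'(2,3) g g' A''(3)] by metis
    have "lrel \<S> precomp s (f \<^bold>+ g) s' (f' \<^bold>+ g')"
      using lrelI[OF h w(1-3), of \<S> precomp] w(4-6) comp_add_left[OF w(1) f g] comp_add_left[OF w(2) A'(2) g'] by auto
    then show "z = frac \<T> \<S> s (f \<^bold>+ g)"
      using frac_eqI[OF s add_closed[OF f g] A'(1) add_closed[OF A'(2) g']] z by simp
  qed
  finally show ?thesis .
qed

lemma quot_comp_left:
  assumes s: "s \<in> denoms \<S> A Y" "f \<in> A \<leadsto> X" and g: "g \<in> X \<leadsto> Z"
  shows "Comp quot (quotient_arr \<T> \<S> g) (frac \<T> \<S> s f) = frac \<T> \<S> s (g \<cdot> f)"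
proof -
  have o: "A \<in> Obj \<T>" "X \<in> Obj \<T>" using homD(4,5)[OF s(2)] .
  have "s \<in> A \<leadsto> Y" using s by blast
  then show ?thesis
    using quot_comp[OF s denoms_id[OF S o(2)] g denoms_id[OF S o(1)] s(2)] id_left[OF s(2)] id_right[OF s(2)]
      id_right[of s A Y] homD(2)[OF g] by (simp add: quotient_arr_def)
qed

lemma quot_comp_right:
  assumes f: "f \<in> Y' \<leadsto> Y" and s: "s \<in> denoms \<S> A Y" "g \<in> A \<leadsto> X"
    and s': "s' \<in> denoms \<S> A' Y'" "f' \<in> A' \<leadsto> A" "s \<cdot> f' = f \<cdot> s'"
  shows "Comp quot (frac \<T> \<S> s g) (quotient_arr \<T> \<S> f) = frac \<T> \<S> s' (g \<cdot> f')"
proof -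
  have "s' \<in> A' \<leadsto> Y'" using s' by blast
  then show ?thesis
    using quot_comp[OF denoms_id[OF S homD(4)[OF f]] f s s'(1,2) s'(3)[symmetric]] id_left[of s' A' Y'] homD(2)[OF f]
    by (simp add: quotient_arr_def)
qed

subsection \<open>Germs\<close>

context
  fixes F :: "('o, 'm, 'g) presheaf" assumes F: "cohomological \<T> F"
begin

lemma lrel_eval:
  assumes s: "s \<in> A \<leadsto> Y" "f \<in> A \<leadsto> X" and s': "s' \<in> B \<leadsto> Y" "f' \<in> B \<leadsto> X"
    and r: "lrel \<S> precomp s f s' f'" and x: "x \<in> el F X"
  shows "lrel \<S> (Res F) s (Res F f x) s' (Res F f' x)"
proof -
  obtain W u v where w: "u \<in> W \<leadsto> A" "v \<in> W \<leadsto> B" "s \<cdot> u = s' \<cdot> v" "s \<cdot> u \<in> denoms \<S> W Y" "f \<cdot> u = f' \<cdot> v"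
    using lrelE[OF r s(1) s'(1)] by metis
  show ?thesis
    using lrelI[OF s(1) s'(1) w(1-3), of \<S> "Res F"] w(4,5) res_comp[OF F w(1) s(2) x] res_comp[OF F w(2) s'(2) x]
    by simp
qed

lemma lrelF_trans:
  assumes "s \<in> denoms \<S> A Y" "s' \<in> denoms \<S> B Y" "s'' \<in> denoms \<S> C Y" "y \<in> el F A" "y' \<in> el F B" "y'' \<in> el F C"
    "lrel \<S> (Res F) s y s' y'" "lrel \<S> (Res F) s' y' s'' y''"
  shows "lrel \<S> (Res F) s y s'' y''"
  using lrel_trans[OF S set_presheaf_res[OF F] _ assms(2) _ assms(4-8)] assms(1,3) by blast

text \<open>All pairs \<open>(s', y')\<close> that represent the same element of the colimit over
  denominators as the given triple. This is constant along \<open>elem_step\<close>, hence along the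
  equivalence relation it generates, and so makes different germs distinguishable.\<close>

definition key :: "'o \<Rightarrow> 'o \<times> 'g \<times> ('m \<times> 'm) set \<Rightarrow> ('m \<times> 'g) set" where
  "key Y = (\<lambda>(X, x, \<phi>). {(s', y'). \<exists>A'. s' \<in> denoms \<S> A' Y \<and> y' \<in> el F A' \<and>
    (\<exists>(s, f) \<in> \<phi>. lrel \<S> (Res F) s (Res F f x) s' y')})"

lemma key_frac:
  assumes s: "s \<in> denoms \<S> A Y" "f \<in> A \<leadsto> X" and x: "x \<in> el F X"
  shows "key Y (X, x, frac \<T> \<S> s f) =
    {(s', y'). \<exists>A'. s' \<in> denoms \<S> A' Y \<and> y' \<in> el F A' \<and> lrel \<S> (Res F) s (Res F f x) s' y'}"
proof -
  have "lrel \<S> (Res F) s (Res F f x) s' y'"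
    if 1: "s' \<in> denoms \<S> A' Y" "y' \<in> el F A'" "(a, k) \<in> frac \<T> \<S> s f" "lrel \<S> (Res F) a (Res F k x) s' y'" for A' s' y' a k
  proof -
    obtain B where B: "a \<in> denoms \<S> B Y" "k \<in> B \<leadsto> X" "lrel \<S> precomp s f a k" using 1(3) frac_mem[OF s] by blast
    have "lrel \<S> (Res F) s (Res F f x) a (Res F k x)" using lrel_eval[OF _ s(2) _ B(2,3) x] s B by blast
    then show ?thesis
      using lrelF_trans[OF s(1) B(1) 1(1) res_closed[OF F s(2) x] res_closed[OF F B(2) x] 1(2)] 1(4) by blast
  qed
  then show ?thesis unfolding key_def using frac_self[OF s] by fastforce
qed

abbreviation "germ_rel Y \<equiv> (elem_step \<T> \<S> F Y \<union> (elem_step \<T> \<S> F Y)\<inverse>)\<^sup>*"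

lemma elem_triples_iff:
  "(X, x, \<phi>) \<in> elem_triples \<T> \<S> F Y \<longleftrightarrow>
    x \<in> el F X \<and> (\<exists>A s f. s \<in> denoms \<S> A Y \<and> f \<in> A \<leadsto> X \<and> \<phi> = frac \<T> \<S> s f)"
proof -
  define E where "E \<longleftrightarrow> (\<exists>A s f. s \<in> denoms \<S> A Y \<and> f \<in> A \<leadsto> X \<and> \<phi> = frac \<T> \<S> s f)"
  have "E \<Longrightarrow> X \<in> Obj \<T>" unfolding E_def by (elim exE conjE, rule homD(5))
  then show ?thesis unfolding elem_triples_def quot_hom_iff mem_Collect_eq prod.case E_def[symmetric] by blast
qed

lemma elem_triplesI:
  "s \<in> denoms \<S> A Y \<Longrightarrow> f \<in> A \<leadsto> X \<Longrightarrow> x \<in> el F X \<Longrightarrow> (X, x, frac \<T> \<S> s f) \<in> elem_triples \<T> \<S> F Y"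
  unfolding elem_triples_iff by blast

lemma elem_step_iff:
  "(t, t') \<in> elem_step \<T> \<S> F Y \<longleftrightarrow> (\<exists>X X' f x' A s g. f \<in> X \<leadsto> X' \<and> x' \<in> el F X' \<and> s \<in> denoms \<S> A Y \<and>
    g \<in> A \<leadsto> X \<and> t = (X, Res F f x', frac \<T> \<S> s g) \<and> t' = (X', x', frac \<T> \<S> s (f \<cdot> g)))" (is "_ \<longleftrightarrow> ?R")
proof
  assume "(t, t') \<in> elem_step \<T> \<S> F Y"
  then obtain X X' f x' \<phi> where f: "f \<in> X \<leadsto> X'" "x' \<in> el F X'" "\<phi> \<in> Hom quot Y X"
    and t: "t = (X, Res F f x', \<phi>)" "t' = (X', x', Comp quot (quotient_arr \<T> \<S> f) \<phi>)"
    unfolding elem_step_def mem_Collect_eq prod.inject by metis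
  obtain A s g where s: "s \<in> denoms \<S> A Y" "g \<in> A \<leadsto> X" "\<phi> = frac \<T> \<S> s g"
    using f(3) unfolding quot_hom_iff by (elim exE conjE)
  have "Comp quot (quotient_arr \<T> \<S> f) \<phi> = frac \<T> \<S> s (f \<cdot> g)" using quot_comp_left[OF s(1,2) f(1)] s(3) by simp
  then show ?R using f(1,2) s t by blast
next
  assume ?R
  then obtain X X' f x' A s g where f: "f \<in> X \<leadsto> X'" "x' \<in> el F X'" "s \<in> denoms \<S> A Y"
    "g \<in> A \<leadsto> X" "t = (X, Res F f x', frac \<T> \<S> s g)" "t' = (X', x', frac \<T> \<S> s (f \<cdot> g))" by blast
  moreover have "frac \<T> \<S> s g \<in> Hom quot Y X" using f quot_hom_iff by blast
  ultimately show "(t, t') \<in> elem_step \<T> \<S> F Y"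
    using quot_comp_left[OF f(3,4,1), symmetric] unfolding elem_step_def by blast
qed

lemma elem_step_inv:
  assumes "(t, t') \<in> elem_step \<T> \<S> F Y"
  shows "key Y t = key Y t'" "t \<in> elem_triples \<T> \<S> F Y" "t' \<in> elem_triples \<T> \<S> F Y"
proof -
  obtain X X' f x' A s g where f: "f \<in> X \<leadsto> X'" "x' \<in> el F X'" "s \<in> denoms \<S> A Y"
    "g \<in> A \<leadsto> X" "t = (X, Res F f x', frac \<T> \<S> s g)" "t' = (X', x', frac \<T> \<S> s (f \<cdot> g))"
    using assms elem_step_iff by blast
  note fg = comp_closed[OF f(4,1)] and x = res_closed[OF F f(1,2)]
  show "key Y t = key Y t'"
    unfolding f(5,6) key_frac[OF f(3,4) x] key_frac[OF f(3) fg f(2)] using res_comp[OF F f(4,1,2)] by simp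
  show "t \<in> elem_triples \<T> \<S> F Y" "t' \<in> elem_triples \<T> \<S> F Y"
    unfolding f(5,6) using elem_triplesI[OF f(3,4) x] elem_triplesI[OF f(3) fg f(2)] .
qed

lemma germ_rel_inv:
  assumes "(t, t') \<in> germ_rel Y"
  shows "key Y t = key Y t'" "t \<in> elem_triples \<T> \<S> F Y \<Longrightarrow> t' \<in> elem_triples \<T> \<S> F Y"
  using assms by (induction rule: rtrancl_induct) (auto dest: elem_step_inv)

lemma germ_rel_sym: "(t, t') \<in> germ_rel Y \<Longrightarrow> (t', t) \<in> germ_rel Y"
  using sym_rtrancl[of "elem_step \<T> \<S> F Y \<union> (elem_step \<T> \<S> F Y)\<inverse>"] by (auto simp: sym_Un_converse dest: symD)

lemma germ_mem: "t' \<in> germ \<T> \<S> F Y t \<longleftrightarrow> (t, t') \<in> germ_rel Y"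
  unfolding germ_def by simp

lemma germ_eqI: "(t, t') \<in> germ_rel Y \<Longrightarrow> germ \<T> \<S> F Y t = germ \<T> \<S> F Y t'"
  using germ_rel_sym[of t t' Y] unfolding germ_def by (metis (no_types, lifting) Image_singleton_iff rtrancl_trans subset_antisym subsetI)

text \<open>The germ of an element \<open>y\<close> of \<open>F A\<close> over a denominator
  \<open>s\<close> from A to Y, with A and Y read off from \<open>s\<close>. Every germ has this
  form; these representatives identify the colimit over the category of elements with the colimit
  over denominators.\<close>

definition lg :: "'m \<Rightarrow> 'g \<Rightarrow> ('o, 'm, 'g) germ" where
  "lg s y = germ \<T> \<S> F (Cod \<T> s) (Dom \<T> s, y, frac \<T> \<S> s (Id \<T> (Dom \<T> s)))"

lemma lg_eq: "s \<in> denoms \<S> A Y \<Longrightarrow> lg s y = germ \<T> \<S> F Y (A, y, frac \<T> \<S> s (Id \<T> A))"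
  unfolding lg_def using homD(2,3)[of s A Y] by auto

lemma germ_lg:
  assumes s: "s \<in> denoms \<S> A Y" "f \<in> A \<leadsto> X" and x: "x \<in> el F X"
  shows "germ \<T> \<S> F Y (X, x, frac \<T> \<S> s f) = lg s (Res F f x)"
proof -
  have "((A, Res F f x, frac \<T> \<S> s (Id \<T> A)), (X, x, frac \<T> \<S> s f)) \<in> elem_step \<T> \<S> F Y"
    unfolding elem_step_iff using s x id_closed[OF homD(4)[OF s(2)]] id_right[OF s(2)] by metis
  then show ?thesis unfolding lg_eq[OF s(1)] by (intro germ_eqI) blast
qed

lemma lg_refine:
  assumes s: "s \<in> denoms \<S> A Y" and u: "u \<in> W \<leadsto> A" "s \<cdot> u \<in> cone_in \<T> \<S>" and y: "y \<in> el F A"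
  shows "lg (s \<cdot> u) (Res F u y) = lg s y"
proof -
  have sh: "s \<in> A \<leadsto> Y" using s by blast
  have su: "s \<cdot> u \<in> denoms \<S> W Y" using comp_closed[OF u(1) sh] u(2) by blast
  note i = id_closed[OF homD(5)[OF u(1)]]
  have "lrel \<S> precomp s (Id \<T> A) (s \<cdot> u) u"
    using lrel_refine[OF S set_presheaf_hom sh u i] id_left[OF u(1)] by simp
  then have "frac \<T> \<S> s (Id \<T> A) = frac \<T> \<S> (s \<cdot> u) u" using frac_eqI[OF s i su u(1)] by blast
  then show ?thesis using germ_lg[OF su u(1) y] lg_eq[OF s] by simp
qed

text \<open>From left to right the relation is read off from the invariant \<open>key\<close>;
  conversely both representatives are refined to the common span.\<close>

lemma lg_eq_iff:
  assumes s: "s \<in> denoms \<S> A Y" "y \<in> el F A" and s': "s' \<in> denoms \<S> B Y" "y' \<in> el F B"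
  shows "lg s y = lg s' y' \<longleftrightarrow> lrel \<S> (Res F) s y s' y'"
proof
  have h: "s \<in> A \<leadsto> Y" "s' \<in> B \<leadsto> Y" and o: "A \<in> Obj \<T>" "B \<in> Obj \<T>" using s s' denoms_obj by blast+
  assume "lg s y = lg s' y'"
  then have "((A, y, frac \<T> \<S> s (Id \<T> A)), (B, y', frac \<T> \<S> s' (Id \<T> B))) \<in> germ_rel Y"
    using germ_mem unfolding lg_eq[OF s(1)] lg_eq[OF s'(1)] by blast
  note k = germ_rel_inv(1)[OF this] have "(s', y') \<in> key Y (B, y', frac \<T> \<S> s' (Id \<T> B))"
    unfolding key_frac[OF s'(1) id_closed[OF o(2)] s'(2)]
    using s' lrel_refl[OF S set_presheaf_res[OF F] s'(1)] res_id[OF F s'(2) o(2)] by auto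
  then show "lrel \<S> (Res F) s y s' y'"
    unfolding k[symmetric] key_frac[OF s(1) id_closed[OF o(1)] s(2)] using res_id[OF F s(2) o(1)] by auto
next
  have h: "s \<in> A \<leadsto> Y" "s' \<in> B \<leadsto> Y" using s s' by blast+
  assume "lrel \<S> (Res F) s y s' y'"
  then obtain W u v where w: "u \<in> W \<leadsto> A" "v \<in> W \<leadsto> B" "s \<cdot> u = s' \<cdot> v" "s \<cdot> u \<in> denoms \<S> W Y" "Res F u y = Res F v y'"
    using lrelE[OF _ h] by metis
  then show "lg s y = lg s' y'" using lg_refine[OF s(1) w(1) _ s(2)] lg_refine[OF s'(1) w(2) _ s'(2)] by simp
qed

lemma lg_mem:
  assumes s: "s \<in> denoms \<S> A Y" "y \<in> el F A"
  shows "(X, x, \<phi>) \<in> lg s y \<longleftrightarrow> (\<exists>B s' f. s' \<in> denoms \<S> B Y \<and> f \<in> B \<leadsto> X \<and> x \<in> el F X \<and> \<phi> = frac \<T> \<S> s' f \<and>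
    lg s' (Res F f x) = lg s y)" (is "_ \<longleftrightarrow> ?R")
proof
  have o: "A \<in> Obj \<T>" using s denoms_obj by blast
  let ?t = "(A, y, frac \<T> \<S> s (Id \<T> A))"
  have t: "?t \<in> elem_triples \<T> \<S> F Y" unfolding elem_triples_iff using s id_closed[OF o] by blast
  assume "(X, x, \<phi>) \<in> lg s y"
  then have r: "(?t, (X, x, \<phi>)) \<in> germ_rel Y" unfolding lg_eq[OF s(1)] germ_mem .
  then obtain B s' f where "s' \<in> denoms \<S> B Y" "f \<in> B \<leadsto> X" "x \<in> el F X" "\<phi> = frac \<T> \<S> s' f"
    using germ_rel_inv(2)[OF r t] unfolding elem_triples_iff by blast
  moreover from this have "lg s' (Res F f x) = lg s y" using germ_lg[of s' B Y f X x] germ_eqI[OF r] lg_eq[OF s(1)] by simp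
  ultimately show ?R by blast
next
  assume ?R
  then obtain B s' f where *: "s' \<in> denoms \<S> B Y" "f \<in> B \<leadsto> X" "x \<in> el F X" "\<phi> = frac \<T> \<S> s' f"
    "lg s' (Res F f x) = lg s y" by blast
  then have "germ \<T> \<S> F Y (X, x, \<phi>) = lg s y" using germ_lg[OF *(1-3)] by simp
  then show "(X, x, \<phi>) \<in> lg s y" using germ_mem by blast
qed

lemma lg_memI:
  "s \<in> denoms \<S> A Y \<Longrightarrow> y \<in> el F A \<Longrightarrow> s' \<in> denoms \<S> B Y \<Longrightarrow> f \<in> B \<leadsto> X \<Longrightarrow> x \<in> el F X \<Longrightarrow>
    lg s' (Res F f x) = lg s y \<Longrightarrow> (X, x, frac \<T> \<S> s' f) \<in> lg s y"
  unfolding lg_mem by blast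

lemma lg_memE:
  assumes "(X, x, \<phi>) \<in> lg s y" "s \<in> denoms \<S> A Y" "y \<in> el F A"
  obtains B s' f where "s' \<in> denoms \<S> B Y" "f \<in> B \<leadsto> X" "x \<in> el F X" "\<phi> = frac \<T> \<S> s' f"
    "lg s' (Res F f x) = lg s y"
  using assms(1) unfolding lg_mem[OF assms(2,3)] by (elim exE conjE)

lemma lg_mem_self: "s \<in> denoms \<S> A Y \<Longrightarrow> y \<in> el F A \<Longrightarrow> (A, y, frac \<T> \<S> s (Id \<T> A)) \<in> lg s y"
  using germ_mem lg_eq by blast

subsection \<open>The localisation of a cohomological functor\<close>

lemma Loc_carrier: "el (Loc \<T> \<S> F) Y = {lg s y | s y A. s \<in> denoms \<S> A Y \<and> y \<in> el F A}"
proof -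
  have "el (Loc \<T> \<S> F) Y = germ \<T> \<S> F Y ` elem_triples \<T> \<S> F Y"
    by (simp add: Loc_def restrict_presheaf_def extend_presheaf_def)
  also have "\<dots> = {lg s y | s y A. s \<in> denoms \<S> A Y \<and> y \<in> el F A}"
  proof (intro equalityI subsetI)
    fix z assume "z \<in> germ \<T> \<S> F Y ` elem_triples \<T> \<S> F Y"
    then obtain X x \<phi> where "(X, x, \<phi>) \<in> elem_triples \<T> \<S> F Y" "z = germ \<T> \<S> F Y (X, x, \<phi>)" by auto
    then obtain A s f where "s \<in> denoms \<S> A Y" "f \<in> A \<leadsto> X" "x \<in> el F X" "z = germ \<T> \<S> F Y (X, x, frac \<T> \<S> s f)"
      unfolding elem_triples_iff by blast
    then show "z \<in> {lg s y | s y A. s \<in> denoms \<S> A Y \<and> y \<in> el F A}"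
      using germ_lg[of s A Y f X x] res_closed[OF F, of f A X x] by blast
  next
    fix z assume "z \<in> {lg s y | s y A. s \<in> denoms \<S> A Y \<and> y \<in> el F A}"
    then obtain s y A where s: "s \<in> denoms \<S> A Y" "y \<in> el F A" "z = lg s y" by blast
    then have "(A, y, frac \<T> \<S> s (Id \<T> A)) \<in> elem_triples \<T> \<S> F Y"
      unfolding elem_triples_iff using id_closed denoms_obj by blast
    then show "z \<in> germ \<T> \<S> F Y ` elem_triples \<T> \<S> F Y" using s lg_eq by blast
  qed
  finally show ?thesis .
qed

lemma Loc_closed: "s \<in> denoms \<S> A Y \<Longrightarrow> y \<in> el F A \<Longrightarrow> lg s y \<in> el (Loc \<T> \<S> F) Y"
  unfolding Loc_carrier by blast

text \<open>Addition of germs is defined over a common pair \<open>(X, x)\<close> and adds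
  fractions, not elements of F. Here it is identified with addition in F over a common
  denominator.\<close>

lemma Loc_mult:
  assumes s: "s \<in> denoms \<S> A Y" "y \<in> el F A" "z \<in> el F A"
  shows "lg s y \<otimes>\<^bsub>Val (Loc \<T> \<S> F) Y\<^esub> lg s z = lg s (y \<otimes>\<^bsub>Val F A\<^esub> z)"
proof -
  have "lg s y \<otimes>\<^bsub>Val (Loc \<T> \<S> F) Y\<^esub> lg s z = \<Union>{germ \<T> \<S> F Y (X, x, Add quot \<phi> \<psi>) | X x \<phi> \<psi>.
      (X, x, \<phi>) \<in> lg s y \<and> (X, x, \<psi>) \<in> lg s z}"
    by (simp add: Loc_def restrict_presheaf_def extend_presheaf_def)
  also have "\<dots> = lg s (y \<otimes>\<^bsub>Val F A\<^esub> z)"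
  proof (rule Union_eqI)
    have o: "A \<in> Obj \<T>" using s denoms_obj by blast
    \<comment> \<open>To find a common pair for \<open>y\<close> and \<open>z\<close>: an element
      over the biproduct of two copies of A restricts to \<open>y\<close> along one inclusion and to
      \<open>z\<close> along the other. Adding the inclusions then adds the restrictions, as F is
      additive on morphisms.\<close>
    obtain B where "is_biproduct \<T> A A B" using biproduct_exists[OF o o] by blast
    then obtain i j p r where B: "i \<in> A \<leadsto> B" "j \<in> A \<leadsto> B" "p \<in> B \<leadsto> A" "r \<in> B \<leadsto> A" "p \<cdot> i = Id \<T> A"
      "r \<cdot> j = Id \<T> A" "p \<cdot> j = Zero \<T> A A" "r \<cdot> i = Zero \<T> A A" unfolding is_biproduct_def by blast
    interpret A: comm_group "Val F A" by (rule val_group[OF F o])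
    interpret B: comm_group "Val F B" by (rule val_group[OF F homD(5)[OF B(1)]])
    let ?x = "Res F p y \<otimes>\<^bsub>Val F B\<^esub> Res F r z"
    note py = res_closed[OF F B(3) s(2)] and rz = res_closed[OF F B(4) s(3)]
    have x: "?x \<in> el F B" using py rz by simp
    have "Res F i (Res F p y) = y" "Res F i (Res F r z) = \<one>\<^bsub>Val F A\<^esub>"
      "Res F j (Res F p y) = \<one>\<^bsub>Val F A\<^esub>" "Res F j (Res F r z) = z"
      using res_comp[OF F B(1,3) s(2), symmetric] res_comp[OF F B(1,4) s(3), symmetric]
        res_comp[OF F B(2,3) s(2), symmetric] res_comp[OF F B(2,4) s(3), symmetric] B(5-8)
        res_id[OF F _ o] res_zero[OF F o o] s by simp_all
    then have xi: "Res F i ?x = y" and xj: "Res F j ?x = z"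
      using res_mult[OF F B(1) py rz] res_mult[OF F B(2) py rz] s by simp_all
    have "(B, ?x, frac \<T> \<S> s i) \<in> lg s y" "(B, ?x, frac \<T> \<S> s j) \<in> lg s z"
      using lg_memI[OF s(1,2,1) B(1) x] lg_memI[OF s(1,3,1) B(2) x] xi xj by simp_all
    moreover have "germ \<T> \<S> F Y (B, ?x, Add quot (frac \<T> \<S> s i) (frac \<T> \<S> s j)) = lg s (y \<otimes>\<^bsub>Val F A\<^esub> z)"
      using quot_add[OF s(1) B(1,2)] germ_lg[OF s(1) add_closed[OF B(1,2)] x] res_add[OF F B(1,2) x] xi xj by simp
    ultimately show "lg s (y \<otimes>\<^bsub>Val F A\<^esub> z) \<in> {germ \<T> \<S> F Y (X, x, Add quot \<phi> \<psi>) | X x \<phi> \<psi>.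
      (X, x, \<phi>) \<in> lg s y \<and> (X, x, \<psi>) \<in> lg s z}" by fastforce
  next
    fix w assume "w \<in> {germ \<T> \<S> F Y (X, x, Add quot \<phi> \<psi>) | X x \<phi> \<psi>. (X, x, \<phi>) \<in> lg s y \<and> (X, x, \<psi>) \<in> lg s z}"
    then obtain X x \<phi> \<psi> where w: "w = germ \<T> \<S> F Y (X, x, Add quot \<phi> \<psi>)" "(X, x, \<phi>) \<in> lg s y" "(X, x, \<psi>) \<in> lg s z"
      by blast
    obtain A\<^sub>1 s\<^sub>1 f\<^sub>1 where 1: "s\<^sub>1 \<in> denoms \<S> A\<^sub>1 Y" "f\<^sub>1 \<in> A\<^sub>1 \<leadsto> X" "x \<in> el F X" "\<phi> = frac \<T> \<S> s\<^sub>1 f\<^sub>1"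
      "lg s\<^sub>1 (Res F f\<^sub>1 x) = lg s y" using lg_memE[OF w(2) s(1,2)] .
    obtain A\<^sub>2 s\<^sub>2 f\<^sub>2 where 2: "s\<^sub>2 \<in> denoms \<S> A\<^sub>2 Y" "f\<^sub>2 \<in> A\<^sub>2 \<leadsto> X" "\<psi> = frac \<T> \<S> s\<^sub>2 f\<^sub>2"
      "lg s\<^sub>2 (Res F f\<^sub>2 x) = lg s z" using lg_memE[OF w(3) s(1,3)] by metis
    \<comment> \<open>Arbitrary representatives are first given the same denominator
      \<open>r\<close>; the comparisons with \<open>y\<close> and with \<open>z\<close> are then
      realised on one span.\<close>
    obtain P p q where p: "p \<in> P \<leadsto> A\<^sub>1" "q \<in> P \<leadsto> A\<^sub>2" "s\<^sub>1 \<cdot> p = s\<^sub>2 \<cdot> q" "s\<^sub>1 \<cdot> p \<in> denoms \<S> P Y"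
      using denoms_ore[OF S 1(1) 2(1)] .
    define r where "r = s\<^sub>1 \<cdot> p"
    have r: "r \<in> denoms \<S> P Y" using p by (simp add: r_def)
    have h: "s\<^sub>1 \<in> A\<^sub>1 \<leadsto> Y" "s\<^sub>2 \<in> A\<^sub>2 \<leadsto> Y" "s \<in> A \<leadsto> Y" "r \<in> P \<leadsto> Y" using 1 2 s r by blast+
    note f1 = comp_closed[OF p(1) 1(2)] and f2 = comp_closed[OF p(2) 2(2)]
    have "lrel \<S> precomp s\<^sub>1 f\<^sub>1 r (f\<^sub>1 \<cdot> p)" unfolding r_def
      using lrel_refine[OF S set_presheaf_hom h(1) p(1) _ 1(2)] p by simp
    then have \<phi>: "\<phi> = frac \<T> \<S> r (f\<^sub>1 \<cdot> p)" using frac_eqI[OF 1(1,2) r f1] 1(4) by simp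
    have "lrel \<S> precomp s\<^sub>2 f\<^sub>2 r (f\<^sub>2 \<cdot> q)" unfolding r_def p(3)
      using lrel_refine[OF S set_presheaf_hom h(2) p(2) _ 2(2)] p by simp
    then have \<psi>: "\<psi> = frac \<T> \<S> r (f\<^sub>2 \<cdot> q)" using frac_eqI[OF 2(1,2) r f2] 2(3) by simp
    define a where "a = Res F (f\<^sub>1 \<cdot> p) x"
    define b where "b = Res F (f\<^sub>2 \<cdot> q) x"
    have ab: "a \<in> el F P" "b \<in> el F P" unfolding a_def b_def using res_closed[OF F f1 1(3)] res_closed[OF F f2 1(3)] .
    have "lg r a = lg s y" "lg r b = lg s z"
      using lg_refine[OF 1(1) p(1) _ res_closed[OF F 1(2,3)]] lg_refine[OF 2(1) p(2) _ res_closed[OF F 2(2) 1(3)]]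
        p(3,4) 1(5) 2(4) res_comp[OF F p(1) 1(2,3)] res_comp[OF F p(2) 2(2) 1(3)] unfolding r_def a_def b_def by simp_all
    then have "lrel \<S> (Res F) s y r a" "lrel \<S> (Res F) s z r b"
      using lg_eq_iff[OF s(1,2) r ab(1)] lg_eq_iff[OF s(1,3) r ab(2)] by simp_all
    then obtain W u v where v: "u \<in> W \<leadsto> A" "v \<in> W \<leadsto> P" "s \<cdot> u = r \<cdot> v" "s \<cdot> u \<in> denoms \<S> W Y"
      "Res F u y = Res F v a" "Res F u z = Res F v b"
      using lrel_pair[OF S set_presheaf_res[OF F] set_presheaf_res[OF F] s(1) r s(2) ab(1) _ s(3) ab(2)] by metis
    interpret A: comm_group "Val F A" by (rule val_group[OF F homD(5)[OF v(1)]])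
    interpret P: comm_group "Val F P" by (rule val_group[OF F homD(5)[OF v(2)]])
    have m: "y \<otimes>\<^bsub>Val F A\<^esub> z \<in> el F A" "a \<otimes>\<^bsub>Val F P\<^esub> b \<in> el F P" using s ab by simp_all
    have "lrel \<S> (Res F) s (y \<otimes>\<^bsub>Val F A\<^esub> z) r (a \<otimes>\<^bsub>Val F P\<^esub> b)"
      using lrelI[OF h(3,4) v(1-3), of \<S> "Res F"] v(4-6) res_mult[OF F v(1) s(2,3)] res_mult[OF F v(2) ab] by simp
    then have "lg s (y \<otimes>\<^bsub>Val F A\<^esub> z) = lg r (a \<otimes>\<^bsub>Val F P\<^esub> b)" using lg_eq_iff[OF s(1) m(1) r m(2)] by simp
    moreover have "w = lg r (a \<otimes>\<^bsub>Val F P\<^esub> b)"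
      unfolding w(1) \<phi> \<psi> quot_add[OF r f1 f2] germ_lg[OF r add_closed[OF f1 f2] 1(3)] res_add[OF F f1 f2 1(3)]
      by (simp add: a_def b_def)
    ultimately show "w = lg s (y \<otimes>\<^bsub>Val F A\<^esub> z)" by simp
  qed
  finally show ?thesis .
qed

lemma lg_one:
  assumes s: "s \<in> denoms \<S> A Y"
  shows "lg s \<one>\<^bsub>Val F A\<^esub> = lg (Id \<T> Y) \<one>\<^bsub>Val F Y\<^esub>"
proof -
  have sh: "s \<in> A \<leadsto> Y" and Y: "Y \<in> Obj \<T>" using s denoms_obj by blast+
  interpret Y: comm_group "Val F Y" by (rule val_group[OF F Y])
  show ?thesis using lg_refine[OF denoms_id[OF S Y] sh _ Y.one_closed] id_left[OF sh] s res_one[OF F sh] by auto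
qed

lemma Loc_one:
  assumes Y: "Y \<in> Obj \<T>"
  shows "\<one>\<^bsub>Val (Loc \<T> \<S> F) Y\<^esub> = lg (Id \<T> Y) \<one>\<^bsub>Val F Y\<^esub>"
proof -
  note i = denoms_id[OF S Y]
  interpret Y: comm_group "Val F Y" by (rule val_group[OF F Y])
  have z: "germ \<T> \<S> F Y (X, x, Zero quot Y X) = lg (Id \<T> Y) \<one>\<^bsub>Val F Y\<^esub>" if "X \<in> Obj \<T>" "x \<in> el F X" for X x
    using germ_lg[OF i zero_closed[OF Y that(1)] that(2)] res_zero[OF F Y that(1,2)]
    by (simp add: verdier_quotient_def)
  have "\<one>\<^bsub>Val (Loc \<T> \<S> F) Y\<^esub> = \<Union>{germ \<T> \<S> F Y (X, x, Zero quot Y X) | X x. X \<in> Obj \<T> \<and> x \<in> el F X}"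
    by (simp add: Loc_def restrict_presheaf_def extend_presheaf_def)
  also have "\<dots> = lg (Id \<T> Y) \<one>\<^bsub>Val F Y\<^esub>"
    by (rule Union_eqI[of "germ \<T> \<S> F Y (Y, \<one>\<^bsub>Val F Y\<^esub>, Zero quot Y Y)"]) (use Y z[OF Y] Y.one_closed z in blast)+
  finally show ?thesis .
qed

text \<open>Independence of the completing square and of the representative is
  \<open>lrel_pull\<close> for the presheaf F, where \<open>f\<close> is viewed as a fraction with
  identity denominator.\<close>

lemma Loc_res:
  assumes f: "f \<in> Y' \<leadsto> Y" and s: "s \<in> denoms \<S> A Y" "y \<in> el F A"
    and s': "s' \<in> denoms \<S> A' Y'" "f' \<in> A' \<leadsto> A" "s \<cdot> f' = f \<cdot> s'"
  shows "Res (Loc \<T> \<S> F) f (lg s y) = lg s' (Res F f' y)"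
proof -
  note Y' = homD(4)[OF f]
  have "Dom quot (quotient_arr \<T> \<S> f) = Y'"
    unfolding quotient_arr_def using quot_dom_cod(1)[OF denoms_id[OF S Y'] f] homD(2)[OF f] by simp
  then have "Res (Loc \<T> \<S> F) f (lg s y) =
      \<Union>{germ \<T> \<S> F Y' (X, x, Comp quot \<phi> (quotient_arr \<T> \<S> f)) | X x \<phi>. (X, x, \<phi>) \<in> lg s y}"
    by (simp add: Loc_def restrict_presheaf_def extend_presheaf_def)
  also have "\<dots> = lg s' (Res F f' y)"
  proof (rule Union_eqI)
    have A: "A \<in> Obj \<T>" using s denoms_obj by blast
    have "germ \<T> \<S> F Y' (A, y, Comp quot (frac \<T> \<S> s (Id \<T> A)) (quotient_arr \<T> \<S> f)) = lg s' (Res F f' y)"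
      using quot_comp_right[OF f s(1) id_closed[OF A] s'] id_left[OF s'(2)] germ_lg[OF s'(1,2) s(2)] by simp
    then show "lg s' (Res F f' y) \<in> {germ \<T> \<S> F Y' (X, x, Comp quot \<phi> (quotient_arr \<T> \<S> f)) | X x \<phi>. (X, x, \<phi>) \<in> lg s y}"
      using lg_mem_self[OF s] by fastforce
  next
    fix w assume "w \<in> {germ \<T> \<S> F Y' (X, x, Comp quot \<phi> (quotient_arr \<T> \<S> f)) | X x \<phi>. (X, x, \<phi>) \<in> lg s y}"
    then obtain X x \<phi> where w: "w = germ \<T> \<S> F Y' (X, x, Comp quot \<phi> (quotient_arr \<T> \<S> f))" "(X, x, \<phi>) \<in> lg s y" by blast
    obtain B t g where t: "t \<in> denoms \<S> B Y" "g \<in> B \<leadsto> X" "x \<in> el F X" "\<phi> = frac \<T> \<S> t g" "lg t (Res F g x) = lg s y"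
      using lg_memE[OF w(2) s] .
    obtain B' t' g' where t': "t' \<in> denoms \<S> B' Y'" "g' \<in> B' \<leadsto> B" "t \<cdot> g' = f \<cdot> t'" using denoms_pullback[OF S t(1) f] .
    note gx = res_closed[OF F t(2,3)] and i = denoms_id[OF S Y']
    have h: "s' \<in> A' \<leadsto> Y'" "t' \<in> B' \<leadsto> Y'" using s' t' by blast+
    have "lrel \<S> (Res F) s y t (Res F g x)" using lg_eq_iff[OF s t(1) gx] t(5) by simp
    from lrel_pull[OF S set_presheaf_res[OF F] s(1) t(1) s(2) gx this i i f f
        lrel_refl[OF S set_presheaf_hom i] s'(1,2) s'(3)[symmetric] t'(1,2) t'(3)[symmetric]]
    have "lrel \<S> (Res F) s' (Res F f' y) t' (Res F g' (Res F g x))" using id_left[OF h(1)] id_left[OF h(2)] by simp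
    then have "lg s' (Res F f' y) = lg t' (Res F g' (Res F g x))"
      using lg_eq_iff[OF s'(1) res_closed[OF F s'(2) s(2)] t'(1) res_closed[OF F t'(2) gx]] by simp
    moreover have "w = lg t' (Res F (g \<cdot> g') x)"
      unfolding w(1) t(4) quot_comp_right[OF f t(1,2) t'] germ_lg[OF t'(1) comp_closed[OF t'(2) t(2)] t(3)] ..
    ultimately show "w = lg s' (Res F f' y)" using res_comp[OF F t'(2) t(2,3)] by simp
  qed
  finally show ?thesis .
qed

end

end

end

context triangulated_category
begin

text \<open>Both cones are compared with the cone of the diagonal of the square.\<close>

lemma denoms_cone:
  assumes S: "\<S> \<in> Thick \<T>" and t: "tri X f Y g Z h" and t': "tri X' f' Y' g' Z' h'"
    and s: "s \<in> denoms \<S> X' X" and r: "r \<in> denoms \<S> Y' Y" and sq: "r \<cdot> f' = f \<cdot> s"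
  obtains w where "w \<in> denoms \<S> Z' Z" "w \<cdot> g' = g \<cdot> r"
proof -
  obtain s\<^sub>2 A s\<^sub>3 where A: "tri X' s X s\<^sub>2 A s\<^sub>3" "A \<in> \<S>" using denomsE[OF s] .
  obtain r\<^sub>2 B r\<^sub>3 where B: "tri Y' r Y r\<^sub>2 B r\<^sub>3" "B \<in> \<S>" using denomsE[OF r] .
  have "f \<cdot> s \<in> X' \<leadsto> Y" using comp_closed[OF triD(2)[OF A(1)] triD(2)[OF t]] .
  then obtain p P q where P: "tri X' (f \<cdot> s) Y p P q" using tri_exists by blast
  obtain d\<^sub>1 d\<^sub>2 where d: "tri Z' d\<^sub>1 P d\<^sub>2 B (\<Sigma>\<^sub>1 g' \<cdot> r\<^sub>3)" "d\<^sub>1 \<cdot> g' = p \<cdot> r"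
    using octahedron[OF t' B(1) P[folded sq]] by metis
  obtain e\<^sub>1 e\<^sub>2 where e: "tri A e\<^sub>1 P e\<^sub>2 Z (\<Sigma>\<^sub>1 s\<^sub>2 \<cdot> h)" "e\<^sub>2 \<cdot> p = g" using octahedron[OF A(1) t P] by metis
  have "e\<^sub>2 \<cdot> d\<^sub>1 \<in> denoms \<S> Z' Z" using denoms_comp[OF S denomsI[OF d(1) B(2)] denoms_fiberI[OF S e(1) A(2)]] .
  moreover have "e\<^sub>2 \<cdot> d\<^sub>1 \<cdot> g' = g \<cdot> r"
    using comp_assoc[OF triD(3)[OF t'] triD(2)[OF d(1)] triD(3)[OF e(1)]] d(2)
      comp_assoc[OF triD(2)[OF B(1)] triD(3)[OF P] triD(3)[OF e(1)]] e(2) by simp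
  ultimately show thesis using that by blast
qed

text \<open>Exactness at the middle term of every triangle is enough, since the second equation in
  the definition is the same statement for the rotated triangle.\<close>

lemma cohomologicalI:
  assumes "\<And>X. X \<in> Obj \<T> \<Longrightarrow> comm_group (Val F X)"
    and "\<And>X x. X \<in> Obj \<T> \<Longrightarrow> x \<in> el F X \<Longrightarrow> Res F (Id \<T> X) x = x"
    and closed: "\<And>X Y f y. f \<in> X \<leadsto> Y \<Longrightarrow> y \<in> el F Y \<Longrightarrow> Res F f y \<in> el F X"
    and "\<And>X Y f y y'. f \<in> X \<leadsto> Y \<Longrightarrow> y \<in> el F Y \<Longrightarrow> y' \<in> el F Y \<Longrightarrow>
      Res F f (y \<otimes>\<^bsub>Val F Y\<^esub> y') = Res F f y \<otimes>\<^bsub>Val F X\<^esub> Res F f y'"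
    and "\<And>X Y Z f g z. f \<in> X \<leadsto> Y \<Longrightarrow> g \<in> Y \<leadsto> Z \<Longrightarrow> z \<in> el F Z \<Longrightarrow> Res F (g \<cdot> f) z = Res F f (Res F g z)"
    and "\<And>X Y f g y. f \<in> X \<leadsto> Y \<Longrightarrow> g \<in> X \<leadsto> Y \<Longrightarrow> y \<in> el F Y \<Longrightarrow>
      Res F (f \<^bold>+ g) y = Res F f y \<otimes>\<^bsub>Val F X\<^esub> Res F g y"
    and zero: "\<And>X f Y g Z h z. tri X f Y g Z h \<Longrightarrow> z \<in> el F Z \<Longrightarrow> Res F f (Res F g z) = \<one>\<^bsub>Val F X\<^esub>"
    and exact: "\<And>X f Y g Z h y. tri X f Y g Z h \<Longrightarrow> y \<in> el F Y \<Longrightarrow> Res F f y = \<one>\<^bsub>Val F X\<^esub> \<Longrightarrow>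
      \<exists>z \<in> el F Z. Res F g z = y"
  shows "cohomological \<T> F"
proof -
  have *: "Res F g ` el F Z = kernel (Val F Y) (Val F X) (Res F f)" if t: "tri X f Y g Z h" for X f Y g Z h
  proof (intro equalityI subsetI)
    show "y \<in> kernel (Val F Y) (Val F X) (Res F f)" if "y \<in> Res F g ` el F Z" for y
      using that closed[OF triD(3)[OF t]] zero[OF t] unfolding kernel_def by auto
    show "y \<in> Res F g ` el F Z" if "y \<in> kernel (Val F Y) (Val F X) (Res F f)" for y
      using that exact[OF t, of y] unfolding kernel_def by blast
  qed
  have "Res F g ` carrier (Val F (Cod \<T> g)) = kernel (Val F (Cod \<T> f)) (Val F (Dom \<T> f)) (Res F f) \<and>
      Res F h ` carrier (Val F (Cod \<T> h)) = kernel (Val F (Cod \<T> g)) (Val F (Cod \<T> f)) (Res F g)"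
    if "(f, g, h) \<in> Dist \<T>" for f g h
    using *[OF dist_tri[OF that]] *[OF tri_rotate[OF dist_tri[OF that]]] tri_dom_cod[OF dist_tri[OF that]] by simp
  moreover have "Res F f \<in> hom (Val F Y) (Val F X)" if "f \<in> X \<leadsto> Y" for f X Y
    unfolding hom_def using closed[OF that] assms(4)[OF that] by auto
  ultimately show ?thesis unfolding cohomological_def using assms(1,2,5,6) by simp
qed

context
  fixes \<S> assumes S: "\<S> \<in> Thick \<T>"
begin

context
  fixes F :: "('o, 'm, 'g) presheaf" assumes F: "cohomological \<T> F"
begin

abbreviation "lgF \<equiv> lg \<S> F"
abbreviation "LF \<equiv> Loc \<T> \<S> F"

section \<open>Localisations of cohomological functors are cohomological\<close>

lemma Loc_elem:
  assumes "z \<in> el LF Y" obtains A s y where "s \<in> denoms \<S> A Y" "y \<in> el F A" "z = lgF s y"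
  using assms unfolding Loc_carrier[OF S F] by blast

lemma Loc_common:
  assumes s: "s \<in> denoms \<S> A Y" and z: "z \<in> el LF Y"
  obtains B u z' where "u \<in> B \<leadsto> A" "s \<cdot> u \<in> denoms \<S> B Y" "z' \<in> el F B" "z = lgF (s \<cdot> u) z'"
proof -
  obtain A' s' y where s': "s' \<in> denoms \<S> A' Y" "y \<in> el F A'" "z = lgF s' y" using Loc_elem[OF z] .
  obtain B u v where u: "u \<in> B \<leadsto> A" "v \<in> B \<leadsto> A'" "s \<cdot> u = s' \<cdot> v" "s \<cdot> u \<in> denoms \<S> B Y"
    using denoms_ore[OF S s s'(1)] .
  then show thesis using that res_closed[OF F u(2) s'(2)] lg_refine[OF S F s'(1) u(2) _ s'(2)] s'(3) by auto
qed

lemma Loc_common2: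
  assumes z: "z\<^sub>1 \<in> el LF Y" "z\<^sub>2 \<in> el LF Y"
  obtains A s y\<^sub>1 y\<^sub>2 where "s \<in> denoms \<S> A Y" "y\<^sub>1 \<in> el F A" "y\<^sub>2 \<in> el F A" "z\<^sub>1 = lgF s y\<^sub>1" "z\<^sub>2 = lgF s y\<^sub>2"
proof -
  obtain A s y where s: "s \<in> denoms \<S> A Y" "y \<in> el F A" "z\<^sub>1 = lgF s y" using Loc_elem[OF z(1)] .
  obtain B u z' where u: "u \<in> B \<leadsto> A" "s \<cdot> u \<in> denoms \<S> B Y" "z' \<in> el F B" "z\<^sub>2 = lgF (s \<cdot> u) z'"
    using Loc_common[OF s(1) z(2)] .
  then show thesis using that[OF u(2) res_closed[OF F u(1) s(2)] u(3)] lg_refine[OF S F s(1) u(1) _ s(2)] s(3) by auto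
qed

lemma Loc_group:
  assumes Y: "Y \<in> Obj \<T>" shows "comm_group (Val LF Y)"
proof (rule comm_groupI)
  note i = denoms_id[OF S Y]
  have G: "comm_group (Val F A)" if "s \<in> denoms \<S> A Y" for s A using val_group[OF F denoms_obj(1)[OF that]] .
  note M = Loc_mult[OF S F]
  have cl: "y \<otimes>\<^bsub>Val F A\<^esub> z \<in> el F A" if "s \<in> denoms \<S> A Y" "y \<in> el F A" "z \<in> el F A" for s A y z
    using comm_groupE(1)[OF G[OF that(1)] that(2,3)] .
  have one: "\<one>\<^bsub>Val LF Y\<^esub> = lgF s \<one>\<^bsub>Val F A\<^esub>" if "s \<in> denoms \<S> A Y" for s A
    using lg_one[OF S F that] Loc_one[OF S F Y] by simp
  show "\<one>\<^bsub>Val LF Y\<^esub> \<in> el LF Y" unfolding one[OF i] using Loc_closed[OF S F i comm_groupE(2)[OF G[OF i]]] .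
  show "a \<otimes>\<^bsub>Val LF Y\<^esub> b \<in> el LF Y" "a \<otimes>\<^bsub>Val LF Y\<^esub> b = b \<otimes>\<^bsub>Val LF Y\<^esub> a"
    if ab: "a \<in> el LF Y" "b \<in> el LF Y" for a b
  proof -
    obtain A s y\<^sub>1 y\<^sub>2 where s: "s \<in> denoms \<S> A Y" "y\<^sub>1 \<in> el F A" "y\<^sub>2 \<in> el F A" "a = lgF s y\<^sub>1" "b = lgF s y\<^sub>2"
      using Loc_common2[OF ab] .
    show "a \<otimes>\<^bsub>Val LF Y\<^esub> b \<in> el LF Y"
      unfolding s(4,5) M[OF s(1-3)] using Loc_closed[OF S F s(1) cl[OF s(1-3)]] .
    show "a \<otimes>\<^bsub>Val LF Y\<^esub> b = b \<otimes>\<^bsub>Val LF Y\<^esub> a"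
      unfolding s(4,5) M[OF s(1-3)] M[OF s(1,3,2)] using comm_groupE(4)[OF G[OF s(1)] s(2,3)] by simp
  qed
  show "a \<otimes>\<^bsub>Val LF Y\<^esub> b \<otimes>\<^bsub>Val LF Y\<^esub> c = a \<otimes>\<^bsub>Val LF Y\<^esub> (b \<otimes>\<^bsub>Val LF Y\<^esub> c)"
    if abc: "a \<in> el LF Y" "b \<in> el LF Y" "c \<in> el LF Y" for a b c
  proof -
    obtain A s y\<^sub>1 y\<^sub>2 where s: "s \<in> denoms \<S> A Y" "y\<^sub>1 \<in> el F A" "y\<^sub>2 \<in> el F A" "a = lgF s y\<^sub>1" "b = lgF s y\<^sub>2"
      using Loc_common2[OF abc(1,2)] .
    obtain B u y\<^sub>3 where u: "u \<in> B \<leadsto> A" "s \<cdot> u \<in> denoms \<S> B Y" "y\<^sub>3 \<in> el F B" "c = lgF (s \<cdot> u) y\<^sub>3"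
      using Loc_common[OF s(1) abc(3)] .
    have su: "s \<cdot> u \<in> cone_in \<T> \<S>" using u(2) by blast
    note r = res_closed[OF F u(1) s(2)] res_closed[OF F u(1) s(3)]
    have ab: "a = lgF (s \<cdot> u) (Res F u y\<^sub>1)" "b = lgF (s \<cdot> u) (Res F u y\<^sub>2)"
      using lg_refine[OF S F s(1) u(1) su] s by simp_all
    show ?thesis
      unfolding ab u(4) M[OF u(2) r] M[OF u(2) r(2) u(3)] M[OF u(2) cl[OF u(2) r] u(3)]
        M[OF u(2) r(1) cl[OF u(2) r(2) u(3)]] using comm_groupE(3)[OF G[OF u(2)] r u(3)] by simp
  qed
  show "\<one>\<^bsub>Val LF Y\<^esub> \<otimes>\<^bsub>Val LF Y\<^esub> a = a" "\<exists>b \<in> el LF Y. b \<otimes>\<^bsub>Val LF Y\<^esub> a = \<one>\<^bsub>Val LF Y\<^esub>" if a: "a \<in> el LF Y" for a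
  proof -
    obtain A s y where s: "s \<in> denoms \<S> A Y" "y \<in> el F A" "a = lgF s y" using Loc_elem[OF a] .
    interpret A: comm_group "Val F A" using G[OF s(1)] .
    show "\<one>\<^bsub>Val LF Y\<^esub> \<otimes>\<^bsub>Val LF Y\<^esub> a = a" unfolding one[OF s(1)] s(3) M[OF s(1) A.one_closed s(2)] using s by simp
    have "lgF s (inv\<^bsub>Val F A\<^esub> y) \<otimes>\<^bsub>Val LF Y\<^esub> a = \<one>\<^bsub>Val LF Y\<^esub>"
      unfolding one[OF s(1)] s(3) M[OF s(1) A.inv_closed[OF s(2)] s(2)] using s by simp
    then show "\<exists>b \<in> el LF Y. b \<otimes>\<^bsub>Val LF Y\<^esub> a = \<one>\<^bsub>Val LF Y\<^esub>"
      using Loc_closed[OF S F s(1) A.inv_closed[OF s(2)]] by blast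
  qed
qed

lemma Loc_res_elem:
  assumes f: "f \<in> X \<leadsto> Y" and s: "s \<in> denoms \<S> A Y"
  obtains B s' f' where "s' \<in> denoms \<S> B X" "f' \<in> B \<leadsto> A" "s \<cdot> f' = f \<cdot> s'"
    "\<And>y. y \<in> el F A \<Longrightarrow> Res LF f (lgF s y) = lgF s' (Res F f' y)"
proof -
  obtain B s' f' where "s' \<in> denoms \<S> B X" "f' \<in> B \<leadsto> A" "s \<cdot> f' = f \<cdot> s'" using denoms_pullback[OF S s f] .
  then show thesis using that Loc_res[OF S F f s] by blast
qed

lemma Loc_one_refine:
  assumes s: "s \<in> denoms \<S> A Y" "y \<in> el F A" and one: "lgF s y = \<one>\<^bsub>Val LF Y\<^esub>"
  obtains B u where "u \<in> B \<leadsto> A" "s \<cdot> u \<in> denoms \<S> B Y" "Res F u y = \<one>\<^bsub>Val F B\<^esub>"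
proof -
  have h: "s \<in> A \<leadsto> Y" and Y: "Y \<in> Obj \<T>" using s denoms_obj by blast+
  note i = denoms_id[OF S Y] and e = comm_groupE(2)[OF val_group[OF F Y]]
  have "lrel \<S> (Res F) s y (Id \<T> Y) \<one>\<^bsub>Val F Y\<^esub>"
    using one lg_eq_iff[OF S F s i e] Loc_one[OF S F Y] by simp
  then obtain B u v where "u \<in> B \<leadsto> A" "v \<in> B \<leadsto> Y" "s \<cdot> u \<in> denoms \<S> B Y" "Res F u y = Res F v \<one>\<^bsub>Val F Y\<^esub>"
    using lrelE[OF _ h id_closed[OF Y]] by metis
  then show thesis using that res_one[OF F] by metis
qed

lemma Loc_cohomological: "cohomological \<T> LF"
proof (rule cohomologicalI)
  show "comm_group (Val LF X)" if "X \<in> Obj \<T>" for X using Loc_group[OF that] .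
  show "Res LF (Id \<T> X) z = z" if X: "X \<in> Obj \<T>" and z: "z \<in> el LF X" for X z
  proof -
    obtain A s y where s: "s \<in> denoms \<S> A X" "y \<in> el F A" "z = lgF s y" using Loc_elem[OF z] .
    have h: "s \<in> A \<leadsto> X" using s by blast
    show ?thesis
      using Loc_res[OF S F id_closed[OF X] s(1,2,1) id_closed[OF homD(4)[OF h]]] id_left[OF h] id_right[OF h]
        res_id[OF F s(2) homD(4)[OF h]] s(3) by simp
  qed
next
  fix X Y f assume f: "f \<in> X \<leadsto> Y"
  show "Res LF f z \<in> el LF X" if z: "z \<in> el LF Y" for z
  proof -
    obtain A s y where s: "s \<in> denoms \<S> A Y" "y \<in> el F A" "z = lgF s y" using Loc_elem[OF z] .
    obtain B s' f' where p: "s' \<in> denoms \<S> B X" "f' \<in> B \<leadsto> A" "\<And>y. y \<in> el F A \<Longrightarrow> Res LF f (lgF s y) = lgF s' (Res F f' y)"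
      using Loc_res_elem[OF f s(1)] by metis
    show ?thesis unfolding s(3) p(3)[OF s(2)] using Loc_closed[OF S F p(1) res_closed[OF F p(2) s(2)]] .
  qed
  show "Res LF f (z \<otimes>\<^bsub>Val LF Y\<^esub> z') = Res LF f z \<otimes>\<^bsub>Val LF X\<^esub> Res LF f z'" if z: "z \<in> el LF Y" "z' \<in> el LF Y" for z z'
  proof -
    obtain A s y\<^sub>1 y\<^sub>2 where s: "s \<in> denoms \<S> A Y" "y\<^sub>1 \<in> el F A" "y\<^sub>2 \<in> el F A" "z = lgF s y\<^sub>1" "z' = lgF s y\<^sub>2"
      using Loc_common2[OF z] .
    obtain B s' f' where p: "s' \<in> denoms \<S> B X" "f' \<in> B \<leadsto> A" "\<And>y. y \<in> el F A \<Longrightarrow> Res LF f (lgF s y) = lgF s' (Res F f' y)"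
      using Loc_res_elem[OF f s(1)] by metis
    have "y\<^sub>1 \<otimes>\<^bsub>Val F A\<^esub> y\<^sub>2 \<in> el F A" using comm_groupE(1)[OF val_group[OF F homD(5)[OF p(2)]] s(2,3)] .
    then show ?thesis
      unfolding s(4,5) Loc_mult[OF S F s(1-3)] p(3)[OF s(2)] p(3)[OF s(3)]
        Loc_mult[OF S F p(1) res_closed[OF F p(2) s(2)] res_closed[OF F p(2) s(3)]]
      using p(3) res_mult[OF F p(2) s(2,3)] by simp
  qed
  show "Res LF (g \<cdot> f) z = Res LF f (Res LF g z)" if g: "g \<in> Y \<leadsto> Z" and z: "z \<in> el LF Z" for g Z z
  proof -
    obtain A s y where s: "s \<in> denoms \<S> A Z" "y \<in> el F A" "z = lgF s y" using Loc_elem[OF z] .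
    obtain B s' g' where p: "s' \<in> denoms \<S> B Y" "g' \<in> B \<leadsto> A" "s \<cdot> g' = g \<cdot> s'"
      "\<And>y. y \<in> el F A \<Longrightarrow> Res LF g (lgF s y) = lgF s' (Res F g' y)" using Loc_res_elem[OF g s(1)] by metis
    obtain C s'' f' where q: "s'' \<in> denoms \<S> C X" "f' \<in> C \<leadsto> B" "s' \<cdot> f' = f \<cdot> s''"
      "\<And>y. y \<in> el F B \<Longrightarrow> Res LF f (lgF s' y) = lgF s'' (Res F f' y)" using Loc_res_elem[OF f p(1)] by metis
    have h: "s \<in> A \<leadsto> Z" "s' \<in> B \<leadsto> Y" "s'' \<in> C \<leadsto> X" using s p q by blast+
    have "s \<cdot> (g' \<cdot> f') = g \<cdot> f \<cdot> s''"
      using comp_assoc[OF q(2) p(2) h(1)] p(3) comp_assoc[OF q(2) h(2) g] q(3) comp_assoc[OF h(3) f g] by simp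
    from Loc_res[OF S F comp_closed[OF f g] s(1,2) q(1) comp_closed[OF q(2) p(2)] this]
    show ?thesis unfolding s(3) p(4)[OF s(2)] q(4)[OF res_closed[OF F p(2) s(2)]] res_comp[OF F q(2) p(2) s(2)] .
  qed
  show "Res LF (f \<^bold>+ g) z = Res LF f z \<otimes>\<^bsub>Val LF X\<^esub> Res LF g z" if g: "g \<in> X \<leadsto> Y" and z: "z \<in> el LF Y" for g z
  proof -
    obtain A s y where s: "s \<in> denoms \<S> A Y" "y \<in> el F A" "z = lgF s y" using Loc_elem[OF z] .
    obtain B s\<^sub>1 f\<^sub>1 where p: "s\<^sub>1 \<in> denoms \<S> B X" "f\<^sub>1 \<in> B \<leadsto> A" "s \<cdot> f\<^sub>1 = f \<cdot> s\<^sub>1" using denoms_pullback[OF S s(1) f] .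
    obtain C s\<^sub>2 g\<^sub>1 where q: "s\<^sub>2 \<in> denoms \<S> C X" "g\<^sub>1 \<in> C \<leadsto> A" "s \<cdot> g\<^sub>1 = g \<cdot> s\<^sub>2" using denoms_pullback[OF S s(1) g] .
    obtain W a b where w: "a \<in> W \<leadsto> B" "b \<in> W \<leadsto> C" "s\<^sub>1 \<cdot> a = s\<^sub>2 \<cdot> b" "s\<^sub>1 \<cdot> a \<in> denoms \<S> W X"
      using denoms_ore[OF S p(1) q(1)] .
    have h: "s \<in> A \<leadsto> Y" "s\<^sub>1 \<in> B \<leadsto> X" "s\<^sub>2 \<in> C \<leadsto> X" "s\<^sub>1 \<cdot> a \<in> W \<leadsto> X" using s p q w by blast+
    note fa = comp_closed[OF w(1) p(2)] and gb = comp_closed[OF w(2) q(2)]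
    have 1: "s \<cdot> (f\<^sub>1 \<cdot> a) = f \<cdot> (s\<^sub>1 \<cdot> a)"
      using comp_assoc[OF w(1) p(2) h(1)] p(3) comp_assoc[OF w(1) h(2) f] by simp
    have 2: "s \<cdot> (g\<^sub>1 \<cdot> b) = g \<cdot> (s\<^sub>1 \<cdot> a)"
      using comp_assoc[OF w(2) q(2) h(1)] q(3) comp_assoc[OF w(2) h(3) g] w(3) by simp
    have 3: "s \<cdot> (f\<^sub>1 \<cdot> a \<^bold>+ g\<^sub>1 \<cdot> b) = (f \<^bold>+ g) \<cdot> (s\<^sub>1 \<cdot> a)"
      using comp_add_right[OF fa gb h(1)] comp_add_left[OF h(4) f g] 1 2 by simp
    show ?thesis
      unfolding s(3) Loc_res[OF S F f s(1,2) w(4) fa 1] Loc_res[OF S F g s(1,2) w(4) gb 2]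
        Loc_res[OF S F add_closed[OF f g] s(1,2) w(4) add_closed[OF fa gb] 3] res_add[OF F fa gb s(2)]
        Loc_mult[OF S F w(4) res_closed[OF F fa s(2)] res_closed[OF F gb s(2)]] ..
  qed
next
  fix X f Y g Z h assume t: "tri X f Y g Z h"
  note f = triD(2)[OF t] and g = triD(3)[OF t] and o = triD(5-7)[OF t]
  show "Res LF f (Res LF g z) = \<one>\<^bsub>Val LF X\<^esub>" if z: "z \<in> el LF Z" for z
  proof -
    obtain A s y where s: "s \<in> denoms \<S> A Z" "y \<in> el F A" "z = lgF s y" using Loc_elem[OF z] .
    obtain B s' g' where p: "s' \<in> denoms \<S> B Y" "g' \<in> B \<leadsto> A" "s \<cdot> g' = g \<cdot> s'"
      "\<And>y. y \<in> el F A \<Longrightarrow> Res LF g (lgF s y) = lgF s' (Res F g' y)" using Loc_res_elem[OF g s(1)] by metis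
    obtain C s'' f' where q: "s'' \<in> denoms \<S> C X" "f' \<in> C \<leadsto> B" "s' \<cdot> f' = f \<cdot> s''"
      "\<And>y. y \<in> el F B \<Longrightarrow> Res LF f (lgF s' y) = lgF s'' (Res F f' y)" using Loc_res_elem[OF f p(1)] by metis
    have h: "s \<in> A \<leadsto> Z" "s' \<in> B \<leadsto> Y" "s'' \<in> C \<leadsto> X" using s p q by blast+
    note gf = comp_closed[OF q(2) p(2)] and oC = homD(4)[OF h(3)] and oA = homD(4)[OF h(1)]
    \<comment> \<open>The composite of the lifted arrows need not be zero. It becomes zero after
      \<open>s\<close>, hence on a further denominator, and refinement does not change the
      germ.\<close>
    have "s \<cdot> (g' \<cdot> f') = s \<cdot> Zero \<T> C A"
      using comp_assoc[OF q(2) p(2) h(1)] p(3) comp_assoc[OF q(2) h(2) g] q(3) comp_assoc[OF h(3) f g]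
        tri_comp_zero(1)[OF t] comp_zero_left[OF h(3) o(3)] comp_zero_right[OF h(1) oC] by simp
    then obtain D r where r: "r \<in> denoms \<S> D C" "g' \<cdot> f' \<cdot> r = Zero \<T> C A \<cdot> r"
      using denoms_cancel[OF S s(1) gf zero_closed[OF oC oA]] by metis
    have rh: "r \<in> D \<leadsto> C" using r by blast
    have gf0: "Res F (g' \<cdot> f' \<cdot> r) y = \<one>\<^bsub>Val F D\<^esub>"
      using r(2) comp_zero_left[OF rh oA] res_zero[OF F homD(4)[OF rh] oA s(2)] by simp
    note sr = denoms_comp[OF S r(1) q(1)]
    have "Res LF f (Res LF g z) = lgF s'' (Res F (g' \<cdot> f') y)"
      unfolding s(3) p(4)[OF s(2)] q(4)[OF res_closed[OF F p(2) s(2)]] res_comp[OF F q(2) p(2) s(2)] ..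
    also have "\<dots> = lgF (s'' \<cdot> r) (Res F r (Res F (g' \<cdot> f') y))"
      using lg_refine[OF S F q(1) rh _ res_closed[OF F gf s(2)]] sr by simp
    also have "\<dots> = \<one>\<^bsub>Val LF X\<^esub>"
      using res_comp[OF F rh gf s(2)] gf0 lg_one[OF S F sr] Loc_one[OF S F o(1)] by simp
    finally show ?thesis .
  qed
  show "\<exists>z \<in> el LF Z. Res LF g z = y" if y: "y \<in> el LF Y" "Res LF f y = \<one>\<^bsub>Val LF X\<^esub>" for y
  proof -
    obtain A s y\<^sub>0 where s: "s \<in> denoms \<S> A Y" "y\<^sub>0 \<in> el F A" "y = lgF s y\<^sub>0" using Loc_elem[OF y(1)] .
    obtain B s' f' where p: "s' \<in> denoms \<S> B X" "f' \<in> B \<leadsto> A" "s \<cdot> f' = f \<cdot> s'"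
      "\<And>y. y \<in> el F A \<Longrightarrow> Res LF f (lgF s y) = lgF s' (Res F f' y)" using Loc_res_elem[OF f s(1)] by metis
    have "lgF s' (Res F f' y\<^sub>0) = \<one>\<^bsub>Val LF X\<^esub>" using y(2) s(3) p(4)[OF s(2)] by simp
    then obtain W u where u: "u \<in> W \<leadsto> B" "s' \<cdot> u \<in> denoms \<S> W X" "Res F u (Res F f' y\<^sub>0) = \<one>\<^bsub>Val F W\<^esub>"
      using Loc_one_refine[OF p(1) res_closed[OF F p(2) s(2)]] by metis
    have h: "s \<in> A \<leadsto> Y" "s' \<in> B \<leadsto> X" using s p by blast+
    note fu = comp_closed[OF u(1) p(2)]
    \<comment> \<open>Exactness of F is applied to a triangle over the refinement W, where the
      representative restricts to the neutral element. By \<open>denoms_cone\<close> the map of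
      cones is a denominator over Z, so the preimage found in F defines a germ there.\<close>
    obtain g\<^sub>0 Z\<^sub>0 h\<^sub>0 where t0: "tri W (f' \<cdot> u) A g\<^sub>0 Z\<^sub>0 h\<^sub>0" using tri_exists[OF fu] .
    have "s \<cdot> (f' \<cdot> u) = f \<cdot> (s' \<cdot> u)"
      using comp_assoc[OF u(1) p(2) h(1)] p(3) comp_assoc[OF u(1) h(2) f] by simp
    then obtain w where w: "w \<in> denoms \<S> Z\<^sub>0 Z" "w \<cdot> g\<^sub>0 = g \<cdot> s" using denoms_cone[OF S t t0 u(2) s(1)] by metis
    have "Res F (f' \<cdot> u) y\<^sub>0 = \<one>\<^bsub>Val F W\<^esub>" using res_comp[OF F u(1) p(2) s(2)] u(3) by simp
    then obtain z where z: "z \<in> el F Z\<^sub>0" "Res F g\<^sub>0 z = y\<^sub>0" using res_exact[OF F t0 s(2)] by metis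
    have "Res LF g (lgF w z) = y" using Loc_res[OF S F g w(1) z(1) s(1) triD(3)[OF t0] w(2)] z(2) s(3) by simp
    then show ?thesis using Loc_closed[OF S F w(1) z(1)] by blast
  qed
qed

text \<open>For X in \<S> the morphism from a zero object to X is a denominator, so every germ can
  be refined to one represented at a zero object, where F is trivial.\<close>

lemma Loc_vanishes:
  assumes X: "X \<in> \<S>" shows "el LF X = {\<one>\<^bsub>Val LF X\<^esub>}"
proof -
  obtain N where N: "zero_object \<T> N" using zero_object_exists by blast
  have o: "X \<in> Obj \<T>" "N \<in> Obj \<T>" using thick_obj[OF S X] zero_object_hom(1)[OF N] by blast+
  have "z = \<one>\<^bsub>Val LF X\<^esub>" if z: "z \<in> el LF X" for z
  proof -
    obtain A s y where s: "s \<in> denoms \<S> A X" "y \<in> el F A" "z = lgF s y" using Loc_elem[OF z] .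
    have h: "s \<in> A \<leadsto> X" using s by blast
    have u: "Zero \<T> N A \<in> N \<leadsto> A" using zero_closed[OF o(2) homD(4)[OF h]] .
    have su: "s \<cdot> Zero \<T> N A \<in> denoms \<S> N X" using comp_zero_right[OF h o(2)] denoms_zero[OF S X N] by simp
    have "z = lgF (s \<cdot> Zero \<T> N A) (Res F (Zero \<T> N A) y)" using lg_refine[OF S F s(1) u _ s(2)] su s(3) by simp
    then show ?thesis using res_zero[OF F o(2) homD(4)[OF h] s(2)] lg_one[OF S F su] Loc_one[OF S F o(1)] by simp
  qed
  then show ?thesis using comm_groupE(2)[OF Loc_group[OF o(1)]] by blast
qed

section \<open>Functoriality of the localisation in the functor and in the subcategory\<close>

lemma Loc_map_lg:
  fixes F' :: "('o, 'm, 'g) presheaf"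
  assumes F': "cohomological \<T> F'" and \<alpha>: "natural_transformation \<T> F F' \<alpha>"
    and s: "s \<in> denoms \<S> A Y" "y \<in> el F A"
  shows "Loc_map \<T> \<S> F' \<alpha> Y (lgF s y) = lg \<S> F' s (\<alpha> A y)"
proof -
  have \<alpha>c: "\<alpha> X x \<in> el F' X" if "X \<in> Obj \<T>" "x \<in> el F X" for X x
    using \<alpha> that unfolding natural_transformation_def hom_def by blast
  have \<alpha>n: "\<alpha> X (Res F f x) = Res F' f (\<alpha> X' x)" if "f \<in> X \<leadsto> X'" "x \<in> el F X'" for X X' f x
    using \<alpha> that unfolding natural_transformation_def by blast
  have A: "A \<in> Obj \<T>" using denoms_obj[OF s(1)] by blast
  show ?thesis unfolding Loc_map_def
  proof (rule Union_eqI)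
    have "germ \<T> \<S> F' Y (A, \<alpha> A y, frac \<T> \<S> s (Id \<T> A)) = lg \<S> F' s (\<alpha> A y)" using lg_eq[OF S F' s(1)] by simp
    then show "lg \<S> F' s (\<alpha> A y) \<in> {germ \<T> \<S> F' Y (X, \<alpha> X x, \<phi>) | X x \<phi>. (X, x, \<phi>) \<in> lgF s y}"
      using lg_mem_self[OF S F s] by blast
  next
    fix w assume "w \<in> {germ \<T> \<S> F' Y (X, \<alpha> X x, \<phi>) | X x \<phi>. (X, x, \<phi>) \<in> lgF s y}"
    then obtain X x \<phi> where w: "w = germ \<T> \<S> F' Y (X, \<alpha> X x, \<phi>)" "(X, x, \<phi>) \<in> lgF s y" by blast
    obtain B t f where t: "t \<in> denoms \<S> B Y" "f \<in> B \<leadsto> X" "x \<in> el F X" "\<phi> = frac \<T> \<S> t f" "lgF t (Res F f x) = lgF s y"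
      using lg_memE[OF S F w(2) s] .
    note fx = res_closed[OF F t(2,3)] and o = homD(4,5)[OF t(2)]
    have h: "t \<in> B \<leadsto> Y" "s \<in> A \<leadsto> Y" using s t by blast+
    have "lrel \<S> (Res F) t (Res F f x) s y" using lg_eq_iff[OF S F t(1) fx s] t(5) by simp
    then obtain W u v where u: "u \<in> W \<leadsto> B" "v \<in> W \<leadsto> A" "t \<cdot> u = s \<cdot> v" "t \<cdot> u \<in> denoms \<S> W Y"
      "Res F u (Res F f x) = Res F v y" using lrelE[OF _ h] by metis
    have "lrel \<S> (Res F') t (\<alpha> B (Res F f x)) s (\<alpha> A y)"
      using lrelI[OF h u(1-3), of \<S> "Res F'"] u(4,5) \<alpha>n[OF u(1) fx] \<alpha>n[OF u(2) s(2)] by simp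
    then have "lg \<S> F' t (\<alpha> B (Res F f x)) = lg \<S> F' s (\<alpha> A y)"
      using lg_eq_iff[OF S F' t(1) \<alpha>c[OF o(1) fx] s(1) \<alpha>c[OF A s(2)]] by simp
    then show "w = lg \<S> F' s (\<alpha> A y)"
      unfolding w(1) t(4) germ_lg[OF S F' t(1,2) \<alpha>c[OF o(2) t(3)]] \<alpha>n[OF t(2,3)] .
  qed
qed

lemma Loc_incl_lg:
  assumes S': "\<S>' \<in> Thick \<T>" and sub: "\<S> \<subseteq> \<S>'" and s: "s \<in> denoms \<S> A Y" "y \<in> el F A"
  shows "Loc_incl \<T> \<S>' F Y (lgF s y) = lg \<S>' F s y"
proof -
  have d: "t \<in> denoms \<S>' B Z" if "t \<in> denoms \<S> B Z" for t B Z using denoms_mono[OF sub] that by blast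
  have qc: "quotient_change \<T> \<S>' (frac \<T> \<S> t f) = frac \<T> \<S>' t f" if t: "t \<in> denoms \<S> B Y" "f \<in> B \<leadsto> X" for t f B X
    unfolding quotient_change_def
  proof (rule Union_eqI)
    show "frac \<T> \<S>' t f \<in> {frac \<T> \<S>' a k |a k. (a, k) \<in> frac \<T> \<S> t f}" using frac_self[OF S t] by blast
    fix w assume "w \<in> {frac \<T> \<S>' a k |a k. (a, k) \<in> frac \<T> \<S> t f}"
    then obtain t' f' where w: "w = frac \<T> \<S>' t' f'" "(t', f') \<in> frac \<T> \<S> t f" by blast
    obtain B' where B': "t' \<in> denoms \<S> B' Y" "f' \<in> B' \<leadsto> X" "lrel \<S> precomp t f t' f'"
      using w(2) unfolding frac_mem[OF S t] by blast
    show "w = frac \<T> \<S>' t f"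
      unfolding w(1) using frac_eqI[OF S' d[OF t(1)] t(2) d[OF B'(1)] B'(2) lrel_mono[OF sub B'(3)]] by simp
  qed
  have A: "A \<in> Obj \<T>" using denoms_obj[OF s(1)] by blast
  show ?thesis unfolding Loc_incl_def
  proof (rule Union_eqI)
    have "germ \<T> \<S>' F Y (A, y, quotient_change \<T> \<S>' (frac \<T> \<S> s (Id \<T> A))) = lg \<S>' F s y"
      using lg_eq[OF S' F d[OF s(1)]] qc[OF s(1) id_closed[OF A]] by simp
    then show "lg \<S>' F s y \<in> {germ \<T> \<S>' F Y (X, x, quotient_change \<T> \<S>' \<phi>) | X x \<phi>. (X, x, \<phi>) \<in> lgF s y}"
      using lg_mem_self[OF S F s] by blast
  next
    fix w assume "w \<in> {germ \<T> \<S>' F Y (X, x, quotient_change \<T> \<S>' \<phi>) | X x \<phi>. (X, x, \<phi>) \<in> lgF s y}"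
    then obtain X x \<phi> where w: "w = germ \<T> \<S>' F Y (X, x, quotient_change \<T> \<S>' \<phi>)" "(X, x, \<phi>) \<in> lgF s y" by blast
    obtain B t f where t: "t \<in> denoms \<S> B Y" "f \<in> B \<leadsto> X" "x \<in> el F X" "\<phi> = frac \<T> \<S> t f" "lgF t (Res F f x) = lgF s y"
      using lg_memE[OF S F w(2) s] .
    note fx = res_closed[OF F t(2,3)]
    have "lrel \<S>' (Res F) t (Res F f x) s y" 
      using lrel_mono[OF sub, of "Res F" t "Res F f x" s y] lg_eq_iff[OF S F t(1) fx s] t(5) by simp
    then have "lg \<S>' F t (Res F f x) = lg \<S>' F s y" using lg_eq_iff[OF S' F d[OF t(1)] fx d[OF s(1)] s(2)] by simp
    then show "w = lg \<S>' F s y" unfolding w(1) t(4) qc[OF t(1,2)] germ_lg[OF S' F d[OF t(1)] t(2,3)] .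
  qed
qed

lemma Loc_incl_natural:
  assumes S': "\<S>' \<in> Thick \<T>" and sub: "\<S> \<subseteq> \<S>'"
  shows "natural_transformation \<T> LF (Loc \<T> \<S>' F) (Loc_incl \<T> \<S>' F)"
proof -
  note L = Loc_incl_lg[OF S' sub]
  have d: "t \<in> denoms \<S>' B Z" if "t \<in> denoms \<S> B Z" for t B Z using denoms_mono[OF sub] that by blast
  have "Loc_incl \<T> \<S>' F Y \<in> hom (Val LF Y) (Val (Loc \<T> \<S>' F) Y)" if Y: "Y \<in> Obj \<T>" for Y
  proof (rule homI)
    show "Loc_incl \<T> \<S>' F Y z \<in> el (Loc \<T> \<S>' F) Y" if z: "z \<in> el LF Y" for z
    proof -
      obtain A s y where s: "s \<in> denoms \<S> A Y" "y \<in> el F A" "z = lgF s y" using Loc_elem[OF z] .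
      show ?thesis unfolding s(3) L[OF s(1,2)] using Loc_closed[OF S' F d[OF s(1)] s(2)] .
    qed
    show "Loc_incl \<T> \<S>' F Y (z \<otimes>\<^bsub>Val LF Y\<^esub> z') =
        Loc_incl \<T> \<S>' F Y z \<otimes>\<^bsub>Val (Loc \<T> \<S>' F) Y\<^esub> Loc_incl \<T> \<S>' F Y z'"
      if z: "z \<in> el LF Y" "z' \<in> el LF Y" for z z'
    proof -
      obtain A s y\<^sub>1 y\<^sub>2 where s: "s \<in> denoms \<S> A Y" "y\<^sub>1 \<in> el F A" "y\<^sub>2 \<in> el F A" "z = lgF s y\<^sub>1" "z' = lgF s y\<^sub>2"
        using Loc_common2[OF z] .
      have "y\<^sub>1 \<otimes>\<^bsub>Val F A\<^esub> y\<^sub>2 \<in> el F A" using comm_groupE(1)[OF val_group[OF F denoms_obj(1)[OF s(1)]] s(2,3)] .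
      then show ?thesis
        unfolding s(4,5) Loc_mult[OF S F s(1-3)] L[OF s(1,2)] L[OF s(1,3)] Loc_mult[OF S' F d[OF s(1)] s(2,3)]
        by (rule L[OF s(1)])
    qed
  qed
  moreover have "Loc_incl \<T> \<S>' F X (Res LF f z) = Res (Loc \<T> \<S>' F) f (Loc_incl \<T> \<S>' F Y z)"
    if f: "f \<in> X \<leadsto> Y" and z: "z \<in> el LF Y" for X Y f z
  proof -
    obtain A s y where s: "s \<in> denoms \<S> A Y" "y \<in> el F A" "z = lgF s y" using Loc_elem[OF z] .
    obtain B s' f' where p: "s' \<in> denoms \<S> B X" "f' \<in> B \<leadsto> A" "s \<cdot> f' = f \<cdot> s'" using denoms_pullback[OF S s(1) f] .
    show ?thesis
      unfolding s(3) Loc_res[OF S F f s(1,2) p] L[OF s(1,2)] L[OF p(1) res_closed[OF F p(2) s(2)]]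
        Loc_res[OF S' F f d[OF s(1)] s(2) d[OF p(1)] p(2,3)] ..
  qed
  ultimately show ?thesis unfolding natural_transformation_def by blast
qed

end

end

text \<open>The properties of the map from a smaller to a larger localisation from which exactness
  is derived without germs: after restriction along some denominator every element of H comes from G
  and every element of the kernel is trivial, and H vanishes on \<S>.\<close>

definition localisation :: "'o set \<Rightarrow> ('o, 'm, 'a) presheaf \<Rightarrow> ('o, 'm, 'b) presheaf \<Rightarrow> ('o \<Rightarrow> 'a \<Rightarrow> 'b) \<Rightarrow> bool" where
  "localisation \<S> G H \<eta> \<longleftrightarrow> cohomological \<T> G \<and> cohomological \<T> H \<and> natural_transformation \<T> G H \<eta> \<and>
    (\<forall>Y. \<forall>z \<in> el H Y. Y \<in> Obj \<T> \<longrightarrow> (\<exists>X. \<exists>s \<in> denoms \<S> X Y. \<exists>x \<in> el G X. Res H s z = \<eta> X x)) \<and>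
    (\<forall>Y. \<forall>x \<in> el G Y. Y \<in> Obj \<T> \<longrightarrow> \<eta> Y x = \<one>\<^bsub>Val H Y\<^esub> \<longrightarrow> (\<exists>X. \<exists>s \<in> denoms \<S> X Y. Res G s x = \<one>\<^bsub>Val G X\<^esub>)) \<and>
    (\<forall>X \<in> \<S>. el H X = {\<one>\<^bsub>Val H X\<^esub>})"

text \<open>A germ represented by \<open>y\<close> over \<open>s\<close> becomes, after restriction
  along \<open>s\<close> itself, the germ of \<open>y\<close> over an identity, which is available
  for \<I> as well.\<close>

lemma Loc_localisation:
  fixes F :: "('o, 'm, 'g) presheaf"
  assumes I: "\<I> \<in> Thick \<T>" and S: "\<S> \<in> Thick \<T>" and sub: "\<I> \<subseteq> \<S>" and F: "cohomological \<T> F"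
  shows "localisation \<S> (Loc \<T> \<I> F) (Loc \<T> \<S> F) (Loc_incl \<T> \<S> F)"
  unfolding localisation_def
proof (intro conjI allI ballI impI)
  fix Y z assume z: "z \<in> el (Loc \<T> \<S> F) Y"
  obtain A s y where s: "s \<in> denoms \<S> A Y" "y \<in> el F A" "z = lg \<S> F s y" using Loc_elem[OF S F z] .
  have h: "s \<in> A \<leadsto> Y" and A: "A \<in> Obj \<T>" using s denoms_obj by blast+
  note i = denoms_id[OF I A] and i' = denoms_id[OF S A]
  have "Res (Loc \<T> \<S> F) s z = lg \<S> F (Id \<T> A) y"
    using Loc_res[OF S F h s(1,2) i' id_closed[OF A]] res_id[OF F s(2) A] s(3) by simp
  then have "Res (Loc \<T> \<S> F) s z = Loc_incl \<T> \<S> F A (lg \<I> F (Id \<T> A) y)"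
    using Loc_incl_lg[OF I F S sub i s(2)] by simp
  then show "\<exists>X. \<exists>s \<in> denoms \<S> X Y. \<exists>x \<in> el (Loc \<T> \<I> F) X. Res (Loc \<T> \<S> F) s z = Loc_incl \<T> \<S> F X x"
    using s(1) Loc_closed[OF I F i s(2)] by blast
next
  fix Y x assume x: "x \<in> el (Loc \<T> \<I> F) Y" "Loc_incl \<T> \<S> F Y x = \<one>\<^bsub>Val (Loc \<T> \<S> F) Y\<^esub>"
  obtain A s y where s: "s \<in> denoms \<I> A Y" "y \<in> el F A" "x = lg \<I> F s y" using Loc_elem[OF I F x(1)] .
  have h: "s \<in> A \<leadsto> Y" and A: "A \<in> Obj \<T>" and s': "s \<in> denoms \<S> A Y"
    using s denoms_obj denoms_mono[OF sub, of A Y] by blast+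
  have "lg \<S> F s y = \<one>\<^bsub>Val (Loc \<T> \<S> F) Y\<^esub>" using Loc_incl_lg[OF I F S sub s(1,2)] x(2) s(3) by simp
  then obtain B u where u: "u \<in> B \<leadsto> A" "s \<cdot> u \<in> denoms \<S> B Y" "Res F u y = \<one>\<^bsub>Val F B\<^esub>"
    using Loc_one_refine[OF S F s' s(2)] by blast
  note B = homD(4)[OF u(1)]
  note i = denoms_id[OF I B]
  have su: "s \<cdot> u \<in> B \<leadsto> Y" using comp_closed[OF u(1) h] .
  have "Res (Loc \<T> \<I> F) (s \<cdot> u) x = lg \<I> F (Id \<T> B) (Res F u y)"
    using Loc_res[OF I F su s(1,2) i u(1)] id_right[OF su] s(3) by simp
  then have "Res (Loc \<T> \<I> F) (s \<cdot> u) x = \<one>\<^bsub>Val (Loc \<T> \<I> F) B\<^esub>" using u(3) Loc_one[OF I F B] by simp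
  then show "\<exists>X. \<exists>s \<in> denoms \<S> X Y. Res (Loc \<T> \<I> F) s x = \<one>\<^bsub>Val (Loc \<T> \<I> F) X\<^esub>" using u(2) by blast
qed (use Loc_cohomological[OF _ F] I S Loc_incl_natural[OF I F S sub] Loc_vanishes[OF S F] in blast)+

lemma Loc_incl_comp:
  fixes F :: "('o, 'm, 'g) presheaf"
  assumes I: "\<I> \<in> Thick \<T>" and S: "\<S> \<in> Thick \<T>" "\<I> \<subseteq> \<S>" and S': "\<S>' \<in> Thick \<T>" "\<S> \<subseteq> \<S>'"
    and F: "cohomological \<T> F" and z: "z \<in> el (Loc \<T> \<I> F) Y"
  shows "Loc_incl \<T> \<S>' F Y (Loc_incl \<T> \<S> F Y z) = Loc_incl \<T> \<S>' F Y z"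
proof -
  obtain A s y where s: "s \<in> denoms \<I> A Y" "y \<in> el F A" "z = lg \<I> F s y" using Loc_elem[OF I F z] .
  have "s \<in> denoms \<S> A Y" using denoms_mono[OF S(2)] s(1) by blast
  then show ?thesis
    unfolding s(3) Loc_incl_lg[OF I F S s(1,2)] Loc_incl_lg[OF I F S'(1) subset_trans[OF S(2) S'(2)] s(1,2)]
    by (rule Loc_incl_lg[OF S(1) F S' _ s(2)])
qed

end

section \<open>Commuting pairs\<close>

context triangulated_category
begin

text \<open>The sign is the one that three rotations of the triangle put on
  \<open>\<Sigma>\<^sub>1 s\<close>; it cancels in products of two such morphisms.\<close>

lemma denoms_susp:
  assumes S: "\<S> \<in> Thick \<T>" and s: "s \<in> denoms \<S> X Y"
  shows "neg \<T> (\<Sigma>\<^sub>1 s) \<in> denoms \<S> (\<Sigma>\<^sub>0 X) (\<Sigma>\<^sub>0 Y)"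
proof -
  obtain g C h where t: "tri X s Y g C h" "C \<in> \<S>" using denomsE[OF s] .
  show ?thesis using denomsI[OF tri_rotate[OF tri_rotate[OF tri_rotate[OF t(1)]]]] thick_susp[OF S t(2)] by blast
qed

lemma denoms_desusp:
  assumes S: "\<S> \<in> Thick \<T>" and s: "s \<in> denoms \<S> X Y"
  shows "neg \<T> (\<Omega>\<^sub>1 s) \<in> denoms \<S> (\<Omega>\<^sub>0 X) (\<Omega>\<^sub>0 Y)"
proof -
  obtain W i k where t: "tri W i X s Y k" "W \<in> \<S>" using denoms_fiberE[OF S s] .
  note s = triD(3)[OF t(1)] and o = triD(5-7)[OF t(1)]
  obtain j where j: "tri (\<Omega>\<^sub>0 Y) j W i X (eps' Y \<cdot> s)" using tri_desusp[OF t(1)] by blast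
  obtain r where r: "\<Sigma>\<^sub>1 r = neg \<T> (eps' Y \<cdot> s \<cdot> eps X)" "tri (\<Omega>\<^sub>0 X) r (\<Omega>\<^sub>0 Y) j W (eps' X \<cdot> i)"
    using tri_desusp[OF j] by blast
  note e = eps_hom[OF o(2)] and e' = eps'(1)[OF o(3)] and Os = desusp(3)[OF s]
  have "eps' Y \<cdot> s \<cdot> eps X = \<Sigma>\<^sub>1 (\<Omega>\<^sub>1 s)"
    using comp_assoc[OF e s e'] eps_natural[OF s] comp_assoc[OF susp(3)[OF Os] eps_hom[OF o(3)] e']
      eps'(2)[OF o(3)] id_left[OF susp(3)[OF Os]] by simp
  then have "\<Sigma>\<^sub>1 r = \<Sigma>\<^sub>1 (neg \<T> (\<Omega>\<^sub>1 s))" using r(1) susp_neg[OF Os] by simp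
  then have "r = neg \<T> (\<Omega>\<^sub>1 s)" using susp_faithful[OF triD(2)[OF r(2)] neg_closed[OF Os]] by simp
  then show ?thesis using denomsI[OF r(2) t(2)] by simp
qed

section \<open>Interchange of denominators for a commuting pair, and the objects of the join\<close>

lemma commutingE:
  assumes "commuting \<T> \<U> \<V>" "\<U> \<in> Thick \<T>" "f \<in> X \<leadsto> Y" "X \<in> \<V>" "Y \<in> \<U>"
  obtains Q u v where "Q \<in> \<U> \<inter> \<V>" "u \<in> X \<leadsto> Q" "v \<in> Q \<leadsto> Y" "f = v \<cdot> u"
  using assms(1,3-5) factorsE[OF _ assms(3)] unfolding commuting_def thick_meet_pair[OF assms(2)] by blast

context
  fixes \<U> \<V> assumes U: "\<U> \<in> Thick \<T>" and V: "\<V> \<in> Thick \<T>" and comm: "commuting \<T> \<U> \<V>"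
begin

text \<open>After shrinking the source, a \<U>-denominator followed by a \<V>-denominator can be
  rewritten with the \<V>-denominator applied before the \<U>-denominator. The obstruction is one
  morphism, from the fibre B of \<open>t\<close> to the cone A of \<open>s\<close>, and
  commutativity controls it.\<close>

lemma denoms_swap:
  assumes s: "s \<in> denoms \<U> X Y" and t: "t \<in> denoms \<V> Y Z"
  obtains Z' t' W s' w where "t' \<in> denoms \<U> Z' Z" "s' \<in> denoms \<V> W Z'" "w \<in> W \<leadsto> X" "t \<cdot> (s \<cdot> w) = t' \<cdot> s'"
proof -
  obtain \<kappa> A h where A: "tri X s Y \<kappa> A h" "A \<in> \<U>" using denomsE[OF s] .
  obtain B b k where B: "tri B b Y t Z k" "B \<in> \<V>" using denoms_fiberE[OF V t] .
  note s = triD(2)[OF A(1)] and \<kappa> = triD(3)[OF A(1)] and b = triD(2)[OF B(1)] and th = triD(3)[OF B(1)]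
  obtain Q q\<^sub>1 q\<^sub>2 where Q: "Q \<in> \<U> \<inter> \<V>" "q\<^sub>1 \<in> B \<leadsto> Q" "q\<^sub>2 \<in> Q \<leadsto> A" "\<kappa> \<cdot> b = q\<^sub>2 \<cdot> q\<^sub>1"
    using commutingE[OF comm U comp_closed[OF b \<kappa>] B(2) A(2)] .
  \<comment> \<open>Replacing A by the cone of \<open>q\<^sub>2\<close> kills the obstruction and
    stays in \<U>. The morphism to it therefore descends to Z, and its fibre is the required
    \<open>t'\<close>.\<close>
  obtain g A\<^sub>1 m where g: "tri Q q\<^sub>2 A g A\<^sub>1 m" using tri_exists[OF Q(3)] .
  note gh = triD(3)[OF g]
  have A1: "A\<^sub>1 \<in> \<U>" using thick_cone[OF U g] Q(1) A(2) by blast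
  have "g \<cdot> \<kappa> \<cdot> b = Zero \<T> B A\<^sub>1"
    using comp_assoc[OF b \<kappa> gh] Q(4) comp_assoc[OF Q(2,3) gh] tri_comp_zero(1)[OF g] comp_zero_left[OF Q(2) triD(7)[OF g]] by simp
  then obtain k' where k': "k' \<in> Z \<leadsto> A\<^sub>1" "k' \<cdot> t = g \<cdot> \<kappa>" using weak_cokernel[OF B(1) comp_closed[OF \<kappa> gh]] by metis
  obtain Z' t' n where t': "tri Z' t' Z k' A\<^sub>1 n" using tri_fiber[OF k'(1)] .
  note t'h = triD(2)[OF t']
  obtain P q p where p: "q \<in> denoms \<V> P Z'" "p \<in> P \<leadsto> Y" "t \<cdot> p = t' \<cdot> q" using denoms_pullback[OF V t t'h] .
  have qh: "q \<in> P \<leadsto> Z'" using p(1) by blast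
  have \<kappa>p: "\<kappa> \<cdot> p \<in> P \<leadsto> A" using comp_closed[OF p(2) \<kappa>] .
  have "g \<cdot> (\<kappa> \<cdot> p) = Zero \<T> P A\<^sub>1"
    using comp_assoc[OF p(2) \<kappa> gh] k'(2) comp_assoc[OF p(2) th k'(1)] p(3) comp_assoc[OF qh t'h k'(1)]
      tri_comp_zero(1)[OF t'] comp_zero_left[OF qh triD(7)[OF g]] by simp
  then obtain c where c: "c \<in> P \<leadsto> Q" "q\<^sub>2 \<cdot> c = \<kappa> \<cdot> p" using weak_kernel[OF g \<kappa>p] by metis
  \<comment> \<open>Passing from A to \<open>A\<^sub>1\<close> leaves an error \<open>c\<close> with
    values in Q. As Q lies in \<V> too, the fibre of \<open>c\<close> is one more
    \<V>-denominator.\<close>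
  obtain W r n' where r: "tri W r P c Q n'" using tri_fiber[OF c(1)] .
  note rh = triD(2)[OF r]
  have rV: "r \<in> denoms \<V> W P" using denomsI[OF r] Q(1) by blast
  have "\<kappa> \<cdot> (p \<cdot> r) = Zero \<T> W A"
    using comp_assoc[OF rh p(2) \<kappa>] c(2) comp_assoc[OF rh c(1) Q(3)] tri_comp_zero(1)[OF r]
      comp_zero_right[OF Q(3) triD(5)[OF r]] by simp
  then obtain w where w: "w \<in> W \<leadsto> X" "s \<cdot> w = p \<cdot> r" using weak_kernel[OF A(1) comp_closed[OF rh p(2)]] by metis
  have "t \<cdot> (s \<cdot> w) = t' \<cdot> (q \<cdot> r)"
    using w(2) comp_assoc[OF rh p(2) th] p(3) comp_assoc[OF rh qh t'h] by simp
  then show thesis using that denomsI[OF t' A1] denoms_comp[OF V rV p(1)] w(1) by blast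
qed

text \<open>Objects that vanish after localising at \<open>\<U>\<close> and then at \<open>\<V>\<close>. They form a thick subcategory
  because the two localisations can be interchanged.\<close>

definition killed :: "'o set" where
  "killed = {C \<in> Obj \<T>. \<exists>Y Z s t. s \<in> denoms \<U> Y C \<and> t \<in> denoms \<V> Z Y \<and> s \<cdot> t = Zero \<T> Z C}"

lemma killedI: "s \<in> denoms \<U> Y C \<Longrightarrow> t \<in> denoms \<V> Z Y \<Longrightarrow> s \<cdot> t = Zero \<T> Z C \<Longrightarrow> C \<in> killed"
  unfolding killed_def using denoms_obj(2)[of s Y C \<U>] by blast

lemma killed_pull:
  assumes C: "C \<in> killed" and k: "k \<in> X \<leadsto> C"
  obtains Y Z s t where "s \<in> denoms \<U> Y X" "t \<in> denoms \<V> Z Y" "k \<cdot> (s \<cdot> t) = Zero \<T> Z C"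
proof -
  obtain Y Z s t where st: "s \<in> denoms \<U> Y C" "t \<in> denoms \<V> Z Y" "s \<cdot> t = Zero \<T> Z C"
    using C unfolding killed_def by blast
  obtain Y' s' k' where s': "s' \<in> denoms \<U> Y' X" "k' \<in> Y' \<leadsto> Y" "s \<cdot> k' = k \<cdot> s'" using denoms_pullback[OF U st(1) k] .
  obtain Z' t' k'' where t': "t' \<in> denoms \<V> Z' Y'" "k'' \<in> Z' \<leadsto> Z" "t \<cdot> k'' = k' \<cdot> t'" using denoms_pullback[OF V st(2) s'(2)] .
  have h: "s \<in> Y \<leadsto> C" "t \<in> Z \<leadsto> Y" "s' \<in> Y' \<leadsto> X" "t' \<in> Z' \<leadsto> Y'" using st s' t' by blast+
  have "k \<cdot> (s' \<cdot> t') = Zero \<T> Z' C"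
    using comp_assoc[OF h(4,3) k] s'(3) comp_assoc[OF h(4) s'(2) h(1)] t'(3) comp_assoc[OF t'(2) h(2,1)] st(3)
      comp_zero_left[OF t'(2) homD(5)[OF k]] by simp
  then show thesis using that s'(1) t'(1) by blast
qed

lemma killed_thick: "killed \<in> Thick \<T>"
proof -
  obtain N where N: "zero_object \<T> N" using zero_object_exists by blast
  note oN = zero_object_hom(1)[OF N]
  show ?thesis
  proof (rule thickI[OF _ _ N])
    show "killed \<subseteq> Obj \<T>" unfolding killed_def by blast
    show "N \<in> killed"
      using killedI[OF denoms_id[OF U oN] denoms_id[OF V oN]]
        zero_object_hom(2)[OF N comp_closed[OF id_closed id_closed, OF oN oN]] by blast
  next
    fix X assume X: "X \<in> killed"
    then obtain Y Z s t where st: "s \<in> denoms \<U> Y X" "t \<in> denoms \<V> Z Y" "s \<cdot> t = Zero \<T> Z X" unfolding killed_def by blast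
    have h: "s \<in> Y \<leadsto> X" "t \<in> Z \<leadsto> Y" using st by blast+
    have neg2: "neg \<T> f \<cdot> neg \<T> g = f \<cdot> g" if "g \<in> A \<leadsto> B" "f \<in> B \<leadsto> C" for f g A B C
      using comp_neg_left[OF neg_closed[OF that(1)] that(2)] comp_neg_right[OF that] neg_neg[OF comp_closed[OF that]] by simp
    have "neg \<T> (\<Sigma>\<^sub>1 s) \<cdot> neg \<T> (\<Sigma>\<^sub>1 t) = Zero \<T> (\<Sigma>\<^sub>0 Z) (\<Sigma>\<^sub>0 X)"
      using neg2[OF susp(3)[OF h(2)] susp(3)[OF h(1)]] susp(4)[OF h(2,1)] st(3) susp_zero[OF homD(4)[OF h(2)] homD(5)[OF h(1)]] by simp
    then show "\<Sigma>\<^sub>0 X \<in> killed" using killedI[OF denoms_susp[OF U st(1)] denoms_susp[OF V st(2)]] by blast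
    have "neg \<T> (\<Omega>\<^sub>1 s) \<cdot> neg \<T> (\<Omega>\<^sub>1 t) = Zero \<T> (\<Omega>\<^sub>0 Z) (\<Omega>\<^sub>0 X)"
      using neg2[OF desusp(3)[OF h(2)] desusp(3)[OF h(1)]] desusp(4)[OF h(2,1)] st(3) desusp_zero[OF homD(4)[OF h(2)] homD(5)[OF h(1)]] by simp
    then show "\<Omega>\<^sub>0 X \<in> killed" using killedI[OF denoms_desusp[OF U st(1)] denoms_desusp[OF V st(2)]] by blast
  next
    fix X\<^sub>1 a X b X\<^sub>2 c assume t: "tri X\<^sub>1 a X b X\<^sub>2 c" and X: "X\<^sub>1 \<in> killed" "X\<^sub>2 \<in> killed"
    note a = triD(2)[OF t] and b = triD(3)[OF t]
    obtain Y Z s t' where st: "s \<in> denoms \<U> Y X" "t' \<in> denoms \<V> Z Y" "b \<cdot> (s \<cdot> t') = Zero \<T> Z X\<^sub>2" using killed_pull[OF X(2) b] .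
    have h: "s \<in> Y \<leadsto> X" "t' \<in> Z \<leadsto> Y" using st by blast+
    obtain e where e: "e \<in> Z \<leadsto> X\<^sub>1" "a \<cdot> e = s \<cdot> t'" using weak_kernel[OF t comp_closed[OF h(2,1)] st(3)] .
    obtain Y' Z' p q where p: "p \<in> denoms \<U> Y' Z" "q \<in> denoms \<V> Z' Y'" "e \<cdot> (p \<cdot> q) = Zero \<T> Z' X\<^sub>1" using killed_pull[OF X(1) e(1)] .
    have ph: "p \<in> Y' \<leadsto> Z" "q \<in> Z' \<leadsto> Y'" using p by blast+
    \<comment> \<open>The composite contains denominators in the order \<U>, \<V>, \<U>, \<V>.
      Exchanging the inner two allows those of each kind to be composed.\<close>
    obtain Y'' p' W t'' w where w: "p' \<in> denoms \<U> Y'' Y" "t'' \<in> denoms \<V> W Y''" "w \<in> W \<leadsto> Y'" "t' \<cdot> (p \<cdot> w) = p' \<cdot> t''"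
      using denoms_swap[OF p(1) st(2)] .
    obtain W' q' w' where q': "q' \<in> denoms \<V> W' W" "w' \<in> W' \<leadsto> Z'" "q \<cdot> w' = w \<cdot> q'" using denoms_pullback[OF V p(2) w(3)] .
    have wh: "p' \<in> Y'' \<leadsto> Y" "t'' \<in> W \<leadsto> Y''" "q' \<in> W' \<leadsto> W" using w q' by blast+
    note pw = comp_closed[OF w(3) ph(1)] and pq = comp_closed[OF ph(2,1)] and st' = comp_closed[OF h(2,1)]
    have "s \<cdot> p' \<cdot> (t'' \<cdot> q') = s \<cdot> (p' \<cdot> t'' \<cdot> q')"
      using comp_assoc[OF comp_closed[OF wh(3,2)] wh(1) h(1)] comp_assoc[OF wh(3,2,1)] by simp
    also have "\<dots> = s \<cdot> (t' \<cdot> (p \<cdot> w \<cdot> q'))" using w(4) comp_assoc[OF wh(3) pw h(2)] by simp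
    also have "\<dots> = s \<cdot> (t' \<cdot> (p \<cdot> q \<cdot> w'))" using comp_assoc[OF wh(3) w(3) ph(1)] q'(3) comp_assoc[OF q'(2) ph(2,1)] by simp
    also have "\<dots> = a \<cdot> e \<cdot> (p \<cdot> q) \<cdot> w'"
      using e(2) comp_assoc[OF comp_closed[OF q'(2) pq] h(2,1)] comp_assoc[OF q'(2) pq st'] by simp
    also have "\<dots> = Zero \<T> W' X"
      using comp_assoc[OF pq e(1) a] p(3) comp_zero_right[OF a homD(4)[OF ph(2)]] comp_zero_left[OF q'(2) homD(5)[OF a]] by simp
    finally show "X \<in> killed" using killedI[OF denoms_comp[OF U w(1) st(1)] denoms_comp[OF V q'(1) w(2)]] by blast
  next
    fix X i W p assume i: "i \<in> X \<leadsto> W" "p \<in> W \<leadsto> X" "p \<cdot> i = Id \<T> X" and W: "W \<in> killed"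
    obtain Y Z s t where st: "s \<in> denoms \<U> Y X" "t \<in> denoms \<V> Z Y" "i \<cdot> (s \<cdot> t) = Zero \<T> Z W" using killed_pull[OF W i(1)] .
    then have h: "s \<in> Y \<leadsto> X" "t \<in> Z \<leadsto> Y" by blast+
    note sth = comp_closed[OF h(2,1)]
    have "s \<cdot> t = Zero \<T> Z X"
      using comp_assoc[OF sth i(1,2)] st(3) i(3) id_left[OF sth] comp_zero_right[OF i(2) homD(4)[OF h(2)]] by simp
    then show "X \<in> killed" using killedI st by blast
  qed
qed

lemma join_killed: "thick_join \<T> {\<U>, \<V>} \<subseteq> killed"
proof (rule thick_join_least[OF _ killed_thick])
  obtain N where N: "zero_object \<T> N" using zero_object_exists by blast
  note oN = zero_object_hom(1)[OF N]
  have 1: "C \<in> killed" if C: "C \<in> \<U>" for C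
  proof -
    have "Zero \<T> N C \<cdot> Id \<T> N = Zero \<T> N C" using id_right[OF zero_closed[OF oN thick_obj[OF U C]]] .
    then show ?thesis using killedI[OF denoms_zero[OF U C N] denoms_id[OF V oN]] by blast
  qed
  have 2: "C \<in> killed" if C: "C \<in> \<V>" for C
  proof -
    note o = thick_obj[OF V C]
    have "Id \<T> C \<cdot> Zero \<T> N C = Zero \<T> N C" using id_left[OF zero_closed[OF oN o]] .
    then show ?thesis using killedI[OF denoms_id[OF U o] denoms_zero[OF V C N]] by blast
  qed
  show "\<W> \<subseteq> killed" if "\<W> \<in> {\<U>, \<V>}" for \<W> using that 1 2 by blast
qed (use U V in blast)

text \<open>As \<open>s \<cdot> t\<close> is zero, C splits off its cone X, and the octahedron makes
  X an extension of an object of \<U> by an object of \<V>. Every object of the join of a commuting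
  pair is thus a summand of such an extension.\<close>

lemma join_retract:
  assumes C: "C \<in> thick_join \<T> {\<U>, \<V>}"
  obtains B x X a A h \<delta> \<rho> where "tri B x X a A h" "B \<in> \<V>" "A \<in> \<U>" "\<delta> \<in> C \<leadsto> X" "\<rho> \<in> X \<leadsto> C" "\<rho> \<cdot> \<delta> = Id \<T> C"
proof -
  obtain Y Z s t where st: "s \<in> denoms \<U> Y C" "t \<in> denoms \<V> Z Y" "s \<cdot> t = Zero \<T> Z C"
    using join_killed C unfolding killed_def by blast
  obtain t\<^sub>2 B t\<^sub>3 where B: "tri Z t Y t\<^sub>2 B t\<^sub>3" "B \<in> \<V>" using denomsE[OF st(2)] .
  obtain s\<^sub>2 A s\<^sub>3 where A: "tri Y s C s\<^sub>2 A s\<^sub>3" "A \<in> \<U>" using denomsE[OF st(1)] .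
  obtain \<delta> X h where X: "tri Z (s \<cdot> t) C \<delta> X h" using tri_exists comp_closed[OF triD(2)[OF B(1)] triD(2)[OF A(1)]] by blast
  obtain d\<^sub>1 d\<^sub>2 where d: "tri B d\<^sub>1 X d\<^sub>2 A (\<Sigma>\<^sub>1 t\<^sub>2 \<cdot> s\<^sub>3)" using octahedron[OF B(1) A(1) X] by blast
  have C: "C \<in> Obj \<T>" using triD(6)[OF X] .
  have "Id \<T> C \<cdot> (s \<cdot> t) = Zero \<T> Z C" using st(3) id_left[OF triD(2)[OF X]] by simp
  then obtain \<rho> where "\<rho> \<in> X \<leadsto> C" "\<rho> \<cdot> \<delta> = Id \<T> C" using weak_cokernel[OF X id_closed[OF C]] by metis
  then show thesis using that d B(2) A(2) triD(3)[OF X] by blast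
qed

end

subsection \<open>Torsion elements\<close>

definition tors :: "'o set \<Rightarrow> ('o, 'm, 'a) presheaf \<Rightarrow> 'o \<Rightarrow> 'a set" where
  "tors \<S> G Y = {x \<in> el G Y. \<exists>X. \<exists>s \<in> denoms \<S> X Y. Res G s x = \<one>\<^bsub>Val G X\<^esub>}"

context
  fixes G :: "('o, 'm, 'a) presheaf" assumes G: "cohomological \<T> G"
begin

lemma tors_el: "x \<in> tors \<S> G Y \<Longrightarrow> x \<in> el G Y"
  unfolding tors_def by blast

lemma torsI: "s \<in> denoms \<S> X Y \<Longrightarrow> x \<in> el G Y \<Longrightarrow> Res G s x = \<one>\<^bsub>Val G X\<^esub> \<Longrightarrow> x \<in> tors \<S> G Y"
  unfolding tors_def by blast

text \<open>By exactness an element that dies on a denominator is restricted from its cone. In this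
  form, as elements coming from objects of \<S>, torsion elements are accessible to the commuting
  condition.\<close>

lemma tors_elem:
  assumes x: "x \<in> tors \<S> G Y"
  obtains A \<kappa> a where "A \<in> \<S>" "\<kappa> \<in> Y \<leadsto> A" "a \<in> el G A" "x = Res G \<kappa> a"
proof -
  obtain X s where s: "s \<in> denoms \<S> X Y" "Res G s x = \<one>\<^bsub>Val G X\<^esub>" using x unfolding tors_def by blast
  obtain \<kappa> A h where A: "tri X s Y \<kappa> A h" "A \<in> \<S>" using denomsE[OF s(1)] .
  show thesis using res_exact[OF G A(1) tors_el[OF x] s(2)] that A(2) triD(3)[OF A(1)] by metis
qed

lemma tors_elemI:
  assumes "A \<in> \<S>" "\<kappa> \<in> Y \<leadsto> A" "a \<in> el G A" shows "Res G \<kappa> a \<in> tors \<S> G Y"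
proof -
  obtain X s h where t: "tri X s Y \<kappa> A h" using tri_fiber[OF assms(2)] .
  then show ?thesis using torsI[OF denomsI[OF t assms(1)] res_closed[OF G assms(2,3)] res_comp_one[OF G t assms(3)]] by blast
qed

lemma tors_res:
  assumes x: "x \<in> tors \<S> G Y" and f: "f \<in> X \<leadsto> Y" shows "Res G f x \<in> tors \<S> G X"
proof -
  obtain A \<kappa> a where A: "A \<in> \<S>" "\<kappa> \<in> Y \<leadsto> A" "a \<in> el G A" "x = Res G \<kappa> a" using tors_elem[OF x] .
  then show ?thesis using tors_elemI[OF A(1) comp_closed[OF f A(2)] A(3)] res_comp[OF G f A(2,3)] by simp
qed

lemma tors_all:
  assumes "x \<in> el G X" "X \<in> \<S>" "X \<in> Obj \<T>" shows "x \<in> tors \<S> G X"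
  using tors_elemI[OF assms(2) id_closed[OF assms(3)] assms(1)] res_id[OF G assms(1,3)] by simp

lemma tors_one: "\<S> \<in> Thick \<T> \<Longrightarrow> Y \<in> Obj \<T> \<Longrightarrow> \<one>\<^bsub>Val G Y\<^esub> \<in> tors \<S> G Y"
  using torsI[OF denoms_id] comm_groupE(2)[OF val_group[OF G]] res_one[OF G id_closed] by blast

lemma tors_inv:
  assumes x: "x \<in> tors \<S> G Y" shows "inv\<^bsub>Val G Y\<^esub> x \<in> tors \<S> G Y"
proof -
  obtain X s where s: "s \<in> denoms \<S> X Y" "Res G s x = \<one>\<^bsub>Val G X\<^esub>" using x unfolding tors_def by blast
  have h: "s \<in> X \<leadsto> Y" using s by blast
  interpret Y: comm_group "Val G Y" by (rule val_group[OF G homD(5)[OF h]])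
  interpret X: comm_group "Val G X" by (rule val_group[OF G homD(4)[OF h]])
  show ?thesis using torsI[OF s(1) Y.inv_closed[OF tors_el[OF x]]] res_inv[OF G h tors_el[OF x]] s(2) by simp
qed

lemma tors_mult:
  assumes S: "\<S> \<in> Thick \<T>" and x: "x \<in> tors \<S> G Y" "y \<in> tors \<S> G Y"
  shows "x \<otimes>\<^bsub>Val G Y\<^esub> y \<in> tors \<S> G Y"
proof -
  obtain X s where s: "s \<in> denoms \<S> X Y" "Res G s x = \<one>\<^bsub>Val G X\<^esub>" using x unfolding tors_def by blast
  obtain X' s' where s': "s' \<in> denoms \<S> X' Y" "Res G s' y = \<one>\<^bsub>Val G X'\<^esub>" using x unfolding tors_def by blast
  have h: "s \<in> X \<leadsto> Y" "s' \<in> X' \<leadsto> Y" using s s' by blast+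
  obtain W u v where u: "u \<in> W \<leadsto> X" "v \<in> W \<leadsto> X'" "s \<cdot> u = s' \<cdot> v" "s \<cdot> u \<in> denoms \<S> W Y" using denoms_ore[OF S s(1) s'(1)] .
  have su: "s \<cdot> u \<in> W \<leadsto> Y" using u(4) by blast
  note e = tors_el[OF x(1)] tors_el[OF x(2)]
  interpret Y: comm_group "Val G Y" by (rule val_group[OF G homD(5)[OF h(1)]])
  interpret W: comm_group "Val G W" by (rule val_group[OF G homD(4)[OF u(1)]])
  have "Res G (s \<cdot> u) x = \<one>\<^bsub>Val G W\<^esub>" "Res G (s \<cdot> u) y = \<one>\<^bsub>Val G W\<^esub>"
    using res_comp[OF G u(1) h(1) e(1)] res_comp[OF G u(2) h(2) e(2)] s(2) s'(2) res_one[OF G u(1)] res_one[OF G u(2)] u(3)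
    by simp_all
  then show ?thesis using torsI[OF u(4) Y.m_closed[OF e]] res_mult[OF G su e] by simp
qed

section \<open>Torsion in a functor that vanishes on \<U> \<inter> \<V>\<close>

context
  fixes \<U> \<V> assumes U: "\<U> \<in> Thick \<T>" and V: "\<V> \<in> Thick \<T>" and comm: "commuting \<T> \<U> \<V>"
    and van: "\<And>X. X \<in> \<U> \<inter> \<V> \<Longrightarrow> el G X = {\<one>\<^bsub>Val G X\<^esub>}"
begin

lemma vanishing_surj:
  assumes t: "tri Q q A g A' h" "Q \<in> \<U> \<inter> \<V>" and a: "a \<in> el G A"
  obtains a' where "a' \<in> el G A'" "Res G g a' = a"
  using res_exact[OF G t(1) a] van[OF t(2)] res_closed[OF G triD(2)[OF t(1)] a] by blast

text \<open>The morphism from B to the object A from which the element comes factors through \<U>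
  \<inter> \<V>, where G vanishes.\<close>

lemma tors_orth:
  assumes x: "x \<in> tors \<U> G Y" and b: "b \<in> B \<leadsto> Y" "B \<in> \<V>"
  shows "Res G b x = \<one>\<^bsub>Val G B\<^esub>"
proof -
  obtain A \<kappa> a where A: "A \<in> \<U>" "\<kappa> \<in> Y \<leadsto> A" "a \<in> el G A" "x = Res G \<kappa> a" using tors_elem[OF x] .
  obtain Q q\<^sub>1 q\<^sub>2 where Q: "Q \<in> \<U> \<inter> \<V>" "q\<^sub>1 \<in> B \<leadsto> Q" "q\<^sub>2 \<in> Q \<leadsto> A" "\<kappa> \<cdot> b = q\<^sub>2 \<cdot> q\<^sub>1"
    using commutingE[OF comm U comp_closed[OF b(1) A(2)] b(2) A(1)] .
  have "Res G b x = Res G q\<^sub>1 (Res G q\<^sub>2 a)" using A(4) res_comp[OF G b(1) A(2,3)] Q(4) res_comp[OF G Q(2,3) A(3)] by simp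
  then show ?thesis using res_closed[OF G Q(3) A(3)] van[OF Q(1)] res_one[OF G Q(2)] by simp
qed

text \<open>The fibre B of \<open>p\<close> maps to A through some Q in \<U> \<inter> \<V>. Passing
  to the cone A' of \<open>q\<^sub>2\<close> lets the morphism to A descend to Y, and the element
  \<open>a\<close> survives the passage because G vanishes on Q.\<close>

lemma tors_lift:
  assumes p: "p \<in> denoms \<V> Y' Y" and x': "x' \<in> tors \<U> G Y'"
  obtains x where "x \<in> tors \<U> G Y" "Res G p x = x'"
proof -
  obtain B b k where B: "tri B b Y' p Y k" "B \<in> \<V>" using denoms_fiberE[OF V p] .
  note b = triD(2)[OF B(1)] and p = triD(3)[OF B(1)]
  obtain A \<kappa> a where A: "A \<in> \<U>" "\<kappa> \<in> Y' \<leadsto> A" "a \<in> el G A" "x' = Res G \<kappa> a" using tors_elem[OF x'] .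
  obtain Q q\<^sub>1 q\<^sub>2 where Q: "Q \<in> \<U> \<inter> \<V>" "q\<^sub>1 \<in> B \<leadsto> Q" "q\<^sub>2 \<in> Q \<leadsto> A" "\<kappa> \<cdot> b = q\<^sub>2 \<cdot> q\<^sub>1"
    using commutingE[OF comm U comp_closed[OF b A(2)] B(2) A(1)] .
  obtain g A' m where g: "tri Q q\<^sub>2 A g A' m" using tri_exists[OF Q(3)] .
  note gh = triD(3)[OF g]
  have A': "A' \<in> \<U>" using thick_cone[OF U g] Q(1) A(1) by blast
  obtain a' where a': "a' \<in> el G A'" "Res G g a' = a" using vanishing_surj[OF g Q(1) A(3)] .
  have "g \<cdot> \<kappa> \<cdot> b = Zero \<T> B A'"
    using comp_assoc[OF b A(2) gh] Q(4) comp_assoc[OF Q(2,3) gh] tri_comp_zero(1)[OF g] comp_zero_left[OF Q(2) triD(7)[OF g]] by simp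
  then obtain k' where k': "k' \<in> Y \<leadsto> A'" "k' \<cdot> p = g \<cdot> \<kappa>" using weak_cokernel[OF B(1) comp_closed[OF A(2) gh]] by metis
  have "Res G p (Res G k' a') = x'"
    using res_comp[OF G p k'(1) a'(1)] k'(2) res_comp[OF G A(2) gh a'(1)] a'(2) A(4) by simp
  then show thesis using that tors_elemI[OF A' k'(1) a'(1)] by blast
qed

end

context
  fixes \<U> \<V> assumes U: "\<U> \<in> Thick \<T>" and V: "\<V> \<in> Thick \<T>" and comm: "commuting \<T> \<U> \<V>"
    and van: "\<And>X. X \<in> \<U> \<inter> \<V> \<Longrightarrow> el G X = {\<one>\<^bsub>Val G X\<^esub>}"
begin

lemma van': "X \<in> \<V> \<inter> \<U> \<Longrightarrow> el G X = {\<one>\<^bsub>Val G X\<^esub>}"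
  using van by (simp add: Int_commute)

text \<open>It suffices to decompose \<open>c\<close> over an object C of the join. There
  \<open>s \<cdot> t\<close> is zero, so the restriction of \<open>c\<close> along \<open>s\<close>
  is \<V>-torsion. Lifting it along the \<U>-denominator \<open>s\<close> gives the \<V>-part, and
  the remaining factor dies on \<open>s\<close>.\<close>

lemma join_tors_decomp:
  assumes x: "x \<in> tors (thick_join \<T> {\<U>, \<V>}) G Y"
  obtains u v where "u \<in> tors \<U> G Y" "v \<in> tors \<V> G Y" "x = u \<otimes>\<^bsub>Val G Y\<^esub> v"
proof -
  obtain C k c where C: "C \<in> thick_join \<T> {\<U>, \<V>}" "k \<in> Y \<leadsto> C" "c \<in> el G C" "x = Res G k c" using tors_elem[OF x] .
  note o = homD(4,5)[OF C(2)]
  obtain W Z s t where st: "s \<in> denoms \<U> W C" "t \<in> denoms \<V> Z W" "s \<cdot> t = Zero \<T> Z C"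
    using join_killed[OF U V comm] C(1) unfolding killed_def[OF U V comm] by blast
  have h: "s \<in> W \<leadsto> C" "t \<in> Z \<leadsto> W" using st by blast+
  interpret C: comm_group "Val G C" by (rule val_group[OF G o(2)])
  interpret Y: comm_group "Val G Y" by (rule val_group[OF G o(1)])
  interpret W: comm_group "Val G W" by (rule val_group[OF G homD(4)[OF h(1)]])
  note sc = res_closed[OF G h(1) C(3)]
  have "Res G t (Res G s c) = \<one>\<^bsub>Val G Z\<^esub>"
    using res_comp[OF G h(2,1) C(3)] st(3) res_zero[OF G homD(4)[OF h(2)] o(2) C(3)] by simp
  then have "Res G s c \<in> tors \<V> G W" using torsI[OF st(2) sc] by blast
  then obtain v where v: "v \<in> tors \<V> G C" "Res G s v = Res G s c"
    using tors_lift[OF V U commuting_sym[OF comm] van' st(1)] by blast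
  note vC = tors_el[OF v(1)]
  have uC: "c \<otimes>\<^bsub>Val G C\<^esub> inv\<^bsub>Val G C\<^esub> v \<in> el G C" using C(3) vC by simp
  have "Res G s (c \<otimes>\<^bsub>Val G C\<^esub> inv\<^bsub>Val G C\<^esub> v) = \<one>\<^bsub>Val G W\<^esub>"
    using res_mult[OF G h(1) C(3) C.inv_closed[OF vC]] res_inv[OF G h(1) vC] v(2) sc by simp
  then have u: "c \<otimes>\<^bsub>Val G C\<^esub> inv\<^bsub>Val G C\<^esub> v \<in> tors \<U> G C" using torsI[OF st(1) uC] by blast
  have "c = c \<otimes>\<^bsub>Val G C\<^esub> inv\<^bsub>Val G C\<^esub> v \<otimes>\<^bsub>Val G C\<^esub> v" using C(3) vC by (simp add: C.m_assoc)
  then have "x = Res G k (c \<otimes>\<^bsub>Val G C\<^esub> inv\<^bsub>Val G C\<^esub> v) \<otimes>\<^bsub>Val G Y\<^esub> Res G k v"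
    using C(4) res_mult[OF G C(2) uC vC] by simp
  then show thesis using that tors_res[OF u C(2)] tors_res[OF v(1) C(2)] by blast
qed

text \<open>The element is moved to an extension X of A by B. Being \<U>-torsion it dies on B, so it
  comes from some \<open>e\<close> over A. Being \<V>-torsion it dies on the object A' of \<U>
  mapping to X, so \<open>e\<close> comes from Q in \<U> \<inter> \<V>, where G vanishes.\<close>

lemma join_tors_zero:
  assumes W: "W \<in> thick_join \<T> {\<U>, \<V>}" and x: "x \<in> tors \<U> G W" "x \<in> tors \<V> G W"
  shows "x = \<one>\<^bsub>Val G W\<^esub>"
proof -
  obtain B b X a A h \<delta> \<rho> where t: "tri B b X a A h" "B \<in> \<V>" "A \<in> \<U>"
    and r: "\<delta> \<in> W \<leadsto> X" "\<rho> \<in> X \<leadsto> W" "\<rho> \<cdot> \<delta> = Id \<T> W" using join_retract[OF U V comm W] .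
  define y where "y = Res G \<rho> x"
  note wX = homD(4)[OF r(1)] and xW = tors_el[OF x(1)]
  have yt: "y \<in> tors \<U> G X" "y \<in> tors \<V> G X" unfolding y_def using tors_res[OF x(1) r(2)] tors_res[OF x(2) r(2)] .
  note ah = triD(3)[OF t(1)]
  have "Res G b y = \<one>\<^bsub>Val G B\<^esub>" using tors_orth[OF U V comm van yt(1) triD(2)[OF t(1)] t(2)] .
  then obtain e where e: "e \<in> el G A" "Res G a e = y" using res_exact[OF G t(1) tors_el[OF yt(1)]] by metis
  obtain Q q\<^sub>1 q\<^sub>2 where Q: "Q \<in> \<V> \<inter> \<U>" "q\<^sub>1 \<in> A \<leadsto> Q" "q\<^sub>2 \<in> Q \<leadsto> \<Sigma>\<^sub>0 B" "h = q\<^sub>2 \<cdot> q\<^sub>1"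
    using commutingE[OF commuting_sym[OF comm] V triD(4)[OF t(1)] t(3) thick_susp[OF V t(2)]] .
  obtain A' r' m where r': "tri A' r' A q\<^sub>1 Q m" using tri_fiber[OF Q(2)] .
  note r'h = triD(2)[OF r']
  have A': "A' \<in> \<U>" using thick_fiber[OF U r' t(3)] Q(1) by blast
  have "h \<cdot> r' = Zero \<T> A' (\<Sigma>\<^sub>0 B)"
    using Q(4) comp_assoc[OF r'h Q(2,3)] tri_comp_zero(1)[OF r'] comp_zero_right[OF Q(3) triD(5)[OF r']] by simp
  then obtain l where l: "l \<in> A' \<leadsto> X" "a \<cdot> l = r'" using weak_kernel[OF tri_rotate[OF t(1)] r'h] by metis
  have "Res G r' e = \<one>\<^bsub>Val G A'\<^esub>"
    using tors_orth[OF V U commuting_sym[OF comm] van' yt(2) l(1) A'] e(2) res_comp[OF G l(1) ah e(1)] l(2) by simp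
  then obtain d where d: "d \<in> el G Q" "Res G q\<^sub>1 d = e" using res_exact[OF G r' e(1)] by metis
  then have "e = \<one>\<^bsub>Val G A\<^esub>" using van'[OF Q(1)] res_one[OF G Q(2)] by simp
  then have "y = \<one>\<^bsub>Val G X\<^esub>" using e(2) res_one[OF G ah] by simp
  then show ?thesis
    using res_comp[OF G r(1,2) xW] r(3) res_id[OF G xW wX] res_one[OF G r(1)] unfolding y_def by simp
qed

end

end

end

section \<open>The Mayer--Vietoris sequence\<close>

lemma (in group) mult_inv_one_iff:
  "x \<in> carrier G \<Longrightarrow> y \<in> carrier G \<Longrightarrow> x \<otimes> inv y = \<one> \<longleftrightarrow> x = y"
  by (metis inv_closed inv_equality inv_inv r_inv)

context triangulated_category
begin

section \<open>Natural transformations and abstract localisations\<close>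

lemma
  assumes \<eta>: "natural_transformation \<T> G H \<eta>"
  shows nt_hom: "Y \<in> Obj \<T> \<Longrightarrow> \<eta> Y \<in> hom (Val G Y) (Val H Y)"
    and nt_closed: "Y \<in> Obj \<T> \<Longrightarrow> x \<in> el G Y \<Longrightarrow> \<eta> Y x \<in> el H Y"
    and nt_mult: "Y \<in> Obj \<T> \<Longrightarrow> x \<in> el G Y \<Longrightarrow> y \<in> el G Y \<Longrightarrow>
      \<eta> Y (x \<otimes>\<^bsub>Val G Y\<^esub> y) = \<eta> Y x \<otimes>\<^bsub>Val H Y\<^esub> \<eta> Y y"
    and nt_res: "f \<in> X \<leadsto> Y \<Longrightarrow> y \<in> el G Y \<Longrightarrow> \<eta> X (Res G f y) = Res H f (\<eta> Y y)"
  using \<eta> unfolding natural_transformation_def hom_def by blast+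

lemma
  assumes \<eta>: "natural_transformation \<T> G H \<eta>" and G: "cohomological \<T> G" and H: "cohomological \<T> H"
    and Y: "Y \<in> Obj \<T>"
  shows nt_one: "\<eta> Y \<one>\<^bsub>Val G Y\<^esub> = \<one>\<^bsub>Val H Y\<^esub>"
    and nt_inv: "x \<in> el G Y \<Longrightarrow> \<eta> Y (inv\<^bsub>Val G Y\<^esub> x) = inv\<^bsub>Val H Y\<^esub> (\<eta> Y x)"
proof -
  interpret group_hom "Val G Y" "Val H Y" "\<eta> Y"
    using nt_hom[OF \<eta> Y] val_group[OF G Y] val_group[OF H Y]
    by (simp add: comm_group_def group_hom_def group_hom_axioms_def)
  show "\<eta> Y \<one>\<^bsub>Val G Y\<^esub> = \<one>\<^bsub>Val H Y\<^esub>" by (rule hom_one)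
  show "x \<in> el G Y \<Longrightarrow> \<eta> Y (inv\<^bsub>Val G Y\<^esub> x) = inv\<^bsub>Val H Y\<^esub> (\<eta> Y x)" by (rule hom_inv)
qed

lemma tors_map:
  assumes \<phi>: "natural_transformation \<T> G G' \<phi>" and G: "cohomological \<T> G" "cohomological \<T> G'"
    and x: "x \<in> tors \<S> G Y" and Y: "Y \<in> Obj \<T>"
  shows "\<phi> Y x \<in> tors \<S> G' Y"
proof -
  obtain X s where s: "s \<in> denoms \<S> X Y" "Res G s x = \<one>\<^bsub>Val G X\<^esub>" using x unfolding tors_def by blast
  have h: "s \<in> X \<leadsto> Y" using s by blast
  note xG = tors_el[OF G(1) x]
  have "Res G' s (\<phi> Y x) = \<one>\<^bsub>Val G' X\<^esub>"
    using nt_res[OF \<phi> h xG] s(2) nt_one[OF \<phi> G homD(4)[OF h]] by simp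
  then show ?thesis using torsI[OF G(2) s(1) nt_closed[OF \<phi> Y xG]] by blast
qed

context
  fixes \<S> G H \<eta>
  assumes loc: "localisation \<S> G H \<eta>"
begin

lemma
  shows loc_G: "cohomological \<T> G" and loc_H: "cohomological \<T> H"
    and loc_nt: "natural_transformation \<T> G H \<eta>"
    and loc_vanishes: "X \<in> \<S> \<Longrightarrow> el H X = {\<one>\<^bsub>Val H X\<^esub>}"
  using loc unfolding localisation_def by blast+

lemma loc_surj:
  assumes "Y \<in> Obj \<T>" "z \<in> el H Y"
  obtains X s x where "s \<in> denoms \<S> X Y" "x \<in> el G X" "Res H s z = \<eta> X x"
  using assms loc unfolding localisation_def by blast

text \<open>H vanishes on the cone of a denominator, so restriction along it is injective; vanishing
  on the fibre gives surjectivity in \<open>loc_div\<close>.\<close>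

lemma loc_inj:
  assumes s: "s \<in> denoms \<S> X Y" and z: "z \<in> el H Y" "z' \<in> el H Y" "Res H s z = Res H s z'"
  shows "z = z'"
proof -
  obtain \<kappa> C h where t: "tri X s Y \<kappa> C h" "C \<in> \<S>" using denomsE[OF s] .
  note h = triD(2)[OF t(1)] and k = triD(3)[OF t(1)]
  interpret Y: comm_group "Val H Y" by (rule val_group[OF loc_H homD(5)[OF h]])
  interpret X: comm_group "Val H X" by (rule val_group[OF loc_H homD(4)[OF h]])
  have d: "z \<otimes>\<^bsub>Val H Y\<^esub> inv\<^bsub>Val H Y\<^esub> z' \<in> el H Y" using z by simp
  have "Res H s (z \<otimes>\<^bsub>Val H Y\<^esub> inv\<^bsub>Val H Y\<^esub> z') = \<one>\<^bsub>Val H X\<^esub>"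
    using res_mult[OF loc_H h z(1) Y.inv_closed[OF z(2)]] res_inv[OF loc_H h z(2)] z(3) res_closed[OF loc_H h z(2)] by simp
  then obtain c where c: "c \<in> el H C" "Res H \<kappa> c = z \<otimes>\<^bsub>Val H Y\<^esub> inv\<^bsub>Val H Y\<^esub> z'" using res_exact[OF loc_H t(1) d] by metis
  then have "z \<otimes>\<^bsub>Val H Y\<^esub> inv\<^bsub>Val H Y\<^esub> z' = \<one>\<^bsub>Val H Y\<^esub>" using loc_vanishes[OF t(2)] res_one[OF loc_H k] by auto
  then show ?thesis using Y.mult_inv_one_iff[OF z(1,2)] by blast
qed

lemma loc_div:
  assumes S: "\<S> \<in> Thick \<T>" and s: "s \<in> denoms \<S> X Y" and y: "y \<in> el H X"
  obtains z where "z \<in> el H Y" "Res H s z = y"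
proof -
  obtain W i k where t: "tri W i X s Y k" "W \<in> \<S>" using denoms_fiberE[OF S s] .
  have "Res H i y = \<one>\<^bsub>Val H W\<^esub>" using res_closed[OF loc_H triD(2)[OF t(1)] y] loc_vanishes[OF t(2)] by blast
  then show thesis using res_exact[OF loc_H t(1) y] that by metis
qed

lemma loc_tors:
  assumes Y: "Y \<in> Obj \<T>" and x: "x \<in> el G Y"
  shows "\<eta> Y x = \<one>\<^bsub>Val H Y\<^esub> \<longleftrightarrow> x \<in> tors \<S> G Y"
proof
  assume "\<eta> Y x = \<one>\<^bsub>Val H Y\<^esub>"
  then show "x \<in> tors \<S> G Y" using x Y loc unfolding localisation_def tors_def by blast
next
  assume "x \<in> tors \<S> G Y"
  then obtain A \<kappa> a where A: "A \<in> \<S>" "\<kappa> \<in> Y \<leadsto> A" "a \<in> el G A" "x = Res G \<kappa> a" using tors_elem[OF loc_G] by blast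
  have "\<eta> A a = \<one>\<^bsub>Val H A\<^esub>" using nt_closed[OF loc_nt homD(5)[OF A(2)] A(3)] loc_vanishes[OF A(1)] by blast
  then show "\<eta> Y x = \<one>\<^bsub>Val H Y\<^esub>" using nt_res[OF loc_nt A(2,3)] A(4) res_one[OF loc_H A(2)] by simp
qed

lemma loc_eq:
  assumes Y: "Y \<in> Obj \<T>" and x: "x \<in> el G Y" "x' \<in> el G Y" and eq: "\<eta> Y x = \<eta> Y x'"
  obtains X s where "s \<in> denoms \<S> X Y" "Res G s x = Res G s x'"
proof -
  interpret G: comm_group "Val G Y" by (rule val_group[OF loc_G Y])
  interpret H: comm_group "Val H Y" by (rule val_group[OF loc_H Y])
  have d: "x \<otimes>\<^bsub>Val G Y\<^esub> inv\<^bsub>Val G Y\<^esub> x' \<in> el G Y" using x by simp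
  have "\<eta> Y (x \<otimes>\<^bsub>Val G Y\<^esub> inv\<^bsub>Val G Y\<^esub> x') = \<one>\<^bsub>Val H Y\<^esub>"
    using nt_mult[OF loc_nt Y x(1) G.inv_closed[OF x(2)]] nt_inv[OF loc_nt loc_G loc_H Y x(2)] eq
      nt_closed[OF loc_nt Y x(2)] by simp
  then have "x \<otimes>\<^bsub>Val G Y\<^esub> inv\<^bsub>Val G Y\<^esub> x' \<in> tors \<S> G Y" using loc_tors[OF Y d] by blast
  then obtain X s where s: "s \<in> denoms \<S> X Y" "Res G s (x \<otimes>\<^bsub>Val G Y\<^esub> inv\<^bsub>Val G Y\<^esub> x') = \<one>\<^bsub>Val G X\<^esub>"
    unfolding tors_def by blast
  have h: "s \<in> X \<leadsto> Y" using s by blast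
  interpret X: comm_group "Val G X" by (rule val_group[OF loc_G homD(4)[OF h]])
  have "Res G s x = Res G s x'"
    using s(2) res_mult[OF loc_G h x(1) G.inv_closed[OF x(2)]] res_inv[OF loc_G h x(2)]
      X.mult_inv_one_iff[OF res_closed[OF loc_G h x(1)] res_closed[OF loc_G h x(2)]] by simp
  then show thesis using that s(1) by blast
qed

end

text \<open>
  An element \<open>z\<close> of \<open>H Y\<close> becomes some \<open>\<eta> X y\<close> on an \<open>s: X \<rightarrow> Y\<close> whose fibre \<open>W\<close> lies in
  the join. The restriction of \<open>y\<close> to \<open>W\<close> is the product of a \<open>\<U>\<close>-torsion and a \<open>\<V>\<close>-torsion
  element, and \<open>z\<close> is sent to the restriction of the former to \<open>\<Sigma>\<^sup>-Y\<close>.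
\<close>

definition conn_rel :: "'o set \<Rightarrow> 'o set \<Rightarrow> ('o, 'm, 'a) presheaf \<Rightarrow> ('o, 'm, 'b) presheaf \<Rightarrow> ('o \<Rightarrow> 'a \<Rightarrow> 'b) \<Rightarrow>
    'o \<Rightarrow> 'b \<Rightarrow> 'a \<Rightarrow> bool" where
  "conn_rel \<U> \<V> G H \<eta> Y z w \<longleftrightarrow> (\<exists>l W i X s y a b. dtri Y l W i X s \<and> W \<in> thick_join \<T> {\<U>, \<V>} \<and> y \<in> el G X \<and>
    Res H s z = \<eta> X y \<and> a \<in> tors \<U> G W \<and> b \<in> tors \<V> G W \<and> Res G i y = a \<otimes>\<^bsub>Val G W\<^esub> b \<and> w = Res G l a)"

definition conn :: "'o set \<Rightarrow> 'o set \<Rightarrow> ('o, 'm, 'a) presheaf \<Rightarrow> ('o, 'm, 'b) presheaf \<Rightarrow> ('o \<Rightarrow> 'a \<Rightarrow> 'b) \<Rightarrow>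
    'o \<Rightarrow> 'b \<Rightarrow> 'a" where
  "conn \<U> \<V> G H \<eta> Y z = (THE w. conn_rel \<U> \<V> G H \<eta> Y z w)"

lemma conn_relI:
  assumes "dtri Y l W i X s" "W \<in> thick_join \<T> {\<U>, \<V>}" "y \<in> el G X" "Res H s z = \<eta> X y"
    "a \<in> tors \<U> G W" "b \<in> tors \<V> G W" "Res G i y = a \<otimes>\<^bsub>Val G W\<^esub> b"
  shows "conn_rel \<U> \<V> G H \<eta> Y z (Res G l a)"
  unfolding conn_rel_def using assms by metis

lemma conn_relE:
  assumes "conn_rel \<U> \<V> G H \<eta> Y z w"
  obtains l W i X s y a b where "dtri Y l W i X s" "W \<in> thick_join \<T> {\<U>, \<V>}" "y \<in> el G X"
    "Res H s z = \<eta> X y" "a \<in> tors \<U> G W" "b \<in> tors \<V> G W" "Res G i y = a \<otimes>\<^bsub>Val G W\<^esub> b" "w = Res G l a"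
  using assms unfolding conn_rel_def by (elim exE conjE)

text \<open>Functoriality is stated for the relation, not for the function \<open>conn\<close>, so
  that one choice of triangle and decomposition can be carried over to the other side.\<close>

lemma conn_rel_map:
  assumes \<phi>: "natural_transformation \<T> G G' \<phi>" and G: "cohomological \<T> G" "cohomological \<T> G'"
    and \<psi>: "\<And>f X. f \<in> X \<leadsto> Y \<Longrightarrow> Res H' f (\<psi> Y z) = \<psi> X (Res H f z)"
    and \<psi>\<eta>: "\<And>X x. X \<in> Obj \<T> \<Longrightarrow> x \<in> el G X \<Longrightarrow> \<psi> X (\<eta> X x) = \<eta>' X (\<phi> X x)"
    and c: "conn_rel \<U> \<V> G H \<eta> Y z w"
  shows "conn_rel \<U> \<V> G' H' \<eta>' Y (\<psi> Y z) (\<phi> (\<Omega>\<^sub>0 Y) w)"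
proof -
  obtain l W i X s y a b where d: "dtri Y l W i X s" "W \<in> thick_join \<T> {\<U>, \<V>}" "y \<in> el G X"
    "Res H s z = \<eta> X y" "a \<in> tors \<U> G W" "b \<in> tors \<V> G W" "Res G i y = a \<otimes>\<^bsub>Val G W\<^esub> b" "w = Res G l a"
    using conn_relE[OF c] .
  note D = dtriD[OF d(1)]
  note ab = tors_el[OF G(1) d(5)] tors_el[OF G(1) d(6)]
  have 1: "Res H' s (\<psi> Y z) = \<eta>' X (\<phi> X y)" using \<psi>[OF D(3)] d(4) \<psi>\<eta>[OF D(7) d(3)] by simp
  have 2: "Res G' i (\<phi> X y) = \<phi> W a \<otimes>\<^bsub>Val G' W\<^esub> \<phi> W b"
    using nt_res[OF \<phi> D(2) d(3)] d(7) nt_mult[OF \<phi> D(6) ab] by simp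
  show ?thesis
    using conn_relI[OF d(1,2) nt_closed[OF \<phi> D(7) d(3)], of H' "\<psi> Y z" \<eta>', OF 1
        tors_map[OF \<phi> G d(5) D(6)] tors_map[OF \<phi> G d(6) D(6)] 2]
      nt_res[OF \<phi> D(1) ab(1)] d(8) by simp
qed

lemma thick_join_pair:
  assumes "\<U> \<in> Thick \<T>" "\<V> \<in> Thick \<T>"
  shows "thick_join \<T> {\<U>, \<V>} \<in> Thick \<T>" "\<U> \<subseteq> thick_join \<T> {\<U>, \<V>}" "\<V> \<subseteq> thick_join \<T> {\<U>, \<V>}"
  using thick_join_closed[of "{\<U>, \<V>}"] thick_join_upper[of "{\<U>, \<V>}"] assms by simp_all

text \<open>Over a \<U>-denominator the element is the image of some \<open>x\<close> that is
  torsion for the join. Its \<U>-part dies in H, and its \<V>-part lifts back to Y by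
  \<open>tors_lift\<close>.\<close>

lemma loc_kernel:
  assumes U: "\<U> \<in> Thick \<T>" and V: "\<V> \<in> Thick \<T>" and comm: "commuting \<T> \<U> \<V>"
    and van: "\<And>X. X \<in> \<U> \<inter> \<V> \<Longrightarrow> el G X = {\<one>\<^bsub>Val G X\<^esub>}"
    and loc: "localisation \<U> G H \<eta>" and locJ: "localisation (thick_join \<T> {\<U>, \<V>}) G HJ \<eta>J"
    and \<zeta>: "natural_transformation \<T> H HJ \<zeta>" and \<zeta>\<eta>: "\<And>X x. X \<in> Obj \<T> \<Longrightarrow> x \<in> el G X \<Longrightarrow> \<zeta> X (\<eta> X x) = \<eta>J X x"
    and Y: "Y \<in> Obj \<T>" and z: "z \<in> el H Y" "\<zeta> Y z = \<one>\<^bsub>Val HJ Y\<^esub>"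
  obtains w where "w \<in> tors \<V> G Y" "\<eta> Y w = z"
proof -
  note G = loc_G[OF loc] and H = loc_H[OF loc] and HJ = loc_H[OF locJ] and \<eta> = loc_nt[OF loc]
  obtain X s x where s: "s \<in> denoms \<U> X Y" "x \<in> el G X" "Res H s z = \<eta> X x" using loc_surj[OF loc Y z(1)] .
  have h: "s \<in> X \<leadsto> Y" and X: "X \<in> Obj \<T>" using s denoms_obj by blast+
  interpret H: comm_group "Val H X" by (rule val_group[OF H X])
  have "\<eta>J X x = Res HJ s (\<zeta> Y z)" using \<zeta>\<eta>[OF X s(2)] s(3) nt_res[OF \<zeta> h z(1)] by simp
  then have "\<eta>J X x = \<one>\<^bsub>Val HJ X\<^esub>" using z(2) res_one[OF HJ h] by simp
  then have "x \<in> tors (thick_join \<T> {\<U>, \<V>}) G X" using loc_tors[OF locJ X s(2)] by blast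
  then obtain u v where uv: "u \<in> tors \<U> G X" "v \<in> tors \<V> G X" "x = u \<otimes>\<^bsub>Val G X\<^esub> v"
    using join_tors_decomp[OF G U V comm van] by blast
  note e = tors_el[OF G uv(1)] tors_el[OF G uv(2)]
  obtain w where w: "w \<in> tors \<V> G Y" "Res G s w = v"
    using tors_lift[OF G V U commuting_sym[OF comm] van s(1) uv(2)] by (auto simp: Int_commute)
  note wY = tors_el[OF G w(1)]
  have "\<eta> X x = \<eta> X v"
    using nt_mult[OF \<eta> X e] loc_tors[OF loc X e(1)] uv(1,3) nt_closed[OF \<eta> X e(2)] by simp
  then have "Res H s z = Res H s (\<eta> Y w)" using s(3) nt_res[OF \<eta> h wY] w(2) by simp
  then have "z = \<eta> Y w" using loc_inj[OF loc s(1) z(1) nt_closed[OF \<eta> Y wY]] by blast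
  then show thesis using that w(1) by blast
qed

end

text \<open>G stands for the localisation of a functor at \<U> \<inter> \<V>, and \<open>HU\<close>,
  \<open>HV\<close>, \<open>HJ\<close> for those at \<U>, \<V> and the join. The maps \<eta> come
  out of G, and the maps \<zeta> lead to \<open>HJ\<close>.\<close>

locale commuting_localisations = triangulated_category \<T>
  for \<T> :: "('o, 'm) tricat" (structure) +
  fixes \<U> \<V> :: "'o set" and G :: "('o, 'm, 'a) presheaf" and HU :: "('o, 'm, 'b) presheaf"
    and HV :: "('o, 'm, 'c) presheaf" and HJ :: "('o, 'm, 'd) presheaf" and \<eta>U \<eta>V \<eta>J \<zeta>U \<zeta>V
  assumes U: "\<U> \<in> Thick \<T>" and V: "\<V> \<in> Thick \<T>" and comm: "commuting \<T> \<U> \<V>"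
    and van: "\<And>X. X \<in> \<U> \<inter> \<V> \<Longrightarrow> el G X = {\<one>\<^bsub>Val G X\<^esub>}"
    and locU: "localisation \<U> G HU \<eta>U" and locV: "localisation \<V> G HV \<eta>V"
    and locJ: "localisation (thick_join \<T> {\<U>, \<V>}) G HJ \<eta>J"
    and \<zeta>U: "natural_transformation \<T> HU HJ \<zeta>U" and \<zeta>V: "natural_transformation \<T> HV HJ \<zeta>V"
    and \<zeta>\<eta>U: "\<And>X x. X \<in> Obj \<T> \<Longrightarrow> x \<in> el G X \<Longrightarrow> \<zeta>U X (\<eta>U X x) = \<eta>J X x"
    and \<zeta>\<eta>V: "\<And>X x. X \<in> Obj \<T> \<Longrightarrow> x \<in> el G X \<Longrightarrow> \<zeta>V X (\<eta>V X x) = \<eta>J X x"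
begin

section \<open>The connecting morphism\<close>

abbreviation "\<J> \<equiv> thick_join \<T> {\<U>, \<V>}"
abbreviation "crel \<equiv> conn_rel \<U> \<V> G HJ \<eta>J"
abbreviation "cmap \<equiv> conn \<U> \<V> G HJ \<eta>J"

lemmas J = thick_join_pair[OF U V]
lemmas coh = loc_G[OF locU] loc_H[OF locU] loc_H[OF locV] loc_H[OF locJ]
lemmas eta = loc_nt[OF locU] loc_nt[OF locV] loc_nt[OF locJ]
lemmas crelI = conn_relI[where \<U> = \<U> and \<V> = \<V> and G = G and H = HJ and \<eta> = \<eta>J]

lemma tzero: "W \<in> \<J> \<Longrightarrow> x \<in> tors \<U> G W \<Longrightarrow> x \<in> tors \<V> G W \<Longrightarrow> x = \<one>\<^bsub>Val G W\<^esub>"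
  using join_tors_zero[OF coh(1) U V comm van] by blast

lemma tors_decomp_unique:
  assumes W: "W \<in> \<J>" and a: "a \<in> tors \<U> G W" "a' \<in> tors \<U> G W" and b: "b \<in> tors \<V> G W" "b' \<in> tors \<V> G W"
    and eq: "a \<otimes>\<^bsub>Val G W\<^esub> b = a' \<otimes>\<^bsub>Val G W\<^esub> b'"
  shows "a = a'"
proof -
  note o = thick_obj[OF J(1) W]
  interpret G: comm_group "Val G W" by (rule val_group[OF coh(1) o])
  note e = tors_el[OF coh(1) a(1)] tors_el[OF coh(1) a(2)] tors_el[OF coh(1) b(1)] tors_el[OF coh(1) b(2)]
  have "a \<otimes>\<^bsub>Val G W\<^esub> inv\<^bsub>Val G W\<^esub> a' = b' \<otimes>\<^bsub>Val G W\<^esub> inv\<^bsub>Val G W\<^esub> b"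
  proof -
    have "a = a' \<otimes>\<^bsub>Val G W\<^esub> b' \<otimes>\<^bsub>Val G W\<^esub> inv\<^bsub>Val G W\<^esub> b" using eq e G.inv_solve_right by simp
    then have "a = a' \<otimes>\<^bsub>Val G W\<^esub> (b' \<otimes>\<^bsub>Val G W\<^esub> inv\<^bsub>Val G W\<^esub> b)" using e by (simp add: G.m_assoc)
    then have "a = (b' \<otimes>\<^bsub>Val G W\<^esub> inv\<^bsub>Val G W\<^esub> b) \<otimes>\<^bsub>Val G W\<^esub> a'" using e by (simp add: G.m_comm)
    then show ?thesis using e by (simp add: G.m_assoc)
  qed
  moreover have "a \<otimes>\<^bsub>Val G W\<^esub> inv\<^bsub>Val G W\<^esub> a' \<in> tors \<U> G W" using tors_mult[OF coh(1) U a(1) tors_inv[OF coh(1) a(2)]] .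
  moreover have "b' \<otimes>\<^bsub>Val G W\<^esub> inv\<^bsub>Val G W\<^esub> b \<in> tors \<V> G W" using tors_mult[OF coh(1) V b(2) tors_inv[OF coh(1) b(1)]] .
  ultimately have "a \<otimes>\<^bsub>Val G W\<^esub> inv\<^bsub>Val G W\<^esub> a' = \<one>\<^bsub>Val G W\<^esub>" using tzero[OF W] by simp
  then show ?thesis using G.mult_inv_one_iff[OF e(1,2)] by blast
qed

lemma decomp_at:
  assumes W: "W \<in> \<J>" and e: "e \<in> el G W"
  obtains a b where "a \<in> tors \<U> G W" "b \<in> tors \<V> G W" "e = a \<otimes>\<^bsub>Val G W\<^esub> b"
  using join_tors_decomp[OF coh(1) U V comm van tors_all[OF coh(1) e W thick_obj[OF J(1) W]]] that by blast

lemma dtri_of_denoms: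
  assumes "s \<in> denoms \<J> X Y" obtains l W i where "dtri Y l W i X s" "W \<in> \<J>"
  using denoms_fiberE[OF J(1) assms] tri_dtri by metis

lemma dtri_denoms:
  assumes "dtri Y l W i X s" "W \<in> \<J>" shows "s \<in> denoms \<J> X Y"
  using denoms_fiberI[OF J(1) dtri_tri[OF assms(1)] assms(2)] .

text \<open>The two values come from unrelated choices, one for \<open>z\<close> and one for its
  restriction. For \<open>f\<close> an identity this gives independence of all choices, so a single
  comparison yields both well-definedness and naturality.\<close>

lemma conn_natural:
  assumes c: "crel Y z w" and z: "z \<in> el HJ Y" and f: "f \<in> Y' \<leadsto> Y" and c': "crel Y' (Res HJ f z) w'"
  shows "w' = Res G (\<Omega>\<^sub>1 f) w"
proof -
  obtain l W i X s y a b where d: "dtri Y l W i X s" "W \<in> \<J>" "y \<in> el G X"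
    "Res HJ s z = \<eta>J X y" "a \<in> tors \<U> G W" "b \<in> tors \<V> G W" "Res G i y = a \<otimes>\<^bsub>Val G W\<^esub> b" "w = Res G l a"
    using conn_relE[OF c] .
  obtain l' W' i' X' s' y' a' b' where d': "dtri Y' l' W' i' X' s'" "W' \<in> \<J>" "y' \<in> el G X'"
    "Res HJ s' (Res HJ f z) = \<eta>J X' y'" "a' \<in> tors \<U> G W'" "b' \<in> tors \<V> G W'"
    "Res G i' y' = a' \<otimes>\<^bsub>Val G W'\<^esub> b'" "w' = Res G l' a'"
    using conn_relE[OF c'] .
  note D = dtriD[OF d(1)] and D' = dtriD[OF d'(1)]
  obtain P s\<^sub>1 f\<^sub>1 where p: "s\<^sub>1 \<in> denoms \<J> P Y'" "f\<^sub>1 \<in> P \<leadsto> X" "s \<cdot> f\<^sub>1 = f \<cdot> s\<^sub>1"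
    using denoms_pullback[OF J(1) dtri_denoms[OF d(1,2)] f] .
  obtain R u v where r: "u \<in> R \<leadsto> P" "v \<in> R \<leadsto> X'" "s\<^sub>1 \<cdot> u = s' \<cdot> v" "s\<^sub>1 \<cdot> u \<in> denoms \<J> R Y'"
    using denoms_ore[OF J(1) p(1) dtri_denoms[OF d'(1,2)]] .
  have ph: "s\<^sub>1 \<in> P \<leadsto> Y'" "s\<^sub>1 \<cdot> u \<in> R \<leadsto> Y'" using p r by blast+
  note fu = comp_closed[OF r(1) p(2)] and R = homD(4)[OF r(1)]
  have sfu: "s \<cdot> (f\<^sub>1 \<cdot> u) = f \<cdot> (s\<^sub>1 \<cdot> u)" using comp_assoc[OF r(1) p(2) D(3)] p(3) comp_assoc[OF r(1) ph(1) f] by simp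
  note g1 = res_closed[OF coh(1) fu d(3)] and g2 = res_closed[OF coh(1) r(2) d'(3)]
  have "\<eta>J R (Res G (f\<^sub>1 \<cdot> u) y) = \<eta>J R (Res G v y')"
    using nt_res[OF eta(3) fu d(3)] nt_res[OF eta(3) r(2) d'(3)] d(4)[symmetric] d'(4)[symmetric]
      res_comp[OF coh(4) fu D(3) z] res_comp[OF coh(4) r(2) D'(3) res_closed[OF coh(4) f z]] sfu r(3)
      res_comp[OF coh(4) ph(2) f z] by simp
  \<comment> \<open>The two representatives have the same image in \<open>HJ\<close> only; a further
    denominator makes them equal in G.\<close>
  then obtain R' q where q: "q \<in> denoms \<J> R' R" "Res G q (Res G (f\<^sub>1 \<cdot> u) y) = Res G q (Res G v y')"
    using loc_eq[OF locJ R g1 g2] by metis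
  have qh: "q \<in> R' \<leadsto> R" using q by blast
  define t where "t = s\<^sub>1 \<cdot> u \<cdot> q"
  define m where "m = f\<^sub>1 \<cdot> u \<cdot> q"
  define n where "n = v \<cdot> q"
  have t: "t \<in> denoms \<J> R' Y'" unfolding t_def using denoms_comp[OF J(1) q(1) r(4)] .
  have th: "t \<in> R' \<leadsto> Y'" using t by blast
  have m: "m \<in> R' \<leadsto> X" and n: "n \<in> R' \<leadsto> X'" unfolding m_def n_def using comp_closed[OF qh fu] comp_closed[OF qh r(2)] .
  have sm: "s \<cdot> m = f \<cdot> t"
    unfolding m_def t_def using comp_assoc[OF qh fu D(3)] sfu comp_assoc[OF qh ph(2) f] by simp
  have sn: "s' \<cdot> n = Id \<T> Y' \<cdot> t"
    unfolding n_def using comp_assoc[OF qh r(2) D'(3)] r(3) id_left[OF th] by (simp add: t_def)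
  have mn: "Res G m y = Res G n y'"
    unfolding m_def n_def using res_comp[OF coh(1) qh fu d(3)] res_comp[OF coh(1) qh r(2) d'(3)] q(2) by simp
  \<comment> \<open>Both given triangles receive a morphism from the triangle on the common
    refinement \<open>t\<close>. The components \<open>g\<close> and \<open>g'\<close> on the fibres
    are not canonical, but uniqueness of the decomposition over \<open>W\<^sub>0\<close> makes the
    results agree.\<close>
  obtain l\<^sub>0 W\<^sub>0 i\<^sub>0 where d0: "dtri Y' l\<^sub>0 W\<^sub>0 i\<^sub>0 R' t" "W\<^sub>0 \<in> \<J>" using dtri_of_denoms[OF t] .
  note D0 = dtriD[OF d0(1)]
  obtain g where g: "g \<in> W\<^sub>0 \<leadsto> W" "i \<cdot> g = m \<cdot> i\<^sub>0" "l \<cdot> \<Omega>\<^sub>1 f = g \<cdot> l\<^sub>0" using dtri_morphism[OF d0(1) d(1) f m sm] .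
  obtain g' where g': "g' \<in> W\<^sub>0 \<leadsto> W'" "i' \<cdot> g' = n \<cdot> i\<^sub>0" "l' \<cdot> \<Omega>\<^sub>1 (Id \<T> Y') = g' \<cdot> l\<^sub>0"
    using dtri_morphism[OF d0(1) d'(1) id_closed[OF D'(5)] n sn] .
  note ab = tors_el[OF coh(1) d(5)] tors_el[OF coh(1) d(6)] tors_el[OF coh(1) d'(5)] tors_el[OF coh(1) d'(6)]
  have "Res G g a \<otimes>\<^bsub>Val G W\<^sub>0\<^esub> Res G g b = Res G i\<^sub>0 (Res G m y)"
    using res_mult[OF coh(1) g(1) ab(1,2)] d(7) res_comp[OF coh(1) g(1) D(2) d(3)] g(2) res_comp[OF coh(1) D0(2) m d(3)] by simp
  also have "\<dots> = Res G g' a' \<otimes>\<^bsub>Val G W\<^sub>0\<^esub> Res G g' b'"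
    using mn res_mult[OF coh(1) g'(1) ab(3,4)] d'(7) res_comp[OF coh(1) g'(1) D'(2) d'(3)] g'(2)
      res_comp[OF coh(1) D0(2) n d'(3)] by simp
  finally have e: "Res G g a = Res G g' a'"
    by (rule tors_decomp_unique[OF d0(2) tors_res[OF coh(1) d(5) g(1)] tors_res[OF coh(1) d'(5) g'(1)]
        tors_res[OF coh(1) d(6) g(1)] tors_res[OF coh(1) d'(6) g'(1)]])
  have "l' = g' \<cdot> l\<^sub>0" using g'(3) desusp(2)[OF D'(5)] id_right[OF D'(1)] by simp
  then have "w' = Res G l\<^sub>0 (Res G g' a')" using d'(8) res_comp[OF coh(1) D0(1) g'(1) ab(3)] by simp
  also have "\<dots> = Res G (\<Omega>\<^sub>1 f) w"
    unfolding e[symmetric] d(8)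
    using res_comp[OF coh(1) D0(1) g(1) ab(1)] g(3) res_comp[OF coh(1) desusp(3)[OF f] D(1) ab(1)] by simp
  finally show ?thesis .
qed

text \<open>Additivity of the connecting morphism needs representatives of two elements over one and
  the same triangle.\<close>

lemma conn_data:
  assumes Y: "Y \<in> Obj \<T>" and z: "z \<in> el HJ Y" "z' \<in> el HJ Y"
  obtains l W i X s y a b y' a' b' where "dtri Y l W i X s" "W \<in> \<J>"
    "y \<in> el G X" "Res HJ s z = \<eta>J X y" "a \<in> tors \<U> G W" "b \<in> tors \<V> G W" "Res G i y = a \<otimes>\<^bsub>Val G W\<^esub> b"
    "y' \<in> el G X" "Res HJ s z' = \<eta>J X y'" "a' \<in> tors \<U> G W" "b' \<in> tors \<V> G W" "Res G i y' = a' \<otimes>\<^bsub>Val G W\<^esub> b'"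
proof -
  obtain X\<^sub>1 s\<^sub>1 y\<^sub>1 where 1: "s\<^sub>1 \<in> denoms \<J> X\<^sub>1 Y" "y\<^sub>1 \<in> el G X\<^sub>1" "Res HJ s\<^sub>1 z = \<eta>J X\<^sub>1 y\<^sub>1" using loc_surj[OF locJ Y z(1)] .
  obtain X\<^sub>2 s\<^sub>2 y\<^sub>2 where 2: "s\<^sub>2 \<in> denoms \<J> X\<^sub>2 Y" "y\<^sub>2 \<in> el G X\<^sub>2" "Res HJ s\<^sub>2 z' = \<eta>J X\<^sub>2 y\<^sub>2" using loc_surj[OF locJ Y z(2)] .
  obtain X u v where u: "u \<in> X \<leadsto> X\<^sub>1" "v \<in> X \<leadsto> X\<^sub>2" "s\<^sub>1 \<cdot> u = s\<^sub>2 \<cdot> v" "s\<^sub>1 \<cdot> u \<in> denoms \<J> X Y"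
    using denoms_ore[OF J(1) 1(1) 2(1)] .
  have h: "s\<^sub>1 \<in> X\<^sub>1 \<leadsto> Y" "s\<^sub>2 \<in> X\<^sub>2 \<leadsto> Y" using 1 2 by blast+
  have e: "Res HJ (s\<^sub>1 \<cdot> u) z = \<eta>J X (Res G u y\<^sub>1)"
    using res_comp[OF coh(4) u(1) h(1) z(1)] 1(3) nt_res[OF eta(3) u(1) 1(2)] by simp
  have e': "Res HJ (s\<^sub>1 \<cdot> u) z' = \<eta>J X (Res G v y\<^sub>2)"
    using u(3) res_comp[OF coh(4) u(2) h(2) z(2)] 2(3) nt_res[OF eta(3) u(2) 2(2)] by simp
  note y = res_closed[OF coh(1) u(1) 1(2)] and y' = res_closed[OF coh(1) u(2) 2(2)]
  obtain l W i where d: "dtri Y l W i X (s\<^sub>1 \<cdot> u)" "W \<in> \<J>" using dtri_of_denoms[OF u(4)] .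
  note i = dtriD(2)[OF d(1)]
  obtain a b where a: "a \<in> tors \<U> G W" "b \<in> tors \<V> G W" "Res G i (Res G u y\<^sub>1) = a \<otimes>\<^bsub>Val G W\<^esub> b"
    using decomp_at[OF d(2) res_closed[OF coh(1) i y]] .
  obtain a' b' where a': "a' \<in> tors \<U> G W" "b' \<in> tors \<V> G W" "Res G i (Res G v y\<^sub>2) = a' \<otimes>\<^bsub>Val G W\<^esub> b'"
    using decomp_at[OF d(2) res_closed[OF coh(1) i y']] .
  show thesis using that[OF d y e a y' e' a'] .
qed

lemma conn_exists:
  assumes "Y \<in> Obj \<T>" "z \<in> el HJ Y" obtains w where "crel Y z w"
  using conn_data[OF assms(1) assms(2) assms(2)] crelI by metis

lemma conn_unique:
  assumes "Y \<in> Obj \<T>" "z \<in> el HJ Y" "crel Y z w" "crel Y z w'" shows "w = w'"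
proof -
  have "w' = Res G (Id \<T> (\<Omega>\<^sub>0 Y)) w"
    using conn_natural[OF assms(3,2) id_closed[OF assms(1)]] assms(4) res_id[OF coh(4) assms(2,1)] desusp(2)[OF assms(1)]
    by simp
  moreover obtain l W i X s y a b where "dtri Y l W i X s" "a \<in> tors \<U> G W" "w = Res G l a"
    using conn_relE[OF assms(3)] by metis
  then have "w \<in> el G (\<Omega>\<^sub>0 Y)" using res_closed[OF coh(1) dtriD(1)] tors_el[OF coh(1)] by blast
  ultimately show ?thesis using res_id[OF coh(1) _ desusp(1)[OF assms(1)]] by simp
qed

lemma cmap_eq: "Y \<in> Obj \<T> \<Longrightarrow> z \<in> el HJ Y \<Longrightarrow> crel Y z w \<Longrightarrow> cmap Y z = w"
  unfolding conn_def using conn_unique by blast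

lemma cmap_crel: "Y \<in> Obj \<T> \<Longrightarrow> z \<in> el HJ Y \<Longrightarrow> crel Y z (cmap Y z)"
  using cmap_eq conn_exists by metis

lemma cmap_res:
  assumes "f \<in> Y' \<leadsto> Y" "z \<in> el HJ Y"
  shows "cmap Y' (Res HJ f z) = Res G (\<Omega>\<^sub>1 f) (cmap Y z)"
  using conn_natural[OF cmap_crel[OF homD(5)[OF assms(1)] assms(2)] assms(2,1)
      cmap_crel[OF homD(4)[OF assms(1)] res_closed[OF coh(4) assms]]] .

lemma
  assumes Y: "Y \<in> Obj \<T>" and z: "z \<in> el HJ Y" "z' \<in> el HJ Y"
  shows cmap_closed: "cmap Y z \<in> el G (\<Omega>\<^sub>0 Y)"
    and cmap_mult: "cmap Y (z \<otimes>\<^bsub>Val HJ Y\<^esub> z') = cmap Y z \<otimes>\<^bsub>Val G (\<Omega>\<^sub>0 Y)\<^esub> cmap Y z'"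
proof -
  obtain l W i X s y a b y' a' b' where d: "dtri Y l W i X s" "W \<in> \<J>"
    and y: "y \<in> el G X" "Res HJ s z = \<eta>J X y" "a \<in> tors \<U> G W" "b \<in> tors \<V> G W" "Res G i y = a \<otimes>\<^bsub>Val G W\<^esub> b"
    and y': "y' \<in> el G X" "Res HJ s z' = \<eta>J X y'" "a' \<in> tors \<U> G W" "b' \<in> tors \<V> G W" "Res G i y' = a' \<otimes>\<^bsub>Val G W\<^esub> b'"
    using conn_data[OF Y z] .
  note D = dtriD[OF d(1)]
  note ab = tors_el[OF coh(1) y(3)] tors_el[OF coh(1) y(4)] tors_el[OF coh(1) y'(3)] tors_el[OF coh(1) y'(4)]
  have 1: "cmap Y z = Res G l a" using cmap_eq[OF Y z(1) crelI[OF d y]] .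
  have 2: "cmap Y z' = Res G l a'" using cmap_eq[OF Y z(2) crelI[OF d y']] .
  show "cmap Y z \<in> el G (\<Omega>\<^sub>0 Y)" using 1 res_closed[OF coh(1) D(1) ab(1)] by simp
  interpret W: comm_group "Val G W" by (rule val_group[OF coh(1) D(6)])
  interpret X: comm_group "Val G X" by (rule val_group[OF coh(1) D(7)])
  interpret HY: comm_group "Val HJ Y" by (rule val_group[OF coh(4) Y])
  have p1: "y \<otimes>\<^bsub>Val G X\<^esub> y' \<in> el G X" using y y' by simp
  have p2: "Res HJ s (z \<otimes>\<^bsub>Val HJ Y\<^esub> z') = \<eta>J X (y \<otimes>\<^bsub>Val G X\<^esub> y')"
    using res_mult[OF coh(4) D(3) z] y(2) y'(2) nt_mult[OF eta(3) D(7) y(1) y'(1)] by simp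
  have p3: "Res G i (y \<otimes>\<^bsub>Val G X\<^esub> y') = (a \<otimes>\<^bsub>Val G W\<^esub> a') \<otimes>\<^bsub>Val G W\<^esub> (b \<otimes>\<^bsub>Val G W\<^esub> b')"
    using res_mult[OF coh(1) D(2) y(1) y'(1)] y(5) y'(5) ab by (simp add: W.m_ac)
  have "crel Y (z \<otimes>\<^bsub>Val HJ Y\<^esub> z') (Res G l (a \<otimes>\<^bsub>Val G W\<^esub> a'))"
    using crelI[OF d p1 p2 tors_mult[OF coh(1) U y(3) y'(3)] tors_mult[OF coh(1) V y(4) y'(4)] p3] .
  then show "cmap Y (z \<otimes>\<^bsub>Val HJ Y\<^esub> z') = cmap Y z \<otimes>\<^bsub>Val G (\<Omega>\<^sub>0 Y)\<^esub> cmap Y z'"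
    using cmap_eq[OF Y HY.m_closed[OF z]] 1 2 res_mult[OF coh(1) D(1) ab(1,3)] by simp
qed

section \<open>Exactness at the three kinds of terms\<close>

lemma exact_left:
  assumes Y: "Y \<in> Obj \<T>" and z: "z\<^sub>1 \<in> el HU Y" "z\<^sub>2 \<in> el HV Y" "\<zeta>U Y z\<^sub>1 = \<zeta>V Y z\<^sub>2"
  obtains w where "w \<in> el G Y" "\<eta>U Y w = z\<^sub>1" "\<eta>V Y w = z\<^sub>2"
proof -
  obtain Y\<^sub>1 s y\<^sub>1 where s: "s \<in> denoms \<U> Y\<^sub>1 Y" "y\<^sub>1 \<in> el G Y\<^sub>1" "Res HU s z\<^sub>1 = \<eta>U Y\<^sub>1 y\<^sub>1" using loc_surj[OF locU Y z(1)] .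
  obtain Y\<^sub>2 t y\<^sub>2 where t: "t \<in> denoms \<V> Y\<^sub>2 Y" "y\<^sub>2 \<in> el G Y\<^sub>2" "Res HV t z\<^sub>2 = \<eta>V Y\<^sub>2 y\<^sub>2" using loc_surj[OF locV Y z(2)] .
  have h: "s \<in> Y\<^sub>1 \<leadsto> Y" "t \<in> Y\<^sub>2 \<leadsto> Y" using s t by blast+
  have st: "s \<in> denoms \<J> Y\<^sub>1 Y" "t \<in> denoms \<J> Y\<^sub>2 Y" using s(1) t(1) denoms_mono[OF J(2)] denoms_mono[OF J(3)] by blast+
  obtain W\<^sub>1 u\<^sub>1 v\<^sub>1 where u1: "u\<^sub>1 \<in> W\<^sub>1 \<leadsto> Y\<^sub>1" "v\<^sub>1 \<in> W\<^sub>1 \<leadsto> Y\<^sub>2" "s \<cdot> u\<^sub>1 = t \<cdot> v\<^sub>1" "s \<cdot> u\<^sub>1 \<in> denoms \<J> W\<^sub>1 Y"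
    using denoms_ore[OF J(1) st] .
  note \<zeta>1 = nt_closed[OF \<zeta>U Y z(1)]
  have "\<eta>J W\<^sub>1 (Res G u\<^sub>1 y\<^sub>1) = Res HJ (s \<cdot> u\<^sub>1) (\<zeta>U Y z\<^sub>1)"
    using nt_res[OF eta(3) u1(1) s(2)] \<zeta>\<eta>U[OF homD(4)[OF h(1)] s(2)] s(3) nt_res[OF \<zeta>U h(1) z(1)]
      res_comp[OF coh(4) u1(1) h(1) \<zeta>1] by simp
  moreover have "\<eta>J W\<^sub>1 (Res G v\<^sub>1 y\<^sub>2) = Res HJ (t \<cdot> v\<^sub>1) (\<zeta>V Y z\<^sub>2)"
    using nt_res[OF eta(3) u1(2) t(2)] \<zeta>\<eta>V[OF homD(4)[OF h(2)] t(2)] t(3) nt_res[OF \<zeta>V h(2) z(2)]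
      res_comp[OF coh(4) u1(2) h(2) nt_closed[OF \<zeta>V Y z(2)]] by simp
  ultimately have "\<eta>J W\<^sub>1 (Res G u\<^sub>1 y\<^sub>1) = \<eta>J W\<^sub>1 (Res G v\<^sub>1 y\<^sub>2)" using u1(3) z(3) by simp
  then obtain W q where q: "q \<in> denoms \<J> W W\<^sub>1" "Res G q (Res G u\<^sub>1 y\<^sub>1) = Res G q (Res G v\<^sub>1 y\<^sub>2)"
    using loc_eq[OF locJ homD(4)[OF u1(1)] res_closed[OF coh(1) u1(1) s(2)] res_closed[OF coh(1) u1(2) t(2)]] by metis
  have qh: "q \<in> W \<leadsto> W\<^sub>1" using q by blast
  define u where "u = u\<^sub>1 \<cdot> q"
  define v where "v = v\<^sub>1 \<cdot> q"
  have uv: "u \<in> W \<leadsto> Y\<^sub>1" "v \<in> W \<leadsto> Y\<^sub>2" unfolding u_def v_def using comp_closed[OF qh u1(1)] comp_closed[OF qh u1(2)] .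
  have su: "s \<cdot> u = t \<cdot> v" "s \<cdot> u \<in> denoms \<J> W Y"
    unfolding u_def v_def using comp_assoc[OF qh u1(1) h(1)] comp_assoc[OF qh u1(2) h(2)] u1(3) denoms_comp[OF J(1) q(1) u1(4)] by simp_all
  have eq: "Res G u y\<^sub>1 = Res G v y\<^sub>2"
    unfolding u_def v_def using res_comp[OF coh(1) qh u1(1) s(2)] res_comp[OF coh(1) qh u1(2) t(2)] q(2) by simp
  have suh: "s \<cdot> u \<in> W \<leadsto> Y" using su(2) by blast
  obtain E j k where E: "tri E j W (s \<cdot> u) Y k" "E \<in> \<J>" using denoms_fiberE[OF J(1) su(2)] .
  note j = triD(2)[OF E(1)]
  \<comment> \<open>The fibre E of \<open>s \<cdot> u\<close> maps to the fibre A of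
    \<open>r\<close>, which lies in \<S>, and the restriction to E factors through the value of G at
    A.\<close>
  have fib: "Res G j (Res G x y) \<in> tors \<S> G E"
    if S: "\<S> \<in> Thick \<T>" and r: "r \<in> denoms \<S> X Y" "x \<in> W \<leadsto> X" "r \<cdot> x = s \<cdot> u" and y: "y \<in> el G X" for \<S> r X x y
  proof -
    obtain A i k' where A: "tri A i X r Y k'" "A \<in> \<S>" using denoms_fiberE[OF S r(1)] .
    note i = triD(2)[OF A(1)]
    have "r \<cdot> (x \<cdot> j) = Zero \<T> E Y" using comp_assoc[OF j r(2) triD(3)[OF A(1)]] r(3) tri_comp_zero(1)[OF E(1)] by simp
    then obtain g where g: "g \<in> E \<leadsto> A" "i \<cdot> g = x \<cdot> j" using weak_kernel[OF A(1) comp_closed[OF j r(2)]] by metis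
    have "Res G j (Res G x y) = Res G g (Res G i y)"
      using res_comp[OF coh(1) j r(2) y] g(2) res_comp[OF coh(1) g(1) i y] by simp
    then show ?thesis using tors_elemI[OF coh(1) A(2) g(1) res_closed[OF coh(1) i y]] by simp
  qed
  \<comment> \<open>The common restriction to E is torsion for both subcategories, hence trivial, so
    the common element on W descends to Y.\<close>
  have "Res G j (Res G u y\<^sub>1) = \<one>\<^bsub>Val G E\<^esub>"
    using tzero[OF E(2) fib[OF U s(1) uv(1) refl s(2)]] fib[OF V t(1) uv(2) su(1)[symmetric] t(2)] eq by simp
  then obtain w where w: "w \<in> el G Y" "Res G (s \<cdot> u) w = Res G u y\<^sub>1"
    using res_exact[OF coh(1) E(1) res_closed[OF coh(1) uv(1) s(2)]] by metis
  have "Res HJ (s \<cdot> u) (\<eta>J Y w) = Res HJ (s \<cdot> u) (\<zeta>U Y z\<^sub>1)"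
    using nt_res[OF eta(3) suh w(1)] w(2) nt_res[OF eta(3) uv(1) s(2)] \<zeta>\<eta>U[OF homD(4)[OF h(1)] s(2)] s(3)
      nt_res[OF \<zeta>U h(1) z(1)] res_comp[OF coh(4) uv(1) h(1) \<zeta>1] by simp
  then have wJ: "\<eta>J Y w = \<zeta>U Y z\<^sub>1" using loc_inj[OF locJ su(2) nt_closed[OF eta(3) Y w(1)] \<zeta>1] by blast
  interpret GY: comm_group "Val G Y" by (rule val_group[OF coh(1) Y])
  interpret UY: comm_group "Val HU Y" by (rule val_group[OF coh(2) Y])
  interpret VY: comm_group "Val HV Y" by (rule val_group[OF coh(3) Y])
  interpret JY: comm_group "Val HJ Y" by (rule val_group[OF coh(4) Y])
  note wU = nt_closed[OF eta(1) Y w(1)] and wV = nt_closed[OF eta(2) Y w(1)]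
  \<comment> \<open>So far \<open>w\<close> matches \<open>z\<^sub>1\<close> and
    \<open>z\<^sub>2\<close> only in \<open>HJ\<close>. The errors come from \<V>-torsion and from
    \<U>-torsion of G respectively, and each correction is invisible in the other localisation, so
    both can be made together.\<close>
  have "\<zeta>U Y (z\<^sub>1 \<otimes>\<^bsub>Val HU Y\<^esub> inv\<^bsub>Val HU Y\<^esub> \<eta>U Y w) = \<one>\<^bsub>Val HJ Y\<^esub>"
    using nt_mult[OF \<zeta>U Y z(1) UY.inv_closed[OF wU]] nt_inv[OF \<zeta>U coh(2,4) Y wU] \<zeta>\<eta>U[OF Y w(1)] wJ \<zeta>1 by simp
  then obtain w\<^sub>1 where w1: "w\<^sub>1 \<in> tors \<V> G Y" "\<eta>U Y w\<^sub>1 = z\<^sub>1 \<otimes>\<^bsub>Val HU Y\<^esub> inv\<^bsub>Val HU Y\<^esub> \<eta>U Y w"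
    using loc_kernel[OF U V comm van locU locJ \<zeta>U \<zeta>\<eta>U Y UY.m_closed[OF z(1) UY.inv_closed[OF wU]]] by blast
  have "\<zeta>V Y (z\<^sub>2 \<otimes>\<^bsub>Val HV Y\<^esub> inv\<^bsub>Val HV Y\<^esub> \<eta>V Y w) = \<one>\<^bsub>Val HJ Y\<^esub>"
    using nt_mult[OF \<zeta>V Y z(2) VY.inv_closed[OF wV]] nt_inv[OF \<zeta>V coh(3,4) Y wV] \<zeta>\<eta>V[OF Y w(1)] wJ \<zeta>1 z(3) by simp
  moreover have "el G X = {\<one>\<^bsub>Val G X\<^esub>}" if "X \<in> \<V> \<inter> \<U>" for X using van that by blast
  moreover have "localisation (thick_join \<T> {\<V>, \<U>}) G HJ \<eta>J" using locJ by (simp add: insert_commute)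
  ultimately obtain w\<^sub>2 where w2: "w\<^sub>2 \<in> tors \<U> G Y" "\<eta>V Y w\<^sub>2 = z\<^sub>2 \<otimes>\<^bsub>Val HV Y\<^esub> inv\<^bsub>Val HV Y\<^esub> \<eta>V Y w"
    using loc_kernel[OF V U commuting_sym[OF comm] _ locV _ \<zeta>V \<zeta>\<eta>V Y VY.m_closed[OF z(2) VY.inv_closed[OF wV]]] by blast
  note e1 = tors_el[OF coh(1) w1(1)] and e2 = tors_el[OF coh(1) w2(1)]
  have n1: "\<eta>V Y w\<^sub>1 = \<one>\<^bsub>Val HV Y\<^esub>" and n2: "\<eta>U Y w\<^sub>2 = \<one>\<^bsub>Val HU Y\<^esub>"
    using loc_tors[OF locV Y e1] w1(1) loc_tors[OF locU Y e2] w2(1) by blast+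
  have e12: "w\<^sub>1 \<otimes>\<^bsub>Val G Y\<^esub> w\<^sub>2 \<in> el G Y" using e1 e2 by simp
  show thesis
  proof (rule that[of "w\<^sub>1 \<otimes>\<^bsub>Val G Y\<^esub> w\<^sub>2 \<otimes>\<^bsub>Val G Y\<^esub> w"])
    show "w\<^sub>1 \<otimes>\<^bsub>Val G Y\<^esub> w\<^sub>2 \<otimes>\<^bsub>Val G Y\<^esub> w \<in> el G Y" using e12 w(1) by simp
    show "\<eta>U Y (w\<^sub>1 \<otimes>\<^bsub>Val G Y\<^esub> w\<^sub>2 \<otimes>\<^bsub>Val G Y\<^esub> w) = z\<^sub>1"
      using nt_mult[OF eta(1) Y e12 w(1)] nt_mult[OF eta(1) Y e1 e2] n2 w1(2) z(1) wU by (simp add: UY.m_assoc)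
    show "\<eta>V Y (w\<^sub>1 \<otimes>\<^bsub>Val G Y\<^esub> w\<^sub>2 \<otimes>\<^bsub>Val G Y\<^esub> w) = z\<^sub>2"
      using nt_mult[OF eta(2) Y e12 w(1)] nt_mult[OF eta(2) Y e1 e2] n1 w2(2) z(2) wV by (simp add: VY.m_assoc)
  qed
qed

text \<open>A representative over a \<U>-denominator has its fibre W in \<U>, so its whole
  restriction to W is the \<U>-part, and this dies on \<open>\<Omega>\<^sub>0 Y\<close> because
  consecutive arrows of a triangle compose to zero. In \<open>cmap_right\<close> the \<U>-part is
  trivial instead.\<close>

lemma cmap_left:
  assumes Y: "Y \<in> Obj \<T>" and z: "z \<in> el HU Y"
  shows "cmap Y (\<zeta>U Y z) = \<one>\<^bsub>Val G (\<Omega>\<^sub>0 Y)\<^esub>"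
proof -
  obtain X s x where s: "s \<in> denoms \<U> X Y" "x \<in> el G X" "Res HU s z = \<eta>U X x" using loc_surj[OF locU Y z] .
  obtain W i k where t: "tri W i X s Y k" "W \<in> \<U>" using denoms_fiberE[OF U s(1)] .
  obtain l where d: "dtri Y l W i X s" using tri_dtri[OF t(1)] .
  note D = dtriD[OF d]
  interpret W: comm_group "Val G W" by (rule val_group[OF coh(1) D(6)])
  note ix = res_closed[OF coh(1) D(2) s(2)]
  have 1: "Res HJ s (\<zeta>U Y z) = \<eta>J X x" using nt_res[OF \<zeta>U D(3) z] s(3) \<zeta>\<eta>U[OF D(7) s(2)] by simp
  have 2: "Res G i x = Res G i x \<otimes>\<^bsub>Val G W\<^esub> \<one>\<^bsub>Val G W\<^esub>" using ix by simp
  have "crel Y (\<zeta>U Y z) (Res G l (Res G i x))"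
    using crelI[OF d _ s(2) 1 tors_all[OF coh(1) ix t(2) D(6)] tors_one[OF coh(1) V D(6)] 2]
      t(2) J(2) by blast
  then have "cmap Y (\<zeta>U Y z) = Res G l (Res G i x)" using cmap_eq[OF Y nt_closed[OF \<zeta>U Y z]] by blast
  then show ?thesis using res_comp_one[OF coh(1) D(4) s(2)] by simp
qed

lemma cmap_right:
  assumes Y: "Y \<in> Obj \<T>" and z: "z \<in> el HV Y"
  shows "cmap Y (\<zeta>V Y z) = \<one>\<^bsub>Val G (\<Omega>\<^sub>0 Y)\<^esub>"
proof -
  obtain X s x where s: "s \<in> denoms \<V> X Y" "x \<in> el G X" "Res HV s z = \<eta>V X x" using loc_surj[OF locV Y z] .
  obtain W i k where t: "tri W i X s Y k" "W \<in> \<V>" using denoms_fiberE[OF V s(1)] .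
  obtain l where d: "dtri Y l W i X s" using tri_dtri[OF t(1)] .
  note D = dtriD[OF d]
  interpret W: comm_group "Val G W" by (rule val_group[OF coh(1) D(6)])
  note ix = res_closed[OF coh(1) D(2) s(2)]
  have 1: "Res HJ s (\<zeta>V Y z) = \<eta>J X x" using nt_res[OF \<zeta>V D(3) z] s(3) \<zeta>\<eta>V[OF D(7) s(2)] by simp
  have 2: "Res G i x = \<one>\<^bsub>Val G W\<^esub> \<otimes>\<^bsub>Val G W\<^esub> Res G i x" using ix by simp
  have "crel Y (\<zeta>V Y z) (Res G l \<one>\<^bsub>Val G W\<^esub>)"
    using crelI[OF d _ s(2) 1 tors_one[OF coh(1) U D(6)] tors_all[OF coh(1) ix t(2) D(6)] 2]
      t(2) J(3) by blast
  then have "cmap Y (\<zeta>V Y z) = Res G l \<one>\<^bsub>Val G W\<^esub>" using cmap_eq[OF Y nt_closed[OF \<zeta>V Y z]] by blast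
  then show ?thesis using res_one[OF coh(1) D(1)] by simp
qed

lemma exact_middle:
  assumes Y: "Y \<in> Obj \<T>" and z: "z \<in> el HJ Y" "cmap Y z = \<one>\<^bsub>Val G (\<Omega>\<^sub>0 Y)\<^esub>"
  obtains z\<^sub>1 z\<^sub>2 where "z\<^sub>1 \<in> el HU Y" "z\<^sub>2 \<in> el HV Y" "z = \<zeta>U Y z\<^sub>1 \<otimes>\<^bsub>Val HJ Y\<^esub> \<zeta>V Y z\<^sub>2"
proof -
  obtain l W i X s y a b where d: "dtri Y l W i X s" "W \<in> \<J>" "y \<in> el G X"
    "Res HJ s z = \<eta>J X y" "a \<in> tors \<U> G W" "b \<in> tors \<V> G W" "Res G i y = a \<otimes>\<^bsub>Val G W\<^esub> b" "cmap Y z = Res G l a"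
    using conn_relE[OF cmap_crel[OF Y z(1)]] .
  note D = dtriD[OF d(1)]
  note t = dtri_tri[OF d(1)]
  have sJ: "s \<in> denoms \<J> X Y" using dtri_denoms[OF d(1,2)] .
  note ab = tors_el[OF coh(1) d(5)] tors_el[OF coh(1) d(6)]
  interpret W: comm_group "Val G W" by (rule val_group[OF coh(1) D(6)])
  interpret X: comm_group "Val G X" by (rule val_group[OF coh(1) D(7)])
  interpret JY: comm_group "Val HJ Y" by (rule val_group[OF coh(4) Y])
  \<comment> \<open>The \<U>-part \<open>a\<close> dies on \<open>\<Omega>\<^sub>0 Y\<close>, so it
    is restricted from X. This splits \<open>y\<close> into a factor that dies in \<open>HU\<close>
    on W and one that dies in \<open>HV\<close> on W, and their images descend to Y there.\<close>
  obtain y\<^sub>1 where y1: "y\<^sub>1 \<in> el G X" "Res G i y\<^sub>1 = a" using res_exact[OF coh(1) D(4) ab(1)] d(8) z(2) by metis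
  define y\<^sub>2 where "y\<^sub>2 = inv\<^bsub>Val G X\<^esub> y\<^sub>1 \<otimes>\<^bsub>Val G X\<^esub> y"
  have y2: "y\<^sub>2 \<in> el G X" and y12: "y = y\<^sub>1 \<otimes>\<^bsub>Val G X\<^esub> y\<^sub>2"
    unfolding y\<^sub>2_def using y1(1) d(3) by (simp_all flip: X.m_assoc)
  have iy2: "Res G i y\<^sub>2 = b"
    unfolding y\<^sub>2_def using res_mult[OF coh(1) D(2) X.inv_closed[OF y1(1)] d(3)] res_inv[OF coh(1) D(2) y1(1)] y1(2) d(7) ab
    by (simp flip: W.m_assoc)
  have "Res HU i (\<eta>U X y\<^sub>1) = \<one>\<^bsub>Val HU W\<^esub>" "Res HV i (\<eta>V X y\<^sub>2) = \<one>\<^bsub>Val HV W\<^esub>"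
    using nt_res[OF eta(1) D(2) y1(1)] y1(2) loc_tors[OF locU D(6) ab(1)] d(5)
      nt_res[OF eta(2) D(2) y2] iy2 loc_tors[OF locV D(6) ab(2)] d(6) by simp_all
  then obtain z\<^sub>1 z\<^sub>2 where zz: "z\<^sub>1 \<in> el HU Y" "Res HU s z\<^sub>1 = \<eta>U X y\<^sub>1" "z\<^sub>2 \<in> el HV Y" "Res HV s z\<^sub>2 = \<eta>V X y\<^sub>2"
    using res_exact[OF coh(2) t nt_closed[OF eta(1) D(7) y1(1)]] res_exact[OF coh(3) t nt_closed[OF eta(2) D(7) y2]] by metis
  note \<zeta> = nt_closed[OF \<zeta>U Y zz(1)] nt_closed[OF \<zeta>V Y zz(3)]
  have "Res HJ s (\<zeta>U Y z\<^sub>1 \<otimes>\<^bsub>Val HJ Y\<^esub> \<zeta>V Y z\<^sub>2) = Res HJ s z"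
    using res_mult[OF coh(4) D(3) \<zeta>] nt_res[OF \<zeta>U D(3) zz(1)] nt_res[OF \<zeta>V D(3) zz(3)] zz(2,4)
      \<zeta>\<eta>U[OF D(7) y1(1)] \<zeta>\<eta>V[OF D(7) y2] nt_mult[OF eta(3) D(7) y1(1) y2] y12 d(4) by simp
  then have "z = \<zeta>U Y z\<^sub>1 \<otimes>\<^bsub>Val HJ Y\<^esub> \<zeta>V Y z\<^sub>2" using loc_inj[OF locJ sJ z(1) JY.m_closed[OF \<zeta>]] by simp
  then show thesis using that zz by blast
qed

lemma cmap_tors:
  assumes Y: "Y \<in> Obj \<T>" and z: "z \<in> el HJ Y"
  shows "cmap Y z \<in> tors \<U> G (\<Omega>\<^sub>0 Y)" "cmap Y z \<in> tors \<V> G (\<Omega>\<^sub>0 Y)"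
proof -
  obtain l W i X s y a b where d: "dtri Y l W i X s" "W \<in> \<J>" "y \<in> el G X"
    "Res HJ s z = \<eta>J X y" "a \<in> tors \<U> G W" "b \<in> tors \<V> G W" "Res G i y = a \<otimes>\<^bsub>Val G W\<^esub> b" "cmap Y z = Res G l a"
    using conn_relE[OF cmap_crel[OF Y z]] .
  note D = dtriD[OF d(1)]
  note ab = tors_el[OF coh(1) d(5)] tors_el[OF coh(1) d(6)]
  interpret O: comm_group "Val G (\<Omega>\<^sub>0 Y)" by (rule val_group[OF coh(1) desusp(1)[OF Y]])
  note la = res_closed[OF coh(1) D(1) ab(1)] and lb = res_closed[OF coh(1) D(1) ab(2)]
  show "cmap Y z \<in> tors \<U> G (\<Omega>\<^sub>0 Y)" using tors_res[OF coh(1) d(5) D(1)] d(8) by simp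
  \<comment> \<open>The arrows \<open>l\<close> and \<open>i\<close> compose to zero, so the two
    parts restrict to mutually inverse elements on \<open>\<Omega>\<^sub>0 Y\<close>.\<close>
  have "Res G l a \<otimes>\<^bsub>Val G (\<Omega>\<^sub>0 Y)\<^esub> Res G l b = \<one>\<^bsub>Val G (\<Omega>\<^sub>0 Y)\<^esub>"
    using res_mult[OF coh(1) D(1) ab] d(7) res_comp_one[OF coh(1) D(4) d(3)] by simp
  then have "cmap Y z = inv\<^bsub>Val G (\<Omega>\<^sub>0 Y)\<^esub> (Res G l b)" using O.inv_equality[OF _ lb la] d(8) by simp
  then show "cmap Y z \<in> tors \<V> G (\<Omega>\<^sub>0 Y)" using tors_inv[OF coh(1) tors_res[OF coh(1) d(6) D(1)]] by simp
qed

text \<open>Here \<open>x\<close> comes from A in \<U> and its inverse from B in \<V>. With W their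
  biproduct, the two morphisms combine to \<open>l\<close> from \<open>\<Omega>\<^sub>0 Y\<close> to
  W, and the product of the two elements over W restricts to the neutral element along
  \<open>l\<close>. It therefore comes from the cone X of \<open>l\<close>, and its image in
  \<open>HJ\<close> descends along X \<rightarrow> Y.\<close>

lemma exact_right:
  assumes Y: "Y \<in> Obj \<T>" and x: "x \<in> tors \<U> G (\<Omega>\<^sub>0 Y)" "x \<in> tors \<V> G (\<Omega>\<^sub>0 Y)"
  obtains z where "z \<in> el HJ Y" "cmap Y z = x"
proof -
  obtain A \<kappa> a where A: "A \<in> \<U>" "\<kappa> \<in> \<Omega>\<^sub>0 Y \<leadsto> A" "a \<in> el G A" "x = Res G \<kappa> a" using tors_elem[OF coh(1) x(1)] .
  obtain B \<mu> b where B: "B \<in> \<V>" "\<mu> \<in> \<Omega>\<^sub>0 Y \<leadsto> B" "b \<in> el G B" "inv\<^bsub>Val G (\<Omega>\<^sub>0 Y)\<^esub> x = Res G \<mu> b"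
    using tors_elem[OF coh(1) tors_inv[OF coh(1) x(2)]] .
  obtain W where "is_biproduct \<T> A B W" using biproduct_exists homD(5)[OF A(2)] homD(5)[OF B(2)] by blast
  then obtain i j p r where W: "is_biproduct \<T> A B W" "i \<in> A \<leadsto> W" "j \<in> B \<leadsto> W" "p \<in> W \<leadsto> A" "r \<in> W \<leadsto> B"
    "p \<cdot> i = Id \<T> A" "r \<cdot> j = Id \<T> B" "p \<cdot> j = Zero \<T> B A" "r \<cdot> i = Zero \<T> A B" unfolding is_biproduct_def by blast
  have WJ: "W \<in> \<J>" using thick_biproduct[OF J(1) _ _ W(1)] A(1) B(1) J(2,3) by blast
  note i\<kappa> = comp_closed[OF A(2) W(2)] and j\<mu> = comp_closed[OF B(2) W(3)]
  note oA = homD(5)[OF A(2)] and oB = homD(5)[OF B(2)]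
  define l where "l = i \<cdot> \<kappa> \<^bold>+ j \<cdot> \<mu>"
  have l: "l \<in> \<Omega>\<^sub>0 Y \<leadsto> W" unfolding l_def using add_closed[OF i\<kappa> j\<mu>] .
  have pl: "p \<cdot> l = \<kappa>"
    unfolding l_def using comp_add_right[OF i\<kappa> j\<mu> W(4)] comp_assoc[OF A(2) W(2,4)] comp_assoc[OF B(2) W(3,4)] W(6,8)
      id_left[OF A(2)] comp_zero_left[OF B(2) oA] add_zero[OF A(2)] by simp
  have rl: "r \<cdot> l = \<mu>"
    unfolding l_def using comp_add_right[OF i\<kappa> j\<mu> W(5)] comp_assoc[OF A(2) W(2,5)] comp_assoc[OF B(2) W(3,5)] W(7,9)
      id_left[OF B(2)] comp_zero_left[OF A(2) oB] zero_add[OF B(2)] by simp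
  obtain i' X s where d: "dtri Y l W i' X s" using dtri_complete[OF l Y] by metis
  note D = dtriD[OF d]
  note xO = tors_el[OF coh(1) x(1)]
  interpret O: comm_group "Val G (\<Omega>\<^sub>0 Y)" by (rule val_group[OF coh(1) desusp(1)[OF Y]])
  interpret W: comm_group "Val G W" by (rule val_group[OF coh(1) D(6)])
  have at: "Res G p a \<in> tors \<U> G W" and bt: "Res G r b \<in> tors \<V> G W"
    using tors_elemI[OF coh(1) A(1) W(4) A(3)] tors_elemI[OF coh(1) B(1) W(5) B(3)] .
  note ab = tors_el[OF coh(1) at] tors_el[OF coh(1) bt]
  have la: "Res G l (Res G p a) = x" using res_comp[OF coh(1) l W(4) A(3)] pl A(4) by simp
  have lb: "Res G l (Res G r b) = inv\<^bsub>Val G (\<Omega>\<^sub>0 Y)\<^esub> x" using res_comp[OF coh(1) l W(5) B(3)] rl B(4) by simp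
  have "Res G l (Res G p a \<otimes>\<^bsub>Val G W\<^esub> Res G r b) = \<one>\<^bsub>Val G (\<Omega>\<^sub>0 Y)\<^esub>" using res_mult[OF coh(1) l ab] la lb xO by simp
  then obtain y where y: "y \<in> el G X" "Res G i' y = Res G p a \<otimes>\<^bsub>Val G W\<^esub> Res G r b"
    using res_exact[OF coh(1) D(4) W.m_closed[OF ab]] by metis
  obtain z where z: "z \<in> el HJ Y" "Res HJ s z = \<eta>J X y"
    using loc_div[OF locJ J(1) dtri_denoms[OF d WJ] nt_closed[OF eta(3) D(7) y(1)]] .
  have "cmap Y z = x" using cmap_eq[OF Y z(1) crelI[OF d WJ y(1) z(2) at bt y(2)]] la by simp
  then show thesis using that z(1) by blast
qed

lemma mv_exact_left:
  assumes Y: "Y \<in> Obj \<T>"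
  shows "(\<lambda>w. (\<eta>U Y w, \<eta>V Y w)) ` el G Y =
    kernel (Val HU Y \<times>\<times> Val HV Y) (Val HJ Y) (\<lambda>(a, b). \<zeta>U Y a \<otimes>\<^bsub>Val HJ Y\<^esub> inv\<^bsub>Val HJ Y\<^esub> (\<zeta>V Y b))"
proof -
  interpret J: comm_group "Val HJ Y" by (rule val_group[OF coh(4) Y])
  show ?thesis
  proof (intro equalityI subsetI)
    fix p assume "p \<in> (\<lambda>w. (\<eta>U Y w, \<eta>V Y w)) ` el G Y"
    then obtain w where w: "w \<in> el G Y" "p = (\<eta>U Y w, \<eta>V Y w)" by blast
    then show "p \<in> kernel (Val HU Y \<times>\<times> Val HV Y) (Val HJ Y) (\<lambda>(a, b). \<zeta>U Y a \<otimes>\<^bsub>Val HJ Y\<^esub> inv\<^bsub>Val HJ Y\<^esub> (\<zeta>V Y b))"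
      using nt_closed[OF eta(1) Y] nt_closed[OF eta(2) Y] nt_closed[OF eta(3) Y] \<zeta>\<eta>U[OF Y] \<zeta>\<eta>V[OF Y]
      by (simp add: kernel_def)
  next
    fix p assume "p \<in> kernel (Val HU Y \<times>\<times> Val HV Y) (Val HJ Y) (\<lambda>(a, b). \<zeta>U Y a \<otimes>\<^bsub>Val HJ Y\<^esub> inv\<^bsub>Val HJ Y\<^esub> (\<zeta>V Y b))"
    then obtain a b where p: "p = (a, b)" "a \<in> el HU Y" "b \<in> el HV Y"
      "\<zeta>U Y a \<otimes>\<^bsub>Val HJ Y\<^esub> inv\<^bsub>Val HJ Y\<^esub> (\<zeta>V Y b) = \<one>\<^bsub>Val HJ Y\<^esub>" by (auto simp: kernel_def)
    then have "\<zeta>U Y a = \<zeta>V Y b" using J.mult_inv_one_iff nt_closed[OF \<zeta>U Y] nt_closed[OF \<zeta>V Y] by blast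
    then show "p \<in> (\<lambda>w. (\<eta>U Y w, \<eta>V Y w)) ` el G Y" using exact_left[OF Y p(2,3)] p(1) by blast
  qed
qed

lemma mv_exact_middle:
  assumes Y: "Y \<in> Obj \<T>"
  shows "(\<lambda>(a, b). \<zeta>U Y a \<otimes>\<^bsub>Val HJ Y\<^esub> inv\<^bsub>Val HJ Y\<^esub> (\<zeta>V Y b)) ` (el HU Y \<times> el HV Y) =
    {z \<in> el HJ Y. cmap Y z = \<one>\<^bsub>Val G (\<Omega>\<^sub>0 Y)\<^esub>}"
proof -
  interpret J: comm_group "Val HJ Y" by (rule val_group[OF coh(4) Y])
  interpret V: comm_group "Val HV Y" by (rule val_group[OF coh(3) Y])
  interpret O: comm_group "Val G (\<Omega>\<^sub>0 Y)" by (rule val_group[OF coh(1) desusp(1)[OF Y]])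
  show ?thesis
  proof (intro equalityI subsetI)
    fix z assume "z \<in> (\<lambda>(a, b). \<zeta>U Y a \<otimes>\<^bsub>Val HJ Y\<^esub> inv\<^bsub>Val HJ Y\<^esub> (\<zeta>V Y b)) ` (el HU Y \<times> el HV Y)"
    then obtain a b where ab: "a \<in> el HU Y" "b \<in> el HV Y" "z = \<zeta>U Y a \<otimes>\<^bsub>Val HJ Y\<^esub> inv\<^bsub>Val HJ Y\<^esub> (\<zeta>V Y b)" by auto
    note c = nt_closed[OF \<zeta>U Y ab(1)] nt_closed[OF \<zeta>V Y V.inv_closed[OF ab(2)]]
    have z: "z = \<zeta>U Y a \<otimes>\<^bsub>Val HJ Y\<^esub> \<zeta>V Y (inv\<^bsub>Val HV Y\<^esub> b)" using ab nt_inv[OF \<zeta>V coh(3,4) Y] by simp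
    have "cmap Y z = \<one>\<^bsub>Val G (\<Omega>\<^sub>0 Y)\<^esub>"
      unfolding z cmap_mult[OF Y c] using cmap_left[OF Y ab(1)] cmap_right[OF Y V.inv_closed[OF ab(2)]] by simp
    then show "z \<in> {z \<in> el HJ Y. cmap Y z = \<one>\<^bsub>Val G (\<Omega>\<^sub>0 Y)\<^esub>}" using z c by simp
  next
    fix z assume "z \<in> {z \<in> el HJ Y. cmap Y z = \<one>\<^bsub>Val G (\<Omega>\<^sub>0 Y)\<^esub>}"
    then obtain a b where ab: "a \<in> el HU Y" "b \<in> el HV Y" "z = \<zeta>U Y a \<otimes>\<^bsub>Val HJ Y\<^esub> \<zeta>V Y b"
      using exact_middle[OF Y] by blast
    then have "z = \<zeta>U Y a \<otimes>\<^bsub>Val HJ Y\<^esub> inv\<^bsub>Val HJ Y\<^esub> (\<zeta>V Y (inv\<^bsub>Val HV Y\<^esub> b))"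
      using nt_inv[OF \<zeta>V coh(3,4) Y] nt_closed[OF \<zeta>V Y] by simp
    then show "z \<in> (\<lambda>(a, b). \<zeta>U Y a \<otimes>\<^bsub>Val HJ Y\<^esub> inv\<^bsub>Val HJ Y\<^esub> (\<zeta>V Y b)) ` (el HU Y \<times> el HV Y)"
      using ab(1) V.inv_closed[OF ab(2)] by (intro image_eqI[of _ _ "(a, inv\<^bsub>Val HV Y\<^esub> b)"]) simp_all
  qed
qed

lemma mv_kernel_tors:
  "X \<in> Obj \<T> \<Longrightarrow> kernel (Val G X) (Val HU X \<times>\<times> Val HV X) (\<lambda>w. (\<eta>U X w, \<eta>V X w)) = tors \<U> G X \<inter> tors \<V> G X"
  using loc_tors[OF locU] loc_tors[OF locV] tors_el[OF coh(1)] unfolding kernel_def by auto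

lemma mv_exact_right:
  assumes Y: "Y \<in> Obj \<T>"
  shows "cmap Y ` el HJ Y = tors \<U> G (\<Omega>\<^sub>0 Y) \<inter> tors \<V> G (\<Omega>\<^sub>0 Y)"
  using cmap_tors[OF Y] exact_right[OF Y] by blast

end

context triangulated_category
begin

section \<open>Naturality in the functor, and the shifted sequences\<close>

lemma Loc_map_natural:
  fixes F F' :: "('o, 'm, 'g) presheaf"
  assumes S: "\<S> \<in> Thick \<T>" and F: "cohomological \<T> F" "cohomological \<T> F'"
    and \<alpha>: "natural_transformation \<T> F F' \<alpha>"
  shows "natural_transformation \<T> (Loc \<T> \<S> F) (Loc \<T> \<S> F') (Loc_map \<T> \<S> F' \<alpha>)"
proof -
  note L = Loc_map_lg[OF S F \<alpha>]
  have "Loc_map \<T> \<S> F' \<alpha> Y \<in> hom (Val (Loc \<T> \<S> F) Y) (Val (Loc \<T> \<S> F') Y)" if Y: "Y \<in> Obj \<T>" for Y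
  proof (rule homI)
    show "Loc_map \<T> \<S> F' \<alpha> Y z \<in> el (Loc \<T> \<S> F') Y" if z: "z \<in> el (Loc \<T> \<S> F) Y" for z
    proof -
      obtain A s y where s: "s \<in> denoms \<S> A Y" "y \<in> el F A" "z = lg \<S> F s y" using Loc_elem[OF S F(1) z] .
      show ?thesis unfolding s(3) L[OF s(1,2)] using Loc_closed[OF S F(2) s(1) nt_closed[OF \<alpha> denoms_obj(1)[OF s(1)] s(2)]] .
    qed
    show "Loc_map \<T> \<S> F' \<alpha> Y (z \<otimes>\<^bsub>Val (Loc \<T> \<S> F) Y\<^esub> z') =
        Loc_map \<T> \<S> F' \<alpha> Y z \<otimes>\<^bsub>Val (Loc \<T> \<S> F') Y\<^esub> Loc_map \<T> \<S> F' \<alpha> Y z'"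
      if z: "z \<in> el (Loc \<T> \<S> F) Y" "z' \<in> el (Loc \<T> \<S> F) Y" for z z'
    proof -
      obtain A s y\<^sub>1 y\<^sub>2 where s: "s \<in> denoms \<S> A Y" "y\<^sub>1 \<in> el F A" "y\<^sub>2 \<in> el F A" "z = lg \<S> F s y\<^sub>1" "z' = lg \<S> F s y\<^sub>2"
        using Loc_common2[OF S F(1) z] .
      note A = denoms_obj(1)[OF s(1)]
      have m: "y\<^sub>1 \<otimes>\<^bsub>Val F A\<^esub> y\<^sub>2 \<in> el F A" using comm_groupE(1)[OF val_group[OF F(1) A] s(2,3)] .
      show ?thesis
        unfolding s(4,5) Loc_mult[OF S F(1) s(1-3)] L[OF s(1,2)] L[OF s(1,3)] L[OF s(1) m] nt_mult[OF \<alpha> A s(2,3)]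
          Loc_mult[OF S F(2) s(1) nt_closed[OF \<alpha> A s(2)] nt_closed[OF \<alpha> A s(3)]] ..
    qed
  qed
  moreover have "Loc_map \<T> \<S> F' \<alpha> X (Res (Loc \<T> \<S> F) f z) = Res (Loc \<T> \<S> F') f (Loc_map \<T> \<S> F' \<alpha> Y z)"
    if f: "f \<in> X \<leadsto> Y" and z: "z \<in> el (Loc \<T> \<S> F) Y" for X Y f z
  proof -
    obtain A s y where s: "s \<in> denoms \<S> A Y" "y \<in> el F A" "z = lg \<S> F s y" using Loc_elem[OF S F(1) z] .
    obtain B s' f' where p: "s' \<in> denoms \<S> B X" "f' \<in> B \<leadsto> A" "s \<cdot> f' = f \<cdot> s'" using denoms_pullback[OF S s(1) f] .
    show ?thesis
      unfolding s(3) Loc_res[OF S F(1) f s(1,2) p] L[OF s(1,2)] L[OF p(1) res_closed[OF F(1) p(2) s(2)]]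
        Loc_res[OF S F(2) f s(1) nt_closed[OF \<alpha> denoms_obj(1)[OF s(1)] s(2)] p] nt_res[OF \<alpha> p(2) s(2)] ..
  qed
  ultimately show ?thesis unfolding natural_transformation_def by blast
qed

lemma Loc_map_incl:
  fixes F F' :: "('o, 'm, 'g) presheaf"
  assumes I: "\<I> \<in> Thick \<T>" and S: "\<S> \<in> Thick \<T>" "\<I> \<subseteq> \<S>" and F: "cohomological \<T> F" "cohomological \<T> F'"
    and \<alpha>: "natural_transformation \<T> F F' \<alpha>" and z: "z \<in> el (Loc \<T> \<I> F) Y"
  shows "Loc_map \<T> \<S> F' \<alpha> Y (Loc_incl \<T> \<S> F Y z) = Loc_incl \<T> \<S> F' Y (Loc_map \<T> \<I> F' \<alpha> Y z)"
proof -
  obtain A s y where s: "s \<in> denoms \<I> A Y" "y \<in> el F A" "z = lg \<I> F s y" using Loc_elem[OF I F(1) z] .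
  have s': "s \<in> denoms \<S> A Y" using denoms_mono[OF S(2)] s(1) by blast
  show ?thesis
    unfolding s(3) Loc_incl_lg[OF I F(1) S s(1,2)] Loc_map_lg[OF S(1) F \<alpha> s' s(2)] Loc_map_lg[OF I F \<alpha> s(1,2)]
      Loc_incl_lg[OF I F(2) S s(1) nt_closed[OF \<alpha> denoms_obj(1)[OF s(1)] s(2)]] ..
qed

lemma susp_pow_closed: "X \<in> Obj \<T> \<Longrightarrow> susp_pow_obj \<T> n X \<in> Obj \<T>"
proof -
  assume X: "X \<in> Obj \<T>"
  have "(\<Sigma>\<^sub>0 ^^ k) X \<in> Obj \<T>" "(\<Omega>\<^sub>0 ^^ k) X \<in> Obj \<T>" for k
    by (induction k) (use X susp(1) desusp(1) in simp_all)
  then show ?thesis unfolding susp_pow_obj_def by simp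
qed

text \<open>Iterates are of \<Sigma> for positive and of its quasi-inverse for negative exponents.
  Lowering \<open>- n\<close> by one therefore adds a desuspension for \<open>n \<ge> 0\<close>, but
  removes a suspension for \<open>n < 0\<close>.\<close>

lemma susp_pow_step:
  "n \<ge> 0 \<Longrightarrow> susp_pow_obj \<T> (- n - 1) X = \<Omega>\<^sub>0 (susp_pow_obj \<T> (- n) X)"
  "n < 0 \<Longrightarrow> susp_pow_obj \<T> (- n) X = \<Sigma>\<^sub>0 (susp_pow_obj \<T> (- n - 1) X)"
proof -
  assume "n \<ge> 0"
  then have "nat (n + 1) = Suc (nat n)" by simp
  then show "susp_pow_obj \<T> (- n - 1) X = \<Omega>\<^sub>0 (susp_pow_obj \<T> (- n) X)"
    using \<open>n \<ge> 0\<close> unfolding susp_pow_obj_def by (cases "n = 0") (simp_all add: add.commute)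
next
  assume "n < 0"
  then have "nat (- n) = Suc (nat (- n - 1))" by simp
  then show "susp_pow_obj \<T> (- n) X = \<Sigma>\<^sub>0 (susp_pow_obj \<T> (- n - 1) X)"
    using \<open>n < 0\<close> unfolding susp_pow_obj_def by simp
qed

theorem mayer_vietoris:
  assumes U: "\<U> \<in> Thick \<T>" and V: "\<V> \<in> Thick \<T>" and comm: "commuting \<T> \<U> \<V>"
  shows "mayer_vietoris_exists \<T> TYPE('g) \<U> \<V>"
proof -
  define I where "I = \<U> \<inter> \<V>"
  define J where "J = thick_join \<T> {\<U>, \<V>}"
  define c :: "('o, 'm, 'g) presheaf \<Rightarrow> 'o \<Rightarrow> ('o, 'm, 'g) germ \<Rightarrow> ('o, 'm, 'g) germ"
    where "c F = conn \<U> \<V> (Loc \<T> I F) (Loc \<T> J F) (Loc_incl \<T> J F)" for F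
  have I: "I \<in> Thick \<T>" "I \<subseteq> \<U>" "I \<subseteq> \<V>" unfolding I_def using thick_Int[OF U V] by auto
  have J: "J \<in> Thick \<T>" "\<U> \<subseteq> J" "\<V> \<subseteq> J" unfolding J_def using thick_join_pair[OF U V] .
  have IJ: "I \<subseteq> J" using I J by blast
  have loc: "commuting_localisations \<T> \<U> \<V> (Loc \<T> I F) (Loc \<T> \<U> F) (Loc \<T> \<V> F) (Loc \<T> J F)
      (Loc_incl \<T> \<U> F) (Loc_incl \<T> \<V> F) (Loc_incl \<T> J F) (Loc_incl \<T> J F) (Loc_incl \<T> J F)"
    if F: "cohomological \<T> F" for F :: "('o, 'm, 'g) presheaf"
  proof
    show "el (Loc \<T> I F) X = {\<one>\<^bsub>Val (Loc \<T> I F) X\<^esub>}" if "X \<in> \<U> \<inter> \<V>" for X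
      using Loc_vanishes[OF I(1) F] that I_def by blast
  qed (use U V comm I J IJ F J_def Loc_localisation[OF I(1) _ _ F] Loc_incl_natural[OF _ F J(1)]
      Loc_incl_comp[OF I(1) _ _ J(1) _ F] in simp_all)
  have "natural_transformation \<T> (Loc \<T> J F) (shift \<T> 1 (Loc \<T> I F)) (c F)"
    if F: "cohomological \<T> F" for F
  proof -
    interpret M: commuting_localisations \<T> \<U> \<V> "Loc \<T> I F" "Loc \<T> \<U> F" "Loc \<T> \<V> F" "Loc \<T> J F"
      "Loc_incl \<T> \<U> F" "Loc_incl \<T> \<V> F" "Loc_incl \<T> J F" "Loc_incl \<T> J F" "Loc_incl \<T> J F" by (rule loc[OF F])
    show ?thesis
      unfolding natural_transformation_def c_def hom_def shift_def susp_pow_obj_def susp_pow_arr_def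
      using M.cmap_closed M.cmap_mult M.cmap_res by simp
  qed
  moreover have "c F' Y (Loc_map \<T> J F' \<alpha> Y z) = shift_nt \<T> 1 (Loc_map \<T> I F' \<alpha>) Y (c F Y z)"
    if F: "cohomological \<T> F" "cohomological \<T> F'" and \<alpha>: "natural_transformation \<T> F F' \<alpha>"
      and Y: "Y \<in> Obj \<T>" and z: "z \<in> el (Loc \<T> J F) Y" for F F' \<alpha> Y z
  proof -
    interpret M: commuting_localisations \<T> \<U> \<V> "Loc \<T> I F" "Loc \<T> \<U> F" "Loc \<T> \<V> F" "Loc \<T> J F"
      "Loc_incl \<T> \<U> F" "Loc_incl \<T> \<V> F" "Loc_incl \<T> J F" "Loc_incl \<T> J F" "Loc_incl \<T> J F" by (rule loc[OF F(1)])
    interpret M': commuting_localisations \<T> \<U> \<V> "Loc \<T> I F'" "Loc \<T> \<U> F'" "Loc \<T> \<V> F'" "Loc \<T> J F'"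
      "Loc_incl \<T> \<U> F'" "Loc_incl \<T> \<V> F'" "Loc_incl \<T> J F'" "Loc_incl \<T> J F'" "Loc_incl \<T> J F'" by (rule loc[OF F(2)])
    note \<psi> = Loc_map_natural[OF J(1) F \<alpha>]
    have "conn_rel \<U> \<V> (Loc \<T> I F') (Loc \<T> J F') (Loc_incl \<T> J F') Y (Loc_map \<T> J F' \<alpha> Y z)
        (Loc_map \<T> I F' \<alpha> (\<Omega>\<^sub>0 Y) (c F Y z))"
      unfolding c_def
      by (rule conn_rel_map[OF Loc_map_natural[OF I(1) F \<alpha>] M.coh(1) M'.coh(1) _ _ M.cmap_crel[OF Y z]])
        (simp_all add: nt_res[OF \<psi> _ z] Loc_map_incl[OF I(1) J(1) IJ F \<alpha>])
    then show ?thesis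
      unfolding c_def[of F'] using M'.cmap_eq[OF Y nt_closed[OF \<psi> Y z]] by (simp add: shift_nt_def susp_pow_obj_def)
  qed
  moreover have "exact_presheaves \<T>
          (shift \<T> n (Loc \<T> I F)) (shift_nt \<T> n (mv_in \<T> \<U> \<V> F))
          (shift \<T> n (presheaf_sum (Loc \<T> \<U> F) (Loc \<T> \<V> F))) (shift_nt \<T> n (mv_out \<T> \<U> \<V> F))
          (shift \<T> n (Loc \<T> J F)) \<and>
        exact_presheaves \<T>
          (shift \<T> n (presheaf_sum (Loc \<T> \<U> F) (Loc \<T> \<V> F))) (shift_nt \<T> n (mv_out \<T> \<U> \<V> F))
          (shift \<T> n (Loc \<T> J F)) (shift_connecting \<T> n (Loc \<T> I F) (c F))
          (shift \<T> (n + 1) (Loc \<T> I F)) \<and>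
        exact_presheaves \<T>
          (shift \<T> n (Loc \<T> J F)) (shift_connecting \<T> n (Loc \<T> I F) (c F))
          (shift \<T> (n + 1) (Loc \<T> I F)) (shift_nt \<T> (n + 1) (mv_in \<T> \<U> \<V> F))
          (shift \<T> (n + 1) (presheaf_sum (Loc \<T> \<U> F) (Loc \<T> \<V> F)))"
    if F: "cohomological \<T> F" for F :: "('o, 'm, 'g) presheaf" and n
  proof -
    interpret M: commuting_localisations \<T> \<U> \<V> "Loc \<T> I F" "Loc \<T> \<U> F" "Loc \<T> \<V> F" "Loc \<T> J F"
      "Loc_incl \<T> \<U> F" "Loc_incl \<T> \<V> F" "Loc_incl \<T> J F" "Loc_incl \<T> J F" "Loc_incl \<T> J F" by (rule loc[OF F])
    have out: "mv_out \<T> \<U> \<V> F Y = (\<lambda>(a, b). Loc_incl \<T> J F Y a \<otimes>\<^bsub>Val (Loc \<T> J F) Y\<^esub>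
        inv\<^bsub>Val (Loc \<T> J F) Y\<^esub> (Loc_incl \<T> J F Y b))" for Y
      unfolding mv_out_def J_def Let_def ..
    have "in": "mv_in \<T> \<U> \<V> F Y = (\<lambda>w. (Loc_incl \<T> \<U> F Y w, Loc_incl \<T> \<V> F Y w))" for Y
      unfolding mv_in_def ..
    \<comment> \<open>In degree n at X the sequence is the unshifted one at Y, except that the last
      term is taken at an object which is \<open>\<Omega>\<^sub>0 Y\<close> for
      \<open>n \<ge> 0\<close> and only isomorphic to it for \<open>n < 0\<close>.\<close>
    have conn: "shift_connecting \<T> n (Loc \<T> I F) (c F) X z = \<one>\<^bsub>Val (Loc \<T> I F) (susp_pow_obj \<T> (- n - 1) X)\<^esub> \<longleftrightarrow>
          c F Y z = \<one>\<^bsub>Val (Loc \<T> I F) (\<Omega>\<^sub>0 Y)\<^esub>" (is "?zero z")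
      "shift_connecting \<T> n (Loc \<T> I F) (c F) X ` el (Loc \<T> J F) Y =
        tors \<U> (Loc \<T> I F) (susp_pow_obj \<T> (- n - 1) X) \<inter> tors \<V> (Loc \<T> I F) (susp_pow_obj \<T> (- n - 1) X)"
      if X: "X \<in> Obj \<T>" and Y_def: "Y = susp_pow_obj \<T> (- n) X" and z: "z \<in> el (Loc \<T> J F) Y" for X Y z
    proof -
      define P where "P = susp_pow_obj \<T> (- n - 1) X"
      have Y: "Y \<in> Obj \<T>" and P: "P \<in> Obj \<T>" unfolding Y_def P_def using susp_pow_closed[OF X] by simp_all
      let ?G = "Loc \<T> I F"
      have cY: "c F Y ` el (Loc \<T> J F) Y = tors \<U> ?G (\<Omega>\<^sub>0 Y) \<inter> tors \<V> ?G (\<Omega>\<^sub>0 Y)"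
        using M.mv_exact_right[OF Y] unfolding c_def .
      have "?zero z \<and> shift_connecting \<T> n ?G (c F) X ` el (Loc \<T> J F) Y = tors \<U> ?G P \<inter> tors \<V> ?G P"
      proof (cases "n \<ge> 0")
        case True
        then have "shift_connecting \<T> n ?G (c F) X = c F Y" "P = \<Omega>\<^sub>0 Y"
          unfolding shift_connecting_def shift_nt_def Y_def P_def using susp_pow_step(1) by auto
        then show ?thesis using cY P_def by simp
      next
        case False
        \<comment> \<open>Now \<open>\<Omega>\<^sub>0 Y\<close> is the desuspension of
          \<open>\<Sigma>\<^sub>0 P\<close>; restriction along the unit isomorphism transports
          kernel and image to P.\<close>
        then have YP: "Y = \<Sigma>\<^sub>0 P" unfolding Y_def P_def using susp_pow_step(2) by simp
        have sc: "shift_connecting \<T> n ?G (c F) X = (\<lambda>z. Res ?G (Unit \<T> P) (c F Y z))"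
          unfolding shift_connecting_def shift_nt_def Y_def P_def using False by auto
        note u = unit_hom[OF P, folded YP]
        obtain v where v: "v \<in> \<Omega>\<^sub>0 Y \<leadsto> P" "v \<cdot> Unit \<T> P = Id \<T> P" "Unit \<T> P \<cdot> v = Id \<T> (\<Omega>\<^sub>0 Y)"
          using iso_inverse[OF unit_iso[OF P] u] .
        note O = desusp(1)[OF Y]
        have vu: "Res ?G v (Res ?G (Unit \<T> P) w) = w" if "w \<in> el ?G (\<Omega>\<^sub>0 Y)" for w
          using res_comp[OF M.coh(1) v(1) u that] v(3) res_id[OF M.coh(1) that O] by simp
        have uv: "Res ?G (Unit \<T> P) (Res ?G v w) = w" if "w \<in> el ?G P" for w
          using res_comp[OF M.coh(1) u v(1) that] v(2) res_id[OF M.coh(1) that P] by simp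
        have "c F Y z \<in> el ?G (\<Omega>\<^sub>0 Y)" unfolding c_def using M.cmap_closed[OF Y z z] .
        then have "Res ?G (Unit \<T> P) (c F Y z) = \<one>\<^bsub>Val ?G P\<^esub> \<longleftrightarrow> c F Y z = \<one>\<^bsub>Val ?G (\<Omega>\<^sub>0 Y)\<^esub>"
          using vu res_one[OF M.coh(1) u] res_one[OF M.coh(1) v(1)] by metis
        moreover have "(\<lambda>z. Res ?G (Unit \<T> P) (c F Y z)) ` el (Loc \<T> J F) Y =
            Res ?G (Unit \<T> P) ` (tors \<U> ?G (\<Omega>\<^sub>0 Y) \<inter> tors \<V> ?G (\<Omega>\<^sub>0 Y))"
          unfolding cY[symmetric] by (simp add: image_image)
        moreover have "Res ?G (Unit \<T> P) ` (tors \<U> ?G (\<Omega>\<^sub>0 Y) \<inter> tors \<V> ?G (\<Omega>\<^sub>0 Y)) = tors \<U> ?G P \<inter> tors \<V> ?G P"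
        proof (intro equalityI subsetI)
          fix w assume "w \<in> Res ?G (Unit \<T> P) ` (tors \<U> ?G (\<Omega>\<^sub>0 Y) \<inter> tors \<V> ?G (\<Omega>\<^sub>0 Y))"
          then show "w \<in> tors \<U> ?G P \<inter> tors \<V> ?G P" using tors_res[OF M.coh(1) _ u] by blast
        next
          fix w assume w: "w \<in> tors \<U> ?G P \<inter> tors \<V> ?G P"
          then have "w = Res ?G (Unit \<T> P) (Res ?G v w)" using uv[OF tors_el[OF M.coh(1), of w \<U> P]] by simp
          then show "w \<in> Res ?G (Unit \<T> P) ` (tors \<U> ?G (\<Omega>\<^sub>0 Y) \<inter> tors \<V> ?G (\<Omega>\<^sub>0 Y))"
            using w tors_res[OF M.coh(1) _ v(1)] by blast
        qed
        ultimately show ?thesis unfolding sc P_def[symmetric] by simp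
      qed
      then show "?zero z" "shift_connecting \<T> n (Loc \<T> I F) (c F) X ` el (Loc \<T> J F) Y =
        tors \<U> (Loc \<T> I F) (susp_pow_obj \<T> (- n - 1) X) \<inter> tors \<V> (Loc \<T> I F) (susp_pow_obj \<T> (- n - 1) X)"
        unfolding P_def by blast+
    qed
    \<comment> \<open>The second fact of \<open>conn\<close> shares with the first the hypothesis
      that some element \<open>z\<close> is given; the neutral element is supplied for it.\<close>
    have one: "\<one>\<^bsub>Val (Loc \<T> J F) (susp_pow_obj \<T> m X)\<^esub> \<in> el (Loc \<T> J F) (susp_pow_obj \<T> m X)" if "X \<in> Obj \<T>" for X m
      using comm_groupE(2)[OF val_group[OF M.coh(4) susp_pow_closed[OF that]]] .
    show ?thesis
      unfolding exact_presheaves_def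
    proof (intro conjI ballI)
      fix X assume X: "X \<in> Obj \<T>"
      define Y where "Y = susp_pow_obj \<T> (- n) X"
      have Y: "Y \<in> Obj \<T>" unfolding Y_def using susp_pow_closed[OF X] .
      note P = susp_pow_closed[OF X, of "- n - 1"]
      show "shift_nt \<T> n (mv_in \<T> \<U> \<V> F) X ` el (shift \<T> n (Loc \<T> I F)) X =
          kernel (Val (shift \<T> n (presheaf_sum (Loc \<T> \<U> F) (Loc \<T> \<V> F))) X) (Val (shift \<T> n (Loc \<T> J F)) X)
            (shift_nt \<T> n (mv_out \<T> \<U> \<V> F) X)"
        using M.mv_exact_left[OF Y] by (simp add: shift_def shift_nt_def presheaf_sum_def out "in" Y_def)
      show "shift_nt \<T> n (mv_out \<T> \<U> \<V> F) X ` el (shift \<T> n (presheaf_sum (Loc \<T> \<U> F) (Loc \<T> \<V> F))) X =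
          kernel (Val (shift \<T> n (Loc \<T> J F)) X) (Val (shift \<T> (n + 1) (Loc \<T> I F)) X)
            (shift_connecting \<T> n (Loc \<T> I F) (c F) X)"
      proof -
        have "kernel (Val (shift \<T> n (Loc \<T> J F)) X) (Val (shift \<T> (n + 1) (Loc \<T> I F)) X)
            (shift_connecting \<T> n (Loc \<T> I F) (c F) X) = {z \<in> el (Loc \<T> J F) Y. c F Y z = \<one>\<^bsub>Val (Loc \<T> I F) (\<Omega>\<^sub>0 Y)\<^esub>}"
          using conn(1)[OF X Y_def] by (auto simp: kernel_def shift_def Y_def)
        then show ?thesis
          using M.mv_exact_middle[OF Y] by (simp add: shift_def shift_nt_def presheaf_sum_def out Y_def c_def)
      qed
      show "shift_connecting \<T> n (Loc \<T> I F) (c F) X ` el (shift \<T> n (Loc \<T> J F)) X =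
          kernel (Val (shift \<T> (n + 1) (Loc \<T> I F)) X) (Val (shift \<T> (n + 1) (presheaf_sum (Loc \<T> \<U> F) (Loc \<T> \<V> F))) X)
            (shift_nt \<T> (n + 1) (mv_in \<T> \<U> \<V> F) X)"
        using conn(2)[OF X refl one[OF X]] M.mv_kernel_tors[OF P]
        by (simp add: shift_def shift_nt_def presheaf_sum_def "in")
    qed
  qed
  ultimately show ?thesis
    unfolding mayer_vietoris_exists_def Let_def thick_meet_pair[OF U] I_def[symmetric] J_def[symmetric]
    by (intro exI[of _ c]) blast
qed

end

theorem theorem2:
  fixes \<T> :: "('o, 'm) tricat" and L :: "'o set set"
  assumes "triangulated_category \<T>"
    and "thick_sublattice \<T> L"
    and "closed_under_joins \<T> L"
    and "zero_subcat \<T> \<in> L" and "Obj \<T> \<in> L"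
  shows "thick_sublattice \<T> (centre \<T> L) \<and> closed_under_joins \<T> (centre \<T> L) \<and>
    spatial_frame (inclusion_order (centre \<T> L)) \<and>
    (\<forall>\<U> \<in> L. \<forall>\<V> \<in> L. \<U> \<in> centre \<T> L \<or> \<V> \<in> centre \<T> L \<longrightarrow>
      mayer_vietoris_exists \<T> TYPE('g) \<U> \<V>)"
proof -
  interpret triangulated_category \<T> by fact
  note L = assms(2,3,5)
  have "mayer_vietoris_exists \<T> TYPE('g) \<U> \<V>"
    if UV: "\<U> \<in> L" "\<V> \<in> L" and c: "\<U> \<in> centre \<T> L \<or> \<V> \<in> centre \<T> L" for \<U> \<V>
  proof (rule mayer_vietoris[OF sublattice_thick[OF L UV(1)] sublattice_thick[OF L UV(2)]])
    show "commuting \<T> \<U> \<V>" using c UV centreD(2)[OF L] commuting_sym by blast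
  qed
  then show ?thesis using centre_sublattice[OF L] centre_spatial[OF L] by blast
qed

end
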